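(* Let $N\ge 1$, $n\ge 1$ be integers and $\beta$ a positive real number, and let $F_{N,n}$, $\hat u_k$, $\mathcal L^{(1)}_n$, the dominance order, the Yangian action $T_{ab}(u)\mapsto T_{ab}(u;\beta)$ on $F_{N,n}$, the series $A_m(u;\beta)$ and the scalar product $\langle\cdot,\cdot\rangle_{\beta,N}$ be as in the context. There is a basis $\{X_k^{(\beta,N)}\mid k\in\mathcal L^{(1)}_n\}$ of $F_{N,n}$ with the following properties. (i) For each $k$, $X_k^{(\beta,N)}=\hat u_k+\sum_{l\in\mathcal L^{(1)}_n,\ l<k}x^{(\beta,N)}_{kl}\,\hat u_l$ with real coefficients $x^{(\beta,N)}_{kl}$. (ii) For each $m=1,\dots,N$ and each $k$, $A_m(u;\beta)X_k^{(\beta,N)}=A_m(u;\beta;k)X_k^{(\beta,N)}$, where $$A_m(u;\beta;k)=\prod_{i=1}^n\frac{u+\beta^{-1}\overline{k_i}+i-1+\delta(\underline{k_i}\le m)}{u+\beta^{-1}\overline{k_i}+i-1}$$ (expanded in $u^{-1}$; $\delta(P)=1$ if $P$ holds and $0$ otherwise). (iii) The $N$-tuples of rational functions $(A_1(u;\beta;k),\dots,A_N(u;\beta;k))$ are pairwise distinct for distinct $k\in\mathcal L^{(1)}_n$ (i.e. the joint spectrum of the coefficients of $A_1(u;\beta),\dots,A_N(u;\beta)$ on $F_{N,n}$ is simple). (iv) $\langle X_k^{(\beta,N)},X_l^{(\beta,N)}\rangle_{\beta,N}=0$ whenever $k\ne l$.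
   Context: Notation. For $k\in\mathbb Z$ let $\underline{k}\in\{1,\dots,N\}$ and $\overline{k}\in\mathbb Z$ be the unique integers with $k=\underline{k}-N\overline{k}$; for $k=(k_1,\dots,k_n)\in\mathbb Z^n$ put $\underline{k}=(\underline{k_1},\dots,\underline{k_n})$, $\overline{k}=(\overline{k_1},\dots,\overline{k_n})$, $|k|=\sum k_i$. Dominance order on $\mathbb Z^n$: for distinct $k,l$, $k>l$ iff $|k|=|l|$ and $k_1+\dots+k_i\ge l_1+\dots+l_i$ for all $i$. $\mathcal L^{(1)}_n=\{k\in\mathbb Z^n:k_1>k_2>\dots>k_n\}$. Space of states. $V=\mathbb C^N$ with basis $v_1,\dots,v_N$; $E_{ab}$ are matrix units ($E_{ab}v_c=\delta_{bc}v_a$) and $E^{(i)}_{ab}$ is $E_{ab}$ acting on the $i$-th factor of $V^{\otimes n}$. On $\mathbb C[z_1^{\pm1},\dots,z_n^{\pm1}]\otimes V^{\otimes n}$, $K_{ij}$ swaps the variables $z_i,z_j$ and $P_{ij}$ swaps the $i$-th and $j$-th factors of $V^{\otimes n}$. $F_{N,n}$ is the subspace of all $f$ with $K_{ij}f=-P_{ij}f$ for all $i\neq j$. For $k\in\mathbb Z^n$, $\hat u_k=\sum_{w\in S_n}\mathrm{sign}(w)\,z_1^{\overline{k_{w(1)}}}\cdots z_n^{\overline{k_{w(n)}}}\otimes v_{\underline{k_{w(1)}}}\otimes\cdots\otimes v_{\underline{k_{w(n)}}}$; the $\hat u_k$, $k\in\mathcal L^{(1)}_n$, form a basis of $F_{N,n}$.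 Cherednik–Dunkl operators. $D_i=z_i\partial/\partial z_i$, $\theta_{ij}=z_i/(z_i-z_j)$, and $d_i(\beta)=\beta^{-1}D_i+n-i+\sum_{j>i}\theta_{ji}(K_{ij}-1)-\sum_{j<i}\theta_{ij}(K_{ij}-1)$, $i=1,\dots,n$, acting on Laurent polynomials (and on the polynomial factor of $\mathbb C[z^{\pm1}]\otimes V^{\otimes n}$). Yangian. $Y(\mathfrak{gl}_N)$ is the unital associative algebra generated by $T^{(s)}_{ab}$ ($s\ge1$, $1\le a,b\le N$) with relations $(u-v)[T_{ab}(u),T_{cd}(v)]=T_{cb}(v)T_{ad}(u)-T_{cb}(u)T_{ad}(v)$, where $T_{ab}(u)=\delta_{ab}+\sum_{s\ge1}T^{(s)}_{ab}u^{-s}$. For $m=1,\dots,N$, $A_m(u)=\sum_{w\in S_m}\mathrm{sign}(w)T_{1w(1)}(u)T_{2w(2)}(u-1)\cdots T_{mw(m)}(u-m+1)$. Action. Let $L^{(i)}_{ab}(u)=\delta_{ab}+(u+d_i(\beta))^{-1}E^{(i)}_{ba}$, with $(u+d_i(\beta))^{-1}=\sum_{s\ge0}(-1)^sd_i(\beta)^su^{-s-1}$, and $T_{ab}(u;\beta)=\sum_{c_1,\dots,c_{n-1}=1}^NL^{(1)}_{ac_1}(u)L^{(2)}_{c_1c_2}(u)\cdots L^{(n)}_{c_{n-1}b}(u)$. The coefficients of the $T_{ab}(u;\beta)$ preserve $F_{N,n}$ and $T_{ab}(u)\mapsto T_{ab}(u;\beta)$ defines a left $Y(\mathfrak{gl}_N)$-action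 on $F_{N,n}$; $A_m(u;\beta)$ is the image of $A_m(u)$. Scalar product. For $\delta\ge0$, $\Delta(w;\delta)=\prod_{1\le i\ne j\le n}(1-w_iw_j^{-1})^{\delta}$. For Laurent polynomials $f,g$ and $u,v\in V^{\otimes n}$, $\langle f\otimes u,g\otimes v\rangle'_{\delta,N}=\frac1{n!}\prod_{j}\oint\frac{dw_j}{2\pi iw_j}\Delta(w;\delta)\bar f(w^{-1})g(w)\cdot\langle u,v\rangle_N$, integrals over the unit circles, where $\bar f$ has complex-conjugated coefficients and $\langle\cdot,\cdot\rangle_N$ is the sesquilinear form on $V^{\otimes n}$ in which the tensor monomials $v_{a_1}\otimes\cdots\otimes v_{a_n}$ are orthonormal; extended sesquilinearly. $\langle\cdot,\cdot\rangle_{\delta,N}$ is its restriction to $F_{N,n}$. *)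

theory Defs
  imports "HOL-Complex_Analysis.Contour_Integration" "HOL-Combinatorics.Permutations"
begin

text \<open>An element of C[z_1^{+-1},...,z_n^{+-1}] (x) V^{(x)n} is encoded by its coefficient
  function: the coefficient of z^e (x) v_{a_1} (x) ... (x) v_{a_n} is f (e, a), where
  e is the exponent list (length n) and a the colour list (length n, entries in 1..N).
  Positions are 0-based: position i corresponds to index i+1 of the paper.\<close>

type_synonym idx = "int list \<times> nat list"
type_synonym st = "idx \<Rightarrow> complex"
type_synonym opser = "nat \<Rightarrow> st \<Rightarrow> st"  \<comment> \<open>coefficient of u^(-s)\<close>
type_synonym scser = "nat \<Rightarrow> complex"      \<comment> \<open>coefficient of u^(-s)\<close>

definition under :: "nat \<Rightarrow> int \<Rightarrow> int" where
  "under N k = (k - 1) mod int N + 1"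

definition over :: "nat \<Rightarrow> int \<Rightarrow> int" where
  "over N k = (under N k - k) div int N"

definition valid_idx :: "nat \<Rightarrow> nat \<Rightarrow> idx \<Rightarrow> bool" where
  "valid_idx n N p \<longleftrightarrow> length (fst p) = n \<and> length (snd p) = n \<and> set (snd p) \<subseteq> {1..N}"

definition supp :: "st \<Rightarrow> idx set" where
  "supp f = {p. f p \<noteq> 0}"

definition is_state :: "nat \<Rightarrow> nat \<Rightarrow> st \<Rightarrow> bool" where
  "is_state n N f \<longleftrightarrow> finite (supp f) \<and> (\<forall>p. \<not> valid_idx n N p \<longrightarrow> f p = 0)"

definition swap_list :: "nat \<Rightarrow> nat \<Rightarrow> 'a list \<Rightarrow> 'a list" where
  "swap_list i j xs = xs[i := xs ! j, j := xs ! i]"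

definition Kop :: "nat \<Rightarrow> nat \<Rightarrow> st \<Rightarrow> st" where
  "Kop i j f = (\<lambda>(e, a). f (swap_list i j e, a))"

definition Pop :: "nat \<Rightarrow> nat \<Rightarrow> st \<Rightarrow> st" where
  "Pop i j f = (\<lambda>(e, a). f (e, swap_list i j a))"

definition Fspace :: "nat \<Rightarrow> nat \<Rightarrow> st set" where
  "Fspace n N = {f. is_state n N f \<and>
      (\<forall>i<n. \<forall>j<n. i \<noteq> j \<longrightarrow> Kop i j f = (\<lambda>p. - Pop i j f p))}"

text \<open>D_i = z_i d/dz_i\<close>
definition Dop :: "nat \<Rightarrow> st \<Rightarrow> st" where
  "Dop i f = (\<lambda>(e, a). of_int (e ! i) * f (e, a))"

text \<open>E^{(i)}_{xy}: the matrix unit E_{xy} (E_{xy} v_c = delta_{yc} v_x) on the i-th factor.\<close>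
definition Eop :: "nat \<Rightarrow> nat \<Rightarrow> nat \<Rightarrow> st \<Rightarrow> st" where
  "Eop i x y f = (\<lambda>(e, c). if c ! i = x then f (e, c[i := y]) else 0)"

definition mulz :: "nat \<Rightarrow> st \<Rightarrow> st" where
  "mulz j g = (\<lambda>(e, a). g (e[j := e ! j - 1], a))"

text \<open>theta_{ab} (K_{ab} - 1) = z_a/(z_a - z_b) (K_{ab} - 1), acting on the polynomial part:
  the unique Laurent polynomial g with (z_a - z_b) g = z_a (K_{ab} f - f).\<close>
definition ddop :: "nat \<Rightarrow> nat \<Rightarrow> nat \<Rightarrow> st \<Rightarrow> st" where
  "ddop n a b f = (THE g. finite (supp g) \<and> (\<forall>p. length (fst p) \<noteq> n \<longrightarrow> g p = 0) \<and>
      (\<forall>p. length (fst p) = n \<longrightarrow>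
         mulz a g p - mulz b g p = mulz a (\<lambda>q. Kop a b f q - f q) p))"

text \<open>Cherednik--Dunkl operator d_i(beta) (0-based position i, i.e. paper index i+1)\<close>
definition dop :: "nat \<Rightarrow> real \<Rightarrow> nat \<Rightarrow> st \<Rightarrow> st" where
  "dop n \<beta> i f = (\<lambda>p. of_real (1 / \<beta>) * Dop i f p + (of_nat n - of_nat (i + 1)) * f p
      + (\<Sum>j\<in>{i+1..<n}. ddop n j i f p) - (\<Sum>j\<in>{0..<i}. ddop n i j f p))"

definition ser_zero_op :: "st \<Rightarrow> st" where "ser_zero_op f = (\<lambda>p. 0)"

definition ser_one :: opser where
  "ser_one s f = (if s = 0 then f else ser_zero_op f)"

definition ser_mult :: "opser \<Rightarrow> opser \<Rightarrow> opser" where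
  "ser_mult A B s f = (\<lambda>p. \<Sum>t\<le>s. A t (B (s - t) f) p)"

definition ser_listprod :: "opser list \<Rightarrow> opser" where
  "ser_listprod As = foldr ser_mult As ser_one"

text \<open>coefficients of A(u - r) expanded in u^(-1)\<close>
definition ser_shift :: "complex \<Rightarrow> opser \<Rightarrow> opser" where
  "ser_shift r A s f = (if s = 0 then A 0 f else
     (\<lambda>p. \<Sum>s'\<in>{1..s}. of_nat ((s - 1) choose (s - s')) * r ^ (s - s') * A s' f p))"

text \<open>L^{(i)}_{ab}(u) = delta_ab + (u + d_i)^(-1) E^{(i)}_{ba}\<close>
definition Lser :: "nat \<Rightarrow> real \<Rightarrow> nat \<Rightarrow> nat \<Rightarrow> nat \<Rightarrow> opser" where
  "Lser n \<beta> i a b s f = (if s = 0 then (if a = b then f else ser_zero_op f)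
     else (\<lambda>p. (-1) ^ (s - 1) * ((dop n \<beta> i ^^ (s - 1)) (Eop i b a f)) p))"

primrec Tpart :: "nat \<Rightarrow> nat \<Rightarrow> real \<Rightarrow> nat list \<Rightarrow> nat \<Rightarrow> nat \<Rightarrow> opser" where
  "Tpart n N \<beta> [] a b = (\<lambda>s f. if s = 0 \<and> a = b then f else ser_zero_op f)"
| "Tpart n N \<beta> (i # is) a b =
     (\<lambda>s f p. \<Sum>c\<in>{1..N}. ser_mult (Lser n \<beta> i a c) (Tpart n N \<beta> is c b) s f p)"

definition Tser :: "nat \<Rightarrow> nat \<Rightarrow> real \<Rightarrow> nat \<Rightarrow> nat \<Rightarrow> opser" where
  "Tser n N \<beta> a b = Tpart n N \<beta> [0..<n] a b"

definition Aop :: "nat \<Rightarrow> nat \<Rightarrow> real \<Rightarrow> nat \<Rightarrow> opser" where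
  "Aop n N \<beta> m s f = (\<lambda>p. \<Sum>w\<in>{w. w permutes {1..m}}. of_int (sign w) *
      ser_listprod (map (\<lambda>r. ser_shift (of_nat (r - 1)) (Tser n N \<beta> r (w r))) [1..<m+1]) s f p)"

definition sc_one :: scser where "sc_one s = (if s = 0 then 1 else 0)"

definition sc_mult :: "scser \<Rightarrow> scser \<Rightarrow> scser" where
  "sc_mult a b s = (\<Sum>t\<le>s. a t * b (s - t))"

text \<open>expansion of (u + c + 1)/(u + c) = 1 + sum_{s>=0} (-c)^s u^(-s-1)\<close>
definition sc_factor :: "complex \<Rightarrow> scser" where
  "sc_factor c s = (if s = 0 then 1 else (- c) ^ (s - 1))"

definition Asc :: "nat \<Rightarrow> nat \<Rightarrow> real \<Rightarrow> nat \<Rightarrow> int list \<Rightarrow> scser" where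
  "Asc n N \<beta> m k = foldr sc_mult
     (map (\<lambda>i. if under N (k ! i) \<le> int m
                then sc_factor (of_real (1 / \<beta> * of_int (over N (k ! i)) + of_nat i))
                else sc_one) [0..<n]) sc_one"

definition uhat :: "nat \<Rightarrow> nat \<Rightarrow> int list \<Rightarrow> st" where
  "uhat n N k = (\<lambda>p. \<Sum>w\<in>{w. w permutes {0..<n}}. of_int (sign w) *
      (if p = (map (\<lambda>i. over N (k ! w i)) [0..<n], map (\<lambda>i. nat (under N (k ! w i))) [0..<n])
       then 1 else 0))"

definition Lset :: "nat \<Rightarrow> int list set" where
  "Lset n = {k. length k = n \<and> (\<forall>i. Suc i < n \<longrightarrow> k ! i > k ! Suc i)}"

definition dom_less :: "int list \<Rightarrow> int list \<Rightarrow> bool" where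
  "dom_less l k \<longleftrightarrow> l \<noteq> k \<and> length l = length k \<and> sum_list l = sum_list k \<and>
     (\<forall>i\<le>length k. sum_list (take i k) \<ge> sum_list (take i l))"

definition is_basis :: "nat \<Rightarrow> nat \<Rightarrow> int list set \<Rightarrow> (int list \<Rightarrow> st) \<Rightarrow> bool" where
  "is_basis n N I X \<longleftrightarrow> inj_on X I \<and> X ` I \<subseteq> Fspace n N \<and>
     (\<forall>S c. finite S \<and> S \<subseteq> I \<and> (\<forall>p. (\<Sum>k\<in>S. c k * X k p) = 0) \<longrightarrow> (\<forall>k\<in>S. c k = 0)) \<and>
     (\<forall>f\<in>Fspace n N. \<exists>S c. finite S \<and> S \<subseteq> I \<and> f = (\<lambda>p. \<Sum>k\<in>S. c k * X k p))"

fun torus_int :: "nat \<Rightarrow> (complex list \<Rightarrow> complex) \<Rightarrow> complex" where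
  "torus_int 0 F = F []"
| "torus_int (Suc m) F = contour_integral (circlepath 0 1)
      (\<lambda>w. torus_int m (\<lambda>ws. F (w # ws)) / (2 * of_real pi * \<i> * w))"

definition Delta :: "nat \<Rightarrow> real \<Rightarrow> complex list \<Rightarrow> complex" where
  "Delta n \<delta> w = (\<Prod>(i, j)\<in>{(i, j). i < n \<and> j < n \<and> i \<noteq> j}.
      (1 - w ! i * inverse (w ! j)) powr of_real \<delta>)"

definition monom :: "nat \<Rightarrow> int list \<Rightarrow> complex list \<Rightarrow> complex" where
  "monom n e w = (\<Prod>i<n. (w ! i) powi (e ! i))"

text \<open><z^e (x) v_a, z^e' (x) v_a'>' (coefficients of z^e are real, so bar f = f)\<close>
definition sp_basic :: "nat \<Rightarrow> real \<Rightarrow> idx \<Rightarrow> idx \<Rightarrow> complex" where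
  "sp_basic n \<delta> p q = 1 / of_nat (fact n) *
     torus_int n (\<lambda>w. Delta n \<delta> w * monom n (fst p) (map inverse w) * monom n (fst q) w) *
     (if snd p = snd q then 1 else 0)"

definition sp :: "nat \<Rightarrow> real \<Rightarrow> st \<Rightarrow> st \<Rightarrow> complex" where
  "sp n \<delta> f g = (\<Sum>p\<in>supp f. \<Sum>q\<in>supp g. cnj (f p) * g q * sp_basic n \<delta> p q)"

end

theory Submission
  imports Defs
    "HOL-Analysis.Weierstrass_Theorems"
    "HOL-Complex_Analysis.Cauchy_Integral_Formula"
    "HOL-Computational_Algebra.Polynomial_FPS"
    "HOL-Library.Poly_Mapping"
begin

text \<open>A bra of colours \<open>a\<close> applied to the quantum determinant collapses, when the colours not exceeding \<open>m\<close> stand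
  first, to the product of the factors \<open>1 + (u + d\<^sub>i)\<^sup>-\<^sup>1\<close> over the corresponding sites (an antisymmetrised product of
  rows can be expanded along its first site). An antisymmetric state is determined by its components with
  ascending colours, so on \<open>F\<close> the coefficients of the \<open>A\<^sub>m(u)\<close> act through functions of the commuting Dunkl operators
  only. Hence they commute, are self-adjoint, and, the Dunkl operators being triangular for the order on
  exponents induced by dominance of the sequences \<open>c\<^sub>i - N e\<^sub>i\<close>, are triangular on the \<open>u\<^sub>k\<close> with the stated
  eigenvalues. The zeros and poles of these eigenvalues separate the sequences \<open>k\<close>, which gives the common
  eigenvectors by spectral projection and their orthogonality by self-adjointness. Self-adjointness of the Dunkl
  operators is integration by parts against the weight; their commutativity is checked on the values of Laurent
  polynomials at points with distinct coordinates.\<close>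

section \<open>Laurent functions on the torus\<close>

text \<open>The defining relation of the Yangian enters at spectral parameters differing by one,
  where it degenerates: antisymmetrising the columns of a product of rows also antisymmetrises the
  rows. The obstacle is that a single \<open>d_i\<close> does not in general preserve the
  antisymmetric space; only symmetric combinations do. Testing a state against a bra with ascending
  colours removes the colours altogether and leaves a product of resolvents of the
  \<open>d_i\<close>, but then the \<open>d_i\<close> act on exponents at fixed colours, where the
  sequences \<open>k\<close> are unsorted. Hence triangularity is measured by an order insensitive
  to rearrangement. Two sites of equal colour can still exchange their exponents without going down
  in this order; the diagonal value is therefore read at the arrangement in which \<open>k\<close>
  increases inside each colour, which no exchange can restore. Counting inversions there turns the
  constant \<open>n - i\<close> of the Dunkl operator into the shift \<open>i - 1\<close> of the
  eigenvalue. In the scalar product the factor \<beta> from differentiating the weight cancels the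
  factor \<open>1 / \<beta>\<close> in front of \<open>z_i d/dz_i\<close>, and what remains cancels
  against the divided differences.\<close>

lemma powr_shift_bound:
  fixes \<gamma> s \<epsilon> :: real
  assumes "\<gamma> > 0" "0 \<le> s" "s \<le> 4" "0 < \<epsilon>" "\<epsilon> \<le> 1"
  shows "\<epsilon> * (s + \<epsilon>) powr (\<gamma> - 1) \<le> \<epsilon> powr \<gamma> + \<epsilon> * 5 powr \<gamma>"
proof (cases "\<gamma> \<ge> 1")
  case True
  have "(s + \<epsilon>) powr (\<gamma> - 1) \<le> 5 powr (\<gamma> - 1)"
    using assms True by (intro powr_mono2) auto
  also have "\<dots> \<le> 5 powr \<gamma>" by (intro powr_mono) auto
  finally show ?thesis
    using assms by (simp add: add_increasing mult_left_mono)
next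
  case False
  have "(s + \<epsilon>) powr (\<gamma> - 1) \<le> \<epsilon> powr (\<gamma> - 1)"
    using assms False by (intro powr_mono2') auto
  then have "\<epsilon> * (s + \<epsilon>) powr (\<gamma> - 1) \<le> \<epsilon> * \<epsilon> powr (\<gamma> - 1)"
    using assms by (intro mult_left_mono) auto
  also have "\<dots> = \<epsilon> powr \<gamma>"
    using assms by (simp add: powr_mult_base)
  finally show ?thesis
    using assms by (simp add: add_increasing2)
qed

text \<open>For \<gamma> < 1 the derivative of \<open>s powr \<gamma>\<close> is unbounded at 0, so
  only \<open>s\<close> times the derivative can be approximated uniformly. The shifted power
  \<open>(s + \<epsilon>) powr \<gamma>\<close> is smooth on the interval; its derivative is
  approximated by a polynomial, which is then integrated. The interval is the range of a squared
  distance on the unit circle.\<close>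

lemma powr_poly_approx:
  fixes \<gamma> \<delta> :: real
  assumes \<gamma>: "\<gamma> > 0" and \<delta>: "\<delta> > 0"
  obtains P :: "real poly" where
    "\<And>s. s \<in> {0..4} \<Longrightarrow> \<bar>poly P s - s powr \<gamma>\<bar> \<le> \<delta>"
    "\<And>s. s \<in> {0..4} \<Longrightarrow> \<bar>s * poly (pderiv P) s - \<gamma> * s powr \<gamma>\<bar> \<le> \<delta>"
proof -
  have "uniformly_continuous_on {0..5} (\<lambda>s::real. s powr \<gamma>)"
    using \<gamma> by (intro compact_uniformly_continuous continuous_on_powr' continuous_on_id continuous_on_const) auto
  then obtain e0 where e0: "e0 > 0"
    "\<And>s t. s \<in> {0..5} \<Longrightarrow> t \<in> {0..5} \<Longrightarrow> dist t s < e0 \<Longrightarrow> dist (t powr \<gamma>) (s powr \<gamma>) < \<delta> / (4 * (1 + \<gamma>))"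
    unfolding uniformly_continuous_on_def using \<delta> \<gamma> by (metis add_pos_pos divide_pos_pos mult_pos_pos zero_less_numeral zero_less_one)
  have "((\<lambda>\<epsilon>. \<epsilon> powr \<gamma>) \<longlongrightarrow> 0 powr \<gamma>) (at_right 0)"
    by (rule tendsto_powr'[OF tendsto_ident_at tendsto_const])
       (use \<gamma> in \<open>auto intro: eventually_mono[OF eventually_at_right_less]\<close>)
  then have "((\<lambda>\<epsilon>. \<gamma> * (\<epsilon> powr \<gamma> + \<epsilon> * 5 powr \<gamma>)) \<longlongrightarrow> \<gamma> * (0 powr \<gamma> + 0 * 5 powr \<gamma>)) (at_right 0)"
    by (intro tendsto_mult tendsto_add tendsto_const tendsto_ident_at)
  then have "\<forall>\<^sub>F \<epsilon> in at_right 0. \<gamma> * (\<epsilon> powr \<gamma> + \<epsilon> * 5 powr \<gamma>) < \<delta> / 4"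
    using \<delta> \<gamma> by (intro order_tendstoD(2)) auto
  moreover have "\<forall>\<^sub>F \<epsilon> in at_right 0. \<epsilon> < min 1 e0"
    by (rule eventually_mono[OF eventually_at_right_real[of 0 "min 1 e0"]]) (use e0 in auto)
  moreover have "\<forall>\<^sub>F \<epsilon> in at_right (0::real). 0 < \<epsilon>"
    by (rule eventually_at_right_less)
  ultimately have "\<forall>\<^sub>F \<epsilon> in at_right 0. \<gamma> * (\<epsilon> powr \<gamma> + \<epsilon> * 5 powr \<gamma>) < \<delta> / 4 \<and> \<epsilon> < min 1 e0 \<and> 0 < \<epsilon>"
    by eventually_elim simp
  from eventually_happens'[OF trivial_limit_at_right_real this]
  obtain \<epsilon> where \<epsilon>: "0 < \<epsilon>" "\<epsilon> < 1" "\<epsilon> < e0" and \<epsilon>\<gamma>: "\<gamma> * (\<epsilon> powr \<gamma> + \<epsilon> * 5 powr \<gamma>) < \<delta> / 4"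
    by auto
  define f where "f s = (s + \<epsilon>) powr \<gamma>" for s
  define f' where "f' s = \<gamma> * (s + \<epsilon>) powr (\<gamma> - 1)" for s
  have f: "(f has_real_derivative f' s) (at s)" if "s \<ge> 0" for s
    unfolding f_def f'_def using \<epsilon> that by (auto intro!: derivative_eq_intros)
  have "continuous_on {0..4} f'"
    unfolding f'_def using \<epsilon> by (auto intro!: continuous_intros)
  \<comment> \<open>The precision \<open>\<delta> / 16\<close> is multiplied by the interval length
    4 twice: when \<open>h\<close> is integrated to \<open>P\<close>, and in the factor
    \<open>s\<close> of \<open>s * h s\<close>.\<close>
  then obtain h where h: "real_polynomial_function h" "\<And>s. s \<in> {0..4} \<Longrightarrow> \<bar>f' s - h s\<bar> < \<delta> / 16"
    using Stone_Weierstrass_real_polynomial_function[of "{0..4}" f' "\<delta> / 16"] \<delta> by auto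
  obtain c m where c: "h = (\<lambda>s. \<Sum>i\<le>m. c i * s ^ i)"
    using h(1) real_polynomial_function_iff_sum by auto
  define P where "P = [:f 0:] + (\<Sum>i\<le>m. Polynomial.monom (c i / real (Suc i)) (Suc i))"
  have pderiv_sum: "pderiv (sum q A) = (\<Sum>x\<in>A. pderiv (q x))" for q :: "nat \<Rightarrow> real poly" and A
    by (induction A rule: infinite_finite_induct) (auto simp: pderiv_add)
  have dP: "poly (pderiv P) s = h s" for s
    by (simp add: P_def c pderiv_add pderiv_sum pderiv_pCons pderiv_monom poly_sum poly_monom)
  have P0: "poly P 0 = f 0"
    by (simp add: P_def poly_sum poly_monom)
  have Pf: "\<bar>poly P s - f s\<bar> \<le> \<delta> / 4" if s: "s \<in> {0..4}" for s
  proof -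
    have "norm ((poly P s - f s) - (poly P 0 - f 0)) \<le> \<delta> / 16 * norm (s - 0)"
    proof (rule field_differentiable_bound[of "{0..4}" _ "\<lambda>s. h s - f' s"])
      fix x :: real assume x: "x \<in> {0..4}"
      show "((\<lambda>a. poly P a - f a) has_field_derivative h x - f' x) (at x within {0..4})"
        using f[of x] poly_DERIV[of P x] x unfolding dP
        by (intro derivative_intros) (auto intro: has_field_derivative_at_within)
      show "norm (h x - f' x) \<le> \<delta> / 16" unfolding real_norm_def using h(2)[OF x] by linarith
    qed (use s in auto)
    also have "\<dots> \<le> \<delta> / 16 * 4" using s \<delta> by (intro mult_left_mono) auto
    finally show ?thesis using P0 by simp
  qed
  have fs: "\<bar>f s - s powr \<gamma>\<bar> \<le> \<delta> / (4 * (1 + \<gamma>))" if "s \<in> {0..4}" for s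
    using e0(2)[of s "s + \<epsilon>"] that \<epsilon> by (auto simp: dist_real_def f_def)
  have le: "\<delta> / (4 * (1 + \<gamma>)) \<le> \<delta> / 4"
    using \<gamma> \<delta> by (simp add: divide_simps)
  show thesis
  proof
    fix s :: real assume s: "s \<in> {0..4}"
    show "\<bar>poly P s - s powr \<gamma>\<bar> \<le> \<delta>"
      using Pf[OF s] fs[OF s] le \<delta> by linarith
    \<comment> \<open>Euler's relation for the shifted power; the defect carries a factor
      \<epsilon>, which is what \<open>powr_shift_bound\<close> makes small.\<close>
    have "s * f' s = \<gamma> * f s - \<gamma> * (\<epsilon> * (s + \<epsilon>) powr (\<gamma> - 1))"
    proof -
      have "f s = (s + \<epsilon>) * (s + \<epsilon>) powr (\<gamma> - 1)"
        using s \<epsilon> by (simp add: f_def powr_mult_base)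
      then show ?thesis by (simp add: f'_def algebra_simps)
    qed
    moreover have "\<bar>\<gamma> * (\<epsilon> * (s + \<epsilon>) powr (\<gamma> - 1))\<bar> \<le> \<delta> / 4"
    proof -
      have "\<bar>\<gamma> * (\<epsilon> * (s + \<epsilon>) powr (\<gamma> - 1))\<bar> = \<gamma> * (\<epsilon> * (s + \<epsilon>) powr (\<gamma> - 1))"
        using \<gamma> \<epsilon> by simp
      also have "\<dots> \<le> \<gamma> * (\<epsilon> powr \<gamma> + \<epsilon> * 5 powr \<gamma>)"
        using powr_shift_bound[of \<gamma> s \<epsilon>] s \<gamma> \<epsilon> by (intro mult_left_mono) auto
      finally show ?thesis using \<epsilon>\<gamma> by linarith
    qed
    moreover have "\<bar>\<gamma> * f s - \<gamma> * s powr \<gamma>\<bar> \<le> \<delta> / 4"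
    proof -
      have "\<bar>\<gamma> * f s - \<gamma> * s powr \<gamma>\<bar> = \<gamma> * \<bar>f s - s powr \<gamma>\<bar>"
        using \<gamma> by (simp add: abs_mult flip: right_diff_distrib)
      also have "\<dots> \<le> \<gamma> * (\<delta> / (4 * (1 + \<gamma>)))"
        using fs[OF s] \<gamma> by (intro mult_left_mono) auto
      also have "\<dots> \<le> \<delta> / 4" using \<gamma> \<delta> by (simp add: divide_simps)
      finally show ?thesis .
    qed
    moreover have "\<bar>s * h s - s * f' s\<bar> \<le> \<delta> / 4"
    proof -
      have "\<bar>s * h s - s * f' s\<bar> = s * \<bar>f' s - h s\<bar>"
        using s by (simp add: abs_mult abs_minus_commute flip: right_diff_distrib)
      also have "\<dots> \<le> 4 * (\<delta> / 16)"
        using s h(2)[OF s] by (intro mult_mono) auto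
      finally show ?thesis by simp
    qed
    ultimately show "\<bar>s * poly (pderiv P) s - \<gamma> * s powr \<gamma>\<bar> \<le> \<delta>"
      unfolding dP using \<delta> by linarith
  qed
qed

section \<open>Laurent polynomials on the torus and their constant terms\<close>

abbreviation (input) tsp :: "nat \<Rightarrow> nat \<Rightarrow> nat \<Rightarrow> nat" where "tsp \<equiv> Transposition.transpose"

definition Tor :: "nat \<Rightarrow> (nat \<Rightarrow> complex) set" where
  "Tor n = {w. \<forall>i<n. cmod (w i) = 1}"

definition mon :: "nat \<Rightarrow> (nat \<Rightarrow> int) \<Rightarrow> (nat \<Rightarrow> complex) \<Rightarrow> complex" where
  "mon n v w = (\<Prod>i<n. w i powi v i)"

text \<open>Points are functions on all naturals rather than lists, so that a permutation of
  variables is a composition. Only the first \<open>n\<close> coordinates are meaningful, as in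
  \<open>Tor\<close>.\<close>

definition J :: "nat \<Rightarrow> ((nat \<Rightarrow> complex) \<Rightarrow> complex) \<Rightarrow> complex" where
  "J n F = torus_int n (\<lambda>ws. F (nth ws))"

text \<open>A Laurent polynomial function on the torus together with its logarithmic partial derivatives and its
  constant term.\<close>
inductive lau :: "nat \<Rightarrow> ((nat \<Rightarrow> complex) \<Rightarrow> complex) \<Rightarrow> (nat \<Rightarrow> (nat \<Rightarrow> complex) \<Rightarrow> complex) \<Rightarrow> complex \<Rightarrow> bool"
  for n where
  zero: "lau n (\<lambda>_. 0) (\<lambda>_ _. 0) 0"
| add: "lau n F F' t \<Longrightarrow> lau n (\<lambda>w. c * mon n v w + F w) (\<lambda>i w. c * of_int (v i) * mon n v w + F' i w)
     ((if \<forall>i<n. v i = 0 then c else 0) + t)"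
| cong: "lau n F F' t \<Longrightarrow> (\<And>w. w \<in> Tor n \<Longrightarrow> F w = G w) \<Longrightarrow>
     (\<And>i w. i < n \<Longrightarrow> w \<in> Tor n \<Longrightarrow> F' i w = G' i w) \<Longrightarrow> lau n G G' t"

lemma Tor_nonzero: "w \<in> Tor n \<Longrightarrow> i < n \<Longrightarrow> w i \<noteq> 0"
  by (auto simp: Tor_def)

lemma norm_mon: "w \<in> Tor n \<Longrightarrow> cmod (mon n v w) = 1"
  by (simp add: mon_def Tor_def norm_power_int flip: prod_norm)

lemma mon_add: "w \<in> Tor n \<Longrightarrow> mon n v w * mon n v' w = mon n (\<lambda>i. v i + v' i) w"
  unfolding mon_def prod.distrib[symmetric]
  by (intro prod.cong refl) (auto simp: power_int_add dest: Tor_nonzero)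

lemma tsp_less: "a < n \<Longrightarrow> b < n \<Longrightarrow> tsp a b i < n \<longleftrightarrow> i < (n :: nat)"
  by (auto simp: Transposition.transpose_def)

lemma mon_swap:
  assumes "a < n" "b < n"
  shows "mon n v (w \<circ> tsp a b) = mon n (v \<circ> tsp a b) w"
  unfolding mon_def
  by (rule prod.reindex_bij_witness[of _ "tsp a b" "tsp a b"]) (use assms in \<open>auto simp: tsp_less\<close>)

lemma Tor_swap: "a < n \<Longrightarrow> b < n \<Longrightarrow> w \<in> Tor n \<Longrightarrow> w \<circ> tsp a b \<in> Tor n"
  by (auto simp: Tor_def tsp_less)

lemma lau_mon: "lau n (mon n v) (\<lambda>i w. of_int (v i) * mon n v w) (if \<forall>i<n. v i = 0 then 1 else 0)"
  using lau.add[OF lau.zero, of n 1 v] by simp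

lemma lau_const: "lau n (\<lambda>_. c) (\<lambda>_ _. 0) c"
  using lau.add[OF lau.zero, of n c "\<lambda>_. 0"] by (simp add: mon_def)

lemma lau_plus:
  "lau n F F' t \<Longrightarrow> lau n G G' s \<Longrightarrow> lau n (\<lambda>w. F w + G w) (\<lambda>i w. F' i w + G' i w) (t + s)"
proof (induction rule: lau.induct)
  case zero
  then show ?case by simp
next
  case (add F F' t c v)
  then show ?case using lau.add[of n "\<lambda>w. F w + G w" "\<lambda>i w. F' i w + G' i w" "t + s" c v]
    by (simp add: add.assoc)
next
  case (cong F F' t H H')
  show ?case by (rule lau.cong[OF cong.IH[OF cong.prems]]) (auto simp: cong.hyps)
qed

lemma lau_mon_times:
  "lau n F F' t \<Longrightarrow> \<exists>r. lau n (\<lambda>w. c * mon n v w * F w)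
     (\<lambda>i w. c * of_int (v i) * mon n v w * F w + c * mon n v w * F' i w) r"
proof (induction rule: lau.induct)
  case zero
  show ?case by (rule exI, rule lau.cong[OF lau.zero]) auto
next
  case (add F F' t b u)
  then obtain r where r: "lau n (\<lambda>w. c * mon n v w * F w)
     (\<lambda>i w. c * of_int (v i) * mon n v w * F w + c * mon n v w * F' i w) r" by blast
  show ?case
    by (rule exI, rule lau.cong[OF lau.add[OF r, of "c * b" "\<lambda>i. v i + u i"]])
       (auto simp: algebra_simps mon_add[symmetric])
next
  case (cong F F' t G G')
  then obtain r where r: "lau n (\<lambda>w. c * mon n v w * F w)
     (\<lambda>i w. c * of_int (v i) * mon n v w * F w + c * mon n v w * F' i w) r" by blast
  show ?case by (rule exI, rule lau.cong[OF r]) (auto simp: cong)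
qed

lemma lau_times:
  "lau n F F' t \<Longrightarrow> lau n G G' s \<Longrightarrow> \<exists>r. lau n (\<lambda>w. F w * G w) (\<lambda>i w. F' i w * G w + F w * G' i w) r"
proof (induction rule: lau.induct)
  case zero
  show ?case by (rule exI, rule lau.cong[OF lau.zero]) auto
next
  case (add F F' t c v)
  then obtain r where r: "lau n (\<lambda>w. F w * G w) (\<lambda>i w. F' i w * G w + F w * G' i w) r" by blast
  obtain q where q: "lau n (\<lambda>w. c * mon n v w * G w)
     (\<lambda>i w. c * of_int (v i) * mon n v w * G w + c * mon n v w * G' i w) q"
    using lau_mon_times[OF add.prems] by blast
  show ?case
    by (rule exI, rule lau.cong[OF lau_plus[OF q r]]) (auto simp: algebra_simps)
next
  case (cong F F' t H H')
  then obtain r where r: "lau n (\<lambda>w. F w * G w) (\<lambda>i w. F' i w * G w + F w * G' i w) r" by blast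
  show ?case by (rule exI, rule lau.cong[OF r]) (auto simp: cong)
qed

text \<open>The constant term 0 is the content: a monomial contributing to the constant term has all
  exponents zero and is killed by the derivative. Together with \<open>lau_J\<close> this is the
  vanishing of the integral of a logarithmic derivative, the source of integration by parts.\<close>

lemma lau_deriv: "lau n F F' t \<Longrightarrow> i < n \<Longrightarrow> \<exists>F''. lau n (F' i) F'' 0"
proof (induction rule: lau.induct)
  case zero
  show ?case by (rule exI, rule lau.zero)
next
  case (add F F' t c v)
  then obtain F'' where F'': "lau n (F' i) F'' 0" by blast
  have "(if \<forall>j<n. v j = 0 then c * of_int (v i) else 0) + 0 = (0::complex)"
    using add.prems by auto
  then show ?case using lau.add[OF F'', of "c * of_int (v i)" v] by metis
next
  case (cong F F' t G G')
  then obtain F'' where F'': "lau n (F' i) F'' 0" by blast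
  show ?case by (rule exI, rule lau.cong[OF F'']) (auto simp: cong)
qed

lemma lau_swap:
  assumes ab: "a < n" "b < n"
  shows "lau n F F' t \<Longrightarrow> lau n (\<lambda>w. F (w \<circ> tsp a b)) (\<lambda>i w. F' (tsp a b i) (w \<circ> tsp a b)) t"
proof (induction rule: lau.induct)
  case zero
  show ?case by (rule lau.zero)
next
  case (add F F' t c v)
  have "(\<forall>i<n. (v \<circ> tsp a b) i = 0) \<longleftrightarrow> (\<forall>i<n. v i = 0)"
    using tsp_less[OF ab] by (metis comp_apply transpose_involutory)
  then show ?case using lau.add[OF add.IH, of c "v \<circ> tsp a b"] by (simp add: comp_def mon_swap[OF ab, unfolded comp_def])
next
  case (cong F F' t G G')
  show ?case
  proof (rule lau.cong[OF cong.IH])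
    fix w assume "w \<in> Tor n"
    then show "F (w \<circ> tsp a b) = G (w \<circ> tsp a b)"
      by (intro cong.hyps(2) Tor_swap[OF ab])
  next
    fix i w assume "i < n" "w \<in> Tor n"
    then show "F' (tsp a b i) (w \<circ> tsp a b) = G' (tsp a b i) (w \<circ> tsp a b)"
      using tsp_less[OF ab] by (intro cong.hyps(3) Tor_swap[OF ab]) auto
  qed
qed

lemma lau_bounded: "lau n F F' t \<Longrightarrow> \<exists>M. \<forall>w\<in>Tor n. cmod (F w) \<le> M"
proof (induction rule: lau.induct)
  case zero
  show ?case by auto
next
  case (add F F' t c v)
  then obtain M where "\<forall>w\<in>Tor n. cmod (F w) \<le> M" by blast
  then have "\<forall>w\<in>Tor n. cmod (c * mon n v w + F w) \<le> cmod c + M"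
    by (auto intro!: norm_triangle_mono simp: norm_mult norm_mon)
  then show ?case by blast
next
  case (cong F F' t G G')
  then show ?case by auto
qed

lemma lau_0: "lau n F F' t \<Longrightarrow> n = 0 \<Longrightarrow> F w = t"
  by (induction rule: lau.induct) (auto simp: mon_def Tor_def)

lemma has_contour_integral_powi:
  "((\<lambda>w. w powi k / (2 * of_real pi * \<i> * w)) has_contour_integral (if k = 0 then 1 else 0)) (circlepath 0 1)"
proof (cases "k = 0")
  case True
  have "((\<lambda>u. 1 / (u - 0)) has_contour_integral (2 * of_real pi * \<i> * 1)) (circlepath 0 1)"
    by (rule Cauchy_integral_circlepath) auto
  from has_contour_integral_lmul[OF this, of "1 / (2 * of_real pi * \<i>)"]
  show ?thesis using True by (simp add: field_simps)
next
  case False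
  have "((\<lambda>w. of_int k * w powi (k - 1)) has_contour_integral
     (pathfinish (circlepath 0 1) powi k - pathstart (circlepath 0 1) powi k)) (circlepath 0 1)"
    by (rule contour_integral_primitive[of "-{0}"]) (auto intro!: derivative_eq_intros)
  from has_contour_integral_lmul[OF this, of "1 / (2 * of_real pi * \<i> * of_int k)"]
  have "((\<lambda>w. 1 / (2 * of_real pi * \<i> * of_int k) * (of_int k * w powi (k - 1))) has_contour_integral 0) (circlepath 0 1)"
    by simp
  then have "((\<lambda>w. w powi k / (2 * of_real pi * \<i> * w)) has_contour_integral 0) (circlepath 0 1)"
  proof (rule has_contour_integral_eq)
    fix x assume "x \<in> path_image (circlepath 0 (1::real))"
    then have "x \<noteq> 0" by auto
    then show "1 / (2 * of_real pi * \<i> * of_int k) * (of_int k * x powi (k - 1)) = x powi k / (2 * of_real pi * \<i> * x)"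
      using False by (simp add: power_int_diff field_simps)
  qed
  then show ?thesis using False by simp
qed

lemma mon_Suc: "mon (Suc m) v (case_nat w u) = w powi v 0 * mon m (\<lambda>i. v (Suc i)) u"
  by (simp add: mon_def prod.lessThan_Suc_shift del: prod.lessThan_Suc)

text \<open>Fubini for constant terms. With the first variable frozen, the constant term in the
  others is a continuous function \<psi> of it, and the contour integral of \<psi> is the total
  constant term. This is the inductive step for iterated integrals.\<close>

lemma lau_slice:
  "lau n G G' t \<Longrightarrow> n = Suc m \<Longrightarrow> \<exists>\<psi>. continuous_on (sphere 0 1) \<psi> \<and>
     ((\<lambda>w. \<psi> w / (2 * of_real pi * \<i> * w)) has_contour_integral t) (circlepath 0 1) \<and>
     (\<forall>w. cmod w = 1 \<longrightarrow> (\<exists>H'. lau m (\<lambda>u. G (case_nat w u)) H' (\<psi> w)))"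
proof (induction rule: lau.induct)
  case zero
  show ?case by (rule exI[of _ "\<lambda>_. 0"]) (auto intro: lau.zero has_contour_integral_0)
next
  case (add F F' t c v)
  then obtain \<psi> where \<psi>: "continuous_on (sphere 0 1) \<psi>"
     "((\<lambda>w. \<psi> w / (2 * of_real pi * \<i> * w)) has_contour_integral t) (circlepath 0 1)"
     "\<And>w. cmod w = 1 \<Longrightarrow> \<exists>H'. lau m (\<lambda>u. F (case_nat w u)) H' (\<psi> w)"
    by blast
  define b where "b = (if \<forall>i<m. v (Suc i) = 0 then c else 0)"
  have all: "(\<forall>i<Suc m. v i = 0) \<longleftrightarrow> v 0 = 0 \<and> (\<forall>i<m. v (Suc i) = 0)"
    by (rule All_less_Suc2)
  show ?case
  proof (intro exI[of _ "\<lambda>w. b * w powi v 0 + \<psi> w"] conjI allI impI)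
    show "continuous_on (sphere 0 1) (\<lambda>w. b * w powi v 0 + \<psi> w)"
      by (intro continuous_intros \<psi>(1)) auto
    have "((\<lambda>w. b * (w powi v 0 / (2 * of_real pi * \<i> * w)) + \<psi> w / (2 * of_real pi * \<i> * w))
       has_contour_integral (b * (if v 0 = 0 then 1 else 0) + t)) (circlepath 0 1)"
      by (intro has_contour_integral_add has_contour_integral_lmul has_contour_integral_powi \<psi>(2))
    moreover have "b * (if v 0 = 0 then 1 else 0) + t = (if \<forall>i<n. v i = 0 then c else 0) + t"
      using add.prems all by (auto simp: b_def)
    ultimately show "((\<lambda>w. (b * w powi v 0 + \<psi> w) / (2 * of_real pi * \<i> * w)) has_contour_integral
        (if \<forall>i<n. v i = 0 then c else 0) + t) (circlepath 0 1)"
      by (simp add: add_divide_distrib)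
    fix w :: complex assume w: "cmod w = 1"
    then obtain H' where H': "lau m (\<lambda>u. F (case_nat w u)) H' (\<psi> w)" using \<psi>(3) by blast
    have "(if \<forall>i<m. v (Suc i) = 0 then c * w powi v 0 else 0) + \<psi> w = b * w powi v 0 + \<psi> w"
      by (auto simp: b_def)
    moreover note lau.add[OF H', of "c * w powi v 0" "\<lambda>i. v (Suc i)"]
    ultimately show "\<exists>H'. lau m (\<lambda>u. c * mon n v (case_nat w u) + F (case_nat w u)) H' (b * w powi v 0 + \<psi> w)"
      using add.prems by (auto simp: mon_Suc mult.assoc)
  qed
next
  case (cong F F' t G G')
  then obtain \<psi> where \<psi>: "continuous_on (sphere 0 1) \<psi>"
     "((\<lambda>w. \<psi> w / (2 * of_real pi * \<i> * w)) has_contour_integral t) (circlepath 0 1)"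
     "\<And>w. cmod w = 1 \<Longrightarrow> \<exists>H'. lau m (\<lambda>u. F (case_nat w u)) H' (\<psi> w)"
    by blast
  have T: "case_nat w u \<in> Tor n" if "cmod w = 1" "u \<in> Tor m" for w u
    using that cong.prems by (auto simp: Tor_def split: nat.split)
  have "\<exists>H'. lau m (\<lambda>u. G (case_nat w u)) H' (\<psi> w)" if w: "cmod w = 1" for w
  proof -
    obtain H' where "lau m (\<lambda>u. F (case_nat w u)) H' (\<psi> w)" using \<psi>(3) w by blast
    from lau.cong[OF this, of "\<lambda>u. G (case_nat w u)" H'] show ?thesis
      using T[OF w] cong.hyps by auto
  qed
  then show ?case using \<psi> by blast
qed

section \<open>Uniform limits of Laurent polynomials and their integrals\<close>

definition appr :: "nat \<Rightarrow> ((nat \<Rightarrow> complex) \<Rightarrow> complex) \<Rightarrow> bool" where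
  "appr n F \<longleftrightarrow> (\<forall>\<delta>>0. \<exists>G G' t. lau n G G' t \<and> (\<forall>w\<in>Tor n. cmod (F w - G w) \<le> \<delta>))"

lemma J_Suc: "J (Suc m) F = contour_integral (circlepath 0 1)
    (\<lambda>w. J m (\<lambda>u. F (case_nat w u)) / (2 * of_real pi * \<i> * w))"
proof -
  have "(!) (w # ws) = case_nat w ((!) ws)" for w :: complex and ws
    by (auto simp: fun_eq_iff nth_Cons)
  then show ?thesis by (simp add: J_def)
qed

text \<open>The torus measure has mass one, so the integral inherits the uniform distance. What
  needs proof is that the iterated contour integrals exist at all: the inner integral is a uniform
  limit of continuous functions of the outer variable. This is why \<open>appr n F\<close> is
  assumed in addition to one close \<open>G\<close>.\<close>

lemma J_close:
  "appr n F \<Longrightarrow> lau n G G' t \<Longrightarrow> (\<And>w. w \<in> Tor n \<Longrightarrow> cmod (F w - G w) \<le> \<delta>) \<Longrightarrow> cmod (J n F - t) \<le> \<delta>"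
proof (induction n arbitrary: F G G' t \<delta>)
  case 0
  then show ?case using lau_0[OF 0(2)] by (simp add: J_def Tor_def)
next
  case (Suc m)
  define \<phi> where "\<phi> w = J m (\<lambda>u. F (case_nat w u))" for w
  have T: "case_nat w u \<in> Tor (Suc m)" if "cmod w = 1" "u \<in> Tor m" for w u
    using that by (auto simp: Tor_def split: nat.split)
  have ap: "appr m (\<lambda>u. F (case_nat w u))" if w: "cmod w = 1" for w
    unfolding appr_def
  proof (intro allI impI)
    fix \<delta> :: real assume "\<delta> > 0"
    then obtain G G' t where G: "lau (Suc m) G G' t" "\<forall>w\<in>Tor (Suc m). cmod (F w - G w) \<le> \<delta>"
      using Suc.prems(1) unfolding appr_def by blast
    then show "\<exists>G G' t. lau m G G' t \<and> (\<forall>u\<in>Tor m. cmod (F (case_nat w u) - G u) \<le> \<delta>)"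
      using lau_slice[OF G(1) refl] w T by blast
  qed
  have near: "\<exists>\<psi>. continuous_on (sphere 0 1) \<psi> \<and>
     ((\<lambda>w. \<psi> w / (2 * of_real pi * \<i> * w)) has_contour_integral t) (circlepath 0 1) \<and>
     (\<forall>w. cmod w = 1 \<longrightarrow> cmod (\<phi> w - \<psi> w) \<le> \<delta>)"
    if G: "lau (Suc m) G G' t" "\<And>w. w \<in> Tor (Suc m) \<Longrightarrow> cmod (F w - G w) \<le> \<delta>" for G G' t \<delta>
  proof -
    obtain \<psi> where \<psi>: "continuous_on (sphere 0 1) \<psi>"
     "((\<lambda>w. \<psi> w / (2 * of_real pi * \<i> * w)) has_contour_integral t) (circlepath 0 1)"
     "\<And>w. cmod w = 1 \<Longrightarrow> \<exists>H'. lau m (\<lambda>u. G (case_nat w u)) H' (\<psi> w)"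
      using lau_slice[OF G(1) refl] by blast
    have "cmod (\<phi> w - \<psi> w) \<le> \<delta>" if w: "cmod w = 1" for w
    proof -
      obtain H' where "lau m (\<lambda>u. G (case_nat w u)) H' (\<psi> w)" using \<psi>(3) w by blast
      then show ?thesis unfolding \<phi>_def using G(2) T[OF w] by (intro Suc.IH ap w) auto
    qed
    then show ?thesis using \<psi> by blast
  qed
  \<comment> \<open>Approximation at every precision \<open>inverse (Suc k)\<close>, independent of
    the given \<delta>, serves only to make \<phi> continuous.\<close>
  have "\<exists>\<psi>. continuous_on (sphere 0 1) \<psi> \<and> (\<forall>w. cmod w = 1 \<longrightarrow> cmod (\<phi> w - \<psi> w) \<le> inverse (Suc k))" for k
  proof -
    obtain G G' t where "lau (Suc m) G G' t" "\<forall>w\<in>Tor (Suc m). cmod (F w - G w) \<le> inverse (Suc k)"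
      using Suc.prems(1) unfolding appr_def by (metis inverse_positive_iff_positive of_nat_0_less_iff zero_less_Suc)
    then show ?thesis using near by blast
  qed
  then obtain \<psi>s where \<psi>s: "\<And>k. continuous_on (sphere 0 1) (\<psi>s k)"
    "\<And>k w. cmod w = 1 \<Longrightarrow> cmod (\<phi> w - \<psi>s k w) \<le> inverse (Suc k)" by metis
  have "continuous_on (sphere 0 1) \<phi>"
  proof (rule uniform_limit_theorem[where f = \<psi>s and F = sequentially])
    show "uniform_limit (sphere 0 1) \<psi>s \<phi> sequentially"
    proof (rule uniform_limitI)
      fix e :: real assume "e > 0"
      then have "\<forall>\<^sub>F k in sequentially. inverse (Suc k) < e"
        using LIMSEQ_inverse_real_of_nat order_tendstoD(2) by blast
      then show "\<forall>\<^sub>F k in sequentially. \<forall>w\<in>sphere 0 1. dist (\<psi>s k w) (\<phi> w) < e"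
        by eventually_elim (auto simp: dist_norm norm_minus_commute simp del: of_nat_Suc intro: le_less_trans[OF \<psi>s(2)])
    qed
  qed (use \<psi>s(1) in auto)
  then have "continuous_on (path_image (circlepath 0 1)) (\<lambda>w. \<phi> w / (2 * of_real pi * \<i> * w))"
    by (auto intro!: continuous_intros simp: sphere_def)
  then have int: "(\<lambda>w. \<phi> w / (2 * of_real pi * \<i> * w)) contour_integrable_on circlepath 0 1"
    by (rule contour_integrable_continuous_circlepath)
  obtain \<psi> where \<psi>: "((\<lambda>w. \<psi> w / (2 * of_real pi * \<i> * w)) has_contour_integral t) (circlepath 0 1)"
     "\<And>w. cmod w = 1 \<Longrightarrow> cmod (\<phi> w - \<psi> w) \<le> \<delta>"
    using near[OF Suc.prems(2,3)] by blast
  have "((\<lambda>w. \<phi> w / (2 * of_real pi * \<i> * w) - \<psi> w / (2 * of_real pi * \<i> * w)) has_contour_integral (J (Suc m) F - t)) (circlepath 0 1)"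
    unfolding J_Suc \<phi>_def[symmetric]
    by (intro has_contour_integral_diff has_contour_integral_integral int \<psi>)
  moreover have "\<delta> \<ge> 0" using \<psi>(2)[of 1] by (meson norm_ge_zero norm_one order_trans)
  moreover have "cmod (\<phi> w / (2 * of_real pi * \<i> * w) - \<psi> w / (2 * of_real pi * \<i> * w)) \<le> \<delta> / (2 * pi)"
    if "cmod (w - 0) = 1" for w
    using \<psi>(2)[of w] that by (simp add: norm_divide norm_mult divide_right_mono flip: diff_divide_distrib)
  ultimately have "cmod (J (Suc m) F - t) \<le> \<delta> / (2 * pi) * (2 * pi * 1)"
    by (intro has_contour_integral_bound_circlepath) auto
  then show ?case by simp
qed

lemma lau_appr: "lau n F F' t \<Longrightarrow> appr n F"
  unfolding appr_def by (metis cancel_comm_monoid_add_class.diff_cancel less_imp_le norm_zero)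

lemma lau_J: "lau n F F' t \<Longrightarrow> J n F = t"
  using J_close[OF lau_appr, of n F F' t F F' t 0] by auto

lemma appr_seq:
  assumes "appr n F"
  obtains G G' t where "\<And>k. lau n (G k) (G' k) (t k)" "\<And>k w. w \<in> Tor n \<Longrightarrow> cmod (F w - G k w) \<le> inverse (real (Suc k))"
    "t \<longlonglongrightarrow> J n F"
proof -
  have "\<exists>G G' t. lau n G G' t \<and> (\<forall>w\<in>Tor n. cmod (F w - G w) \<le> inverse (real (Suc k)))" for k
    using assms unfolding appr_def by (metis inverse_positive_iff_positive of_nat_0_less_iff zero_less_Suc)
  then obtain G G' t where G: "\<And>k. lau n (G k) (G' k) (t k)"
    "\<And>k w. w \<in> Tor n \<Longrightarrow> cmod (F w - G k w) \<le> inverse (real (Suc k))" by metis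
  have "cmod (J n F - t k) \<le> inverse (real (Suc k))" for k
    by (rule J_close[OF assms G(1)]) (rule G(2))
  then have "(\<lambda>k. t k - J n F) \<longlonglongrightarrow> 0"
    by (intro Lim_null_comparison[OF _ LIMSEQ_inverse_real_of_nat]) (auto simp: norm_minus_commute)
  then have lim: "t \<longlonglongrightarrow> J n F" by (rule LIM_zero_cancel)
  show thesis by (rule that[OF G(1) G(2) lim])
qed

lemma J_limit:
  assumes "\<And>k. lau n (G k) (G' k) (t k)" "\<And>k w. w \<in> Tor n \<Longrightarrow> cmod (F w - G k w) \<le> e k" "e \<longlonglongrightarrow> 0"
  shows "appr n F" "t \<longlonglongrightarrow> J n F"
proof -
  show ap: "appr n F"
    unfolding appr_def
  proof (intro allI impI)
    fix \<delta> :: real assume "\<delta> > 0"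
    then have "\<forall>\<^sub>F k in sequentially. e k < \<delta>"
      using assms(3) order_tendstoD(2) by blast
    then obtain k where "e k < \<delta>" using eventually_happens' sequentially_bot by blast
    then show "\<exists>G G' t. lau n G G' t \<and> (\<forall>w\<in>Tor n. cmod (F w - G w) \<le> \<delta>)"
      using assms(1)[of k] assms(2)[of _ k] by (meson less_imp_le order_trans)
  qed
  have "cmod (J n F - t k) \<le> e k" for k
    by (rule J_close[OF ap assms(1)]) (rule assms(2))
  then have "(\<lambda>k. t k - J n F) \<longlonglongrightarrow> 0"
    by (intro Lim_null_comparison[OF _ assms(3)]) (auto simp: norm_minus_commute)
  then show "t \<longlonglongrightarrow> J n F" by (rule LIM_zero_cancel)
qed

lemma inverse_Suc_tendsto: "(\<lambda>k. c * inverse (real (Suc k))) \<longlonglongrightarrow> 0"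
  using tendsto_mult_right_zero[OF LIMSEQ_inverse_real_of_nat] by simp

lemma J_add:
  assumes "appr n F" "appr n G"
  shows "appr n (\<lambda>w. F w + G w)" "J n (\<lambda>w. F w + G w) = J n F + J n G"
proof -
  obtain A A' a where A: "\<And>k. lau n (A k) (A' k) (a k)" "\<And>k w. w \<in> Tor n \<Longrightarrow> cmod (F w - A k w) \<le> inverse (real (Suc k))"
    "a \<longlonglongrightarrow> J n F" by (rule appr_seq[OF assms(1)]) (rule that; blast)
  obtain B B' b where B: "\<And>k. lau n (B k) (B' k) (b k)" "\<And>k w. w \<in> Tor n \<Longrightarrow> cmod (G w - B k w) \<le> inverse (real (Suc k))"
    "b \<longlonglongrightarrow> J n G" by (rule appr_seq[OF assms(2)]) (rule that; blast)
  have close: "cmod (F w + G w - (A k w + B k w)) \<le> 2 * inverse (real (Suc k))" if "w \<in> Tor n" for k w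
    using norm_triangle_ineq[of "F w - A k w" "G w - B k w"] A(2)[OF that, of k] B(2)[OF that, of k]
    by (simp add: algebra_simps)
  show "appr n (\<lambda>w. F w + G w)"
    by (rule J_limit(1)[OF lau_plus[OF A(1) B(1)] close inverse_Suc_tendsto])
  have "(\<lambda>k. a k + b k) \<longlonglongrightarrow> J n (\<lambda>w. F w + G w)"
    by (rule J_limit(2)[OF lau_plus[OF A(1) B(1)] close inverse_Suc_tendsto])
  moreover have "(\<lambda>k. a k + b k) \<longlonglongrightarrow> J n F + J n G"
    using A(3) B(3) by (rule tendsto_add)
  ultimately show "J n (\<lambda>w. F w + G w) = J n F + J n G"
    using LIMSEQ_unique by blast
qed

lemma lau_cmult: "lau n F F' t \<Longrightarrow> lau n (\<lambda>w. c * F w) (\<lambda>i w. c * F' i w) (c * t)"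
proof (induction rule: lau.induct)
  case zero
  show ?case using lau.zero[of n] by simp
next
  case (add F F' t b v)
  then show ?case using lau.add[OF add.IH, of "c * b" v] by (cases "\<forall>i<n. v i = 0") (auto simp: algebra_simps)
next
  case (cong F F' t G G')
  show ?case by (rule lau.cong[OF cong.IH]) (auto simp: cong)
qed

lemma J_cmult:
  assumes "appr n F"
  shows "appr n (\<lambda>w. c * F w)" "J n (\<lambda>w. c * F w) = c * J n F"
proof -
  obtain A A' a where A: "\<And>k. lau n (A k) (A' k) (a k)" "\<And>k w. w \<in> Tor n \<Longrightarrow> cmod (F w - A k w) \<le> inverse (real (Suc k))"
    "a \<longlonglongrightarrow> J n F" by (rule appr_seq[OF assms(1)]) (rule that; blast)
  have close: "cmod (c * F w - c * A k w) \<le> cmod c * inverse (real (Suc k))" if "w \<in> Tor n" for k w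
    using A(2)[OF that, of k] by (simp add: norm_mult mult_left_mono flip: right_diff_distrib)
  show "appr n (\<lambda>w. c * F w)"
    by (rule J_limit(1)[OF lau_cmult[OF A(1)] close inverse_Suc_tendsto])
  have "(\<lambda>k. c * a k) \<longlonglongrightarrow> J n (\<lambda>w. c * F w)"
    by (rule J_limit(2)[OF lau_cmult[OF A(1)] close inverse_Suc_tendsto])
  moreover have "(\<lambda>k. c * a k) \<longlonglongrightarrow> c * J n F"
    using A(3) by (rule tendsto_mult_left)
  ultimately show "J n (\<lambda>w. c * F w) = c * J n F"
    using LIMSEQ_unique by blast
qed

text \<open>The iterated integral is not visibly symmetric in its variables. Constant terms of
  Laurent polynomials are, and the symmetry survives the uniform limit.\<close>

lemma J_swap:
  assumes "appr n F" and ab: "a < n" "b < n"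
  shows "appr n (\<lambda>w. F (w \<circ> tsp a b))" "J n (\<lambda>w. F (w \<circ> tsp a b)) = J n F"
proof -
  obtain A A' t where A: "\<And>k. lau n (A k) (A' k) (t k)" "\<And>k w. w \<in> Tor n \<Longrightarrow> cmod (F w - A k w) \<le> inverse (real (Suc k))"
    "t \<longlonglongrightarrow> J n F" by (rule appr_seq[OF assms(1)]) (rule that; blast)
  note lim = J_limit[where F = "\<lambda>w. F (w \<circ> tsp a b)", OF lau_swap[OF ab A(1)] A(2)[OF Tor_swap[OF ab]] LIMSEQ_inverse_real_of_nat]
  show "appr n (\<lambda>w. F (w \<circ> tsp a b))" by (rule lim(1))
  show "J n (\<lambda>w. F (w \<circ> tsp a b)) = J n F" using lim(2) A(3) LIMSEQ_unique by blast
qed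

lemma appr_mult_lau:
  assumes "appr n F" "lau n H H' t"
  shows "appr n (\<lambda>w. F w * H w)"
  unfolding appr_def
proof (intro allI impI)
  fix \<delta> :: real assume \<delta>: "\<delta> > 0"
  obtain M where M: "\<forall>w\<in>Tor n. cmod (H w) \<le> M" using lau_bounded[OF assms(2)] by blast
  obtain G G' s where G: "lau n G G' s" "\<forall>w\<in>Tor n. cmod (F w - G w) \<le> \<delta> / (1 + \<bar>M\<bar>)"
    using assms(1) \<delta> unfolding appr_def by (metis abs_ge_zero add_pos_nonneg divide_pos_pos zero_less_one)
  obtain r where r: "lau n (\<lambda>w. G w * H w) (\<lambda>i w. G' i w * H w + G w * H' i w) r"
    using lau_times[OF G(1) assms(2)] by blast
  have "cmod (F w * H w - G w * H w) \<le> \<delta>" if w: "w \<in> Tor n" for w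
  proof -
    have "cmod (F w * H w - G w * H w) = cmod (F w - G w) * cmod (H w)"
      by (simp add: norm_mult flip: left_diff_distrib)
    also have "\<dots> \<le> \<delta> / (1 + \<bar>M\<bar>) * (1 + \<bar>M\<bar>)"
      using G(2) M w \<delta> by (intro mult_mono) force+
    finally show ?thesis by simp
  qed
  then show "\<exists>G G' t. lau n G G' t \<and> (\<forall>w\<in>Tor n. cmod (F w * H w - G w) \<le> \<delta>)"
    using r by blast
qed

lemma J_cong: "appr n F \<Longrightarrow> (\<And>w. w \<in> Tor n \<Longrightarrow> F w = G w) \<Longrightarrow> J n F = J n G \<and> appr n G"
proof
  assume ap: "appr n F" and eq: "\<And>w. w \<in> Tor n \<Longrightarrow> F w = G w"
  obtain A A' a where A: "\<And>k. lau n (A k) (A' k) (a k)" "\<And>k w. w \<in> Tor n \<Longrightarrow> cmod (F w - A k w) \<le> inverse (real (Suc k))"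
    "a \<longlonglongrightarrow> J n F" by (rule appr_seq[OF ap]) (rule that; blast)
  have close: "\<And>k w. w \<in> Tor n \<Longrightarrow> cmod (G w - A k w) \<le> inverse (real (Suc k))" using A(2) eq by simp
  show "appr n G" by (rule J_limit(1)[OF A(1) close LIMSEQ_inverse_real_of_nat])
  show "J n F = J n G" using J_limit(2)[OF A(1) close LIMSEQ_inverse_real_of_nat] A(3) LIMSEQ_unique by blast
qed

lemma J_sum:
  assumes "finite I" "\<And>i. i \<in> I \<Longrightarrow> appr n (F i)"
  shows "appr n (\<lambda>w. \<Sum>i\<in>I. F i w) \<and> J n (\<lambda>w. \<Sum>i\<in>I. F i w) = (\<Sum>i\<in>I. J n (F i))"
  using assms
proof (induction I rule: finite_induct)
  case empty
  then show ?case using lau_J[OF lau.zero] lau_appr[OF lau.zero] by simp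
next
  case (insert i I)
  then show ?case using J_add[of n "F i" "\<lambda>w. \<Sum>i\<in>I. F i w"] by simp
qed

section \<open>The weight function\<close>

lemma torus_int_cong:
  "(\<And>ws. length ws = n \<Longrightarrow> \<forall>i<n. cmod (ws ! i) = 1 \<Longrightarrow> F ws = G ws) \<Longrightarrow> torus_int n F = torus_int n G"
proof (induction n arbitrary: F G)
  case 0
  then show ?case by simp
next
  case (Suc m)
  have "torus_int m (\<lambda>ws. F (w # ws)) = torus_int m (\<lambda>ws. G (w # ws))" if "cmod w = 1" for w
    using that by (intro Suc.IH Suc.prems) (auto simp: All_less_Suc2)
  then show ?case by (auto intro!: contour_integral_eq)
qed

definition sqd :: "(nat \<Rightarrow> complex) \<Rightarrow> nat \<Rightarrow> nat \<Rightarrow> real" where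
  "sqd w a b = (cmod (w a - w b))\<^sup>2"

definition Pairs :: "nat \<Rightarrow> (nat \<times> nat) set" where
  "Pairs n = {(i, j). i < n \<and> j < n \<and> i \<noteq> j}"

text \<open>Each ordered pair contributes the \<beta>-th power of the distance, written as a power
  of the squared distance because the latter is a Laurent polynomial on the torus.\<close>

definition Dl :: "nat \<Rightarrow> real \<Rightarrow> (nat \<Rightarrow> complex) \<Rightarrow> complex" where
  "Dl n \<beta> w = (\<Prod>(a, b)\<in>Pairs n. of_real (sqd w a b powr (\<beta> / 2)))"

text \<open>On the torus \<open>-(w j + w i) / (w j - w i)\<close> is the logarithmic derivative of
  \<open>sqd w i j\<close> in the variable \<open>i\<close>. It is odd under the exchange of
  \<open>i\<close> and \<open>j\<close>, so it meets the antisymmetrised monomial, which cancels its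
  pole. On the diagonal the value is 0 by the convention for division; the weight vanishes
  there.\<close>

definition Wf :: "nat \<Rightarrow> nat \<Rightarrow> nat \<Rightarrow> (nat \<Rightarrow> int) \<Rightarrow> (nat \<Rightarrow> complex) \<Rightarrow> complex" where
  "Wf n i j v w = (w j + w i) / (w j - w i) * (mon n v w - mon n (v \<circ> tsp i j) w)"

lemma finite_Pairs [simp]: "finite (Pairs n)"
  by (rule finite_subset[of _ "{..<n} \<times> {..<n}"]) (auto simp: Pairs_def)

lemma sqd_sym: "sqd w a b = sqd w b a"
  by (simp add: sqd_def norm_minus_commute)

lemma sqd_range: "w \<in> Tor n \<Longrightarrow> a < n \<Longrightarrow> b < n \<Longrightarrow> sqd w a b \<in> {0..4}"
  using norm_triangle_ineq4[of "w a" "w b"] power_mono[of "cmod (w a - w b)" 2 2]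
  by (auto simp: sqd_def Tor_def)

lemma inverse_Tor: "w \<in> Tor n \<Longrightarrow> i < n \<Longrightarrow> inverse (w i) = cnj (w i)"
  using complex_norm_square[of "w i"] by (intro inverse_unique) (auto simp: Tor_def)

lemma sqd_complex:
  assumes "w \<in> Tor n" "a < n" "b < n"
  shows "of_real (sqd w a b) = 2 - w a / w b - w b / w a"
proof -
  have "of_real (sqd w a b) = (w a - w b) * (cnj (w a) - cnj (w b))"
    unfolding sqd_def complex_norm_square by simp
  also have "\<dots> = (w a - w b) * (inverse (w a) - inverse (w b))"
    using assms by (simp add: inverse_Tor)
  also have "\<dots> = 2 - w a / w b - w b / w a"
    using assms Tor_nonzero[OF assms(1)] by (simp add: field_simps)
  finally show ?thesis .
qed

definition lau0 :: "nat \<Rightarrow> ((nat \<Rightarrow> complex) \<Rightarrow> complex) \<Rightarrow> (nat \<Rightarrow> (nat \<Rightarrow> complex) \<Rightarrow> complex) \<Rightarrow> bool" where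
  "lau0 n F F' \<longleftrightarrow> (\<exists>t. lau n F F' t)"

lemma lau0_cong: "lau0 n F F' \<Longrightarrow> (\<And>w. w \<in> Tor n \<Longrightarrow> F w = G w) \<Longrightarrow>
     (\<And>i w. i < n \<Longrightarrow> w \<in> Tor n \<Longrightarrow> F' i w = G' i w) \<Longrightarrow> lau0 n G G'"
  unfolding lau0_def using lau.cong by blast

lemma lau0_times: "lau0 n F F' \<Longrightarrow> lau0 n G G' \<Longrightarrow> lau0 n (\<lambda>w. F w * G w) (\<lambda>i w. F' i w * G w + F w * G' i w)"
  unfolding lau0_def using lau_times by blast

lemma lau0_plus: "lau0 n F F' \<Longrightarrow> lau0 n G G' \<Longrightarrow> lau0 n (\<lambda>w. F w + G w) (\<lambda>i w. F' i w + G' i w)"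
  unfolding lau0_def using lau_plus by blast

lemma lau0_const: "lau0 n (\<lambda>_. c) (\<lambda>_ _. 0)"
  unfolding lau0_def using lau_const by blast

lemma lau0_mon: "lau0 n (mon n v) (\<lambda>i w. of_int (v i) * mon n v w)"
  unfolding lau0_def using lau_mon by blast

lemma lau0_appr: "lau0 n F F' \<Longrightarrow> appr n F"
  unfolding lau0_def using lau_appr by blast

lemma lau0_deriv: "lau0 n F F' \<Longrightarrow> i < n \<Longrightarrow> J n (F' i) = 0 \<and> (\<exists>F''. lau0 n (F' i) F'')"
  unfolding lau0_def using lau_deriv lau_J by blast

lemma mon_ratio:
  assumes "w \<in> Tor n" "a < n" "b < n" "a \<noteq> b"
  shows "mon n (\<lambda>k. if k = a then 1 else if k = b then -1 else 0) w = w a / w b"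
proof -
  have "mon n (\<lambda>k. if k = a then 1 else if k = b then -1 else 0) w
      = (\<Prod>k<n. (if k = a then w a else 1) * (if k = b then inverse (w b) else 1))"
    unfolding mon_def by (intro prod.cong refl) (use assms in auto)
  then show ?thesis using assms by (simp add: prod.distrib divide_inverse)
qed

text \<open>The logarithmic derivative of \<open>sqd w a b\<close> in the variable \<open>i\<close>,
  read off from \<open>sqd_complex\<close>.\<close>

definition Ds :: "nat \<Rightarrow> nat \<Rightarrow> nat \<Rightarrow> (nat \<Rightarrow> complex) \<Rightarrow> complex" where
  "Ds a b i w = (if a = i then w b / w a - w a / w b else if b = i then w a / w b - w b / w a else 0)"

lemma lau0_sqd:
  assumes "a < n" "b < n" "a \<noteq> b"
  shows "lau0 n (\<lambda>w. of_real (sqd w a b)) (Ds a b)"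
proof -
  define u where "u a b = (\<lambda>k. if k = a then 1 else if k = b then -1 else (0::int))" for a b :: nat
  have neg: "lau0 n (\<lambda>w. - 1 * mon n (u a b) w) (\<lambda>i w. 0 * mon n (u a b) w + - 1 * (of_int (u a b i) * mon n (u a b) w))" for a b
    by (intro lau0_times lau0_const lau0_mon)
  show ?thesis
    by (rule lau0_cong[OF lau0_plus[OF lau0_const[of n 2] lau0_plus[OF neg[of a b] neg[of b a]]]])
       (use assms in \<open>auto simp: sqd_complex u_def Ds_def mon_ratio\<close>)
qed

lemma lau0_poly:
  assumes F: "lau0 n (\<lambda>w. of_real (f w)) F'"
  shows "lau0 n (\<lambda>w. of_real (poly p (f w))) (\<lambda>i w. F' i w * of_real (poly (pderiv p) (f w)))"
proof (induction p)
  case 0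
  show ?case by (rule lau0_cong[OF lau0_const[of n 0]]) auto
next
  case (pCons c p)
  show ?case
    by (rule lau0_cong[OF lau0_plus[OF lau0_const[of n "of_real c"] lau0_times[OF F pCons.IH]]])
       (auto simp: pderiv_pCons algebra_simps)
qed

lemma lau0_prod:
  "finite X \<Longrightarrow> (\<And>x. x \<in> X \<Longrightarrow> lau0 n (F x) (F' x)) \<Longrightarrow>
     lau0 n (\<lambda>w. \<Prod>x\<in>X. F x w) (\<lambda>i w. \<Sum>x\<in>X. F' x i w * (\<Prod>y\<in>X-{x}. F y w))"
proof (induction X rule: finite_induct)
  case empty
  show ?case using lau0_const[of n 1] by simp
next
  case (insert z X)
  have sum: "(\<Sum>x\<in>X. F' x i w * (\<Prod>y\<in>insert z X - {x}. F y w)) = F z w * (\<Sum>x\<in>X. F' x i w * (\<Prod>y\<in>X-{x}. F y w))" for i w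
    unfolding sum_distrib_left
  proof (intro sum.cong refl)
    fix x assume "x \<in> X"
    then have "insert z X - {x} = insert z (X - {x})" using insert.hyps by auto
    then show "F' x i w * (\<Prod>y\<in>insert z X - {x}. F y w) = F z w * (F' x i w * (\<Prod>y\<in>X-{x}. F y w))"
      using insert.hyps by simp
  qed
  have zX: "insert z X - {z} = X" using insert.hyps by auto
  show ?case
    by (rule lau0_cong[OF lau0_times[OF insert.prems[of z] insert.IH[OF insert.prems]]])
       (use insert.hyps in \<open>auto simp: sum zX\<close>)
qed

lemma uniform_limit_prod:
  fixes f :: "'i \<Rightarrow> nat \<Rightarrow> 'w \<Rightarrow> complex"
  shows "finite X \<Longrightarrow> (\<And>x. x \<in> X \<Longrightarrow> uniform_limit S (f x) (g x) sequentially) \<Longrightarrow> (\<And>x. x \<in> X \<Longrightarrow> bounded (g x ` S)) \<Longrightarrow>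
    uniform_limit S (\<lambda>k w. \<Prod>x\<in>X. f x k w) (\<lambda>w. \<Prod>x\<in>X. g x w) sequentially \<and> bounded ((\<lambda>w. \<Prod>x\<in>X. g x w) ` S)"
proof (induction X rule: finite_induct)
  case empty
  then show ?case by (auto intro!: uniform_limit_const intro: boundedI[of _ 1])
next
  case (insert z X)
  then have IH: "uniform_limit S (\<lambda>k w. \<Prod>x\<in>X. f x k w) (\<lambda>w. \<Prod>x\<in>X. g x w) sequentially" "bounded ((\<lambda>w. \<Prod>x\<in>X. g x w) ` S)"
    by auto
  have "uniform_limit S (\<lambda>k w. f z k w * (\<Prod>x\<in>X. f x k w)) (\<lambda>w. g z w * (\<Prod>x\<in>X. g x w)) sequentially"
    using insert by (intro uniform_lim_mult IH) auto
  moreover have "bounded ((\<lambda>w. g z w * (\<Prod>x\<in>X. g x w)) ` S)"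
  proof -
    obtain A where "\<forall>w\<in>S. cmod (g z w) \<le> A" using insert.prems(2)[of z] by (auto simp: bounded_iff)
    moreover obtain B where "\<forall>w\<in>S. cmod (\<Prod>x\<in>X. g x w) \<le> B" using IH(2) by (auto simp: bounded_iff)
    ultimately have "\<forall>w\<in>S. cmod (g z w * (\<Prod>x\<in>X. g x w)) \<le> \<bar>A\<bar> * \<bar>B\<bar>"
      by (auto simp: norm_mult intro!: mult_mono intro: order_trans[OF _ abs_ge_self])
    then show ?thesis by (auto simp: bounded_iff)
  qed
  ultimately show ?case using insert by simp
qed

lemma J_uniform:
  assumes F: "\<And>k. lau0 n (F k) (F' k)" and lim: "uniform_limit (Tor n) F l sequentially"
  shows "appr n l" "(\<lambda>k. J n (F k)) \<longlonglongrightarrow> J n l"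
proof -
  obtain t where t: "\<And>k. lau n (F k) (F' k) (t k)" using F unfolding lau0_def by metis
  have close: "\<forall>\<^sub>F k in sequentially. \<forall>w\<in>Tor n. cmod (l w - F k w) \<le> \<delta>" if "\<delta> > 0" for \<delta>
    using uniform_limitD[OF lim that] by eventually_elim (auto simp: dist_norm norm_minus_commute intro: less_imp_le)
  show ap: "appr n l"
    unfolding appr_def
  proof (intro allI impI)
    fix \<delta> :: real assume "\<delta> > 0"
    then obtain k where "\<forall>w\<in>Tor n. cmod (l w - F k w) \<le> \<delta>"
      using eventually_happens'[OF sequentially_bot close] by blast
    then show "\<exists>G G' s. lau n G G' s \<and> (\<forall>w\<in>Tor n. cmod (l w - G w) \<le> \<delta>)" using t by blast
  qed
  have "\<forall>\<^sub>F k in sequentially. dist (J n (F k)) (J n l) < e" if e: "e > 0" for e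
  proof -
    have "\<forall>\<^sub>F k in sequentially. \<forall>w\<in>Tor n. cmod (l w - F k w) \<le> e / 2" using close[of "e / 2"] e by simp
    then show ?thesis
    proof eventually_elim
      case (elim k)
      then have "cmod (J n l - t k) \<le> e / 2" by (intro J_close[OF ap t]) auto
      then show ?case using e lau_J[OF t] by (simp add: dist_norm norm_minus_commute)
    qed
  qed
  then show "(\<lambda>k. J n (F k)) \<longlonglongrightarrow> J n l" by (rule tendstoI)
qed

lemma power_int_swap_bound:
  fixes x y :: complex and p q :: int
  assumes "cmod x = 1" "cmod y = 1"
  shows "cmod (x powi p * y powi q - x powi q * y powi p) \<le> of_int \<bar>p - q\<bar> * cmod (x - y)"
proof -
  have nz: "x \<noteq> 0" "y \<noteq> 0" using assms by auto
  have wlog: "cmod (x powi p * y powi q - x powi q * y powi p) \<le> of_int \<bar>p - q\<bar> * cmod (x - y)" if "q \<le> p" for p q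
  proof -
    define m where "m = nat (p - q)"
    have m: "p = q + int m" using that by (simp add: m_def)
    have pw: "z powi p = z powi q * z ^ m" if "z \<noteq> 0" for z :: complex
      unfolding m using that by (simp add: power_int_add)
    have "x powi p * y powi q - x powi q * y powi p = x powi q * y powi q * (x ^ m - y ^ m)"
      unfolding pw[OF nz(1)] pw[OF nz(2)] by (simp add: right_diff_distrib mult_ac)
    then have "cmod (x powi p * y powi q - x powi q * y powi p) = cmod (x ^ m - y ^ m)"
      using assms by (simp add: norm_mult norm_power_int)
    also have "\<dots> \<le> m * cmod (x - y)" using assms by (intro norm_power_diff) auto
    finally show ?thesis by (simp add: m)
  qed
  show ?thesis
  proof (cases "q \<le> p")
    case False
    then show ?thesis using wlog[of p q] by (simp add: norm_minus_commute abs_minus_commute)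
  qed (rule wlog)
qed

text \<open>A direct estimate is used because the value fixed on the diagonal need not be the limit
  of the neighbouring ones, so boundedness does not follow from continuity on the torus. The
  numerator vanishes to first order in \<open>w i - w j\<close>.\<close>

lemma Wf_bounded:
  assumes "i < n" "j < n" "i \<noteq> j" "w \<in> Tor n"
  shows "cmod (Wf n i j v w) \<le> 2 * of_int \<bar>v i - v j\<bar>"
proof (cases "w i = w j")
  case True
  then show ?thesis by (simp add: Wf_def)
next
  case False
  define R where "R = (\<Prod>k\<in>{..<n} - {i} - {j}. w k powi v k)"
  have split: "mon n u w = w i powi u i * (w j powi u j * (\<Prod>k\<in>{..<n} - {i} - {j}. w k powi u k))" for u
    unfolding mon_def using assms by (subst prod.remove[of _ i], simp, simp, subst prod.remove[of _ j]) auto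
  have "(\<Prod>k\<in>{..<n} - {i} - {j}. w k powi (v \<circ> tsp i j) k) = R"
    unfolding R_def by (intro prod.cong refl) (auto simp: Transposition.transpose_def)
  then have "mon n v w - mon n (v \<circ> tsp i j) w = (w i powi v i * w j powi v j - w i powi v j * w j powi v i) * R"
    unfolding split R_def using assms by (simp add: algebra_simps)
  moreover have "cmod R = 1"
    using assms unfolding R_def by (simp add: Tor_def norm_power_int flip: prod_norm)
  ultimately have "cmod (mon n v w - mon n (v \<circ> tsp i j) w) \<le> of_int \<bar>v i - v j\<bar> * cmod (w i - w j)"
    using power_int_swap_bound[of "w i" "w j" "v i" "v j"] assms by (simp add: norm_mult Tor_def)
  moreover have "cmod (w j + w i) \<le> 2"
    using norm_triangle_ineq[of "w j" "w i"] assms by (simp add: Tor_def)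
  ultimately have "cmod (w j + w i) * cmod (mon n v w - mon n (v \<circ> tsp i j) w) \<le> 2 * (of_int \<bar>v i - v j\<bar> * cmod (w i - w j))"
    by (intro mult_mono) auto
  then have "cmod (w j + w i) * cmod (mon n v w - mon n (v \<circ> tsp i j) w) / cmod (w j - w i) \<le> 2 * of_int \<bar>v i - v j\<bar>"
    using False by (simp add: divide_le_eq norm_minus_commute mult.assoc)
  then show ?thesis by (simp add: Wf_def norm_mult norm_divide)
qed

lemma bounded_powr_sqd:
  assumes "\<beta> > 0" "a < n" "b < n"
  shows "bounded ((\<lambda>w. complex_of_real (sqd w a b powr (\<beta> / 2))) ` Tor n)"
  using sqd_range[OF _ assms(2,3)] assms(1)
  by (auto simp: bounded_iff intro!: exI[of _ "4 powr (\<beta> / 2)"] powr_mono2)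

lemma Pairs_swap_remove:
  fixes h :: "nat \<Rightarrow> nat \<Rightarrow> complex"
  assumes "\<And>a b. h a b = h b a" "(i, j) \<in> Pairs n"
  shows "(\<Prod>(a, b)\<in>Pairs n - {(j, i)}. h a b) = (\<Prod>(a, b)\<in>Pairs n - {(i, j)}. h a b)"
  by (rule prod.reindex_bij_witness[of _ prod.swap prod.swap]) (use assms in \<open>auto simp: Pairs_def\<close>)

lemma tsp_iff:
  "tsp i j a = j \<longleftrightarrow> a = i" "tsp i j a = i \<longleftrightarrow> a = j" "tsp i j a = tsp i j b \<longleftrightarrow> a = b"
  by (auto simp: Transposition.transpose_def)

lemma Pairs_tsp_remove:
  fixes h :: "nat \<Rightarrow> nat \<Rightarrow> complex"
  assumes "(i, j) \<in> Pairs n"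
  shows "(\<Prod>(a, b)\<in>Pairs n - {(i, j)}. h (tsp i j a) (tsp i j b)) = (\<Prod>(a, b)\<in>Pairs n - {(j, i)}. h a b)"
  by (rule prod.reindex_bij_witness[of _ "map_prod (tsp i j) (tsp i j)" "map_prod (tsp i j) (tsp i j)"])
     (use assms in \<open>auto simp: Pairs_def tsp_less tsp_iff\<close>)

lemma Dl_swap:
  assumes "i < n" "j < n"
  shows "Dl n \<beta> (w \<circ> tsp i j) = Dl n \<beta> w"
  unfolding Dl_def
  by (rule prod.reindex_bij_witness[of _ "map_prod (tsp i j) (tsp i j)" "map_prod (tsp i j) (tsp i j)"])
     (use assms in \<open>auto simp: Pairs_def tsp_less tsp_iff sqd_def\<close>)

text \<open>Integration by parts for \<open>w\<^sub>i \<partial> / \<partial> w\<^sub>i\<close>; the logarithmic derivative of the weight contributes the terms with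
  \<open>(w\<^sub>j + w\<^sub>i) / (w\<^sub>j - w\<^sub>i)\<close>. Since the powers are not differentiable at collisions of variables, the identity is
  obtained by polynomial approximation of the weight and of its derivative.\<close>
theorem weight_identity:
  assumes \<beta>: "\<beta> > 0" and i: "i < n"
  shows "of_int (v i) * J n (\<lambda>w. Dl n \<beta> w * mon n v w)
       = of_real (\<beta> / 2) * (\<Sum>j\<in>{..<n} - {i}. J n (\<lambda>w. Dl n \<beta> w * Wf n i j v w))"
    and "appr n (Dl n \<beta>)"
    and "\<And>j. j \<in> {..<n} - {i} \<Longrightarrow> appr n (\<lambda>w. Dl n \<beta> w * Wf n i j v w)"
proof -
  define \<gamma> where "\<gamma> = \<beta> / 2"
  have \<gamma>: "\<gamma> > 0" using \<beta> by (simp add: \<gamma>_def)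
  have "\<exists>P :: real poly. \<forall>s\<in>{0..4}. \<bar>poly P s - s powr \<gamma>\<bar> \<le> inverse (Suc k) \<and>
      \<bar>s * poly (pderiv P) s - \<gamma> * s powr \<gamma>\<bar> \<le> inverse (Suc k)" for k
    by (rule powr_poly_approx[OF \<gamma>, of "inverse (Suc k)"]) (simp, blast)
  then obtain P :: "nat \<Rightarrow> real poly" where
    P1: "\<And>k s. s \<in> {0..4} \<Longrightarrow> \<bar>poly (P k) s - s powr \<gamma>\<bar> \<le> inverse (Suc k)" and
    P2: "\<And>k s. s \<in> {0..4} \<Longrightarrow> \<bar>s * poly (pderiv (P k)) s - \<gamma> * s powr \<gamma>\<bar> \<le> inverse (Suc k)"
    by metis
  define p where "p a b k w = complex_of_real (poly (P k) (sqd w a b))" for a b k w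
  define dp where "dp a b k w = complex_of_real (poly (pderiv (P k)) (sqd w a b))" for a b k w
  define Q where "Q k w = (\<Prod>(a, b)\<in>Pairs n. p a b k w)" for k w
  define Qm where "Qm i j k w = (\<Prod>(a, b)\<in>Pairs n - {(i, j)}. p a b k w)" for i j k w
  have lp: "lau0 n (p a b k) (\<lambda>i w. Ds a b i w * dp a b k w)" if "(a, b) \<in> Pairs n" for a b k
    unfolding p_def dp_def using that by (intro lau0_poly lau0_sqd) (auto simp: Pairs_def)
  have ldp: "lau0 n (dp a b k) (\<lambda>i w. Ds a b i w * complex_of_real (poly (pderiv (pderiv (P k))) (sqd w a b)))" if "(a, b) \<in> Pairs n" for a b k
    unfolding dp_def using that by (intro lau0_poly lau0_sqd) (auto simp: Pairs_def)
  have lQ: "lau0 n (Q k) (\<lambda>i w. \<Sum>(a, b)\<in>Pairs n. Ds a b i w * dp a b k w * Qm a b k w)" for k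
  proof -
    have "lau0 n (\<lambda>w. \<Prod>x\<in>Pairs n. p (fst x) (snd x) k w) (\<lambda>i w. \<Sum>x\<in>Pairs n. Ds (fst x) (snd x) i w * dp (fst x) (snd x) k w * (\<Prod>y\<in>Pairs n - {x}. p (fst y) (snd y) k w))"
      by (intro lau0_prod lp) auto
    then show ?thesis by (simp add: Q_def[abs_def] Qm_def case_prod_unfold)
  qed
  have lQm: "\<exists>H'. lau0 n (Qm a b k) H'" for a b k
  proof -
    have "lau0 n (\<lambda>w. \<Prod>x\<in>Pairs n - {(a, b)}. p (fst x) (snd x) k w) (\<lambda>i w. \<Sum>x\<in>Pairs n - {(a, b)}. Ds (fst x) (snd x) i w * dp (fst x) (snd x) k w * (\<Prod>y\<in>Pairs n - {(a, b)} - {x}. p (fst y) (snd y) k w))"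
      by (intro lau0_prod lp) auto
    then show ?thesis by (auto simp: Qm_def[abs_def] case_prod_unfold)
  qed
  have lDs: "\<exists>H'. lau0 n (Ds a b i) H'" if "(a, b) \<in> Pairs n" for a b
    using lau0_deriv[OF lau0_sqd i, of a b] that by (auto simp: Pairs_def)
  define Tm where "Tm a b k w = Ds a b i w * dp a b k w * Qm a b k w * mon n v w" for a b k w
  have lT: "\<exists>H'. lau0 n (Tm a b k) H'" if ab: "(a, b) \<in> Pairs n" for a b k
  proof -
    obtain A B where "lau0 n (Ds a b i) A" "lau0 n (Qm a b k) B" using lDs[OF ab] lQm by blast
    from lau0_times[OF lau0_times[OF lau0_times[OF this(1) ldp[OF ab]] this(2)] lau0_mon]
    show ?thesis unfolding Tm_def[abs_def] by blast
  qed
  have lQmon: "lau0 n (\<lambda>w. Q k w * mon n v w) (\<lambda>i w. (\<Sum>(a, b)\<in>Pairs n. Ds a b i w * dp a b k w * Qm a b k w) * mon n v w + Q k w * (of_int (v i) * mon n v w))" for k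
    by (intro lau0_times lQ lau0_mon)
  have Q_limit: "uniform_limit (Tor n) (p a b) (\<lambda>w. of_real (sqd w a b powr \<gamma>)) sequentially" if "(a, b) \<in> Pairs n" for a b
  proof (rule uniform_limitI)
    fix e :: real assume "e > 0"
    then have "\<forall>\<^sub>F k in sequentially. inverse (real (Suc k)) < e"
      using LIMSEQ_inverse_real_of_nat order_tendstoD(2) by blast
    then show "\<forall>\<^sub>F k in sequentially. \<forall>w\<in>Tor n. dist (p a b k w) (of_real (sqd w a b powr \<gamma>)) < e"
    proof eventually_elim
      case (elim k)
      then show ?case using P1[OF sqd_range, of _ n a b k] that
        by (auto simp: p_def dist_norm Pairs_def simp flip: of_real_diff simp del: of_nat_Suc intro: le_less_trans)
    qed
  qed
  have dp_limit: "uniform_limit (Tor n) (\<lambda>k w. of_real (sqd w a b) * dp a b k w) (\<lambda>w. of_real (\<gamma> * sqd w a b powr \<gamma>)) sequentially" if "(a, b) \<in> Pairs n" for a b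
  proof (rule uniform_limitI)
    fix e :: real assume "e > 0"
    then have "\<forall>\<^sub>F k in sequentially. inverse (real (Suc k)) < e"
      using LIMSEQ_inverse_real_of_nat order_tendstoD(2) by blast
    then show "\<forall>\<^sub>F k in sequentially. \<forall>w\<in>Tor n. dist (of_real (sqd w a b) * dp a b k w) (of_real (\<gamma> * sqd w a b powr \<gamma>)) < e"
    proof eventually_elim
      case (elim k)
      then show ?case using P2[OF sqd_range, of _ n a b k] that
        by (auto simp: dp_def dist_norm Pairs_def simp flip: of_real_diff of_real_mult simp del: of_nat_Suc intro: le_less_trans)
    qed
  qed
  have bd: "bounded ((\<lambda>w. complex_of_real (sqd w a b powr \<gamma>)) ` Tor n)" if "(a, b) \<in> Pairs n" for a b
    using that \<beta> unfolding \<gamma>_def by (intro bounded_powr_sqd) (auto simp: Pairs_def)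
  have limX: "uniform_limit (Tor n) (\<lambda>k w. \<Prod>(a, b)\<in>X. p a b k w) (\<lambda>w. \<Prod>(a, b)\<in>X. of_real (sqd w a b powr \<gamma>)) sequentially \<and>
     bounded ((\<lambda>w. \<Prod>(a, b)\<in>X. complex_of_real (sqd w a b powr \<gamma>)) ` Tor n)" if "X \<subseteq> Pairs n" for X
    using uniform_limit_prod[where X = X and S = "Tor n" and f = "\<lambda>x. p (fst x) (snd x)"
        and g = "\<lambda>x w. of_real (sqd w (fst x) (snd x) powr \<gamma>)"] Q_limit bd that
      finite_subset[OF that]
    by (auto simp: case_prod_unfold subset_iff)
  have Dl: "Dl n \<beta> = (\<lambda>w. \<Prod>(a, b)\<in>Pairs n. of_real (sqd w a b powr \<gamma>))"
    by (simp add: Dl_def fun_eq_iff \<gamma>_def)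
  have limQ: "uniform_limit (Tor n) Q (Dl n \<beta>) sequentially" and bdDl: "bounded (Dl n \<beta> ` Tor n)"
    using limX[of "Pairs n"] unfolding Dl Q_def[abs_def] by auto
  show apDl: "appr n (Dl n \<beta>)" by (rule J_uniform(1)[OF lQ limQ])
  have bdmon: "bounded (mon n v ` Tor n)"
    by (auto simp: bounded_iff norm_mon intro!: exI[of _ 1])
  have limQmon: "(\<lambda>k. J n (\<lambda>w. Q k w * mon n v w)) \<longlonglongrightarrow> J n (\<lambda>w. Dl n \<beta> w * mon n v w)"
    by (intro J_uniform(2)[OF lQmon] uniform_lim_mult limQ uniform_limit_const bdDl bdmon)
  \<comment> \<open>Antisymmetrising the monomial brings out one factor \<open>sqd w i j\<close>,
    which joins the derivative of the polynomial: exactly the product \<open>s * P' s\<close> that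
    the approximation controls.\<close>
  define C where "C j k w = of_real (sqd w i j) * dp i j k w * Qm i j k w * Wf n i j v w" for j k w
  have BC: "(w j / w i - w i / w j) * dp i j k w * Qm i j k w * (mon n v w - mon n (v \<circ> tsp i j) w) = - C j k w"
    if j: "j \<in> {..<n} - {i}" and w: "w \<in> Tor n" for j k w
  proof -
    have nz: "w i \<noteq> 0" "w j \<noteq> 0" using w i j Tor_nonzero by auto
    have "(w j / w i - w i / w j) * M = - (of_real (sqd w i j) * ((w j + w i) / (w j - w i) * M))" if "w i \<noteq> w j" for M
      using that nz w i j by (simp add: sqd_complex divide_simps) (simp add: algebra_simps power2_eq_square)
    moreover have "(w j / w i - w i / w j) = 0" if "w i = w j" using that nz by simp
    moreover have "sqd w i j = 0" if "w i = w j" using that by (simp add: sqd_def)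
    ultimately have E: "(w j / w i - w i / w j) * (mon n v w - mon n (v \<circ> tsp i j) w) = - (of_real (sqd w i j) * Wf n i j v w)"
      unfolding Wf_def by (cases "w i = w j") auto
    have "(w j / w i - w i / w j) * dp i j k w * Qm i j k w * (mon n v w - mon n (v \<circ> tsp i j) w)
        = (w j / w i - w i / w j) * (mon n v w - mon n (v \<circ> tsp i j) w) * (dp i j k w * Qm i j k w)"
      by (simp only: mult_ac)
    also have "\<dots> = - C j k w"
      unfolding E C_def by (simp add: mult_ac)
    finally show ?thesis .
  qed
  \<comment> \<open>The ordered pairs \<open>(i, j)\<close> and \<open>(j, i)\<close> give the same
    integrand \<open>b * mon\<close>, with \<open>b\<close> odd under the exchange of the two
    variables. Replacing one copy by its image under the exchange antisymmetrises the
    monomial.\<close>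
  have sums: "J n (Tm i j k) + J n (Tm j i k) = - J n (C j k) \<and> (\<exists>H'. lau0 n (C j k) H')" if j: "j \<in> {..<n} - {i}" for j k
  proof -
    have ij: "(i, j) \<in> Pairs n" "(j, i) \<in> Pairs n" using i j by (auto simp: Pairs_def)
    define b where "b w = (w j / w i - w i / w j) * dp i j k w * Qm i j k w" for w
    have psym: "p a b k w = p b a k w" for a b w by (simp add: p_def sqd_sym)
    have dpsym: "dp a b k w = dp b a k w" for a b w by (simp add: dp_def sqd_sym)
    have Qmsym: "Qm j i k w = Qm i j k w" for w
      unfolding Qm_def by (rule Pairs_swap_remove[OF psym ij(1)])
    have T1: "Tm i j k w = b w * mon n v w" for w by (simp add: Tm_def b_def Ds_def)
    have T2: "Tm j i k w = b w * mon n v w" for w using j by (simp add: Tm_def b_def Ds_def dpsym[of j] Qmsym)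
    have bt: "b (w \<circ> tsp i j) = - b w" for w
    proof -
      have "Qm i j k (w \<circ> tsp i j) = Qm j i k w"
        unfolding Qm_def using Pairs_tsp_remove[OF ij(1), of "\<lambda>a b. p a b k w"] by (simp add: p_def sqd_def)
      moreover have "dp i j k (w \<circ> tsp i j) = dp i j k w"
        by (simp add: dp_def sqd_def norm_minus_commute)
      ultimately show ?thesis by (simp add: b_def Qmsym algebra_simps)
    qed
    obtain H where H: "lau0 n (Tm i j k) H" using lT[OF ij(1)] by blast
    have apT: "appr n (\<lambda>w. b w * mon n v w)" using lau0_appr[OF H] T1 by (simp add: Tm_def[abs_def] b_def[abs_def] Ds_def)
    have ijn: "i < n" "j < n" using i j by auto
    have "(\<lambda>w. b (w \<circ> tsp i j) * mon n v (w \<circ> tsp i j)) = (\<lambda>w. -1 * (b w * mon n (v \<circ> tsp i j) w))"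
      by (simp only: bt mon_swap[OF ijn]) simp
    then have sw: "appr n (\<lambda>w. -1 * (b w * mon n (v \<circ> tsp i j) w))"
        "J n (\<lambda>w. -1 * (b w * mon n (v \<circ> tsp i j) w)) = J n (\<lambda>w. b w * mon n v w)"
      using J_swap[OF apT ijn] by simp_all
    have eq: "b w * mon n v w + -1 * (b w * mon n (v \<circ> tsp i j) w) = -1 * C j k w" if "w \<in> Tor n" for w
      using BC[OF j that, of k] unfolding b_def[symmetric] by (simp add: right_diff_distrib)
    have 1: "J n (\<lambda>w. b w * mon n v w) + J n (\<lambda>w. b w * mon n v w) = J n (\<lambda>w. -1 * C j k w)" "appr n (\<lambda>w. -1 * C j k w)"
      using J_add[OF apT sw(1)] J_cong[OF J_add(1)[OF apT sw(1)] eq] sw(2) by auto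
    have "J n (\<lambda>w. -1 * (-1 * C j k w)) = -1 * J n (\<lambda>w. -1 * C j k w)"
      by (rule J_cmult(2)[OF 1(2)])
    then have JC: "J n (\<lambda>w. -1 * C j k w) = - J n (C j k)" by simp
    obtain A B where AB: "lau0 n (Ds i j i) A" "lau0 n (Qm i j k) B" using lDs[OF ij(1)] lQm by blast
    note l = lau0_times[OF lau0_times[OF lau0_times[OF AB(1) ldp[OF ij(1)]] AB(2)]
       lau0_plus[OF lau0_times[OF lau0_const[of n "-1"] lau0_mon] lau0_mon], of k v "v \<circ> tsp i j"]
    have "\<exists>H'. lau0 n (C j k) H'"
    proof (rule exI, rule lau0_cong[OF l _ refl])
      fix w assume w: "w \<in> Tor n"
      have X: "x * (-1 * a + c) = - (x * (a - c))" for x a c :: complex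
        by (simp add: right_diff_distrib distrib_left)
      have "Ds i j i w = w j / w i - w i / w j" by (simp add: Ds_def)
      then show "Ds i j i w * dp i j k w * Qm i j k w * (-1 * mon n v w + mon n (v \<circ> tsp i j) w) = C j k w"
        unfolding X using BC[OF j w, of k] by simp
    qed
    moreover have "J n (Tm i j k) = J n (\<lambda>w. b w * mon n v w)" "J n (Tm j i k) = J n (\<lambda>w. b w * mon n v w)"
      using ext[of "Tm i j k", OF T1] ext[of "Tm j i k", OF T2] by simp_all
    ultimately show ?thesis using 1 JC by simp
  qed
  \<comment> \<open>Exact at every stage \<open>k\<close>: the integral of the derivative of
    \<open>Q k * mon\<close> is zero, and only the pairs containing \<open>i\<close> contribute to
    the derivative of the weight.\<close>
  have key: "of_int (v i) * J n (\<lambda>w. Q k w * mon n v w) = (\<Sum>j\<in>{..<n} - {i}. J n (C j k))" for k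
  proof -
    have "J n (\<lambda>w. (\<Sum>(a, b)\<in>Pairs n. Ds a b i w * dp a b k w * Qm a b k w) * mon n v w + Q k w * (of_int (v i) * mon n v w)) = 0"
      using lau0_deriv[OF lQmon i] by blast
    moreover have "(\<lambda>w. (\<Sum>(a, b)\<in>Pairs n. Ds a b i w * dp a b k w * Qm a b k w) * mon n v w + Q k w * (of_int (v i) * mon n v w))
        = (\<lambda>w. (\<Sum>x\<in>Pairs n. Tm (fst x) (snd x) k w) + of_int (v i) * (Q k w * mon n v w))"
      by (simp add: fun_eq_iff Tm_def case_prod_unfold sum_distrib_right)
    moreover have apT: "appr n (\<lambda>w. \<Sum>x\<in>Pairs n. Tm (fst x) (snd x) k w)"
      "J n (\<lambda>w. \<Sum>x\<in>Pairs n. Tm (fst x) (snd x) k w) = (\<Sum>x\<in>Pairs n. J n (Tm (fst x) (snd x) k))"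
      using J_sum[of "Pairs n" n "\<lambda>x. Tm (fst x) (snd x) k"] lT lau0_appr by (metis finite_Pairs prod.collapse)+
    moreover have cm: "appr n (\<lambda>w. of_int (v i) * (Q k w * mon n v w))"
        "J n (\<lambda>w. of_int (v i) * (Q k w * mon n v w)) = of_int (v i) * J n (\<lambda>w. Q k w * mon n v w)"
      by (intro J_cmult lau0_appr[OF lQmon])+
    ultimately have "(\<Sum>x\<in>Pairs n. J n (Tm (fst x) (snd x) k)) + of_int (v i) * J n (\<lambda>w. Q k w * mon n v w) = 0"
      using J_add(2)[OF apT(1) cm(1)] by simp
    moreover have "(\<Sum>x\<in>Pairs n. J n (Tm (fst x) (snd x) k)) = (\<Sum>j\<in>{..<n} - {i}. J n (Tm i j k) + J n (Tm j i k))"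
    proof -
      let ?A = "Pair i ` ({..<n} - {i})" and ?B = "(\<lambda>j. (j, i)) ` ({..<n} - {i})"
      have z: "J n (\<lambda>w. 0) = 0" using lau_J[OF lau.zero] .
      have "(\<Sum>x\<in>Pairs n. J n (Tm (fst x) (snd x) k)) = (\<Sum>x\<in>?A \<union> ?B. J n (Tm (fst x) (snd x) k))"
      proof (rule sum.mono_neutral_right)
        show "?A \<union> ?B \<subseteq> Pairs n" using i by (auto simp: Pairs_def)
        show "\<forall>x\<in>Pairs n - (?A \<union> ?B). J n (Tm (fst x) (snd x) k) = 0"
        proof
          fix x assume "x \<in> Pairs n - (?A \<union> ?B)"
          then have "fst x \<noteq> i" "snd x \<noteq> i" by (auto simp: Pairs_def image_iff)
          then have "Tm (fst x) (snd x) k = (\<lambda>w. 0)" by (simp add: Tm_def fun_eq_iff Ds_def)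
          then show "J n (Tm (fst x) (snd x) k) = 0" using z by simp
        qed
      qed simp
      also have "\<dots> = (\<Sum>x\<in>?A. J n (Tm (fst x) (snd x) k)) + (\<Sum>x\<in>?B. J n (Tm (fst x) (snd x) k))"
        by (rule sum.union_disjoint) auto
      also have "\<dots> = (\<Sum>j\<in>{..<n} - {i}. J n (Tm i j k)) + (\<Sum>j\<in>{..<n} - {i}. J n (Tm j i k))"
        by (subst (1 2) sum.reindex) (auto simp: inj_on_def)
      finally show ?thesis by (simp add: sum.distrib)
    qed
    moreover have "(\<Sum>j\<in>{..<n} - {i}. J n (Tm i j k) + J n (Tm j i k)) = (\<Sum>j\<in>{..<n} - {i}. - J n (C j k))"
      using sums by (intro sum.cong refl) blast
    ultimately show ?thesis by (simp add: sum_negf add_eq_0_iff2)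
  qed
  \<comment> \<open>The factor \<open>sqd * dp\<close> tends to \<gamma> times the missing factor of
    the weight, \<open>Qm\<close> to the rest of the weight, and \<open>Wf\<close> is fixed and
    bounded.\<close>
  have limC: "appr n (\<lambda>w. of_real \<gamma> * (Dl n \<beta> w * Wf n i j v w)) \<and> (\<lambda>k. J n (C j k)) \<longlonglongrightarrow> J n (\<lambda>w. of_real \<gamma> * (Dl n \<beta> w * Wf n i j v w))"
    if j: "j \<in> {..<n} - {i}" for j
  proof -
    have ij: "(i, j) \<in> Pairs n" using i j by (auto simp: Pairs_def)
    obtain H' where H': "\<And>k. lau0 n (C j k) (H' k)" using sums[OF j] by metis
    let ?rest = "\<lambda>w. \<Prod>(a, b)\<in>Pairs n - {(i, j)}. complex_of_real (sqd w a b powr \<gamma>)"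
    have Dsplit: "Dl n \<beta> w = of_real (sqd w i j powr \<gamma>) * ?rest w" for w
      unfolding Dl by (subst prod.remove[OF finite_Pairs ij]) simp
    have b1: "bounded ((\<lambda>w. complex_of_real (\<gamma> * sqd w i j powr \<gamma>)) ` Tor n)"
    proof -
      obtain A where "\<forall>w\<in>Tor n. cmod (complex_of_real (sqd w i j powr \<gamma>)) \<le> A" using bd[OF ij] by (auto simp: bounded_iff)
      then have "\<forall>w\<in>Tor n. cmod (complex_of_real (\<gamma> * sqd w i j powr \<gamma>)) \<le> \<gamma> * A"
        using \<gamma> by (auto simp: norm_mult abs_mult intro!: mult_left_mono)
      then show ?thesis by (auto simp: bounded_iff)
    qed
    have b2: "bounded (?rest ` Tor n)" and l2: "uniform_limit (Tor n) (Qm i j) ?rest sequentially"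
      using limX[of "Pairs n - {(i, j)}"] unfolding Qm_def[abs_def] by auto
    have b3: "bounded (Wf n i j v ` Tor n)"
      using Wf_bounded[of i n j _ v] i j by (auto simp: bounded_iff)
    have b12: "bounded ((\<lambda>w. of_real (\<gamma> * sqd w i j powr \<gamma>) * ?rest w) ` Tor n)"
    proof -
      obtain A where A: "\<forall>w\<in>Tor n. cmod (Dl n \<beta> w) \<le> A" using bdDl by (auto simp: bounded_iff)
      have eqD: "of_real (\<gamma> * sqd w i j powr \<gamma>) * ?rest w = of_real \<gamma> * Dl n \<beta> w" for w
        by (simp add: Dsplit)
      have "\<forall>w\<in>Tor n. cmod (of_real (\<gamma> * sqd w i j powr \<gamma>) * ?rest w) \<le> \<gamma> * A"
        unfolding eqD using \<gamma> A by (auto simp: norm_mult intro!: mult_left_mono)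
      then show ?thesis by (auto simp: bounded_iff)
    qed
    have "uniform_limit (Tor n) (C j) (\<lambda>w. of_real (\<gamma> * sqd w i j powr \<gamma>) * ?rest w * Wf n i j v w) sequentially"
      unfolding C_def[abs_def] by (intro uniform_lim_mult dp_limit[OF ij] l2 uniform_limit_const b1 b2 b3 b12)
    moreover have "(\<lambda>w. of_real (\<gamma> * sqd w i j powr \<gamma>) * ?rest w * Wf n i j v w) = (\<lambda>w. of_real \<gamma> * (Dl n \<beta> w * Wf n i j v w))"
      by (simp add: Dsplit fun_eq_iff)
    ultimately show ?thesis using J_uniform[OF H'] by simp
  qed
  show ap: "appr n (\<lambda>w. Dl n \<beta> w * Wf n i j v w)" if "j \<in> {..<n} - {i}" for j
    using J_cmult(1)[OF conjunct1[OF limC[OF that]], of "1 / of_real \<gamma>"] \<gamma> by simp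
  have "(\<lambda>k. \<Sum>j\<in>{..<n} - {i}. J n (C j k)) \<longlonglongrightarrow> (\<Sum>j\<in>{..<n} - {i}. J n (\<lambda>w. of_real \<gamma> * (Dl n \<beta> w * Wf n i j v w)))"
    using limC by (intro tendsto_sum) blast
  moreover have "(\<lambda>k. \<Sum>j\<in>{..<n} - {i}. J n (C j k)) \<longlonglongrightarrow> of_int (v i) * J n (\<lambda>w. Dl n \<beta> w * mon n v w)"
    unfolding key[symmetric] by (intro tendsto_mult_left limQmon)
  ultimately have "of_int (v i) * J n (\<lambda>w. Dl n \<beta> w * mon n v w) = (\<Sum>j\<in>{..<n} - {i}. J n (\<lambda>w. of_real \<gamma> * (Dl n \<beta> w * Wf n i j v w)))"
    using LIMSEQ_unique by blast
  also have "\<dots> = of_real \<gamma> * (\<Sum>j\<in>{..<n} - {i}. J n (\<lambda>w. Dl n \<beta> w * Wf n i j v w))"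
    unfolding sum_distrib_left by (intro sum.cong refl J_cmult(2) ap)
  finally show "of_int (v i) * J n (\<lambda>w. Dl n \<beta> w * mon n v w)
       = of_real (\<beta> / 2) * (\<Sum>j\<in>{..<n} - {i}. J n (\<lambda>w. Dl n \<beta> w * Wf n i j v w))"
    by (simp add: \<gamma>_def)
qed

text \<open>A single factor \<open>(1 - w_i / w_j) powr \<beta>\<close> is a complex principal power
  and depends on the order of the pair. The factors for \<open>(i, j)\<close> and
  \<open>(j, i)\<close> are complex conjugate, so their product is a real power of the
  distance.\<close>

lemma Delta_eq_Dl:
  assumes "\<beta> > 0" "\<forall>i<n. cmod (ws ! i) = 1"
  shows "Delta n \<beta> ws = Dl n \<beta> (nth ws)"
proof -
  define f where "f i j = (1 - ws ! i * inverse (ws ! j)) powr complex_of_real \<beta>" for i j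
  define h where "h i j = complex_of_real (sqd (nth ws) i j powr (\<beta> / 2))" for i j
  define X where "X = {(i, j). i < j \<and> j < n}"
  define Y where "Y = {(i, j). j < i \<and> i < n}"
  have fin: "finite X" "finite Y"
    by (rule finite_subset[of _ "{..<n} \<times> {..<n}"]; auto simp: X_def Y_def)+
  have XY: "Pairs n = X \<union> Y" "X \<inter> Y = {}" by (auto simp: Pairs_def X_def Y_def)
  have split: "(\<Prod>(i, j)\<in>Pairs n. q i j) = (\<Prod>(i, j)\<in>X. q i j * q j i)" for q :: "nat \<Rightarrow> nat \<Rightarrow> complex"
  proof -
    have "(\<Prod>(i, j)\<in>Y. q i j) = (\<Prod>(i, j)\<in>X. q j i)"
      by (rule prod.reindex_bij_witness[of _ prod.swap prod.swap]) (auto simp: X_def Y_def)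
    then show ?thesis
      unfolding XY(1) using fin XY(2) by (simp add: prod.union_disjoint case_prod_unfold prod.distrib)
  qed
  have "f i j * f j i = h i j * h j i" if "i < n" "j < n" for i j
  proof -
    define z where "z = 1 - ws ! i * inverse (ws ! j)"
    have inv: "inverse (ws ! k) = cnj (ws ! k)" if "k < n" for k
      using inverse_Tor[of "nth ws" n k] assms(2) that by (auto simp: Tor_def)
    have nz: "ws ! j \<noteq> 0" using assms(2) that by auto
    have cz: "1 - ws ! j * inverse (ws ! i) = cnj z"
      using that by (simp add: z_def inv mult.commute)
    \<comment> \<open>Conjugation commutes with the principal power off the negative real axis; the
      half plane \<open>Re z \<ge> 0\<close> avoids it.\<close>
    have Re: "Re z \<ge> 0"
    proof -
      have "Re (ws ! i * inverse (ws ! j)) \<le> cmod (ws ! i * inverse (ws ! j))" by (rule complex_Re_le_cmod)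
      also have "\<dots> = 1" using assms(2) that by (simp add: norm_mult norm_inverse)
      finally show ?thesis by (simp add: z_def)
    qed
    have "cnj z powr complex_of_real \<beta> = cnj (z powr complex_of_real \<beta>)"
      using cnj_powr[of z "complex_of_real \<beta>"] Re by auto
    then have "f i j * f j i = complex_of_real ((cmod (z powr complex_of_real \<beta>))\<^sup>2)"
      unfolding f_def cz z_def[symmetric] by (simp only: complex_norm_square)
    also have "cmod (z powr complex_of_real \<beta>) = cmod z powr \<beta>"
      using assms(1) by (cases "z = 0") (auto simp: norm_powr_real_powr')
    also have "cmod z = cmod (ws ! i - ws ! j)"
    proof -
      have "z = (ws ! j - ws ! i) / ws ! j" using nz by (simp add: z_def field_simps)
      then show ?thesis using assms(2) that by (simp add: norm_divide norm_minus_commute)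
    qed
    also have "complex_of_real ((cmod (ws ! i - ws ! j) powr \<beta>)\<^sup>2) = h i j * h j i"
    proof -
      have "((cmod (ws ! i - ws ! j))\<^sup>2) powr (\<beta> / 2) = cmod (ws ! i - ws ! j) powr \<beta>"
        using powr_powr[of "cmod (ws ! i - ws ! j)" 2 "\<beta> / 2"] by simp
      then show ?thesis
        unfolding h_def sqd_def norm_minus_commute[of "ws ! j" "ws ! i"] by (simp add: power2_eq_square)
    qed
    finally show ?thesis .
  qed
  then have "(\<Prod>(i, j)\<in>X. f i j * f j i) = (\<Prod>(i, j)\<in>X. h i j * h j i)"
    by (intro prod.cong refl) (auto simp: X_def)
  then show ?thesis
    unfolding Delta_def Dl_def f_def[symmetric] h_def[symmetric] Pairs_def[symmetric] split .
qed

section \<open>Quantum determinants of an RLL chain\<close>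

lemma mult_left_swap:
  fixes a b :: "'a::semigroup_mult"
  assumes "a * b = b * a"
  shows "a * (b * y) = b * (a * y)"
  by (metis assms mult.assoc)

text \<open>\<open>R i r\<close> plays the role of the resolvent of \<open>d_i\<close> at spectral
  parameter \<open>u - r\<close>, and \<open>Rstep\<close> is the resolvent identity for parameters
  differing by one. Absence of 2-torsion lets sums equal to their own negatives vanish.\<close>

locale rll_chain =
  fixes R :: "nat \<Rightarrow> nat \<Rightarrow> 'b::ring_1" and E :: "nat \<Rightarrow> nat \<Rightarrow> nat \<Rightarrow> 'b" and N :: nat
  assumes RR: "R i r * R j t = R j t * R i r"
    and RE: "R i r * E j x y = E j x y * R i r"
    and EE: "i \<noteq> j \<Longrightarrow> E i x y * E j z w = E j z w * E i x y"
    and EEs: "E i x y * E i z w = (if y = z then E i x w else 0)"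
    and Rstep: "R i (Suc r) - R i r = R i r * R i (Suc r)"
    and two: "q + q = 0 \<Longrightarrow> (q::'b) = 0"
begin

definition L :: "nat \<Rightarrow> nat \<Rightarrow> nat \<Rightarrow> nat \<Rightarrow> 'b" where
  "L i r a b = of_bool (a = b) + R i r * E i b a"

primrec T :: "nat \<Rightarrow> nat list \<Rightarrow> nat \<Rightarrow> nat \<Rightarrow> 'b" where
  "T r [] a b = of_bool (a = b)"
| "T r (i # is) a b = (\<Sum>c\<in>{1..N}. L i r a c * T r is c b)"

lemma L_commute:
  assumes "i \<noteq> j"
  shows "L i r a b * L j t c d = L j t c d * L i r a b"
proof -
  have "(R i r * E i b a) * (R j t * E j d c) = R i r * (E i b a * R j t) * E j d c"
    by (simp add: mult.assoc)
  also have "\<dots> = R i r * R j t * (E i b a * E j d c)"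
    by (metis RE mult.assoc)
  also have "\<dots> = R j t * R i r * (E j d c * E i b a)"
    by (metis RR EE[OF assms])
  also have "\<dots> = R j t * (R i r * E j d c) * E i b a"
    by (simp add: mult.assoc)
  also have "\<dots> = (R j t * E j d c) * (R i r * E i b a)"
    by (metis RE mult.assoc)
  finally show ?thesis
    by (simp add: L_def distrib_left distrib_right of_bool_def)
qed

lemma L_T_commute:
  "i \<notin> set is \<Longrightarrow> L i r a b * T t is c d = T t is c d * L i r a b"
proof (induction "is" arbitrary: c d)
  case Nil
  then show ?case by simp
next
  case (Cons j js)
  have "L i r a b * (L j t c e * T t js e d) = (L j t c e * T t js e d) * L i r a b" for e
  proof -
    have 1: "L i r a b * L j t c e = L j t c e * L i r a b"
      using Cons.prems by (intro L_commute) auto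
    have 2: "L i r a b * T t js e d = T t js e d * L i r a b"
      using Cons by simp
    show ?thesis by (metis 1 2 mult.assoc)
  qed
  then show ?case
    by (simp add: sum_distrib_left sum_distrib_right)
qed

lemma L_mult:
  "L i r b w * L i (Suc r) b' w' =
     of_bool (b = w) * of_bool (b' = w') + of_bool (b' = w') * (R i r * E i w b)
   + of_bool (b = w) * (R i (Suc r) * E i w' b')
   + of_bool (b = w') * (R i (Suc r) * E i w b' - R i r * E i w b')"
proof -
  have "(R i r * E i w b) * (R i (Suc r) * E i w' b')
      = R i r * R i (Suc r) * (E i w b * E i w' b')"
    by (metis RE mult.assoc)
  also have "\<dots> = (R i (Suc r) - R i r) * (E i w b * E i w' b')"
    by (simp add: Rstep)
  finally have "(R i r * E i w b) * (R i (Suc r) * E i w' b')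
     = of_bool (b = w') * (R i (Suc r) * E i w b' - R i r * E i w b')"
    by (simp add: EEs left_diff_distrib)
  then show ?thesis
    unfolding L_def by (simp only: distrib_left distrib_right) (simp add: of_bool_def)
qed

text \<open>The exchange relation at spectral distance one: symmetrised in the rows and
  antisymmetrised in the columns, a product of adjacent rows vanishes. By \<open>L_mult\<close> the
  resolvent identity makes the quadratic term linear in the resolvents, after which everything
  cancels.\<close>

lemma L_four_term:
  "L i r b w * L i (Suc r) b' w' - L i r b w' * L i (Suc r) b' w
   + L i r b' w * L i (Suc r) b w' - L i r b' w' * L i (Suc r) b w = 0"
  unfolding L_mult of_bool_def by (simp add: algebra_simps)

text \<open>The relation is inherited by longer chains. Splitting off one site leaves a sum over the
  intermediate pair \<open>(c, c')\<close> of a factor symmetric in it (the site) times a factor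
  antisymmetric in it (the rest of the chain).\<close>

lemma T_four_term:
  "distinct is \<Longrightarrow> T r is b w * T (Suc r) is b' w' - T r is b w' * T (Suc r) is b' w
   + T r is b' w * T (Suc r) is b w' - T r is b' w' * T (Suc r) is b w = 0"
proof (induction "is" arbitrary: b b' w w')
  case Nil
  then show ?case by auto
next
  case (Cons i js)
  let ?C = "{1..N} \<times> {1..N}"
  have i: "i \<notin> set js" using Cons.prems by simp
  have prod: "T r (i # js) b w * T (Suc r) (i # js) b' w'
     = (\<Sum>(c, c')\<in>?C. L i r b c * L i (Suc r) b' c' * (T r js c w * T (Suc r) js c' w'))" for b b' w w'
  proof -
    have "L i r b c * T r js c w * (L i (Suc r) b' c' * T (Suc r) js c' w') =
          L i r b c * L i (Suc r) b' c' * (T r js c w * T (Suc r) js c' w')" for c c'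
      by (metis L_T_commute[OF i] mult.assoc)
    then show ?thesis
      by (simp add: sum_product sum.cartesian_product)
  qed
  define y where "y c c' = T r js c w * T (Suc r) js c' w' - T r js c w' * T (Suc r) js c' w" for c c'
  have y: "y c' c = - y c c'" for c c'
    using Cons.IH[of c w c' w'] Cons.prems unfolding y_def by (simp add: algebra_simps eq_neg_iff_add_eq_0)
  define Z where "Z c c' = L i r b c * L i (Suc r) b' c' + L i r b' c * L i (Suc r) b c'" for c c'
  have Z: "Z c' c = Z c c'" for c c'
    using L_four_term[of i r b c b' c'] unfolding Z_def by (simp add: algebra_simps)
  have "(\<Sum>(c, c')\<in>?C. Z c c' * y c c') = (\<Sum>(c, c')\<in>?C. - (Z c c' * y c c'))"
  proof (rule sum.reindex_bij_witness[of _ prod.swap prod.swap], goal_cases)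
    case (5 p)
    have "Z (snd p) (fst p) * y (snd p) (fst p) = - (Z (fst p) (snd p) * y (fst p) (snd p))"
      by (subst Z, subst y) simp
    then show ?case by (simp add: case_prod_unfold)
  qed auto
  also have "\<dots> = - (\<Sum>(c, c')\<in>?C. Z c c' * y c c')"
    by (simp add: case_prod_unfold sum_negf)
  finally have "(\<Sum>(c, c')\<in>?C. Z c c' * y c c') = 0"
    by (rule two[OF iffD1[OF eq_neg_iff_add_eq_0]])
  moreover have "(\<Sum>(c, c')\<in>?C. Z c c' * y c c')
     = T r (i#js) b w * T (Suc r) (i#js) b' w' - T r (i#js) b w' * T (Suc r) (i#js) b' w
   + T r (i#js) b' w * T (Suc r) (i#js) b w' - T r (i#js) b' w' * T (Suc r) (i#js) b w"
    unfolding prod Z_def y_def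
    by (simp add: case_prod_unfold algebra_simps sum.distrib sum_subtractf)
  ultimately show ?case by simp
qed

section \<open>Antisymmetrised products of rows\<close>

primrec rows :: "nat list \<Rightarrow> nat \<Rightarrow> nat list \<Rightarrow> (nat \<Rightarrow> nat) \<Rightarrow> 'b" where
  "rows is k [] w = 1"
| "rows is k (b # bs) w = T k is b (w (Suc k)) * rows is (Suc k) bs w"

lemma rows_append: "rows is k (xs @ ys) w = rows is k xs w * rows is (k + length xs) ys w"
  by (induction xs arbitrary: k) (simp_all add: mult.assoc)

lemma rows_cong:
  "(\<And>j. k < j \<Longrightarrow> j \<le> k + length bs \<Longrightarrow> w j = w' j) \<Longrightarrow> rows is k bs w = rows is k bs w'"
  by (induction bs arbitrary: k) auto

text \<open>A column-antisymmetrised product with arbitrary row labels, a prefix \<open>C\<close>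
  and a tail \<open>H\<close>. The tail is needed for intermediate expressions in which the first
  rows have already lost a site and the later ones have not; it may depend only on the columns that
  come after the rows of \<open>bs\<close>, which \<open>tail_fun\<close> expresses.\<close>

definition Gsum :: "nat \<Rightarrow> nat list \<Rightarrow> 'b \<Rightarrow> nat list \<Rightarrow> ((nat \<Rightarrow> nat) \<Rightarrow> 'b) \<Rightarrow> 'b" where
  "Gsum m is C bs H =
     (\<Sum>w\<in>{w. w permutes {1..m}}. of_int (sign w) * (C * rows is 0 bs w * H w))"

definition tail_fun :: "nat \<Rightarrow> ((nat \<Rightarrow> nat) \<Rightarrow> 'b) \<Rightarrow> bool" where
  "tail_fun k H \<longleftrightarrow> (\<forall>w w'. (\<forall>j>k. w j = w' j) \<longrightarrow> H w = H w')"

text \<open>Reindexing the columns by the adjacent transposition \<open>s\<close> changes the sign,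
  while \<open>T_four_term\<close> says that the sum over both orders of the two rows is unchanged
  by it. Prefix, other rows and tail do not see these two columns.\<close>

lemma Gsum_swap:
  assumes d: "distinct is" and m: "length xs + 2 + length ys \<le> m"
    and H: "tail_fun (length xs + 2 + length ys) H"
  shows "Gsum m is C (xs @ x # y # ys) H = - Gsum m is C (xs @ y # x # ys) H"
proof -
  define k where "k = length xs"
  define s where "s = Transposition.transpose (Suc k) (Suc (Suc k))"
  have s: "s permutes {1..m}"
    unfolding s_def using m by (intro permutes_swap_id) (auto simp: k_def)
  define F where "F w = C * (rows is 0 xs w *
     (T k is x (w (Suc k)) * T (Suc k) is y (w (Suc (Suc k)))
    + T k is y (w (Suc k)) * T (Suc k) is x (w (Suc (Suc k)))) * rows is (Suc (Suc k)) ys w) * H w" for w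
  have sum: "Gsum m is C (xs @ x # y # ys) H + Gsum m is C (xs @ y # x # ys) H
     = (\<Sum>w\<in>{w. w permutes {1..m}}. of_int (sign w) * F w)"
    unfolding Gsum_def sum.distrib[symmetric]
    by (intro sum.cong refl) (simp add: F_def rows_append k_def algebra_simps)
  have F: "F (w \<circ> s) = F w" for w
  proof -
    have "rows is 0 xs (w \<circ> s) = rows is 0 xs w"
      by (rule rows_cong) (auto simp: s_def k_def transpose_def)
    moreover have "rows is (Suc (Suc k)) ys (w \<circ> s) = rows is (Suc (Suc k)) ys w"
      by (rule rows_cong) (auto simp: s_def k_def transpose_def)
    moreover have "H (w \<circ> s) = H w"
      using H unfolding tail_fun_def
      by (rule allE[of _ "w \<circ> s"]) (auto simp: s_def k_def transpose_def)
    moreover have "T k is x (w (Suc (Suc k))) * T (Suc k) is y (w (Suc k))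
        + T k is y (w (Suc (Suc k))) * T (Suc k) is x (w (Suc k))
       = T k is x (w (Suc k)) * T (Suc k) is y (w (Suc (Suc k)))
        + T k is y (w (Suc k)) * T (Suc k) is x (w (Suc (Suc k)))"
      using T_four_term[OF d, of k x "w (Suc k)" y "w (Suc (Suc k))"] by (simp add: algebra_simps)
    ultimately show ?thesis by (simp add: F_def s_def)
  qed
  have "(\<Sum>w\<in>{w. w permutes {1..m}}. of_int (sign w) * F w)
      = (\<Sum>w\<in>{w. w permutes {1..m}}. of_int (sign (w \<circ> s)) * F (w \<circ> s))"
    by (rule sum_permutations_compose_right[OF s])
  also have "\<dots> = (\<Sum>w\<in>{w. w permutes {1..m}}. - (of_int (sign w) * F w))"
  proof (intro sum.cong refl)
    fix w assume "w \<in> {w. w permutes {1..m}}"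
    then have "sign (w \<circ> s) = sign w * sign s"
      using s by (intro sign_compose) (auto intro: permutation_permutes[THEN iffD2])
    moreover have "sign s = -1" by (simp add: s_def sign_swap_id)
    ultimately show "of_int (sign (w \<circ> s)) * F (w \<circ> s) = - (of_int (sign w) * F w)"
      by (simp add: F)
  qed
  also have "\<dots> = - (\<Sum>w\<in>{w. w permutes {1..m}}. of_int (sign w) * F w)"
    by (simp add: sum_negf)
  finally have "(\<Sum>w\<in>{w. w permutes {1..m}}. of_int (sign w) * F w) = 0"
    by (rule two[OF iffD1[OF eq_neg_iff_add_eq_0]])
  then show ?thesis using sum by (simp add: eq_neg_iff_add_eq_0)
qed

lemma Gsum_to_front:
  assumes d: "distinct is"
    and "length zs + length xs + 1 + length ys \<le> m" "tail_fun (length zs + length xs + 1 + length ys) H"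
  shows "Gsum m is C (zs @ xs @ x # ys) H = (-1) ^ length xs * Gsum m is C (zs @ x # xs @ ys) H"
  using assms(2,3)
proof (induction xs arbitrary: ys rule: rev_induct)
  case Nil
  then show ?case by simp
next
  case (snoc a xs)
  have "Gsum m is C (zs @ (xs @ [a]) @ x # ys) H = Gsum m is C ((zs @ xs) @ a # x # ys) H" by simp
  also have "\<dots> = - Gsum m is C ((zs @ xs) @ x # a # ys) H"
    using snoc.prems by (intro Gsum_swap d) (auto simp: add_ac)
  also have "\<dots> = - ((-1) ^ length xs * Gsum m is C (zs @ x # xs @ (a # ys)) H)"
    using snoc.prems by (subst snoc.IH[symmetric]) (auto simp: add_ac)
  finally show ?case by simp
qed

lemma Gsum_repeated:
  assumes d: "distinct is"
    and m: "length zs + length xs + 2 + length ys \<le> m"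
    and H: "tail_fun (length zs + length xs + 2 + length ys) H"
  shows "Gsum m is C (zs @ x # xs @ x # ys) H = 0"
proof -
  have 1: "Gsum m is C ((zs @ [x]) @ xs @ x # ys) H
      = (-1) ^ length xs * Gsum m is C ((zs @ [x]) @ x # xs @ ys) H"
    using m H by (intro Gsum_to_front d) (simp_all add: add_ac)
  have "Gsum m is C (zs @ x # x # xs @ ys) H = - Gsum m is C (zs @ x # x # xs @ ys) H"
    using m H by (intro Gsum_swap d) (simp_all add: add_ac)
  then have "Gsum m is C (zs @ x # x # xs @ ys) H = 0"
    by (rule two[OF iffD1[OF eq_neg_iff_add_eq_0]])
  then show ?thesis using 1 by simp
qed

lemma L_rows_commute:
  "i \<notin> set is \<Longrightarrow> L i r a b * rows is k bs w = rows is k bs w * L i r a b"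
proof (induction bs arbitrary: k)
  case Nil
  then show ?case by simp
next
  case (Cons c bs)
  have 1: "L i r a b * T k is c (w (Suc k)) = T k is c (w (Suc k)) * L i r a b"
    by (rule L_T_commute) (rule Cons.prems)
  have 2: "L i r a b * rows is (Suc k) bs w = rows is (Suc k) bs w * L i r a b"
    by (rule Cons.IH) (rule Cons.prems)
  show ?case by (simp add: mult.assoc 2 mult_left_swap[OF 1])
qed

definition qdet :: "nat \<Rightarrow> nat list \<Rightarrow> 'b" where
  "qdet m is = Gsum m is 1 [1..<m+1] (\<lambda>_. 1)"

lemma tail_fun_const [simp]: "tail_fun k (\<lambda>_. c)"
  by (simp add: tail_fun_def)

lemma tail_fun_rows: "tail_fun k (rows is k bs)"
  unfolding tail_fun_def by (auto intro!: rows_cong)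

end

section \<open>Bras and the collapse of the quantum determinant\<close>

locale rll_bra = rll_chain R E N for R :: "nat \<Rightarrow> nat \<Rightarrow> 'b::ring_1" and E N +
  fixes B :: "(nat \<Rightarrow> nat) \<Rightarrow> 'b"
  assumes BE: "B a * E i x y = (if a i = x then B (a(i := y)) else 0)"
    and BR: "B a * R i r = R i r * B a"
begin

text \<open>A bra meeting a site either passes it, or trades colours with the row: the row label
  \<open>b\<close> becomes the colour of the site and the old colour \<open>a i\<close> becomes the
  new row label.\<close>

lemma B_L: "B a * L i r b c = of_bool (b = c) * B a + of_bool (a i = c) * (R i r * B (a(i := b)))"
proof -
  have "B a * (R i r * E i c b) = R i r * (B a * E i c b)"
    by (metis BR mult.assoc)
  then show ?thesis by (simp add: L_def distrib_left BE of_bool_def)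
qed

lemma B_T_Cons:
  assumes "b \<in> {1..N}" "a i \<in> {1..N}"
  shows "(\<Sum>c\<in>{1..N}. B a * L i r b c * Y c) = B a * Y b + R i r * B (a(i := b)) * Y (a i)"
proof -
  have "(\<Sum>c\<in>{1..N}. B a * L i r b c * Y c)
     = (\<Sum>c\<in>{1..N}. if b = c then B a * Y c else 0)
     + (\<Sum>c\<in>{1..N}. if a i = c then R i r * B (a(i := b)) * Y c else 0)"
    unfolding sum.distrib[symmetric]
    by (intro sum.cong refl) (auto simp: B_L distrib_right mult.assoc)
  then show ?thesis using assms by (simp add: mult.assoc)
qed

text \<open>Once a row has traded its label for a colour exceeding \<open>m\<close>, the remaining
  high sites cannot bring it back to a column \<open>w \<le> m\<close>, so every trading term
  dies.\<close>

lemma B_T_high: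
  "distinct is \<Longrightarrow> (\<forall>i\<in>set is. a i > m) \<Longrightarrow> c \<in> {1..N} \<Longrightarrow> w \<le> m \<Longrightarrow>
     B a * T r is c w = of_bool (c = w) * B a"
proof (induction "is" arbitrary: a c)
  case Nil
  then show ?case by simp
next
  case (Cons i js)
  have "B a * T r (i # js) c w
     = (\<Sum>d\<in>{1..N}. (if c = d then B a * T r js d w else 0)
         + of_bool (a i = d) * (R i r * (B (a(i := c)) * T r js d w)))"
    by (auto simp: sum_distrib_left mult.assoc[symmetric] B_L distrib_right intro!: sum.cong)
  also have "\<dots> = (\<Sum>d\<in>{1..N}. (if c = d then B a * T r js d w else 0))"
  proof (intro sum.cong refl)
    fix d assume d: "d \<in> {1..N}"
    have "B (a(i := c)) * T r js d w = of_bool (d = w) * B (a(i := c))"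
      using Cons.prems d by (intro Cons.IH) auto
    moreover have "a i = d \<Longrightarrow> d \<noteq> w" using Cons.prems by auto
    ultimately show "(if c = d then B a * T r js d w else 0)
         + of_bool (a i = d) * (R i r * (B (a(i := c)) * T r js d w))
         = (if c = d then B a * T r js d w else 0)"
      by (auto simp: of_bool_def)
  qed
  also have "\<dots> = B a * T r js c w" using Cons.prems by simp
  also have "\<dots> = of_bool (c = w) * B a" using Cons by auto
  finally show ?case .
qed

lemma B_rows_high:
  assumes "distinct is" "\<forall>i\<in>set is. a i > m"
  shows "set bs \<subseteq> {1..N} \<Longrightarrow> (\<forall>j. w (Suc j) \<le> m \<or> j \<ge> k + length bs) \<Longrightarrow>
    B a * rows is k bs w = of_bool (\<forall>j<length bs. bs ! j = w (Suc (k + j))) * B a"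
proof (induction bs arbitrary: k)
  case Nil
  then show ?case by simp
next
  case (Cons b bs)
  have "w (Suc k) \<le> m" using Cons.prems(2)[rule_format, of k] by auto
  then have "B a * rows is k (b # bs) w = of_bool (b = w (Suc k)) * (B a * rows is (Suc k) bs w)"
    using Cons.prems B_T_high[OF assms, of b "w (Suc k)" k]
    by (simp add: mult.assoc[symmetric])
  also have "\<dots> = of_bool (b = w (Suc k)) * of_bool (\<forall>j<length bs. bs ! j = w (Suc (Suc k + j))) * B a"
    using Cons.prems by (subst Cons.IH) (auto simp: mult.assoc)
  also have "\<dots> = of_bool (\<forall>j<length (b # bs). (b # bs) ! j = w (Suc (k + j))) * B a"
    unfolding length_Cons All_less_Suc2 by (auto simp: of_bool_def)
  finally show ?case .
qed

lemma B_qdet_high: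
  assumes "distinct is" "\<forall>i\<in>set is. a i > m" "m \<le> N"
  shows "B a * qdet m is = B a"
proof -
  have "B a * qdet m is = (\<Sum>w\<in>{w. w permutes {1..m}}. of_int (sign w) * (B a * rows is 0 [1..<m+1] w))"
    by (simp add: qdet_def Gsum_def sum_distrib_left mult_of_int_commute mult.assoc[symmetric])
       (simp add: mult_of_int_commute mult.assoc)
  also have "\<dots> = (\<Sum>w\<in>{w. w permutes {1..m}}. if w = id then B a else 0)"
  proof (intro sum.cong refl)
    fix w assume w: "w \<in> {w. w permutes {1..m}}"
    have le: "w (Suc j) \<le> m \<or> j \<ge> 0 + length [1..<m+1]" for j
    proof (cases "j < m")
      case True
      then have "w (Suc j) \<in> {1..m}" using w permutes_in_image[of w "{1..m}" "Suc j"] by simp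
      then show ?thesis by auto
    qed auto
    have "B a * rows is 0 [1..<m+1] w = of_bool (\<forall>j<m. Suc j = w (Suc j)) * B a"
      using B_rows_high[OF assms(1,2), of "[1..<m+1]" w 0] le assms(3)
      by (simp del: upt_Suc One_nat_def add: Suc_le_eq nth_upt subset_iff) (auto simp add: of_bool_def simp del: upt_Suc)
    moreover have "(\<forall>j<m. Suc j = w (Suc j)) \<longleftrightarrow> w = id"
    proof
      assume *: "\<forall>j<m. Suc j = w (Suc j)"
      show "w = id"
      proof
        fix x show "w x = id x"
        proof (cases "x \<in> {1..m}")
          case True
          then obtain j where "x = Suc j" "j < m" by (cases x) auto
          with * show ?thesis by simp
        next
          case False
          then show ?thesis using w by (simp add: permutes_not_in)
        qed
      qed
    qed simp
    ultimately show "of_int (sign w) * (B a * rows is 0 [1..<m+1] w) = (if w = id then B a else 0)"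
      by (auto simp: sign_id)
  qed
  also have "\<dots> = B a"
    by (simp add: sum.delta permutes_id finite_permutations)
  finally show ?thesis .
qed

text \<open>With the colour of the first site as first row label, the site can be stripped from one
  row after another. Only the first row produces a correction; in all later rows the trade creates a
  repeated label.\<close>

lemma B_Gsum_Cons:
  assumes d: "distinct (i # js)" and bs: "bs = a i # cs" "set bs \<subseteq> {1..N}" "length bs = m"
  shows "Gsum m (i # js) (B a) bs (\<lambda>_. 1) = (1 + R i 0) * Gsum m js (B a) bs (\<lambda>_. 1)"
proof -
  have dj: "distinct js" and i: "i \<notin> set js" using d by auto
  have x: "a i \<in> {1..N}" using bs by auto
  \<comment> \<open>The interpolation: the first \<open>r\<close> rows have lost site
    \<open>i\<close>, the others still carry it.\<close>
  define U where "U r = Gsum m js (B a) (take r bs) (rows (i # js) r (drop r bs))" for r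
  have step: "U r = U (Suc r) + (\<Sum>w\<in>{w. w permutes {1..m}}. of_int (sign w) *
      (R i r * (B (a(i := bs ! r)) * rows js 0 (take r bs @ [a i]) w * rows (i # js) (Suc r) (drop (Suc r) bs) w)))"
    if r: "r < m" for r
  proof -
    have b: "bs ! r \<in> {1..N}" using bs r nth_mem by blast
    have len: "length (take r bs) = r" using bs r by simp
    have take: "take (Suc r) bs = take r bs @ [bs ! r]" using bs(3) r by (simp add: take_Suc_conv_app_nth)
    have drop: "drop r bs = bs ! r # drop (Suc r) bs" using bs(3) r by (simp add: Cons_nth_drop_Suc)
    have "B a * rows js 0 (take r bs) w * rows (i # js) r (drop r bs) w
      = B a * rows js 0 (take (Suc r) bs) w * rows (i # js) (Suc r) (drop (Suc r) bs) w
      + R i r * (B (a(i := bs ! r)) * rows js 0 (take r bs @ [a i]) w * rows (i # js) (Suc r) (drop (Suc r) bs) w)"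
      for w
    proof -
      let ?Y = "\<lambda>c. rows js 0 (take r bs) w * T r js c (w (Suc r)) * rows (i # js) (Suc r) (drop (Suc r) bs) w"
      have "B a * rows js 0 (take r bs) w * (L i r (bs ! r) c * T r js c (w (Suc r)) * rows (i # js) (Suc r) (drop (Suc r) bs) w)
          = B a * L i r (bs ! r) c * ?Y c" for c
        by (simp only: mult.assoc mult_left_swap[OF L_rows_commute[OF i]])
      then have "B a * rows js 0 (take r bs) w * rows (i # js) r (drop r bs) w
        = (\<Sum>c\<in>{1..N}. B a * L i r (bs ! r) c * ?Y c)"
        by (simp add: drop sum_distrib_left sum_distrib_right)
      also have "\<dots> = B a * ?Y (bs ! r) + R i r * B (a(i := bs ! r)) * ?Y (a i)"
        using b x by (intro B_T_Cons)
      finally show ?thesis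
        by (simp add: take rows_append len mult.assoc del: length_take)
    qed
    then show ?thesis
      unfolding U_def Gsum_def by (simp add: distrib_left sum.distrib)
  qed
  \<comment> \<open>For \<open>r > 0\<close> the label \<open>a i\<close> already stands in front,
    and the trade puts it into row \<open>r\<close> again.\<close>
  have U_Suc: "U r = U (Suc r)" if r: "0 < r" "r < m" for r
  proof -
    have "take r bs = a i # take (r - 1) cs" using bs r by (cases r) auto
    moreover have "Gsum m js (B (a(i := bs ! r))) ([] @ a i # take (r - 1) cs @ a i # []) (rows (i # js) (Suc r) (drop (Suc r) bs)) = 0"
      using r bs tail_fun_rows[of "Suc r" "i # js" "drop (Suc r) bs"] by (intro Gsum_repeated dj) auto
    ultimately have z: "(\<Sum>w\<in>{w. w permutes {1..m}}. of_int (sign w) *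
       (B (a(i := bs ! r)) * rows js 0 (take r bs @ [a i]) w * rows (i # js) (Suc r) (drop (Suc r) bs) w)) = 0"
      by (simp add: Gsum_def)
    have "(\<Sum>w\<in>{w. w permutes {1..m}}. of_int (sign w) *
      (R i r * (B (a(i := bs ! r)) * rows js 0 (take r bs @ [a i]) w * rows (i # js) (Suc r) (drop (Suc r) bs) w)))
      = R i r * (\<Sum>w\<in>{w. w permutes {1..m}}. of_int (sign w) *
       (B (a(i := bs ! r)) * rows js 0 (take r bs @ [a i]) w * rows (i # js) (Suc r) (drop (Suc r) bs) w))"
      unfolding sum_distrib_left by (intro sum.cong refl) (simp only: mult.assoc mult_left_swap[OF mult_of_int_commute])
    then show ?thesis using step[OF r(2)] z by simp
  qed
  have m: "m > 0" using bs by auto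
  have "U 1 = U m"
  proof -
    have "r \<le> m \<Longrightarrow> 1 \<le> r \<Longrightarrow> U 1 = U r" for r
    proof (induction r)
      case (Suc r)
      then show ?case using U_Suc[of r] by (cases "r = 0") auto
    qed simp
    then show ?thesis using m by auto
  qed
  \<comment> \<open>In row 0 the traded labels coincide, so the bra is unchanged and the correction
    is \<open>R i 0\<close> times the main term.\<close>
  moreover have "U 0 = (1 + R i 0) * U 1"
  proof -
    have "U 0 = U 1 + (\<Sum>w\<in>{w. w permutes {1..m}}. of_int (sign w) *
      (R i 0 * (B a * rows js 0 [a i] w * rows (i # js) 1 (drop 1 bs) w)))"
      using step[OF m] bs(1) by (simp del: rows.simps)
    also have "(\<Sum>w\<in>{w. w permutes {1..m}}. of_int (sign w) *
      (R i 0 * (B a * rows js 0 [a i] w * rows (i # js) 1 (drop 1 bs) w))) = R i 0 * U 1"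
      unfolding U_def Gsum_def sum_distrib_left
      by (intro sum.cong refl) (simp add: bs(1) mult.assoc mult_left_swap[OF mult_of_int_commute] del: rows.simps)
    finally show ?thesis by (simp add: distrib_right)
  qed
  moreover have "U 0 = Gsum m (i # js) (B a) bs (\<lambda>_. 1)"
    by (simp add: U_def Gsum_def)
  moreover have "U m = Gsum m js (B a) bs (\<lambda>_. 1)"
    using bs by (simp add: U_def Gsum_def)
  ultimately show ?thesis by simp
qed

text \<open>Moving the row labelled by \<open>a i\<close> to the front costs the same sign with and
  without the site, so the sign cancels.\<close>

lemma B_qdet_Cons:
  assumes d: "distinct (i # js)" and a: "1 \<le> a i" "a i \<le> m" "m \<le> N"
  shows "B a * qdet m (i # js) = (1 + R i 0) * (B a * qdet m js)"
proof -
  have BG: "B a * qdet m is = Gsum m is (B a) [1..<m+1] (\<lambda>_. 1)" for "is"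
    unfolding qdet_def Gsum_def sum_distrib_left
    by (intro sum.cong refl) (simp add: mult.assoc mult_left_swap[OF mult_of_int_commute] del: rows.simps upt_Suc)
  define xs where "xs = [1..<a i]"
  define ys where "ys = [Suc (a i)..<m+1]"
  have split: "[1..<m+1] = [] @ xs @ a i # ys"
    using a unfolding xs_def ys_def
    by (metis append_Nil less_Suc_eq_le Suc_eq_plus1 upt_conv_Cons upt_add_eq_append le_add_diff_inverse le_Suc_eq)
  have len: "length xs + 1 + length ys = m"
    using a by (simp add: xs_def ys_def)
  have front: "Gsum m is (B a) [1..<m+1] (\<lambda>_. 1)
      = (-1) ^ length xs * Gsum m is (B a) (a i # xs @ ys) (\<lambda>_. 1)" if "distinct is" for "is"
    unfolding split using Gsum_to_front[OF that, of "[]" xs ys m] len by simp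
  have "Gsum m (i # js) (B a) (a i # xs @ ys) (\<lambda>_. 1)
     = (1 + R i 0) * Gsum m js (B a) (a i # xs @ ys) (\<lambda>_. 1)"
    using a len by (intro B_Gsum_Cons d refl) (auto simp: xs_def ys_def)
  moreover have "(-1) ^ length xs * ((1 + R i 0) * y) = (1 + R i 0) * ((-1) ^ length xs * y)" for y :: 'b
    by (cases "even (length xs)") auto
  ultimately show ?thesis
    using d by (simp add: BG front del: upt_Suc One_nat_def)
qed

theorem B_qdet:
  assumes "distinct (is @ js)" "\<forall>i\<in>set is. 1 \<le> a i \<and> a i \<le> m" "\<forall>j\<in>set js. a j > m" "m \<le> N"
  shows "B a * qdet m (is @ js) = prod_list (map (\<lambda>i. 1 + R i 0) is) * B a"
  using assms
proof (induction "is")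
  case Nil
  then show ?case by (simp add: B_qdet_high)
next
  case (Cons i "is")
  then show ?case by (simp add: B_qdet_Cons mult.assoc)
qed

end

section \<open>Dunkl-type operators\<close>

unbundle no vec_syntax and fps_syntax

text \<open>The two-site product with both denominators cleared: \<open>X\<close> stands for the
  inverse of \<open>u\<close>, \<open>A0\<close> and \<open>A1\<close> for the rescaled
  \<open>u - r + d\<close> at the two sites, \<open>s\<close> for the joint exchange of variables
  and colours, \<open>p\<close> for the exchange of colours. The defect \<open>X * p\<close> from
  moving \<open>s\<close> past \<open>A0\<close> or \<open>A1\<close> is absorbed by the term
  quadratic in \<open>X\<close>.\<close>

lemma intertwine_ring_identity:
  fixes X :: "'b::ring_1"
  assumes "s * A0 = A1 * s + X * p" "s * A1 = A0 * s - X * p" "s * E0 = E1 * s" "s * E1 = E0 * s"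
    and "s * y = y * s" "s * p = p * s" "s * p * E0 = E0 * (s * p)" "p * E1 = E0 * p"
    and X: "\<And>z. X * z = z * X"
  shows "(s + 1) * (y + X * (A0 * E1) + X * (A1 * E0) + X * (X * (p * E0)))
       = (y + X * (A1 * E0) + X * (A0 * E1) + X * (X * (E0 * p))) * (s + 1)"
proof -
  have X': "s * (X * z) = X * (s * z)" for z
    by (metis X mult.assoc)
  have "s * (X * (A0 * E1)) = X * (A1 * E0) * s + X * (X * (E0 * p))"
    unfolding X' by (simp add: mult.assoc[symmetric] assms(1)) (simp add: distrib_right distrib_left mult.assoc assms(3-8))
  moreover have "s * (X * (A1 * E0)) = X * (A0 * E1) * s - X * (X * (p * E0))"
    unfolding X' by (simp add: mult.assoc[symmetric] assms(2)) (simp add: left_diff_distrib right_diff_distrib mult.assoc assms(3-8))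
  moreover have "s * (X * (X * (p * E0))) = X * (X * (E0 * p)) * s"
    unfolding X' using assms(7) by (simp only: mult.assoc assms(6)[symmetric])
  ultimately show ?thesis
    using assms(5) by (simp add: distrib_left distrib_right)
qed

lemma inverse_commute:
  fixes A :: "'b::monoid_mult"
  assumes "A * g = 1" "g * A = 1" "A * y = y * A"
  shows "g * y = y * g"
  by (metis assms mult.assoc mult.left_neutral mult.right_neutral)

lemma diff_of_nat_commute:
  fixes a :: "'b::ring_1"
  assumes "a * c = c * a"
  shows "(a - of_nat r) * c = c * (a - of_nat r)"
  using assms mult_of_nat_commute[of r c] by (simp add: left_diff_distrib right_diff_distrib)

lemma fps_X_central: "fps_X * (f :: 'r::ring_1 fps) = f * fps_X"
  by (rule fps_mult_fps_X_commute)

text \<open>\<open>Kd\<close>, \<open>Kd'\<close> and \<open>Kdj\<close> are the degenerate affine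
  Hecke relations. The operators \<open>d\<close>, \<open>E\<close> and \<open>B\<close> obey their
  relations for all indices, the exchanges only for adjacent sites below \<open>n\<close>.
  \<open>Pr\<close> projects to colours in \<open>{1..N}\<close>; the colour sum in
  \<open>sumE\<close> runs over this range, so the identity holds only after the projection.\<close>

locale dunkl =
  fixes d :: "nat \<Rightarrow> 'r::ring_1" and E :: "nat \<Rightarrow> nat \<Rightarrow> nat \<Rightarrow> 'r" and K P :: "nat \<Rightarrow> 'r"
    and B :: "(nat \<Rightarrow> nat) \<Rightarrow> 'r" and Pr :: 'r and n N :: nat
  assumes dd: "d i * d j = d j * d i"
    and dE: "d i * E j x y = E j x y * d i"
    and EE: "i \<noteq> j \<Longrightarrow> E i x y * E j z w = E j z w * E i x y"
    and EEs: "E i x y * E i z w = (if y = z then E i x w else 0)"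
    and two: "q + q = 0 \<Longrightarrow> (q::'r) = 0"
    and BE: "B a * E i x y = (if a i = x then B (a(i := y)) else 0)"
    and Bd: "B a * d i = d i * B a"
    and Kd: "Suc i < n \<Longrightarrow> K i * d i = d (Suc i) * K i + 1"
    and Kd': "Suc i < n \<Longrightarrow> K i * d (Suc i) = d i * K i - 1"
    and Kdj: "Suc i < n \<Longrightarrow> j \<noteq> i \<Longrightarrow> j \<noteq> Suc i \<Longrightarrow> K i * d j = d j * K i"
    and KK: "Suc i < n \<Longrightarrow> K i * K i = 1"
    and PP: "Suc i < n \<Longrightarrow> P i * P i = 1"
    and KP: "Suc i < n \<Longrightarrow> K i * P i = P i * K i"
    and Pd: "Suc i < n \<Longrightarrow> P i * d j = d j * P i"
    and KE: "Suc i < n \<Longrightarrow> K i * E j x y = E j x y * K i"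
    and PE: "Suc i < n \<Longrightarrow> P i * E i x y = E (Suc i) x y * P i"
    and PE': "Suc i < n \<Longrightarrow> P i * E (Suc i) x y = E i x y * P i"
    and PEj: "Suc i < n \<Longrightarrow> j \<noteq> i \<Longrightarrow> j \<noteq> Suc i \<Longrightarrow> P i * E j x y = E j x y * P i"
    and Prd: "Pr * d i = d i * Pr"
    and PrE: "x \<in> {1..N} \<Longrightarrow> y \<in> {1..N} \<Longrightarrow> Pr * E i x y = E i x y * Pr"
    and sumE: "Suc i < n \<Longrightarrow> x \<in> {1..N} \<Longrightarrow> y \<in> {1..N} \<Longrightarrow>
      (\<Sum>c\<in>{1..N}. E i c x * E (Suc i) y c) * Pr = P i * E i y x * Pr"
begin

text \<open>With \<open>fps_X\<close> read as the inverse of \<open>u\<close>, this is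
  \<open>(u - r + d i) / u\<close>; hence \<open>g\<close> is its geometric series and
  \<open>R i r\<close> the resolvent \<open>1 / (u - r + d i)\<close>.\<close>

definition A :: "nat \<Rightarrow> nat \<Rightarrow> 'r fps" where
  "A i r = 1 + fps_const (d i - of_nat r) * fps_X"

definition g :: "nat \<Rightarrow> nat \<Rightarrow> 'r fps" where
  "g i r = Abs_fps (\<lambda>s. (of_nat r - d i) ^ s)"

definition R :: "nat \<Rightarrow> nat \<Rightarrow> 'r fps" where
  "R i r = fps_X * g i r"

definition Es :: "nat \<Rightarrow> nat \<Rightarrow> nat \<Rightarrow> 'r fps" where
  "Es i x y = fps_const (E i x y)"

definition Bs :: "(nat \<Rightarrow> nat) \<Rightarrow> 'r fps" where
  "Bs a = fps_const (B a)"

lemma A_g: "A i r * g i r = 1"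
proof (rule fps_ext)
  fix s
  have "A i r * g i r = g i r + fps_const (d i - of_nat r) * (fps_X * g i r)"
    by (simp add: A_def distrib_right mult.assoc)
  then have "(A i r * g i r) $ s = (g i r) $ s + (d i - of_nat r) * (if s = 0 then 0 else (g i r) $ (s - 1))"
    by simp
  then show "(A i r * g i r) $ s = (1 :: 'r fps) $ s"
    by (cases s) (simp_all add: g_def left_diff_distrib)
qed

lemma g_A: "g i r * A i r = 1"
proof (rule fps_ext)
  fix s
  have "g i r * A i r = g i r + (g i r * fps_const (d i - of_nat r)) * fps_X"
    by (simp add: A_def distrib_left mult.assoc)
  then have "(g i r * A i r) $ s = (g i r) $ s + (if s = 0 then 0 else (g i r) $ (s - 1) * (d i - of_nat r))"
    by simp
  then show "(g i r * A i r) $ s = (1 :: 'r fps) $ s"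
    by (cases s) (simp_all add: g_def power_Suc2 right_diff_distrib del: power_Suc)
qed

lemma d_sub_commute: "(d i - of_nat r) * (d j - of_nat t) = (d j - of_nat t) * (d i - of_nat r)"
  by (intro diff_of_nat_commute diff_of_nat_commute[symmetric] dd)

lemma A_const: "(d i - of_nat r) * c = c * (d i - of_nat r) \<Longrightarrow> A i r * fps_const c = fps_const c * A i r"
  unfolding A_def distrib_left distrib_right mult.assoc fps_X_central[of "fps_const c"]
  by (simp add: mult.assoc[symmetric])

lemma AA: "A i r * A j t = A j t * A i r"
proof -
  have "A i r * fps_const (d j - of_nat t) = fps_const (d j - of_nat t) * A i r"
    by (rule A_const) (rule d_sub_commute)
  then show ?thesis
    unfolding A_def[of j] distrib_left distrib_right mult.assoc fps_X_central[of "A i r"]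
    by (simp add: mult.assoc[symmetric])
qed

lemma AE: "A i r * Es j x y = Es j x y * A i r"
  unfolding Es_def by (rule A_const) (rule diff_of_nat_commute, rule dE)

lemma AB: "A i r * Bs a = Bs a * A i r"
  unfolding Bs_def by (rule A_const) (rule diff_of_nat_commute, rule Bd[symmetric])

lemma APr: "A i r * fps_const Pr = fps_const Pr * A i r"
  by (rule A_const) (rule diff_of_nat_commute, rule Prd[symmetric])

lemma g_commute: "A i r * y = y * A i r \<Longrightarrow> g i r * y = y * g i r"
  by (rule inverse_commute[OF A_g g_A])

lemma R_commute:
  assumes "A i r * y = y * A i r"
  shows "R i r * y = y * R i r"
proof -
  have "R i r * y = fps_X * (y * g i r)"
    by (simp only: R_def mult.assoc g_commute[OF assms])
  also have "\<dots> = y * R i r"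
    unfolding R_def mult.assoc[symmetric] fps_X_central[of y] ..
  finally show ?thesis .
qed

sublocale rll_bra R Es N Bs
proof
  show RR: "R i r * R j t = R j t * R i r" for i r j t
  proof (rule R_commute)
    have "R j t * A i r = A i r * R j t"
      by (rule R_commute) (rule AA)
    then show "A i r * R j t = R j t * A i r" ..
  qed
  show "R i r * Es j x y = Es j x y * R i r" for i r j x y
    by (rule R_commute) (rule AE)
  show "i \<noteq> j \<Longrightarrow> Es i x y * Es j z w = Es j z w * Es i x y" for i j x y z w
    by (simp add: Es_def EE)
  show "Es i x y * Es i z w = (if y = z then Es i x w else 0)" for i x y z w
    by (simp add: Es_def EEs)
  show "R i (Suc r) - R i r = R i r * R i (Suc r)" for i r
  proof -
    have AX: "A i r - A i (Suc r) = fps_X"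
      by (simp add: A_def algebra_simps flip: fps_const_sub fps_const_add)
    have "g i (Suc r) - g i r = g i r * (A i r - A i (Suc r)) * g i (Suc r)"
      by (simp add: right_diff_distrib left_diff_distrib g_A) (simp add: mult.assoc A_g)
    then show ?thesis
      unfolding AX R_def by (simp add: right_diff_distrib[symmetric] mult.assoc)
  qed
  show "q + q = 0 \<Longrightarrow> q = 0" for q :: "'r fps"
    by (metis fps_add_nth fps_ext fps_zero_nth two)
  show "Bs a * Es i x y = (if a i = x then Bs (a(i := y)) else 0)" for a i x y
    by (simp add: Bs_def Es_def BE)
  show "Bs a * R i r = R i r * Bs a" for a i r
    by (rule R_commute[symmetric]) (rule AB)
qed

section \<open>Preservation of the antisymmetric space\<close>

abbreviation S :: "nat \<Rightarrow> 'r fps" where "S i \<equiv> fps_const (K i * P i)"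
abbreviation Prs :: "'r fps" where "Prs \<equiv> fps_const Pr"

text \<open>\<open>Pres i Y\<close> says that \<open>Y\<close> maps the kernel of \<open>S i + 1\<close> on the range of \<open>Pr\<close> into itself; the cofactor
  \<open>Y'\<close> makes this property multiplicative.\<close>
definition Pres :: "nat \<Rightarrow> 'r fps \<Rightarrow> bool" where
  "Pres i Y \<longleftrightarrow> Y * Prs = Prs * Y \<and> (\<exists>Y'. (S i + 1) * Y * Prs = Y' * ((S i + 1) * Prs))"

lemma Pres_mult:
  assumes "Pres i Y" "Pres i Z"
  shows "Pres i (Y * Z)"
proof -
  obtain Y' Z' where 1: "(S i + 1) * Y * Prs = Y' * ((S i + 1) * Prs)"
    and 2: "(S i + 1) * Z * Prs = Z' * ((S i + 1) * Prs)"
    and 3: "Y * Prs = Prs * Y" "Z * Prs = Prs * Z"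
    using assms unfolding Pres_def by blast
  have "(S i + 1) * (Y * Z) * Prs = ((S i + 1) * Y * Prs) * Z"
    by (simp only: mult.assoc 3(2))
  also have "\<dots> = Y' * ((S i + 1) * Z * Prs)"
    unfolding 1 by (simp only: mult.assoc 3(2))
  also have "\<dots> = (Y' * Z') * ((S i + 1) * Prs)"
    unfolding 2 by (simp only: mult.assoc)
  finally have "(S i + 1) * (Y * Z) * Prs = (Y' * Z') * ((S i + 1) * Prs)" .
  moreover have "Y * Z * Prs = Prs * (Y * Z)"
    by (metis 3 mult.assoc)
  ultimately show ?thesis unfolding Pres_def by blast
qed

lemma Pres_zero: "Pres i 0"
  unfolding Pres_def by (auto intro!: exI[of _ 0])

lemma Pres_add:
  assumes "Pres i Y" "Pres i Z"
  shows "Pres i (Y + Z)"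
proof -
  obtain Y' Z' where 1: "(S i + 1) * Y * Prs = Y' * ((S i + 1) * Prs)"
    and 2: "(S i + 1) * Z * Prs = Z' * ((S i + 1) * Prs)"
    and 3: "Y * Prs = Prs * Y" "Z * Prs = Prs * Z"
    using assms unfolding Pres_def by blast
  have "(S i + 1) * (Y + Z) * Prs = (S i + 1) * Y * Prs + (S i + 1) * Z * Prs"
    by (simp only: distrib_left[of "S i + 1" Y Z] distrib_right[of "(S i + 1) * Y" "(S i + 1) * Z" Prs])
  also have "\<dots> = (Y' + Z') * ((S i + 1) * Prs)"
    unfolding 1 2 by (rule distrib_right[symmetric])
  finally have "(S i + 1) * (Y + Z) * Prs = (Y' + Z') * ((S i + 1) * Prs)" .
  moreover have "(Y + Z) * Prs = Prs * (Y + Z)"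
    by (simp add: distrib_left distrib_right 3)
  ultimately show ?thesis unfolding Pres_def by blast
qed

lemma Pres_sum: "(\<And>c. c \<in> C \<Longrightarrow> Pres i (f c)) \<Longrightarrow> Pres i (\<Sum>c\<in>C. f c)"
  by (induction C rule: infinite_finite_induct) (auto simp: Pres_zero Pres_add)

lemma Pres_commute:
  assumes "S i * Y = Y * S i" "Y * Prs = Prs * Y"
  shows "Pres i Y"
proof -
  have "(S i + 1) * Y * Prs = Y * ((S i + 1) * Prs)"
    by (simp only: distrib_left distrib_right mult.assoc[symmetric] mult_1_left mult_1_right assms(1))
  then show ?thesis unfolding Pres_def using assms(2) by blast
qed

lemma Pres_of_int: "Pres i (of_int z)"
  by (rule Pres_commute) (simp_all add: mult_of_int_commute)

lemma Pres_one: "Pres i 1"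
  by (rule Pres_commute) simp_all

lemma Prs_L:
  assumes "a \<in> {1..N}" "b \<in> {1..N}"
  shows "L i r a b * Prs = Prs * L i r a b"
proof -
  have 1: "Es i b a * Prs = Prs * Es i b a"
    using assms by (simp add: Es_def PrE)
  have 2: "R i r * Prs = Prs * R i r"
    by (rule R_commute) (rule APr)
  show ?thesis
    by (simp add: L_def distrib_left distrib_right mult.assoc 1 of_bool_def)
       (metis 2 mult.assoc)
qed

lemma Pres_L:
  assumes i: "Suc i < n" "j \<noteq> i" "j \<noteq> Suc i" and ab: "a \<in> {1..N}" "b \<in> {1..N}"
  shows "Pres i (L j r a b)"
proof (rule Pres_commute)
  have "S i * Es j b a = Es j b a * S i"
    by (simp add: Es_def) (metis i KE PEj mult.assoc)
  moreover have "R j r * S i = S i * R j r"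
  proof (rule R_commute, rule A_const)
    have "d j * (K i * P i) = K i * P i * d j"
      by (metis i Kdj Pd mult.assoc)
    then show "(d j - of_nat r) * (K i * P i) = K i * P i * (d j - of_nat r)"
      by (rule diff_of_nat_commute)
  qed
  ultimately have "S i * (R j r * Es j b a) = R j r * Es j b a * S i"
    by (metis mult.assoc)
  then show "S i * L j r a b = L j r a b * S i"
    by (simp add: L_def distrib_left distrib_right of_bool_def)
  show "L j r a b * Prs = Prs * L j r a b"
    by (rule Prs_L[OF ab])
qed

text \<open>The one place where the exchange does not commute with the operators involved: the sites
  \<open>i\<close> and \<open>Suc i\<close> themselves. On the range of the projector the product of
  their matrix units becomes \<open>p * E0\<close>, which turns the two-site product into a
  numerator \<open>M\<close> over a denominator commuting with \<open>S i\<close>.\<close>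

lemma Pres_L_L:
  assumes i: "Suc i < n" and ab: "a \<in> {1..N}" "b \<in> {1..N}"
  shows "Pres i (\<Sum>c\<in>{1..N}. L i r a c * L (Suc i) r c b)"
proof -
  define y where "y = g i r * g (Suc i) r"
  define p where "p = fps_const (P i)"
  define k where "k = fps_const (K i)"
  define E0 where "E0 = Es i b a"
  define E1 where "E1 = Es (Suc i) b a"
  define A0 where "A0 = A i r"
  define A1 where "A1 = A (Suc i) r"
  let ?X = "fps_X :: 'r fps"
  \<comment> \<open>The numerator of the two-site product: multiplied by \<open>y\<close>, the
    inverse of \<open>A0 * A1\<close>, it gives back the sum on the range of the projector.\<close>
  define M where "M = of_bool (a = b) * (A0 * A1) + ?X * (A0 * E1) + ?X * (A1 * E0) + ?X * (?X * (p * E0))"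
  have S: "S i = k * p" by (simp add: k_def p_def)
  have kA0: "k * A0 = A1 * k + ?X"
    and kA1: "k * A1 = A0 * k - ?X"
  proof -
    have 1: "K i * (d i - of_nat r) = (d (Suc i) - of_nat r) * K i + 1"
      and 2: "K i * (d (Suc i) - of_nat r) = (d i - of_nat r) * K i - 1"
      using Kd[OF i] Kd'[OF i] mult_of_nat_commute[of r "K i"] by (simp_all add: left_diff_distrib right_diff_distrib)
    have kA: "k * A j r = k + fps_const (K i * (d j - of_nat r)) * ?X" for j
      by (simp add: k_def A_def distrib_left mult.assoc[symmetric])
    have Ak: "A j r * k = k + fps_const ((d j - of_nat r) * K i) * ?X" for j
      unfolding k_def A_def distrib_right mult.assoc fps_X_central[of "fps_const (K i)"]
      by (simp add: mult.assoc[symmetric])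
    show "k * A0 = A1 * k + ?X"
      unfolding A0_def A1_def kA Ak 1 by (simp add: distrib_right flip: fps_const_add)
    show "k * A1 = A0 * k - ?X"
      unfolding A0_def A1_def kA Ak 2 by (simp add: left_diff_distrib flip: fps_const_sub)
  qed
  have pA: "p * A0 = A0 * p" "p * A1 = A1 * p"
    unfolding p_def A0_def A1_def using i
    by (auto intro!: A_const[symmetric] diff_of_nat_commute simp: Pd)
  have pp: "p * p = 1" using i by (simp add: p_def PP)
  have kp: "k * p = p * k" using i by (simp add: k_def p_def KP)
  have kE: "k * E0 = E0 * k" "k * E1 = E1 * k" using i by (simp_all add: k_def E0_def E1_def Es_def KE)
  have pE: "p * E0 = E1 * p" "p * E1 = E0 * p" using i by (simp_all add: p_def E0_def E1_def Es_def PE PE')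
  have AA01: "A0 * A1 = A1 * A0" by (simp add: A0_def A1_def AA)
  have sA0: "S i * A0 = A1 * S i + ?X * p"
  proof -
    have "S i * A0 = (k * A0) * p" unfolding S by (simp only: mult.assoc pA)
    then show ?thesis unfolding kA0 S by (simp only: distrib_right mult.assoc)
  qed
  have sA1: "S i * A1 = A0 * S i - ?X * p"
  proof -
    have "S i * A1 = (k * A1) * p" unfolding S by (simp only: mult.assoc pA)
    then show ?thesis unfolding kA1 S by (simp only: left_diff_distrib mult.assoc)
  qed
  \<comment> \<open>The two defects \<open>X * p\<close> enter with opposite signs and cancel: a
    symmetric function of adjacent \<open>d\<close> commutes with the exchange.\<close>
  have sA: "S i * (A0 * A1) = A0 * A1 * S i"
  proof -
    have "S i * (A0 * A1) = A1 * (S i * A1) + ?X * p * A1"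
      by (simp only: mult.assoc[symmetric] sA0 distrib_right)
    also have "\<dots> = A1 * A0 * S i"
      unfolding sA1 right_diff_distrib by (simp add: mult.assoc pA mult_left_swap[OF fps_X_central])
    finally show ?thesis by (simp add: AA01)
  qed
  have sy: "S i * y = y * S i"
  proof -
    have u: "(A0 * A1) * (g (Suc i) r * g i r) = 1" "(g (Suc i) r * g i r) * (A0 * A1) = 1"
      by (simp_all add: A0_def A1_def mult.assoc) (metis A_g g_A mult.assoc mult_1_left)+
    have "(g (Suc i) r * g i r) * S i = S i * (g (Suc i) r * g i r)"
      by (rule inverse_commute[OF u sA[symmetric]])
    moreover have "g (Suc i) r * g i r = y"
      unfolding y_def by (intro g_commute) (rule g_commute[symmetric], rule AA)
    ultimately show ?thesis by simp
  qed
  have M: "(S i + 1) * M = (of_bool (a = b) * (A0 * A1) + ?X * (A1 * E0) + ?X * (A0 * E1) + ?X * (?X * (E0 * p))) * (S i + 1)"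
    unfolding M_def
  proof (rule intertwine_ring_identity)
    show "S i * E0 = E1 * S i" "S i * E1 = E0 * S i"
      unfolding S by (simp_all add: mult.assoc pE) (simp_all add: mult.assoc[symmetric] kE)
    show "S i * (of_bool (a = b) * (A0 * A1)) = of_bool (a = b) * (A0 * A1) * S i"
      using sA by simp
    show "S i * p = p * S i" unfolding S by (simp only: kp mult.assoc)
    show "S i * p * E0 = E0 * (S i * p)" unfolding S by (simp add: mult.assoc pp) (simp add: kE mult.assoc[symmetric] pp)
  qed (use sA0 sA1 pE fps_X_central in auto)
  have sum: "(\<Sum>c\<in>{1..N}. L i r a c * L (Suc i) r c b) * Prs = y * M * Prs"
  proof -
    have "(\<Sum>c\<in>{1..N}. L i r a c * L (Suc i) r c b)
       = (\<Sum>c\<in>{1..N}. (if a = c then of_bool (c = b) + R (Suc i) r * Es (Suc i) b c else 0)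
           + (if c = b then R i r * Es i c a else 0)
           + R i r * R (Suc i) r * (Es i c a * Es (Suc i) b c))"
    proof (intro sum.cong refl)
      fix c
      have "(R i r * Es i c a) * (R (Suc i) r * Es (Suc i) b c) = R i r * R (Suc i) r * (Es i c a * Es (Suc i) b c)"
        by (simp add: mult.assoc mult_left_swap[OF RE, symmetric])
      then show "L i r a c * L (Suc i) r c b = (if a = c then of_bool (c = b) + R (Suc i) r * Es (Suc i) b c else 0)
           + (if c = b then R i r * Es i c a else 0)
           + R i r * R (Suc i) r * (Es i c a * Es (Suc i) b c)"
        by (auto simp add: L_def distrib_left distrib_right)
    qed
    also have "\<dots> = of_bool (a = b) + R (Suc i) r * E1 + R i r * E0
         + R i r * R (Suc i) r * (\<Sum>c\<in>{1..N}. Es i c a * Es (Suc i) b c)"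
      using ab by (simp add: sum.distrib sum_distrib_left E0_def E1_def)
    finally have "(\<Sum>c\<in>{1..N}. L i r a c * L (Suc i) r c b) * Prs = 
       (of_bool (a = b) + R (Suc i) r * E1 + R i r * E0) * Prs + 
        R i r * R (Suc i) r * ((\<Sum>c\<in>{1..N}. Es i c a * Es (Suc i) b c) * Prs)"
      by (simp add: distrib_right mult.assoc)
    also have "(\<Sum>c\<in>{1..N}. Es i c a * Es (Suc i) b c) * Prs = p * E0 * Prs"
    proof -
      have "(\<Sum>c\<in>C. fps_const (h c)) = fps_const (\<Sum>c\<in>C. h c :: 'r)" for h and C :: "nat set"
        by (induction C rule: infinite_finite_induct) auto
      then show ?thesis
        using sumE[OF i ab] by (simp add: Es_def E0_def p_def)
    qed
    finally have 1: "(\<Sum>c\<in>{1..N}. L i r a c * L (Suc i) r c b) * Prs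
       = (of_bool (a = b) + R (Suc i) r * E1 + R i r * E0 + R i r * R (Suc i) r * (p * E0)) * Prs"
      by (simp add: distrib_right mult.assoc)
    have gg: "g i r * g (Suc i) r = g (Suc i) r * g i r"
      by (intro g_commute) (rule g_commute[symmetric], rule AA)
    have y1: "y * (A0 * z) = g (Suc i) r * z" for z
      unfolding y_def gg A0_def by (metis g_A mult.assoc mult_1_left)
    have y2: "y * (A1 * z) = g i r * z" for z
      unfolding y_def A1_def by (metis g_A mult.assoc mult_1_left)
    have yX: "y * (?X * z) = ?X * (y * z)" for z
      by (rule mult_left_swap[OF fps_X_central, symmetric])
    have "y * (A0 * A1) = 1"
      using y1[of A1] by (simp add: A1_def g_A)
    moreover have "R i r * R (Suc i) r = ?X * (?X * y)"
      by (simp only: R_def y_def mult.assoc mult_left_swap[OF fps_X_central[of "g i r"], symmetric])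
    ultimately have "y * M = of_bool (a = b) + R (Suc i) r * E1 + R i r * E0 + R i r * R (Suc i) r * (p * E0)"
      unfolding M_def distrib_left yX y1 y2
      by (cases "a = b") (simp_all only: simp_thms y1 R_def mult.assoc of_bool_eq mult_1_left mult_zero_left mult_zero_right)
    then show ?thesis using 1 by simp
  qed
  have yM: "(S i + 1) * (y * M) = y * ((S i + 1) * M)"
    using sy by (simp add: distrib_left distrib_right mult.assoc[symmetric])
  have "(S i + 1) * (\<Sum>c\<in>{1..N}. L i r a c * L (Suc i) r c b) * Prs
    = ((S i + 1) * (y * M)) * Prs"
    by (simp only: mult.assoc[of "S i + 1"] sum)
  also have "\<dots>
    = y * ((of_bool (a = b) * (A0 * A1) + ?X * (A1 * E0) + ?X * (A0 * E1) + ?X * (?X * (E0 * p))) * (S i + 1)) * Prs"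
    by (simp only: yM M)
  also have "\<dots> = y * (of_bool (a = b) * (A0 * A1) + ?X * (A1 * E0) + ?X * (A0 * E1) + ?X * (?X * (E0 * p))) * ((S i + 1) * Prs)"
    by (simp only: mult.assoc)
  finally have ex: "\<exists>Y'. (S i + 1) * (\<Sum>c\<in>{1..N}. L i r a c * L (Suc i) r c b) * Prs = Y' * ((S i + 1) * Prs)"
    by blast
  have "(\<Sum>c\<in>{1..N}. L i r a c * L (Suc i) r c b) * Prs = Prs * (\<Sum>c\<in>{1..N}. L i r a c * L (Suc i) r c b)"
    unfolding sum_distrib_left sum_distrib_right
  proof (intro sum.cong refl)
    fix c assume "c \<in> {1..N}"
    then have h: "L i r a c * Prs = Prs * L i r a c" "L (Suc i) r c b * Prs = Prs * L (Suc i) r c b"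
      using Prs_L ab by auto
    show "L i r a c * L (Suc i) r c b * Prs = Prs * (L i r a c * L (Suc i) r c b)"
      by (simp only: mult.assoc h(2)) (simp only: mult.assoc[symmetric] h(1))
  qed
  then show ?thesis using ex unfolding Pres_def by blast
qed

lemma T_append:
  "a \<in> {1..N} \<Longrightarrow> T r (xs @ ys) a b = (\<Sum>c\<in>{1..N}. T r xs a c * T r ys c b)"
proof (induction xs arbitrary: a)
  case Nil
  have "(\<Sum>c\<in>{1..N}. of_bool (a = c) * T r ys c b) = (\<Sum>c\<in>{1..N}. if a = c then T r ys c b else 0)"
    by (intro sum.cong) auto
  with Nil show ?case by simp
next
  case (Cons x xs)
  have "T r ((x # xs) @ ys) a b = (\<Sum>e\<in>{1..N}. \<Sum>c\<in>{1..N}. L x r a e * (T r xs e c * T r ys c b))"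
    by (simp add: Cons.IH sum_distrib_left)
  also have "\<dots> = (\<Sum>c\<in>{1..N}. \<Sum>e\<in>{1..N}. L x r a e * (T r xs e c * T r ys c b))"
    by (rule sum.swap)
  finally show ?case
    by (simp add: sum_distrib_right mult.assoc)
qed

lemma Pres_T_other:
  assumes i: "Suc i < n" and ab: "b \<in> {1..N}"
  shows "i \<notin> set is \<Longrightarrow> Suc i \<notin> set is \<Longrightarrow> a \<in> {1..N} \<Longrightarrow> Pres i (T r is a b)"
proof (induction "is" arbitrary: a)
  case Nil
  then show ?case by (simp add: of_bool_def Pres_one Pres_zero)
next
  case (Cons j js)
  then show ?case
    by (auto intro!: Pres_sum Pres_mult Pres_L i)
qed

text \<open>The chain is cut around the pair \<open>i\<close>, \<open>Suc i\<close>. Sites outside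
  the pair commute with the exchange, and sums and products preserve the property.\<close>

lemma Pres_T:
  assumes i: "Suc i < n" and ab: "a \<in> {1..N}" "b \<in> {1..N}"
  shows "Pres i (T r [0..<n] a b)"
proof -
  have "[0..<n] = [0..<i] @ [i, Suc i] @ [Suc (Suc i)..<n]"
    using i upt_add_eq_append[of 0 i "n - i"] by (simp add: upt_conv_Cons)
  moreover have "Pres i (T r [i, Suc i] c e)" if "c \<in> {1..N}" "e \<in> {1..N}" for c e
  proof -
    have "(\<Sum>f\<in>{1..N}. L (Suc i) r c' f * of_bool (f = e)) = L (Suc i) r c' e" for c'
      using that by (subst sum.cong[OF refl, of _ _ "\<lambda>f. if f = e then L (Suc i) r c' f else 0"]) auto
    then have "T r [i, Suc i] c e = (\<Sum>c'\<in>{1..N}. L i r c c' * L (Suc i) r c' e)" by simp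
    then show ?thesis using Pres_L_L[OF i that] by simp
  qed
  moreover have "Pres i (T r [0..<i] c e)" "Pres i (T r [Suc (Suc i)..<n] c e)"
    if "c \<in> {1..N}" "e \<in> {1..N}" for c e
    using that i by (auto intro!: Pres_T_other)
  ultimately show ?thesis
    using ab by (auto simp: T_append simp del: T.simps append.simps intro!: Pres_sum Pres_mult)
qed

lemma Pres_rows:
  assumes i: "Suc i < n"
  shows "set bs \<subseteq> {1..N} \<Longrightarrow> (\<forall>j. k < j \<and> j \<le> k + length bs \<longrightarrow> w j \<in> {1..N}) \<Longrightarrow>
    Pres i (rows [0..<n] k bs w)"
proof (induction bs arbitrary: k)
  case Nil
  then show ?case by (simp add: Pres_one)
next
  case (Cons b bs)
  then show ?case
    by (auto intro!: Pres_mult Pres_T i simp del: T.simps)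
qed

theorem Pres_qdet:
  assumes i: "Suc i < n" and m: "m \<le> N"
  shows "Pres i (qdet m [0..<n])"
  unfolding qdet_def Gsum_def
proof (intro Pres_sum Pres_mult Pres_of_int Pres_one Pres_rows i)
  fix w assume w: "w \<in> {w. w permutes {1..m}}"
  show "\<forall>j. 0 < j \<and> j \<le> 0 + length [1..<m + 1] \<longrightarrow> w j \<in> {1..N}"
  proof (intro allI impI)
    fix j assume "0 < j \<and> j \<le> 0 + length [1..<m + 1]"
    then have "j \<in> {1..m}" by (simp del: upt_Suc)
    then have "w j \<in> {1..m}" using w by (simp only: mem_Collect_eq permutes_in_image)
    then show "w j \<in> {1..N}" using m by auto
  qed
qed (use m in auto)

end

section \<open>The space of states\<close>

type_synonym pidx = "(nat \<Rightarrow> int) \<times> (nat \<Rightarrow> nat)"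
text \<open>Finitely supported coefficient functions. Exponents and colours are functions on all
  naturals, so exchanges are compositions; entries from \<open>n\<close> on act as passive labels of
  the Dunkl operators.\<close>

type_synonym pst = "pidx \<Rightarrow>\<^sub>0 complex"

definition smul :: "complex \<Rightarrow> pst \<Rightarrow> pst" where
  "smul c f = Poly_Mapping.map ((*) c) f"

lemma lookup_smul [simp]: "Poly_Mapping.lookup (smul c f) x = c * Poly_Mapping.lookup f x"
  by (simp add: smul_def Poly_Mapping.map.rep_eq when_def)

lemma smul_simps [simp]:
  "smul c 0 = 0" "smul 0 f = 0" "smul 1 f = f" "smul a (smul b f) = smul (a * b) f"
  by (auto intro!: poly_mapping_eqI)

lemma smul_add: "smul c (f + g) = smul c f + smul c g"
  by (auto intro!: poly_mapping_eqI simp: lookup_add algebra_simps)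

lemma smul_minus: "smul c (f - g) = smul c f - smul c g"
  by (auto intro!: poly_mapping_eqI simp: lookup_minus right_diff_distrib)

lemma smul_uminus: "smul c (- f) = - smul c f"
  by (auto intro!: poly_mapping_eqI)

lemma smul_left_add: "smul (a + b) f = smul a f + smul b f"
  by (auto intro!: poly_mapping_eqI simp: lookup_add algebra_simps)

lemma lookup_sum': "Poly_Mapping.lookup (\<Sum>x\<in>A. f x) y = (\<Sum>x\<in>A. Poly_Mapping.lookup (f x) y)"
  by (induction A rule: infinite_finite_induct) (auto simp: lookup_add)

lemma smul_sum: "smul c (\<Sum>x\<in>A. f x) = (\<Sum>x\<in>A. smul c (f x))"
  by (auto intro!: poly_mapping_eqI simp: lookup_sum' sum_distrib_left)

section \<open>The ring of linear operators\<close>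

definition bas :: "pidx \<Rightarrow> pst" where
  "bas x = Poly_Mapping.single x 1"

lemma lookup_bas: "Poly_Mapping.lookup (bas x) y = (if x = y then 1 else 0)"
  by (simp add: bas_def lookup_single when_def)

lemma pst_expand: "f = (\<Sum>x\<in>Poly_Mapping.keys f. smul (Poly_Mapping.lookup f x) (bas x))"
  by (rule poly_mapping_eqI) (auto simp: lookup_sum' lookup_bas if_distrib in_keys_iff cong: if_cong)

text \<open>Linear maps are made a type so that they form an instance of \<open>ring_1\<close>; only
  then do formal power series over them and the abstract locales apply.\<close>

typedef endo = "{f :: pst \<Rightarrow> pst. (\<forall>x y. f (x + y) = f x + f y) \<and> (\<forall>c x. f (smul c x) = smul c (f x))}"
  morphisms app Endo
  by (rule exI[of _ id]) simp

lemma app_add: "app A (f + g) = app A f + app A g"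
  and app_smul: "app A (smul c f) = smul c (app A f)"
  using app[of A] by auto

lemma app_zero [simp]: "app A 0 = 0"
  using app_add[of A 0 0] by simp

lemma app_uminus: "app A (- f) = - app A f"
  using app_add[of A f "- f"] by (simp add: eq_neg_iff_add_eq_0 add.commute)

lemma app_minus: "app A (f - g) = app A f - app A g"
  using app_add[of A f "- g"] by (simp add: app_uminus)

lemma app_sum: "app A (\<Sum>x\<in>S. f x) = (\<Sum>x\<in>S. app A (f x))"
  by (induction S rule: infinite_finite_induct) (auto simp: app_add)

lemma app_Endo:
  "(\<And>x y. f (x + y) = f x + f y) \<Longrightarrow> (\<And>c x. f (smul c x) = smul c (f x)) \<Longrightarrow> app (Endo f) = f"
  by (subst Endo_inverse) auto

lemma endo_eqI: "(\<And>x. app A (bas x) = app B (bas x)) \<Longrightarrow> A = B"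
proof -
  assume *: "\<And>x. app A (bas x) = app B (bas x)"
  have "app A f = app B f" for f
    by (subst (1 2) pst_expand[of f]) (simp add: app_sum app_smul *)
  then show ?thesis by (metis app_inject ext)
qed

instantiation endo :: ring_1
begin
definition "0 = Endo (\<lambda>f. 0)"
definition "1 = Endo (\<lambda>f. f)"
definition "A + B = Endo (\<lambda>f. app A f + app B f)"
definition "A - B = Endo (\<lambda>f. app A f - app B f)"
definition "- A = Endo (\<lambda>f. - app A f)"
definition "A * B = Endo (\<lambda>f. app A (app B f))"

lemma app_ring [simp]:
  "app 0 f = 0" "app 1 f = f" "app (A + B) f = app A f + app B f" "app (A - B) f = app A f - app B f"
  "app (- A) f = - app A f" "app (A * B) f = app A (app B f)"
  unfolding zero_endo_def one_endo_def plus_endo_def minus_endo_def uminus_endo_def times_endo_def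
  by (subst app_Endo; simp add: app_add app_smul smul_add smul_minus smul_uminus)+

instance
proof
  show "(0 :: endo) \<noteq> 1"
  proof
    assume "(0 :: endo) = 1"
    then have "app 0 (bas undefined) = app 1 (bas undefined)" by simp
    then have "Poly_Mapping.lookup (bas undefined) undefined = 0" by simp
    then show False by (simp add: lookup_bas)
  qed
qed (rule endo_eqI, simp add: app_add app_minus app_uminus algebra_simps)+
end

lemma app_sum_left: "app (\<Sum>x\<in>S. A x) f = (\<Sum>x\<in>S. app (A x) f)"
  by (induction S rule: infinite_finite_induct) auto

lemma app_of_nat [simp]: "app (of_nat k) f = smul (of_nat k) f"
  by (induction k) (auto simp: smul_left_add)

lemma app_of_int [simp]: "app (of_int k) f = smul (of_int k) f"
proof (cases k)
  case (nonneg n)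
  then show ?thesis by simp
next
  case (neg n)
  have "smul (- c) f = - smul c f" for c
    by (auto intro!: poly_mapping_eqI)
  with neg show ?thesis by (simp del: of_nat_Suc)
qed

lemma endo_double_zero: "q + q = 0 \<Longrightarrow> q = (0 :: endo)"
proof (rule endo_eqI)
  fix x assume "q + q = 0"
  then have "app (q + q) (bas x) = 0" by simp
  then have "Poly_Mapping.lookup (app q (bas x)) y + Poly_Mapping.lookup (app q (bas x)) y = 0" for y
    by (metis app_ring(3) lookup_add lookup_zero)
  then have "Poly_Mapping.lookup (app q (bas x)) y = 0" for y
    by (simp flip: mult_2)
  then show "app q (bas x) = app 0 (bas x)"
    by (auto intro!: poly_mapping_eqI)
qed

definition mk :: "(pidx \<Rightarrow> pst) \<Rightarrow> endo" where
  "mk \<phi> = Endo (\<lambda>f. \<Sum>x\<in>Poly_Mapping.keys f. smul (Poly_Mapping.lookup f x) (\<phi> x))"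

lemma app_mk: "app (mk \<phi>) f = (\<Sum>x\<in>Poly_Mapping.keys f. smul (Poly_Mapping.lookup f x) (\<phi> x))"
proof -
  have super: "(\<Sum>x\<in>Poly_Mapping.keys f. smul (Poly_Mapping.lookup f x) (\<phi> x))
      = (\<Sum>x\<in>A. smul (Poly_Mapping.lookup f x) (\<phi> x))"
    if "finite A" "Poly_Mapping.keys f \<subseteq> A" for f A
    using that by (intro sum.mono_neutral_left) (auto simp: in_keys_iff)
  have add: "(\<Sum>x\<in>Poly_Mapping.keys (f + g). smul (Poly_Mapping.lookup (f + g) x) (\<phi> x))
      = (\<Sum>x\<in>Poly_Mapping.keys f. smul (Poly_Mapping.lookup f x) (\<phi> x))
      + (\<Sum>x\<in>Poly_Mapping.keys g. smul (Poly_Mapping.lookup g x) (\<phi> x))" for f g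
    using keys_add[of f g]
    by (subst (1 2 3) super[of "Poly_Mapping.keys f \<union> Poly_Mapping.keys g"])
       (auto simp: lookup_add smul_left_add sum.distrib)
  have sc: "(\<Sum>x\<in>Poly_Mapping.keys (smul c f). smul (Poly_Mapping.lookup (smul c f) x) (\<phi> x))
      = smul c (\<Sum>x\<in>Poly_Mapping.keys f. smul (Poly_Mapping.lookup f x) (\<phi> x))" for c f
    by (subst super[of "Poly_Mapping.keys f"]) (auto simp: smul_sum in_keys_iff)
  show ?thesis unfolding mk_def by (subst app_Endo) (rule add sc refl)+
qed

lemma app_mk_bas [simp]: "app (mk \<phi>) (bas x) = \<phi> x"
  by (simp add: app_mk bas_def)

lemma lookup_app_mk:
  "Poly_Mapping.lookup (app (mk \<phi>) f) y = (\<Sum>x\<in>Poly_Mapping.keys f. Poly_Mapping.lookup f x * Poly_Mapping.lookup (\<phi> x) y)"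
  by (simp add: app_mk lookup_sum')

lemma lookup_app_mk_single:
  assumes "\<And>x. Poly_Mapping.lookup (\<phi> x) y = (if x = z then c else 0)"
  shows "Poly_Mapping.lookup (app (mk \<phi>) f) y = c * Poly_Mapping.lookup f z"
  by (simp add: lookup_app_mk assms if_distrib in_keys_iff cong: if_cong)

definition sc :: "complex \<Rightarrow> endo" where
  "sc c = mk (\<lambda>x. smul c (bas x))"

lemma app_sc [simp]: "app (sc c) f = smul c f"
  unfolding sc_def app_mk by (subst (3) pst_expand[of f]) (simp add: smul_sum mult.commute)

lemma sc_commute: "sc c * A = A * sc c"
  by (rule endo_eqI) (simp add: app_smul)

section \<open>Exchanges, matrix units, bras and divided differences\<close>

abbreviation tr :: "nat \<Rightarrow> nat \<Rightarrow> nat \<Rightarrow> nat" where "tr \<equiv> Transposition.transpose"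

definition Kx :: "nat \<Rightarrow> nat \<Rightarrow> endo" where
  "Kx i j = mk (\<lambda>(e, c). bas (e \<circ> tr i j, c))"

definition Px :: "nat \<Rightarrow> nat \<Rightarrow> endo" where
  "Px i j = mk (\<lambda>(e, c). bas (e, c \<circ> tr i j))"

definition Em :: "nat \<Rightarrow> nat \<Rightarrow> nat \<Rightarrow> endo" where
  "Em i x y = mk (\<lambda>(e, c). if c i = y then bas (e, c(i := x)) else 0)"

text \<open>A bra made into an operator on the same space: the component with colours
  \<open>a\<close> is kept and its colours are overwritten by zero, a value outside
  \<open>{1..N}\<close>.\<close>

definition Bx :: "(nat \<Rightarrow> nat) \<Rightarrow> endo" where
  "Bx a = mk (\<lambda>(e, c). if c = a then bas (e, \<lambda>_. 0) else 0)"

definition Prx :: "nat \<Rightarrow> nat \<Rightarrow> endo" where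
  "Prx n N = mk (\<lambda>(e, c). if \<forall>i<n. c i \<in> {1..N} then bas (e, c) else 0)"

definition Dx :: "nat \<Rightarrow> endo" where
  "Dx a = mk (\<lambda>(e, c). smul (of_int (e a)) (bas (e, c)))"

text \<open>The operator \<open>z_a / (z_a - z_b) * (K_ab - 1)\<close> on monomials, as a geometric
  sum. The factor \<open>z_a\<close> in the numerator accounts for the half-open intervals.\<close>

definition tau :: "nat \<Rightarrow> nat \<Rightarrow> endo" where
  "tau a b = mk (\<lambda>(e, c).
     if e a < e b then \<Sum>x\<in>{e a<..e b}. bas (e(a := x, b := e a + e b - x), c)
     else - (\<Sum>x\<in>{e b<..e a}. bas (e(a := x, b := e a + e b - x), c)))"

text \<open>The value zero for \<open>i \<ge> n\<close> makes commutativity and self-adjointness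
  hold for all indices.\<close>

definition dx :: "nat \<Rightarrow> real \<Rightarrow> nat \<Rightarrow> endo" where
  "dx n \<beta> i = (if i < n then sc (of_real (1 / \<beta>)) * Dx i + of_nat (n - Suc i)
      + (\<Sum>j\<in>{i+1..<n}. tau j i) - (\<Sum>j\<in>{0..<i}. tau i j) else 0)"

lemma tr_eq_iff: "tr i j k = a \<longleftrightarrow> k = tr i j a"
  by (metis transpose_involutory)

lemma upd2_comp_tr:
  fixes e :: "nat \<Rightarrow> 'a"
  shows "(e(a := x, b := y)) \<circ> tr i j = (e \<circ> tr i j)(tr i j a := x, tr i j b := y)"
  by (auto simp: fun_eq_iff tr_eq_iff)

text \<open>This is \<open>z_a / (z_a - z_b) + z_b / (z_b - z_a) = 1\<close>, applied to
  \<open>K - 1\<close>. On monomials the two half-open sums differ only in which endpoint they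
  contain.\<close>

lemma tau_mirror:
  assumes "a \<noteq> b"
  shows "tau a b + tau b a = Kx a b - 1"
proof (rule endo_eqI)
  fix x :: pidx
  obtain e c where x: "x = (e, c)" by force
  let ?f = "\<lambda>x. bas (e(a := x, b := e a + e b - x), c)"
  have swap: "e(b := x, a := e b + e a - x) = e(a := e a + e b - x, b := e a + e b - (e a + e b - x))" for x
    using assms by (auto simp: fun_eq_iff)
  have refl1: "(\<Sum>x\<in>{p<..q}. bas (e(b := x, a := e b + e a - x), c)) = (\<Sum>x\<in>{e a + e b - q..<e a + e b - p}. ?f x)" for p q
    unfolding swap
    by (rule sum.reindex_bij_witness[of _ "\<lambda>x. e a + e b - x" "\<lambda>x. e a + e b - x"]) auto
  have K: "app (Kx a b) (bas x) = ?f (e b)"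
    using assms by (auto simp: Kx_def x fun_eq_iff Transposition.transpose_def intro!: arg_cong[of _ _ bas])
  have one: "bas x = ?f (e a)"
    using assms by (auto simp: x intro!: arg_cong[of _ _ bas])
  have split: "sum ?f {p<..q} - sum ?f {p..<q} = ?f q - ?f p" if "p \<le> q" for p q
  proof (cases "p = q")
    case False
    with that have "p < q" by simp
    then have "{p<..q} = insert q {p<..<q}" "{p..<q} = insert p {p<..<q}" by auto
    then show ?thesis by simp
  qed simp
  show "app (tau a b + tau b a) (bas x) = app (Kx a b - 1) (bas x)"
    unfolding app_ring K one[symmetric]
  proof (cases "e a" "e b" rule: linorder_cases)
    case less
    then show "app (tau a b) (bas x) + app (tau b a) (bas x) = ?f (e b) - bas x"
      using split[of "e a" "e b"] by (simp add: tau_def x refl1)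
  next
    case equal
    then show "app (tau a b) (bas x) + app (tau b a) (bas x) = ?f (e b) - bas x"
      by (auto simp: tau_def x fun_eq_iff intro!: arg_cong[of _ _ bas])
  next
    case greater
    then show "app (tau a b) (bas x) + app (tau b a) (bas x) = ?f (e b) - bas x"
      using arg_cong[OF split[of "e b" "e a"], of uminus] by (simp add: tau_def x refl1)
  qed
qed

lemma Kx_tau:
  assumes "a \<noteq> b"
  shows "Kx i j * tau a b = tau (tr i j a) (tr i j b) * Kx i j"
  by (rule endo_eqI) (auto simp: Kx_def tau_def app_sum app_uminus upd2_comp_tr)

lemma Kx_Dx: "Kx i j * Dx a = Dx (tr i j a) * Kx i j"
  by (rule endo_eqI) (auto simp: Kx_def Dx_def app_smul)

lemma tau_Dx: "j \<noteq> a \<Longrightarrow> j \<noteq> b \<Longrightarrow> tau a b * Dx j = Dx j * tau a b"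
  by (rule endo_eqI) (auto simp: tau_def Dx_def app_smul app_sum app_uminus smul_sum smul_uminus)

lemma tau_Dx_sum:
  assumes "a \<noteq> b"
  shows "tau a b * (Dx a + Dx b) = (Dx a + Dx b) * tau a b"
proof -
  define D where "D = Dx a + Dx b"
  have D: "app D (bas (e, c)) = smul (of_int (e a + e b)) (bas (e, c))" for e c
    by (simp add: D_def Dx_def smul_left_add)
  have "tau a b * D = D * tau a b"
    using assms by (intro endo_eqI)
      (auto simp: tau_def D app_smul app_sum app_uminus smul_sum smul_uminus simp del: of_int_add)
  then show ?thesis by (simp add: D_def)
qed

lemma Dx_Dx: "Dx a * Dx b = Dx b * Dx a"
  by (rule endo_eqI) (auto simp: Dx_def app_smul mult.commute)

text \<open>Any operator that touches only colours and sends a basis vector to a basis vector or to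
  zero; this covers matrix units, colour exchanges, bras and the projector at once.\<close>

lemma colour_op_commute:
  assumes A: "\<And>e c. app A (bas (e, c)) = (case h c of None \<Rightarrow> 0 | Some c' \<Rightarrow> bas (e, c'))"
  shows "A * Dx a = Dx a * A" "A * tau a b = tau a b * A" "A * Kx a b = Kx a b * A"
  by (rule endo_eqI, auto simp: A Dx_def Kx_def tau_def app_smul app_sum app_uminus split: option.split)+

lemma colour_op_dx:
  assumes A: "\<And>e c. app A (bas (e, c)) = (case h c of None \<Rightarrow> 0 | Some c' \<Rightarrow> bas (e, c'))"
  shows "A * dx n \<beta> i = dx n \<beta> i * A"
proof -
  note c = colour_op_commute[of A h, OF A]
  have "A * (sc z * Dx i) = sc z * Dx i * A" for z
    by (metis c(1) mult.assoc sc_commute)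
  then show ?thesis
    by (simp add: dx_def distrib_left distrib_right left_diff_distrib right_diff_distrib sum_distrib_left
        sum_distrib_right c mult_of_nat_commute[symmetric])
qed

lemma Em_colour: "app (Em i x y) (bas (e, c)) = (case if c i = y then Some (c(i := x)) else None of None \<Rightarrow> 0 | Some c' \<Rightarrow> bas (e, c'))"
  and Px_colour: "app (Px i j) (bas (e, c)) = (case Some (c \<circ> tr i j) of None \<Rightarrow> 0 | Some c' \<Rightarrow> bas (e, c'))"
  and Bx_colour: "app (Bx a) (bas (e, c)) = (case if c = a then Some (\<lambda>_. 0) else None of None \<Rightarrow> 0 | Some c' \<Rightarrow> bas (e, c'))"
  and Prx_colour: "app (Prx n N) (bas (e, c)) = (case if \<forall>i<n. c i \<in> {1..N} then Some c else None of None \<Rightarrow> 0 | Some c' \<Rightarrow> bas (e, c'))"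
  by (auto simp: Em_def Px_def Bx_def Prx_def)

lemma Kx_Kx [simp]: "Kx i j * Kx i j = 1"
  by (rule endo_eqI) (auto simp: Kx_def comp_assoc)

lemma dx_eq:
  "i < n \<Longrightarrow> dx n \<beta> i = sc (of_real (1 / \<beta>)) * Dx i + of_nat (n - Suc i)
      + (\<Sum>j\<in>{i+1..<n}. tau j i) - (\<Sum>j\<in>{0..<i}. tau i j)"
  by (simp add: dx_def)

text \<open>Conjugation turns \<open>d_i\<close> into \<open>d_(i+1)\<close> except for the pair
  itself: \<open>tau (Suc i) i\<close> becomes \<open>tau i (Suc i)\<close>, while
  \<open>d_(i+1)\<close> contains \<open>- tau (Suc i) i\<close>. With the constant dropping by one,
  \<open>tau_mirror\<close> leaves exactly the exchange.\<close>

lemma Kx_dx_Kx: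
  assumes "Suc i < n"
  shows "Kx i (Suc i) * dx n \<beta> i * Kx i (Suc i) = dx n \<beta> (Suc i) + Kx i (Suc i)"
proof -
  let ?K = "Kx i (Suc i)"
  have tau: "?K * tau a b * ?K = tau (tr i (Suc i) a) (tr i (Suc i) b)" if "a \<noteq> b" for a b
    using that by (simp add: Kx_tau mult.assoc)
  have D: "?K * (sc z * Dx i) * ?K = sc z * Dx (Suc i)" for z
  proof -
    have "?K * (sc z * Dx i) * ?K = sc z * (?K * Dx i * ?K)" by (metis sc_commute mult.assoc)
    then show ?thesis by (simp add: Kx_Dx mult.assoc)
  qed
  have nat: "?K * of_nat k * ?K = of_nat k" for k
    by (metis Kx_Kx mult.assoc mult.right_neutral mult_of_nat_commute)
  have s1: "{i+1..<n} = insert (Suc i) {Suc i + 1..<n}" and s2: "{0..<Suc i} = insert i {0..<i}"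
    using assms by auto
  have sum1: "?K * (\<Sum>j\<in>{i+1..<n}. tau j i) * ?K = tau i (Suc i) + (\<Sum>j\<in>{Suc i + 1..<n}. tau j (Suc i))"
    unfolding sum_distrib_left sum_distrib_right s1
    by (subst sum.insert) (auto simp: tau intro!: arg_cong2[of _ _ _ _ "(+)"] sum.cong)
  have sum2: "?K * (\<Sum>j\<in>{0..<i}. tau i j) * ?K = (\<Sum>j\<in>{0..<i}. tau (Suc i) j)"
    unfolding sum_distrib_left sum_distrib_right by (auto simp: tau intro!: sum.cong)
  have n: "(of_nat (n - Suc i) :: endo) = of_nat (n - Suc (Suc i)) + 1"
  proof -
    have "n - Suc i = Suc (n - Suc (Suc i))" using assms by simp
    then show ?thesis by (simp only: of_nat_Suc add.commute)
  qed
  have "?K * dx n \<beta> i * ?K = sc (of_real (1 / \<beta>)) * Dx (Suc i) + of_nat (n - Suc i)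
      + (tau i (Suc i) + (\<Sum>j\<in>{Suc i + 1..<n}. tau j (Suc i))) - (\<Sum>j\<in>{0..<i}. tau (Suc i) j)"
    using assms by (simp only: dx_eq[of i] Suc_lessD distrib_left distrib_right left_diff_distrib right_diff_distrib D nat sum1 sum2)
  also have "\<dots> = dx n \<beta> (Suc i) + (1 + (tau i (Suc i) + tau (Suc i) i))"
    using assms by (simp add: dx_eq[of "Suc i"] s2 n algebra_simps)
  also have "\<dots> = dx n \<beta> (Suc i) + ?K"
    by (simp add: tau_mirror)
  finally show ?thesis .
qed

lemma Kx_dx:
  assumes "Suc i < n"
  shows "Kx i (Suc i) * dx n \<beta> i = dx n \<beta> (Suc i) * Kx i (Suc i) + 1"
proof -
  have "Kx i (Suc i) * dx n \<beta> i = (Kx i (Suc i) * dx n \<beta> i * Kx i (Suc i)) * Kx i (Suc i)"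
    by (simp add: mult.assoc)
  then show ?thesis unfolding Kx_dx_Kx[OF assms] by (simp add: distrib_right)
qed

lemma Kx_dx':
  assumes "Suc i < n"
  shows "Kx i (Suc i) * dx n \<beta> (Suc i) = dx n \<beta> i * Kx i (Suc i) - 1"
proof -
  have "dx n \<beta> i * Kx i (Suc i) = Kx i (Suc i) * (Kx i (Suc i) * dx n \<beta> i * Kx i (Suc i))"
    by (simp add: mult.assoc[symmetric])
  then show ?thesis unfolding Kx_dx_Kx[OF assms] by (simp add: distrib_left)
qed

lemma Kx_dx_other:
  assumes "Suc i < n" "j \<noteq> i" "j \<noteq> Suc i"
  shows "Kx i (Suc i) * dx n \<beta> j = dx n \<beta> j * Kx i (Suc i)"
proof (cases "j < n")
  case True
  let ?K = "Kx i (Suc i)" and ?t = "tr i (Suc i)"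
  have tj: "?t j = j" using assms by (auto simp: Transposition.transpose_def)
  have D: "?K * (sc z * Dx j) = sc z * Dx j * ?K" for z
    by (metis Kx_Dx tj mult.assoc sc_commute)
  have 1: "?K * (\<Sum>k\<in>{j+1..<n}. tau k j) = (\<Sum>k\<in>{j+1..<n}. tau k j) * ?K"
    unfolding sum_distrib_left sum_distrib_right
    by (rule sum.reindex_bij_witness[of _ ?t ?t]) (use assms tj in \<open>auto simp: Kx_tau Transposition.transpose_def\<close>)
  have 2: "?K * (\<Sum>k\<in>{0..<j}. tau j k) = (\<Sum>k\<in>{0..<j}. tau j k) * ?K"
    unfolding sum_distrib_left sum_distrib_right
    by (rule sum.reindex_bij_witness[of _ ?t ?t]) (use assms tj in \<open>auto simp: Kx_tau Transposition.transpose_def\<close>)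
  show ?thesis
    using True by (simp only: dx_eq distrib_left distrib_right left_diff_distrib right_diff_distrib D 1 2 mult_of_nat_commute)
qed (simp add: dx_def)

lemma Em_Em: "i \<noteq> j \<Longrightarrow> Em i x y * Em j z w = Em j z w * Em i x y"
  by (rule endo_eqI) (auto simp: Em_def fun_upd_twist)

lemma Em_Em_same: "Em i x y * Em i z w = (if y = z then Em i x w else 0)"
  by (rule endo_eqI) (auto simp: Em_def)

lemma Bx_Em: "Bx a * Em i x y = (if a i = x then Bx (a(i := y)) else 0)"
proof (rule endo_eqI)
  fix p :: pidx
  obtain e c where "p = (e, c)" by force
  moreover have "c(i := x) = a \<and> c i = y \<longleftrightarrow> c = a(i := y) \<and> a i = x"
    by auto
  ultimately show "app (Bx a * Em i x y) (bas p) = app (if a i = x then Bx (a(i := y)) else 0) (bas p)"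
    by (auto simp: Bx_def Em_def)
qed

lemma Px_Px: "Px i j * Px i j = 1"
  by (rule endo_eqI) (auto simp: Px_def comp_assoc)

lemma Px_Em: "Px i j * Em k x y = Em (tr i j k) x y * Px i j"
proof (rule endo_eqI)
  fix p :: pidx
  obtain e c where "p = (e, c)" by force
  moreover have "(c(k := x)) \<circ> tr i j = (c \<circ> tr i j)(tr i j k := x)"
    by (auto simp: fun_eq_iff tr_eq_iff)
  ultimately show "app (Px i j * Em k x y) (bas p) = app (Em (tr i j k) x y * Px i j) (bas p)"
    by (simp add: Px_def Em_def)
qed

lemma Prx_Em:
  assumes "x \<in> {1..N}" "y \<in> {1..N}"
  shows "Prx n N * Em i x y = Em i x y * Prx n N"
proof (rule endo_eqI)
  fix p :: pidx
  obtain e c where "p = (e, c)" by force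
  moreover have "(\<forall>k<n. (c(i := x)) k \<in> {1..N}) \<longleftrightarrow> (\<forall>k<n. c k \<in> {1..N})" if "c i = y"
    using assms that by (metis fun_upd_apply)
  ultimately show "app (Prx n N * Em i x y) (bas p) = app (Em i x y * Prx n N) (bas p)"
    by (auto simp: Prx_def Em_def simp del: fun_upd_apply atLeastAtMost_iff)
qed

text \<open>On a basis vector only the summand \<open>c\<close> equal to the colour at
  \<open>Suc i\<close> survives; the projector guarantees that this colour is among the summation
  indices.\<close>

lemma Em_sum:
  assumes "Suc i < n"
  shows "(\<Sum>c\<in>{1..N}. Em i c x * Em (Suc i) y c) * Prx n N = Px i (Suc i) * Em i y x * Prx n N"
proof (rule endo_eqI)
  fix p :: pidx
  obtain e c where p: "p = (e, c)" by force
  show "app ((\<Sum>c\<in>{1..N}. Em i c x * Em (Suc i) y c) * Prx n N) (bas p)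
      = app (Px i (Suc i) * Em i y x * Prx n N) (bas p)"
  proof (cases "\<forall>k<n. c k \<in> {1..N}")
    case True
    then have ci: "c (Suc i) \<in> {1..N}" using assms by blast
    have "app (\<Sum>b\<in>{1..N}. Em i b x * Em (Suc i) y b) (bas (e, c))
        = (\<Sum>b\<in>{1..N}. if b = c (Suc i) then (if c i = x then bas (e, c(Suc i := y, i := b)) else 0) else 0)"
      unfolding app_sum_left by (intro sum.cong refl) (auto simp: Em_def)
    also have "\<dots> = (if c i = x then bas (e, c(Suc i := y, i := c (Suc i))) else 0)"
      using ci by simp
    also have "\<dots> = app (Px i (Suc i) * Em i y x) (bas (e, c))"
      by (auto simp: Px_def Em_def fun_eq_iff Transposition.transpose_def intro!: arg_cong[of _ _ bas])
    finally show ?thesis using True by (simp add: p Prx_def)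
  next
    case False
    then have "app (Prx n N) (bas p) = 0" by (auto simp: p Prx_def)
    then show ?thesis by simp
  qed
qed

section \<open>Evaluation at points of the torus\<close>

abbreviation lk :: "pst \<Rightarrow> pidx \<Rightarrow> complex" where "lk \<equiv> Poly_Mapping.lookup"
abbreviation ks :: "pst \<Rightarrow> pidx set" where "ks \<equiv> Poly_Mapping.keys"

definition ev :: "nat \<Rightarrow> (pidx \<Rightarrow> bool) \<Rightarrow> pst \<Rightarrow> (nat \<Rightarrow> complex) \<Rightarrow> complex" where
  "ev n S F w = (\<Sum>x\<in>ks F. if S x then lk F x * mon n (fst x) w else 0)"

text \<open>A selection that ignores the first \<open>n\<close> exponents, hence is not disturbed by
  operators moving them; the evaluation can then be taken separately for each set of passive
  labels.\<close>

definition inert :: "nat \<Rightarrow> (pidx \<Rightarrow> bool) \<Rightarrow> bool" where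
  "inert n S \<longleftrightarrow> (\<forall>e e' c. (\<forall>i\<ge>n. e i = e' i) \<longrightarrow> S (e, c) = S (e', c))"

lemma ev_superset:
  "finite A \<Longrightarrow> ks F \<subseteq> A \<Longrightarrow> ev n S F w = (\<Sum>x\<in>A. if S x then lk F x * mon n (fst x) w else 0)"
  unfolding ev_def by (intro sum.mono_neutral_left) (auto simp: in_keys_iff)

lemma ev_add: "ev n S (F + G) w = ev n S F w + ev n S G w"
  using keys_add[of F G]
  by (subst (1 2 3) ev_superset[of "ks F \<union> ks G"])
     (auto simp: lookup_add distrib_right sum.distrib[symmetric] intro!: sum.cong)

lemma ev_smul: "ev n S (smul c F) w = c * ev n S F w"
  by (subst (1 2) ev_superset[of "ks F"]) (auto simp: in_keys_iff sum_distrib_left intro!: sum.cong)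

lemma ev_zero [simp]: "ev n S 0 w = 0"
  by (simp add: ev_def)

lemma ev_uminus: "ev n S (- F) w = - ev n S F w"
  using ev_add[of n S F "- F" w] by (simp add: add_eq_0_iff)

lemma ev_minus: "ev n S (F - G) w = ev n S F w - ev n S G w"
  using ev_add[of n S F "- G" w] by (simp add: ev_uminus)

lemma ev_sum: "ev n S (\<Sum>x\<in>A. f x) w = (\<Sum>x\<in>A. ev n S (f x) w)"
  by (induction A rule: infinite_finite_induct) (auto simp: ev_add)

lemma ev_bas: "ev n S (bas x) w = (if S x then mon n (fst x) w else 0)"
  by (simp add: ev_def bas_def)

lemma ev_app: "ev n S (app A F) w = (\<Sum>x\<in>ks F. lk F x * ev n S (app A (bas x)) w)"
  by (subst pst_expand[of F]) (simp add: app_sum app_smul ev_sum ev_smul)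

lemma ev_expand: "ev n S F w = (\<Sum>x\<in>ks F. lk F x * ev n S (bas x) w)"
  using ev_app[of n S 1 F w] by simp

lemma ev_lau: "\<exists>H'. lau0 n (ev n S F) H'"
proof -
  have "\<exists>H'. lau0 n (\<lambda>w. \<Sum>x\<in>A. if S x then lk F x * mon n (fst x) w else 0) H'" if "finite A" for A
    using that
  proof (induction A rule: finite_induct)
    case empty
    then show ?case using lau0_const[of n 0] by auto
  next
    case (insert x A)
    then obtain H' where H': "lau0 n (\<lambda>w. \<Sum>x\<in>A. if S x then lk F x * mon n (fst x) w else 0) H'" by blast
    have "\<exists>H. lau0 n (\<lambda>w. if S x then lk F x * mon n (fst x) w else 0) H"
      using lau0_times[OF lau0_const[of n "lk F x"] lau0_mon[of n "fst x"]] lau0_const[of n 0] by (cases "S x") auto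
    then show ?case using insert lau0_plus[OF _ H'] by auto
  qed
  then show ?thesis by (simp add: ev_def[abs_def])
qed

lemma mon_upd2:
  assumes "a < n" "b < n" "a \<noteq> b"
  shows "mon n (e(a := x, b := y)) w = w a powi x * w b powi y * (\<Prod>k\<in>{..<n} - {a} - {b}. w k powi e k)"
  unfolding mon_def using assms
  by (subst prod.remove[of _ a], simp, simp, subst prod.remove[of _ b]) (auto intro!: prod.cong simp: mult.assoc)

text \<open>The geometric sum telescopes after multiplication by \<open>w a - w b\<close>, because
  lowering the exponent \<open>x\<close> by one multiplies the monomial by
  \<open>w b / w a\<close>.\<close>

lemma ev_tau_bas:
  assumes S: "inert n S" and ab: "a < n" "b < n" "a \<noteq> b" and w: "w a \<noteq> 0" "w b \<noteq> 0" "w a \<noteq> w b"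
  shows "ev n S (app (tau a b) (bas x)) w
       = w a / (w a - w b) * (ev n S (bas x) (w \<circ> tsp a b) - ev n S (bas x) w)"
proof -
  obtain e c where x: "x = (e, c)" by force
  define h where "h x = mon n (e(a := x, b := e a + e b - x)) w" for x
  define R where "R = (\<Prod>k\<in>{..<n} - {a} - {b}. w k powi e k)"
  have h: "h x = w a powi x * w b powi (e a + e b - x) * R" for x
    unfolding h_def R_def by (rule mon_upd2[OF ab])
  have h1: "(w a - w b) * h x = w a * (h x - h (x - 1))" for x
  proof -
    have 1: "w a powi x = w a * w a powi (x - 1)"
      using power_int_add[of "w a" 1 "x - 1"] w(1) by simp
    have 2: "w b powi (e a + e b - (x - 1)) = w b * w b powi (e a + e b - x)"
      using power_int_add[of "w b" 1 "e a + e b - x"] w(2) by (simp add: algebra_simps)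
    show ?thesis unfolding h 2 1 by (simp add: algebra_simps)
  qed
  have tele: "(\<Sum>x\<in>{p<..q}. h x) = w a / (w a - w b) * (h q - h p)" if "p \<le> q" for p q
  proof -
    have "(w a - w b) * (\<Sum>x\<in>{p<..p + int k}. h x) = w a * (h (p + int k) - h p)" for k
    proof (induction k)
      case (Suc k)
      have "{p<..p + int (Suc k)} = insert (p + int (Suc k)) {p<..p + int k}" by auto
      then have "(w a - w b) * (\<Sum>x\<in>{p<..p + int (Suc k)}. h x)
          = (w a - w b) * h (p + int (Suc k)) + (w a - w b) * (\<Sum>x\<in>{p<..p + int k}. h x)"
        by (simp add: distrib_left)
      also have "\<dots> = w a * (h (p + int (Suc k)) - h (p + int k)) + w a * (h (p + int k) - h p)"
        unfolding Suc.IH h1 by simp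
      finally show ?case by (simp add: algebra_simps)
    qed simp
    from this[of "nat (q - p)"] have "(w a - w b) * (\<Sum>x\<in>{p<..q}. h x) = w a * (h q - h p)"
      using that by simp
    then show ?thesis using w(3) by (simp add: field_simps)
  qed
  have inv: "S (e(a := y, b := z), c) = S (e, c)" for y z
    using S ab unfolding inert_def by (metis fun_upd_apply leD)
  have sum: "ev n S (\<Sum>x\<in>{p<..q}. bas (e(a := x, b := e a + e b - x), c)) w = (if S (e, c) then \<Sum>x\<in>{p<..q}. h x else 0)" for p q
    by (auto simp: ev_sum ev_bas inv h_def)
  have ha: "h (e a) = mon n e w" by (simp add: h_def)
  have hb: "h (e b) = mon n e (w \<circ> tsp a b)"
  proof -
    have "e(a := e b, b := e a) = e \<circ> tsp a b"
      by (auto simp: fun_eq_iff Transposition.transpose_def)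
    then show ?thesis using ab by (simp add: h_def mon_swap)
  qed
  show ?thesis
  proof (cases "S (e, c)")
    case False
    then show ?thesis by (simp add: x tau_def sum ev_uminus ev_bas)
  next
    case True
    show ?thesis
    proof (cases "e a < e b")
      case lt: True
      then show ?thesis using True tele[of "e a" "e b"] by (simp add: x tau_def sum ev_bas ha hb)
    next
      case False
      then have "app (tau a b) (bas x) = - (\<Sum>x\<in>{e b<..e a}. bas (e(a := x, b := e a + e b - x), c))"
        by (simp add: x tau_def)
      then have "ev n S (app (tau a b) (bas x)) w = - (w a / (w a - w b) * (h (e a) - h (e b)))"
        using False True tele[of "e b" "e a"] by (simp add: ev_uminus sum)
      then show ?thesis using True by (simp add: x ev_bas ha hb right_diff_distrib)
    qed
  qed
qed

lemma ev_tau: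
  assumes "inert n S" "a < n" "b < n" "a \<noteq> b" "w a \<noteq> 0" "w b \<noteq> 0" "w a \<noteq> w b"
  shows "ev n S (app (tau a b) F) w = w a / (w a - w b) * (ev n S F (w \<circ> tsp a b) - ev n S F w)"
  unfolding ev_app[of n S "tau a b" F] ev_tau_bas[OF assms] ev_expand[of n S F]
  by (simp add: sum_distrib_left right_diff_distrib sum_subtractf algebra_simps)

text \<open>Exactly the part of an index that \<open>mon n\<close> does not see.\<close>

definition lab :: "nat \<Rightarrow> pidx \<Rightarrow> pidx" where
  "lab n x = ((\<lambda>i. if i < n then 0 else fst x i), snd x)"

lemma lab_pair: "lab n (e, c) = ((\<lambda>i. if i < n then 0 else e i), c)"
  by (simp add: lab_def cong: if_cong)

lemma inert_lab: "inert n (\<lambda>x. lab n x = l)"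
  unfolding inert_def
proof (intro allI impI)
  fix e e' :: "nat \<Rightarrow> int" and c assume "\<forall>i\<ge>n. e i = e' i"
  then have "lab n (e, c) = lab n (e', c)" by (auto simp: lab_def fun_eq_iff)
  then show "(lab n (e, c) = l) = (lab n (e', c) = l)" by simp
qed

text \<open>Fourier inversion: the selection of one label isolates the passive data, and the
  integral against the inverse monomial picks the exponents.\<close>

lemma lookup_eq_J:
  "lk F (e, c) = J n (\<lambda>w. ev n (\<lambda>x. lab n x = lab n (e, c)) F w * mon n (\<lambda>i. - e i) w)"
proof -
  let ?S = "\<lambda>x. lab n x = lab n (e, c)"
  let ?T = "\<lambda>x w. (if ?S x then lk F x else 0) * mon n (\<lambda>i. fst x i - e i) w"
  have ap: "appr n (?T x)" and JT: "J n (?T x) = (if x = (e, c) then lk F x else 0)" for x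
  proof -
    have a: "appr n (mon n (\<lambda>i. fst x i - e i))" by (rule lau_appr[OF lau_mon])
    show "appr n (?T x)" by (rule J_cmult(1)[OF a])
    have "J n (?T x) = (if ?S x then lk F x else 0) * J n (mon n (\<lambda>i. fst x i - e i))"
      by (rule J_cmult(2)[OF a])
    also have "J n (mon n (\<lambda>i. fst x i - e i)) = (if \<forall>i<n. fst x i - e i = 0 then 1 else 0)"
      by (rule lau_J[OF lau_mon])
    also have "(if ?S x then lk F x else 0) * (if \<forall>i<n. fst x i - e i = 0 then 1 else 0) = (if x = (e, c) then lk F x else 0)"
    proof -
      have "?S x \<and> (\<forall>i<n. fst x i - e i = 0) \<longleftrightarrow> x = (e, c)"
      proof (cases x)
        case (Pair e' c')
        have h: "e' = e" if "(\<lambda>i. if i < n then 0 else e' i) = (\<lambda>i. if i < n then 0 else e i)" "\<forall>i<n. e' i - e i = 0"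
        proof
          fix i show "e' i = e i" using fun_cong[OF that(1), of i] that(2) by (cases "i < n") auto
        qed
        show ?thesis
        proof
          assume L: "?S x \<and> (\<forall>i<n. fst x i - e i = 0)"
          then have "e' = e" by (intro h) (simp_all add: lab_pair Pair)
          moreover have "c' = c" using L by (simp add: lab_pair Pair)
          ultimately show "x = (e, c)" by (simp add: Pair)
        qed simp
      qed
      then show ?thesis by auto
    qed
    finally show "J n (?T x) = (if x = (e, c) then lk F x else 0)" .
  qed
  have sum: "appr n (\<lambda>w. \<Sum>x\<in>ks F. ?T x w)" "J n (\<lambda>w. \<Sum>x\<in>ks F. ?T x w) = (\<Sum>x\<in>ks F. J n (?T x))"
    using J_sum[of "ks F" n ?T] ap by auto
  have eq: "(\<Sum>x\<in>ks F. ?T x w) = ev n ?S F w * mon n (\<lambda>i. - e i) w" if "w \<in> Tor n" for w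
    unfolding ev_def sum_distrib_right
    by (intro sum.cong refl) (use mon_add[OF that, of _ "\<lambda>i. - e i"] in auto)
  have "J n (\<lambda>w. \<Sum>x\<in>ks F. ?T x w) = J n (\<lambda>w. ev n ?S F w * mon n (\<lambda>i. - e i) w)"
    by (rule conjunct1[OF J_cong[OF sum(1)]]) (rule eq)
  then show ?thesis unfolding sum(2) JT by (simp add: in_keys_iff split: if_splits)
qed

definition Zx :: "nat \<Rightarrow> endo" where
  "Zx a = mk (\<lambda>(e, c). bas (e(a := e a + 1), c))"

lemma lookup_Zx: "lk (app (Zx a) F) (e, c) = lk F (e(a := e a - 1), c)"
  unfolding Zx_def
  by (subst lookup_app_mk_single[where z = "(e(a := e a - 1), c)" and c = 1])
     (auto simp: lookup_bas fun_eq_iff split: prod.split)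

lemma ev_Zx:
  assumes S: "inert n S" and a: "a < n" and w: "w a \<noteq> 0"
  shows "ev n S (app (Zx a) F) w = w a * ev n S F w"
proof -
  have "ev n S (app (Zx a) (bas x)) w = w a * ev n S (bas x) w" for x
  proof -
    obtain e c where x: "x = (e, c)" by force
    have "S (e(a := e a + 1), c) = S (e, c)"
      using S a unfolding inert_def by (metis fun_upd_apply leD)
    moreover have "mon n (e(a := e a + 1)) w = w a * mon n e w"
      unfolding mon_def using a w
      by (subst (1 2) prod.remove[of _ a]) (auto simp: power_int_add mult_ac intro!: prod.cong)
    ultimately show ?thesis by (simp add: x Zx_def ev_bas)
  qed
  then show ?thesis
    unfolding ev_app[of n S "Zx a" F] ev_expand[of n S F] by (simp add: sum_distrib_left mult_ac)
qed

text \<open>If \<open>z_a * F = z_b * F\<close>, then the coefficients of \<open>F\<close> are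
  constant along a line in the direction raising \<open>e a\<close> and lowering \<open>e b\<close>,
  which a nonzero element of finite support cannot satisfy.\<close>

lemma Zx_diff_inj:
  assumes ab: "a \<noteq> b" and eq: "app (Zx a - Zx b) F = 0"
  shows "F = 0"
proof (rule poly_mapping_eqI, rule ccontr)
  fix x :: pidx assume x: "lk F x \<noteq> lk 0 x"
  obtain e c where ec: "x = (e, c)" by force
  have step: "lk F (e(a := e a - 1), c) = lk F (e(b := e b - 1), c)" for e
  proof -
    have "lk (app (Zx a - Zx b) F) (e, c) = 0" using eq by simp
    then show ?thesis by (simp add: lookup_minus lookup_Zx)
  qed
  have shift: "lk F (e(a := e a + int k, b := e b - int k), c) = lk F (e, c)" for k
  proof (induction k)
    case (Suc k)
    define e1 where "e1 = e(a := e a + int (Suc k), b := e b - int k)"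
    have eqs: "e1(a := e1 a - 1) = e(a := e a + int k, b := e b - int k)"
      "e1(b := e1 b - 1) = e(a := e a + int (Suc k), b := e b - int (Suc k))"
      using ab by (auto simp: fun_eq_iff e1_def)
    have "lk F (e(a := e a + int k, b := e b - int k), c) = lk F (e(a := e a + int (Suc k), b := e b - int (Suc k)), c)"
      using step[of e1] unfolding eqs .
    from trans[OF this[symmetric] Suc] show ?case .
  qed simp
  have "(\<lambda>k. (e(a := e a + int k, b := e b - int k), c)) ` UNIV \<subseteq> ks F"
    using x shift by (auto simp: in_keys_iff ec)
  moreover have "inj (\<lambda>k. (e(a := e a + int k, b := e b - int k), c))"
  proof (rule injI)
    fix k l assume "(e(a := e a + int k, b := e b - int k), c) = (e(a := e a + int l, b := e b - int l), c)"
    then have "(e(a := e a + int k, b := e b - int k)) b = (e(a := e a + int l, b := e b - int l)) b" by simp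
    then show "k = l" by simp
  qed
  ultimately show False
    using finite_keys finite_subset range_inj_infinite by blast
qed

definition Dst :: "nat \<Rightarrow> (nat \<Rightarrow> complex) set" where
  "Dst n = {w \<in> Tor n. \<forall>i<n. \<forall>j<n. i \<noteq> j \<longrightarrow> w i \<noteq> w j}"

text \<open>Values are known only at points with distinct coordinates. Multiplying by the product of
  all \<open>z_a - z_b\<close> forces vanishing on the whole torus, so all Fourier coefficients of
  the product vanish; the multiplication is injective.\<close>

lemma ev_faithful:
  assumes F: "\<And>w l. w \<in> Dst n \<Longrightarrow> ev n (\<lambda>x. lab n x = l) F w = 0"
  shows "F = 0"
proof -
  have fin: "finite {(a, b). a < n \<and> b < n \<and> a \<noteq> (b::nat)}"
    using finite_Pairs[of n] by (simp add: Pairs_def)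
  then obtain ps where ps: "set ps = {(a, b). a < n \<and> b < n \<and> a \<noteq> (b::nat)}"
    using finite_list by blast
  define V where "V = foldr (\<lambda>(a, b) A. (Zx a - Zx b) * A) ps"
  have evV: "ev n (\<lambda>x. lab n x = l) (app (foldr (\<lambda>(a, b) A. (Zx a - Zx b) * A) qs 1) F) w
      = (\<Prod>(a, b)\<leftarrow>qs. w a - w b) * ev n (\<lambda>x. lab n x = l) F w"
    if "w \<in> Tor n" "set qs \<subseteq> set ps" for w l qs
    using that(2)
  proof (induction qs)
    case (Cons q qs)
    obtain a b where q: "q = (a, b)" by force
    with Cons have "a < n" "b < n" using ps by auto
    then show ?case
      using Cons q Tor_nonzero[OF that(1)] by (simp add: ev_minus ev_Zx inert_lab left_diff_distrib)
  qed simp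
  have injV: "app (foldr (\<lambda>(a, b) A. (Zx a - Zx b) * A) qs 1) F = 0 \<Longrightarrow> F = 0"
    if "set qs \<subseteq> set ps" for qs
    using that
  proof (induction qs)
    case (Cons q qs)
    obtain a b where q: "q = (a, b)" by force
    with Cons have "a \<noteq> b" using ps by auto
    then show ?case using Cons Zx_diff_inj[of a b] by (simp add: q del: app_ring(4))
  qed simp
  define G where "G = app (foldr (\<lambda>(a, b) A. (Zx a - Zx b) * A) ps 1) F"
  have evG: "ev n (\<lambda>x. lab n x = l) G w = 0" if w: "w \<in> Tor n" for w l
  proof (cases "w \<in> Dst n")
    case True
    then show ?thesis using evV[OF w subset_refl] F by (simp add: G_def)
  next
    case False
    then obtain i j where ij: "i < n" "j < n" "i \<noteq> j" "w i = w j" using w by (auto simp: Dst_def)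
    then have "(i, j) \<in> set ps" using ps by auto
    then have "0 \<in> set (map (\<lambda>(a, b). w a - w b) ps)"
      using ij(4) by (force simp: image_iff)
    then have "(\<Prod>(a, b)\<leftarrow>ps. w a - w b) = 0" by (simp add: prod_list_zero_iff)
    then show ?thesis using evV[OF w subset_refl] by (simp add: G_def)
  qed
  have "G = 0"
  proof (rule poly_mapping_eqI)
    fix x :: pidx
    obtain e c where x: "x = (e, c)" by force
    have "J n (\<lambda>w. 0) = J n (\<lambda>w. ev n (\<lambda>x. lab n x = lab n (e, c)) G w * mon n (\<lambda>i. - e i) w)"
      by (rule conjunct1[OF J_cong[OF lau_appr[OF lau.zero]]]) (simp add: evG)
    then show "lk G x = lk 0 x"
      using lau_J[OF lau.zero, of n] unfolding x lookup_eq_J[of G e c n] by simp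
  qed
  then show ?thesis unfolding G_def by (rule injV[OF subset_refl])
qed

text \<open>Identities between divided differences thereby reduce to identities of rational
  functions at points where all denominators are nonzero.\<close>

lemma endo_eq_by_ev:
  assumes "\<And>F w l. w \<in> Dst n \<Longrightarrow> ev n (\<lambda>x. lab n x = l) (app A F) w = ev n (\<lambda>x. lab n x = l) (app B F) w"
  shows "A = B"
proof (rule endo_eqI)
  fix x
  have "app A (bas x) - app B (bas x) = 0"
  proof (rule ev_faithful[of n])
    fix w l assume "w \<in> Dst n"
    from assms[OF this, where F = "bas x" and l = l]
    show "ev n (\<lambda>x. lab n x = l) (app A (bas x) - app B (bas x)) w = 0"
      by (simp only: ev_minus right_minus_eq)
  qed
  then show "app A (bas x) = app B (bas x)" by simp
qed

lemma Dst_swap: "w \<in> Dst n \<Longrightarrow> a < n \<Longrightarrow> b < n \<Longrightarrow> w \<circ> tsp a b \<in> Dst n"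
  unfolding Dst_def using Tor_swap[of a n b w] tsp_less[of a n b] tsp_iff(3)[of a b] by auto

lemma ev_tau_Dst:
  assumes "w \<in> Dst n" "a < n" "b < n" "a \<noteq> b"
  shows "ev n (\<lambda>x. lab n x = l) (app (tau a b) F) w
    = w a / (w a - w b) * (ev n (\<lambda>x. lab n x = l) F (w \<circ> tsp a b) - ev n (\<lambda>x. lab n x = l) F w)"
  using assms Tor_nonzero[of w n] by (intro ev_tau inert_lab) (auto simp: Dst_def)

lemma tau_disjoint:
  assumes "a < n" "b < n" "c < n" "d < n" "distinct [a, b, c, d]"
  shows "tau a b * tau c d = tau c d * tau a b"
proof (rule endo_eq_by_ev[of n])
  fix F w l assume w: "w \<in> Dst n"
  have comm: "w \<circ> tsp a b \<circ> tsp c d = w \<circ> tsp c d \<circ> tsp a b"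
    using assms(5) by (auto simp: fun_eq_iff Transposition.transpose_def)
  have vals: "(w \<circ> tsp a b) c = w c" "(w \<circ> tsp a b) d = w d" "(w \<circ> tsp c d) a = w a" "(w \<circ> tsp c d) b = w b"
    using assms(5) by (auto simp: Transposition.transpose_def)
  have ne: "a \<noteq> b" "c \<noteq> d" using assms(5) by auto
  show "ev n (\<lambda>x. lab n x = l) (app (tau a b * tau c d) F) w = ev n (\<lambda>x. lab n x = l) (app (tau c d * tau a b) F) w"
    using w assms(1-4) ne
    by (simp only: simp_thms app_ring ev_tau_Dst Dst_swap vals comm) (simp add: algebra_simps)
qed

text \<open>The contribution of a third variable \<open>c\<close> to the commutator of the operators
  belonging to \<open>a\<close> and \<open>b\<close>. At a point it is a combination of the values
  of \<open>F\<close> at the six permutations of three coordinates, and each coefficient vanishes as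
  a rational function.\<close>

lemma tau_three_body:
  assumes "a < n" "b < n" "c < n" "a \<noteq> b" "a \<noteq> c" "b \<noteq> c"
  shows "tau b a * tau c b - tau c b * tau b a + (tau b a * tau c a - tau c a * tau b a)
     + (tau c a * tau c b - tau c b * tau c a) = 0"
proof (rule endo_eq_by_ev[of n])
  fix F w l assume w: "w \<in> Dst n"
  define U where "U p q r = w(a := p, b := q, c := r)" for p q r
  define x y z where "x = w a" and "y = w b" and "z = w c"
  have wU: "w = U x y z" by (simp add: U_def x_def y_def z_def)
  have ne: "x \<noteq> y" "x \<noteq> z" "y \<noteq> z" using w assms by (auto simp: Dst_def x_def y_def z_def)
  have t: "U p q r \<circ> tsp b a = U q p r" "U p q r \<circ> tsp c a = U r q p" "U p q r \<circ> tsp c b = U p r q" for p q r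
    using assms by (auto simp: U_def fun_eq_iff Transposition.transpose_def)
  have v: "U p q r a = p" "U p q r b = q" "U p q r c = r" for p q r
    using assms by (auto simp: U_def)
  have mem: "U x y z \<in> Dst n" "U y x z \<in> Dst n" "U z y x \<in> Dst n" "U x z y \<in> Dst n" "U y z x \<in> Dst n" "U z x y \<in> Dst n"
    using w Dst_swap[OF _ assms(2,1)] Dst_swap[OF _ assms(3,1)] Dst_swap[OF _ assms(3,2)] unfolding wU
    by (metis t)+
  define f where "f p q r = ev n (\<lambda>x. lab n x = l) F (U p q r)" for p q r
  have e1: "ev n (\<lambda>x. lab n x = l) (app (tau b a) G) (U p q r) = q / (q - p) * (ev n (\<lambda>x. lab n x = l) G (U q p r) - ev n (\<lambda>x. lab n x = l) G (U p q r))"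
   and e2: "ev n (\<lambda>x. lab n x = l) (app (tau c a) G) (U p q r) = r / (r - p) * (ev n (\<lambda>x. lab n x = l) G (U r q p) - ev n (\<lambda>x. lab n x = l) G (U p q r))"
   and e3: "ev n (\<lambda>x. lab n x = l) (app (tau c b) G) (U p q r) = r / (r - q) * (ev n (\<lambda>x. lab n x = l) G (U p r q) - ev n (\<lambda>x. lab n x = l) G (U p q r))"
    if "U p q r \<in> Dst n" for p q r G
    using ev_tau_Dst[OF that, of b a l G] ev_tau_Dst[OF that, of c a l G] ev_tau_Dst[OF that, of c b l G] assms
    by (simp_all add: t v)
  \<comment> \<open>Reciprocal differences replace the divisions, so that the remaining identity is
    polynomial modulo the three relations \<open>pqr\<close>.\<close>
  define p q r where "p = 1 / (y - x)" and "q = 1 / (z - x)" and "r = 1 / (z - y)"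
  have pqr: "p * (y - x) = 1" "q * (z - x) = 1" "r * (z - y) = 1"
    using ne by (simp_all add: p_def q_def r_def)
  have div: "u / (y - x) = u * p" "u / (x - y) = - (u * p)" "u / (z - x) = u * q" "u / (x - z) = - (u * q)"
     "u / (z - y) = u * r" "u / (y - z) = - (u * r)" for u
    using ne by (simp_all add: p_def q_def r_def divide_simps) (simp_all add: algebra_simps)?
  show "ev n (\<lambda>x. lab n x = l) (app (tau b a * tau c b - tau c b * tau b a + (tau b a * tau c a - tau c a * tau b a)
     + (tau c a * tau c b - tau c b * tau c a)) F) w = ev n (\<lambda>x. lab n x = l) (app 0 F) w"
    unfolding wU
    apply (simp only: app_ring ev_add ev_minus e1 e2 e3 mem f_def[symmetric] ev_zero div)
    using pqr by algebra
qed

section \<open>Commutativity and self-adjointness of the Dunkl operators\<close>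

lemma commutator_ring:
  fixes u v t T0 T1 :: "'b::ring_1"
  assumes "u * v = v * u" "u * T1 = T1 * u" "T0 * v = v * T0" "t * (u + v) = (u + v) * t"
    and "t * T1 - T1 * t + (t * T0 - T0 * t) + (T0 * T1 - T1 * T0) = 0"
  shows "(u + (t + T0)) * (v + (T1 - t)) = (v + (T1 - t)) * (u + (t + T0))"
proof -
  have "(u + (t + T0)) * (v + (T1 - t)) - (v + (T1 - t)) * (u + (t + T0))
     = (u * v - v * u) + (u * T1 - T1 * u) + (T0 * v - v * T0) + (t * (u + v) - (u + v) * t)
     + (t * T1 - T1 * t + (t * T0 - T0 * t) + (T0 * T1 - T1 * T0))"
    by (simp add: algebra_simps)
  then show ?thesis using assms by simp
qed

lemma add_of_nat_commute:
  fixes x y :: "'b::ring_1"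
  assumes "x * y = y * x"
  shows "(x + of_nat a) * (y + of_nat b) = (y + of_nat b) * (x + of_nat a)"
  using assms mult_of_nat_commute[of a y] mult_of_nat_commute[of b x] mult_of_nat_commute[of a "of_nat b :: 'b"]
  by (simp add: distrib_left distrib_right add_ac)

text \<open>The single commutator computed by hand; all others follow by conjugation with adjacent
  exchanges.\<close>

lemma dx_0_1:
  assumes n: "1 < n"
  shows "dx n \<beta> 0 * dx n \<beta> 1 = dx n \<beta> 1 * dx n \<beta> 0"
proof -
  define b where "b = sc (of_real (1 / \<beta>))"
  define M where "M = {2..<n}"
  define u v t T0 T1 where "u = b * Dx 0" and "v = b * Dx 1" and "t = tau 1 0"
    and "T0 = (\<Sum>j\<in>M. tau j 0)" and "T1 = (\<Sum>j\<in>M. tau j 1)"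
  have bc: "b * x = x * b" for x by (simp add: b_def sc_commute)
  have bD: "x * y = y * x \<Longrightarrow> b * x * y = y * (b * x)" for x y
    using bc by (metis mult.assoc)
  have set1: "{0 + 1..<n} = insert 1 M" "{1 + 1..<n} = M" "{0..<1::nat} = {0}" "1 \<notin> M" "finite M"
    using n by (auto simp: M_def)
  have d0: "dx n \<beta> 0 = (u + (t + T0)) + of_nat (n - Suc 0)"
    using n set1 by (simp add: dx_eq u_def t_def T0_def b_def add_ac)
  have d1: "dx n \<beta> 1 = (v + (T1 - t)) + of_nat (n - Suc 1)"
    using n set1 by (simp add: dx_eq v_def t_def T1_def b_def add_ac)
  have 1: "u * v = v * u"
    unfolding u_def v_def by (rule bD[THEN trans]) (metis Dx_Dx bc mult.assoc, simp add: mult.assoc)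
  have 2: "u * T1 = T1 * u"
    unfolding u_def T1_def by (rule bD) (auto simp: sum_distrib_left sum_distrib_right M_def tau_Dx intro!: sum.cong)
  have 3: "T0 * v = v * T0"
    unfolding v_def T0_def by (rule bD[symmetric]) (auto simp: sum_distrib_left sum_distrib_right M_def tau_Dx intro!: sum.cong)
  have 4: "t * (u + v) = (u + v) * t"
  proof -
    have "u + v = b * (Dx 1 + Dx 0)" by (simp add: u_def v_def distrib_left add.commute)
    moreover have "b * (Dx 1 + Dx 0) * t = t * (b * (Dx 1 + Dx 0))"
      unfolding t_def by (rule bD) (simp add: tau_Dx_sum)
    ultimately show ?thesis by simp
  qed
  \<comment> \<open>Divided differences on disjoint pairs commute, so only equal third variables
    survive in the double sum, one for each three-body relation.\<close>
  have T01: "T0 * T1 - T1 * T0 = (\<Sum>j\<in>M. tau j 0 * tau j 1 - tau j 1 * tau j 0)"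
  proof -
    have "T0 * T1 - T1 * T0 = (\<Sum>j\<in>M. \<Sum>k\<in>M. tau j 0 * tau k 1) - (\<Sum>k\<in>M. \<Sum>j\<in>M. tau k 1 * tau j 0)"
      by (simp add: T0_def T1_def sum_product)
    also have "(\<Sum>k\<in>M. \<Sum>j\<in>M. tau k 1 * tau j 0) = (\<Sum>j\<in>M. \<Sum>k\<in>M. tau k 1 * tau j 0)"
      by (rule sum.swap)
    also have "(\<Sum>j\<in>M. \<Sum>k\<in>M. tau j 0 * tau k 1) - (\<Sum>j\<in>M. \<Sum>k\<in>M. tau k 1 * tau j 0)
       = (\<Sum>j\<in>M. \<Sum>k\<in>M. if k = j then tau j 0 * tau j 1 - tau j 1 * tau j 0 else 0)"
      unfolding sum_subtractf[symmetric]
    proof (intro sum.cong refl)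
      fix j k assume "j \<in> M" "k \<in> M"
      then show "tau j 0 * tau k 1 - tau k 1 * tau j 0 = (if k = j then tau j 0 * tau j 1 - tau j 1 * tau j 0 else 0)"
        using tau_disjoint[of j n 0 k 1] n by (auto simp: M_def)
    qed
    finally show ?thesis using set1 by simp
  qed
  have 5: "t * T1 - T1 * t + (t * T0 - T0 * t) + (T0 * T1 - T1 * T0) = 0"
  proof -
    have "t * T1 - T1 * t + (t * T0 - T0 * t) + (T0 * T1 - T1 * T0)
      = (\<Sum>j\<in>M. t * tau j 1 - tau j 1 * t + (t * tau j 0 - tau j 0 * t) + (tau j 0 * tau j 1 - tau j 1 * tau j 0))"
      unfolding T01 unfolding T0_def T1_def
      by (simp add: sum_distrib_left sum_distrib_right sum.distrib sum_subtractf)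
    also have "\<dots> = 0"
      unfolding t_def using n by (intro sum.neutral ballI tau_three_body[of 0 n 1]) (auto simp: M_def)
    finally show ?thesis .
  qed
  show ?thesis
    unfolding d0 d1 by (rule add_of_nat_commute) (rule commutator_ring[OF 1 2 3 4 5])
qed

lemma dx_Suc: "Suc i < n \<Longrightarrow> dx n \<beta> (Suc i) = Kx i (Suc i) * dx n \<beta> i * Kx i (Suc i) - Kx i (Suc i)"
  by (simp add: Kx_dx_Kx)

text \<open>By \<open>dx_Suc\<close> each operator is obtained from its predecessor by an exchange
  not involving position 0, and such an exchange commutes with
  \<open>dx n \<beta> 0\<close>.\<close>

lemma dx_0_commute: "0 < j \<Longrightarrow> j < n \<Longrightarrow> dx n \<beta> 0 * dx n \<beta> j = dx n \<beta> j * dx n \<beta> 0"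
proof (induction j)
  case (Suc j)
  show ?case
  proof (cases "j = 0")
    case True
    then show ?thesis using dx_0_1[of n \<beta>] Suc.prems by simp
  next
    case False
    let ?K = "Kx j (Suc j)"
    have K: "?K * dx n \<beta> 0 = dx n \<beta> 0 * ?K"
      using Suc.prems False by (intro Kx_dx_other) auto
    have IH: "dx n \<beta> 0 * dx n \<beta> j = dx n \<beta> j * dx n \<beta> 0" using Suc False by simp
    have "dx n \<beta> 0 * (?K * dx n \<beta> j * ?K) = ?K * dx n \<beta> j * ?K * dx n \<beta> 0"
      by (metis K IH mult.assoc)
    then show ?thesis
      unfolding dx_Suc[OF Suc.prems(2)] using K by (simp add: right_diff_distrib left_diff_distrib)
  qed
qed simp

lemma dx_less_commute: "i < j \<Longrightarrow> j < n \<Longrightarrow> dx n \<beta> i * dx n \<beta> j = dx n \<beta> j * dx n \<beta> i"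
proof (induction i)
  case 0
  then show ?case by (simp add: dx_0_commute)
next
  case (Suc i)
  let ?K = "Kx i (Suc i)"
  have K: "?K * dx n \<beta> j = dx n \<beta> j * ?K"
    using Suc.prems by (intro Kx_dx_other) auto
  have IH: "dx n \<beta> i * dx n \<beta> j = dx n \<beta> j * dx n \<beta> i" using Suc by simp
  have "(?K * dx n \<beta> i * ?K) * dx n \<beta> j = dx n \<beta> j * (?K * dx n \<beta> i * ?K)"
    by (metis K IH mult.assoc)
  moreover have "Suc i < n" using Suc.prems by simp
  ultimately show ?case
    using K by (simp add: dx_Suc right_diff_distrib left_diff_distrib)
qed

theorem dx_commute: "dx n \<beta> i * dx n \<beta> j = dx n \<beta> j * dx n \<beta> i"
proof (cases "i < n \<and> j < n")
  case True
  then show ?thesis using dx_less_commute[of i j n \<beta>] dx_less_commute[of j i n \<beta>] by (cases i j rule: linorder_cases) auto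
qed (auto simp: dx_def)

lemma dunkl_dx: "dunkl (dx n \<beta>) Em (\<lambda>i. Kx i (Suc i)) (\<lambda>i. Px i (Suc i)) Bx (Prx n N) n N"
proof
  show "dx n \<beta> i * dx n \<beta> j = dx n \<beta> j * dx n \<beta> i" for i j by (rule dx_commute)
  show "dx n \<beta> i * Em j x y = Em j x y * dx n \<beta> i" for i j x y
    by (rule colour_op_dx[OF Em_colour, symmetric])
  show "i \<noteq> j \<Longrightarrow> Em i x y * Em j z w = Em j z w * Em i x y" for i j x y z w by (rule Em_Em)
  show "Em i x y * Em i z w = (if y = z then Em i x w else 0)" for i x y z w by (rule Em_Em_same)
  show "q + q = 0 \<Longrightarrow> q = 0" for q :: endo by (rule endo_double_zero)
  show "Bx a * Em i x y = (if a i = x then Bx (a(i := y)) else 0)" for a i x y by (rule Bx_Em)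
  show "Bx a * dx n \<beta> i = dx n \<beta> i * Bx a" for a i by (rule colour_op_dx[OF Bx_colour])
  show "Prx n N * dx n \<beta> i = dx n \<beta> i * Prx n N" for i by (rule colour_op_dx[OF Prx_colour])
  show "x \<in> {1..N} \<Longrightarrow> y \<in> {1..N} \<Longrightarrow> Prx n N * Em i x y = Em i x y * Prx n N" for i x y by (rule Prx_Em)
  fix i assume i: "Suc i < n"
  show "Kx i (Suc i) * dx n \<beta> i = dx n \<beta> (Suc i) * Kx i (Suc i) + 1" by (rule Kx_dx[OF i])
  show "Kx i (Suc i) * dx n \<beta> (Suc i) = dx n \<beta> i * Kx i (Suc i) - 1" by (rule Kx_dx'[OF i])
  show "j \<noteq> i \<Longrightarrow> j \<noteq> Suc i \<Longrightarrow> Kx i (Suc i) * dx n \<beta> j = dx n \<beta> j * Kx i (Suc i)" for j by (rule Kx_dx_other[OF i])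
  show "Kx i (Suc i) * Kx i (Suc i) = 1" by (rule Kx_Kx)
  show "Px i (Suc i) * Px i (Suc i) = 1" by (rule Px_Px)
  show "Kx i (Suc i) * Px i (Suc i) = Px i (Suc i) * Kx i (Suc i)" by (rule colour_op_commute(3)[OF Px_colour, symmetric])
  show "Px i (Suc i) * dx n \<beta> j = dx n \<beta> j * Px i (Suc i)" for j by (rule colour_op_dx[OF Px_colour])
  show "Kx i (Suc i) * Em j x y = Em j x y * Kx i (Suc i)" for j x y by (rule colour_op_commute(3)[OF Em_colour, symmetric])
  show "Px i (Suc i) * Em i x y = Em (Suc i) x y * Px i (Suc i)" for x y by (simp add: Px_Em)
  show "Px i (Suc i) * Em (Suc i) x y = Em i x y * Px i (Suc i)" for x y by (simp add: Px_Em)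
  show "j \<noteq> i \<Longrightarrow> j \<noteq> Suc i \<Longrightarrow> Px i (Suc i) * Em j x y = Em j x y * Px i (Suc i)" for j x y by (simp add: Px_Em)
  show "x \<in> {1..N} \<Longrightarrow> y \<in> {1..N} \<Longrightarrow>
      (\<Sum>c\<in>{1..N}. Em i c x * Em (Suc i) y c) * Prx n N = Px i (Suc i) * Em i y x * Prx n N" for x y by (rule Em_sum[OF i])
qed

section \<open>The sesquilinear form and adjoints\<close>

definition gm :: "nat \<Rightarrow> real \<Rightarrow> pidx \<Rightarrow> pidx \<Rightarrow> complex" where
  "gm n \<beta> x y = (if snd x = snd y then J n (\<lambda>w. Dl n \<beta> w * mon n (\<lambda>i. fst y i - fst x i) w) else 0)"

definition form :: "nat \<Rightarrow> real \<Rightarrow> pst \<Rightarrow> pst \<Rightarrow> complex" where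
  "form n \<beta> F G = (\<Sum>x\<in>ks F. \<Sum>y\<in>ks G. cnj (lk F x) * lk G y * gm n \<beta> x y)"

lemma form_superset:
  assumes "finite A" "ks F \<subseteq> A" "finite B" "ks G \<subseteq> B"
  shows "form n \<beta> F G = (\<Sum>x\<in>A. \<Sum>y\<in>B. cnj (lk F x) * lk G y * gm n \<beta> x y)"
proof -
  have "form n \<beta> F G = (\<Sum>x\<in>ks F. \<Sum>y\<in>B. cnj (lk F x) * lk G y * gm n \<beta> x y)"
    unfolding form_def by (intro sum.cong refl sum.mono_neutral_left) (use assms in \<open>auto simp: in_keys_iff\<close>)
  also have "\<dots> = (\<Sum>x\<in>A. \<Sum>y\<in>B. cnj (lk F x) * lk G y * gm n \<beta> x y)"
    by (intro sum.mono_neutral_left) (use assms in \<open>auto simp: in_keys_iff\<close>)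
  finally show ?thesis .
qed

lemma form_add_left: "form n \<beta> (F + F') G = form n \<beta> F G + form n \<beta> F' G"
proof -
  let ?A = "ks F \<union> ks F'"
  have "form n \<beta> (F + F') G = (\<Sum>x\<in>?A. \<Sum>y\<in>ks G. cnj (lk (F + F') x) * lk G y * gm n \<beta> x y)"
    "form n \<beta> F G = (\<Sum>x\<in>?A. \<Sum>y\<in>ks G. cnj (lk F x) * lk G y * gm n \<beta> x y)"
    "form n \<beta> F' G = (\<Sum>x\<in>?A. \<Sum>y\<in>ks G. cnj (lk F' x) * lk G y * gm n \<beta> x y)"
    using keys_add[of F F'] by (auto intro!: form_superset)
  then show ?thesis by (simp add: lookup_add distrib_right sum.distrib)
qed

lemma form_add_right: "form n \<beta> F (G + G') = form n \<beta> F G + form n \<beta> F G'"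
proof -
  let ?A = "ks G \<union> ks G'"
  have "form n \<beta> F (G + G') = (\<Sum>x\<in>ks F. \<Sum>y\<in>?A. cnj (lk F x) * lk (G + G') y * gm n \<beta> x y)"
    "form n \<beta> F G = (\<Sum>x\<in>ks F. \<Sum>y\<in>?A. cnj (lk F x) * lk G y * gm n \<beta> x y)"
    "form n \<beta> F G' = (\<Sum>x\<in>ks F. \<Sum>y\<in>?A. cnj (lk F x) * lk G' y * gm n \<beta> x y)"
    using keys_add[of G G'] by (auto intro!: form_superset)
  then show ?thesis by (simp add: lookup_add distrib_right distrib_left sum.distrib)
qed

lemma form_smul_left: "form n \<beta> (smul c F) G = cnj c * form n \<beta> F G"
proof -
  have "form n \<beta> (smul c F) G = (\<Sum>x\<in>ks F. \<Sum>y\<in>ks G. cnj (lk (smul c F) x) * lk G y * gm n \<beta> x y)"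
    by (intro form_superset) (auto simp: in_keys_iff)
  then show ?thesis by (simp add: form_def sum_distrib_left mult.assoc)
qed

lemma form_smul_right: "form n \<beta> F (smul c G) = c * form n \<beta> F G"
proof -
  have "form n \<beta> F (smul c G) = (\<Sum>x\<in>ks F. \<Sum>y\<in>ks G. cnj (lk F x) * lk (smul c G) y * gm n \<beta> x y)"
    by (intro form_superset) (auto simp: in_keys_iff)
  then show ?thesis by (simp add: form_def sum_distrib_left mult_ac)
qed

lemma form_zero [simp]: "form n \<beta> 0 G = 0" "form n \<beta> F 0 = 0"
  by (simp_all add: form_def)

lemma form_sum_left: "form n \<beta> (\<Sum>x\<in>A. f x) G = (\<Sum>x\<in>A. form n \<beta> (f x) G)"
  by (induction A rule: infinite_finite_induct) (auto simp: form_add_left)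

lemma form_sum_right: "form n \<beta> F (\<Sum>x\<in>A. f x) = (\<Sum>x\<in>A. form n \<beta> F (f x))"
  by (induction A rule: infinite_finite_induct) (auto simp: form_add_right)

lemma form_uminus_left: "form n \<beta> (- F) G = - form n \<beta> F G"
  using form_add_left[of n \<beta> F "- F" G] by (simp add: add_eq_0_iff)

lemma form_uminus_right: "form n \<beta> F (- G) = - form n \<beta> F G"
  using form_add_right[of n \<beta> F G "- G"] by (simp add: add_eq_0_iff)

lemma form_minus_left: "form n \<beta> (F - F') G = form n \<beta> F G - form n \<beta> F' G"
  using form_add_left[of n \<beta> F "- F'" G] by (simp add: form_uminus_left)

lemma form_minus_right: "form n \<beta> F (G - G') = form n \<beta> F G - form n \<beta> F G'"
  using form_add_right[of n \<beta> F G "- G'"] by (simp add: form_uminus_right)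

lemma form_bas: "form n \<beta> (bas x) (bas y) = gm n \<beta> x y"
  by (simp add: form_def bas_def)

definition adj :: "nat \<Rightarrow> real \<Rightarrow> endo \<Rightarrow> endo \<Rightarrow> bool" where
  "adj n \<beta> A A' \<longleftrightarrow> (\<forall>F G. form n \<beta> (app A F) G = form n \<beta> F (app A' G))"

lemma adj_basis:
  assumes "\<And>x y. form n \<beta> (app A (bas x)) (bas y) = form n \<beta> (bas x) (app A' (bas y))"
  shows "adj n \<beta> A A'"
  unfolding adj_def
proof (intro allI)
  fix F G
  have L: "form n \<beta> (app T F) H = (\<Sum>x\<in>ks F. cnj (lk F x) * form n \<beta> (app T (bas x)) H)" for T H
    by (subst pst_expand[of F]) (simp add: app_sum app_smul form_sum_left form_smul_left)
  have R: "form n \<beta> H (app T G) = (\<Sum>y\<in>ks G. lk G y * form n \<beta> H (app T (bas y)))" for T H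
    by (subst pst_expand[of G]) (simp add: app_sum app_smul form_sum_right form_smul_right)
  have "form n \<beta> (app A F) (app 1 G) = form n \<beta> (app 1 F) (app A' G)"
    unfolding L[of A] L[of 1] R[of _ A'] R[of _ 1] by (simp add: assms)
  then show "form n \<beta> (app A F) G = form n \<beta> F (app A' G)" by simp
qed

lemma adj_add: "adj n \<beta> A A' \<Longrightarrow> adj n \<beta> B B' \<Longrightarrow> adj n \<beta> (A + B) (A' + B')"
  by (simp add: adj_def form_add_left form_add_right)

lemma adj_zero: "adj n \<beta> 0 0"
  by (simp add: adj_def)

lemma adj_one: "adj n \<beta> 1 1"
  by (simp add: adj_def)

lemma adj_uminus: "adj n \<beta> A A' \<Longrightarrow> adj n \<beta> (- A) (- A')"
  by (simp add: adj_def form_uminus_left form_uminus_right)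

lemma adj_sum: "(\<And>x. x \<in> X \<Longrightarrow> adj n \<beta> (A x) (A' x)) \<Longrightarrow> adj n \<beta> (\<Sum>x\<in>X. A x) (\<Sum>x\<in>X. A' x)"
  by (induction X rule: infinite_finite_induct) (auto simp: adj_zero intro: adj_add)

lemma adj_mult: "adj n \<beta> A A' \<Longrightarrow> adj n \<beta> B B' \<Longrightarrow> adj n \<beta> (A * B) (B' * A')"
  by (simp add: adj_def)

lemma adj_power: "adj n \<beta> A A \<Longrightarrow> adj n \<beta> (A ^ k) (A ^ k)"
proof (induction k)
  case (Suc k)
  then show ?case using adj_mult[of n \<beta> A A "A ^ k" "A ^ k"] by (simp add: power_commutes)
qed (simp add: adj_one)

lemma cnj_mon:
  assumes "w \<in> Tor n"
  shows "cnj (mon n v w) = mon n (\<lambda>i. - v i) w"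
proof -
  have "mon n v w * mon n (\<lambda>i. - v i) w = 1"
    using mon_add[OF assms, of v "\<lambda>i. - v i"] by (simp add: mon_def)
  moreover have "mon n v w * cnj (mon n v w) = 1"
    using complex_norm_square[of "mon n v w"] norm_mon[OF assms, of v] by simp
  ultimately show ?thesis
    by (metis mult_cancel_left mult_zero_left zero_neq_one)
qed

lemma Dl_mon_appr: "\<beta> > 0 \<Longrightarrow> 0 < n \<Longrightarrow> appr n (\<lambda>w. Dl n \<beta> w * mon n v w)"
  using appr_mult_lau[OF weight_identity(2) lau_mon] by blast

lemma form_bas_left_J:
  assumes \<beta>: "\<beta> > 0" "0 < n" and G: "\<forall>y\<in>ks G. snd y = c"
  shows "form n \<beta> (bas (e, c)) G = J n (\<lambda>w. Dl n \<beta> w * (mon n (\<lambda>i. - e i) w * ev n (\<lambda>_. True) G w))"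
proof -
  let ?T = "\<lambda>y w. lk G y * (Dl n \<beta> w * mon n (\<lambda>i. fst y i - e i) w)"
  have ap: "appr n (?T y)" for y by (rule J_cmult(1)[OF Dl_mon_appr[OF \<beta>]])
  have S: "appr n (\<lambda>w. \<Sum>y\<in>ks G. ?T y w)" "J n (\<lambda>w. \<Sum>y\<in>ks G. ?T y w) = (\<Sum>y\<in>ks G. J n (?T y))"
    using J_sum[of "ks G" n ?T] ap by auto
  have eq: "(\<Sum>y\<in>ks G. ?T y w) = Dl n \<beta> w * (mon n (\<lambda>i. - e i) w * ev n (\<lambda>_. True) G w)" if "w \<in> Tor n" for w
    unfolding ev_def sum_distrib_left
    by (intro sum.cong refl) (use mon_add[OF that, of _ "\<lambda>i. - e i"] in \<open>auto simp: mult_ac\<close>)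
  have "form n \<beta> (bas (e, c)) G = (\<Sum>y\<in>ks G. lk G y * gm n \<beta> (e, c) y)"
    by (simp add: form_def bas_def)
  also have "\<dots> = (\<Sum>y\<in>ks G. J n (?T y))"
    using G by (intro sum.cong refl) (auto simp: gm_def J_cmult(2)[OF Dl_mon_appr[OF \<beta>]])
  also have "\<dots> = J n (\<lambda>w. Dl n \<beta> w * (mon n (\<lambda>i. - e i) w * ev n (\<lambda>_. True) G w))"
    unfolding S(2)[symmetric] by (rule conjunct1[OF J_cong[OF S(1)]]) (rule eq)
  finally show ?thesis .
qed

lemma form_bas_right_J:
  assumes \<beta>: "\<beta> > 0" "0 < n" and F: "\<forall>x\<in>ks F. snd x = c"
  shows "form n \<beta> F (bas (e, c)) = J n (\<lambda>w. Dl n \<beta> w * (cnj (ev n (\<lambda>_. True) F w) * mon n e w))"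
    and "appr n (\<lambda>w. Dl n \<beta> w * (cnj (ev n (\<lambda>_. True) F w) * mon n e w))"
proof -
  let ?T = "\<lambda>x w. cnj (lk F x) * (Dl n \<beta> w * mon n (\<lambda>i. e i - fst x i) w)"
  have ap: "appr n (?T y)" for y by (rule J_cmult(1)[OF Dl_mon_appr[OF \<beta>]])
  have S: "appr n (\<lambda>w. \<Sum>y\<in>ks F. ?T y w)" "J n (\<lambda>w. \<Sum>y\<in>ks F. ?T y w) = (\<Sum>y\<in>ks F. J n (?T y))"
    using J_sum[of "ks F" n ?T] ap by auto
  have eq: "(\<Sum>x\<in>ks F. ?T x w) = Dl n \<beta> w * (cnj (ev n (\<lambda>_. True) F w) * mon n e w)" if w: "w \<in> Tor n" for w
    unfolding ev_def sum_distrib_left sum_distrib_right cnj_sum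
    by (intro sum.cong refl) (use mon_add[OF w, of "\<lambda>i. - fst _ i" e] cnj_mon[OF w] in \<open>auto simp: mult_ac\<close>)
  have "form n \<beta> F (bas (e, c)) = (\<Sum>x\<in>ks F. cnj (lk F x) * gm n \<beta> x (e, c))"
    by (simp add: form_def bas_def)
  also have "\<dots> = (\<Sum>y\<in>ks F. J n (?T y))"
    using F by (intro sum.cong refl) (auto simp: gm_def J_cmult(2)[OF Dl_mon_appr[OF \<beta>]])
  also have "\<dots> = J n (\<lambda>w. Dl n \<beta> w * (cnj (ev n (\<lambda>_. True) F w) * mon n e w))"
    unfolding S(2)[symmetric] by (rule conjunct1[OF J_cong[OF S(1)]]) (rule eq)
  finally show "form n \<beta> F (bas (e, c)) = J n (\<lambda>w. Dl n \<beta> w * (cnj (ev n (\<lambda>_. True) F w) * mon n e w))" .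
  show "appr n (\<lambda>w. Dl n \<beta> w * (cnj (ev n (\<lambda>_. True) F w) * mon n e w))"
    by (rule conjunct2[OF J_cong[OF S(1)]]) (rule eq)
qed

lemma form_colours: "\<forall>x\<in>ks F. snd x = c \<Longrightarrow> \<forall>y\<in>ks G. snd y = c' \<Longrightarrow> c \<noteq> c' \<Longrightarrow> form n \<beta> F G = 0"
  by (auto simp: form_def gm_def intro!: sum.neutral)

lemma keys_tau: "\<forall>x\<in>ks (app (tau a b) (bas (e, c))). snd x = c"
proof
  fix x assume "x \<in> ks (app (tau a b) (bas (e, c)))"
  then have "lk (app (tau a b) (bas (e, c))) x \<noteq> 0" by (simp add: in_keys_iff)
  then show "snd x = c"
    by (cases "e a < e b"; cases "snd x = c") (auto simp: tau_def lookup_sum' lookup_bas intro!: sum.neutral)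
qed

lemma keys_bas: "\<forall>x\<in>ks (bas (e, c)). snd x = c"
  by (simp add: bas_def)

lemma ratio_identity:
  fixes x y P P' Q Q' :: complex
  assumes "x \<noteq> y"
  shows "P * (x / (x - y) * (Q' - Q)) - y / (y - x) * (P' - P) * Q
       + (P' * (y / (y - x) * (Q - Q')) - x / (x - y) * (P - P') * Q')
       = - ((x + y) / (x - y) * (P * Q - P' * Q'))"
proof -
  have d: "x - y \<noteq> 0" using assms by simp
  have yx: "u / (y - x) = - (u / (x - y))" for u by (metis minus_diff_eq minus_divide_right)
  show ?thesis unfolding yx using d by (simp add: divide_simps) (simp add: algebra_simps)
qed

text \<open>A divided difference is not self-adjoint. Averaging the integrand over the exchange of
  the two variables reduces the defect, by \<open>ratio_identity\<close>, to the integrand that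
  integration by parts produces.\<close>

lemma tau_defect:
  assumes \<beta>: "\<beta> > 0" and ab: "a < n" "b < n" "a \<noteq> b"
  shows "form n \<beta> (bas x) (app (tau a b) (bas y)) - form n \<beta> (app (tau a b) (bas x)) (bas y)
    = (if snd x = snd y then - (1 / 2) * J n (\<lambda>w. Dl n \<beta> w * Wf n b a (\<lambda>i. fst y i - fst x i) w) else 0)"
proof -
  obtain p c where x: "x = (p, c)" by force
  obtain q c' where y: "y = (q, c')" by force
  show ?thesis
  proof (cases "c = c'")
    case False
    then show ?thesis
      using form_colours[OF keys_bas keys_tau, of c c'] form_colours[OF keys_tau keys_bas, of c c'] by (simp add: x y)
  next
    case True
    define v where "v = (\<lambda>i. q i - p i)"
    let ?S = "\<lambda>_::pidx. True"
    define X where "X w = mon n (\<lambda>i. - p i) w * ev n ?S (app (tau a b) (bas y)) w" for w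
    define Y where "Y w = cnj (ev n ?S (app (tau a b) (bas x)) w) * mon n q w" for w
    have n: "0 < n" using ab by simp
    have S: "inert n ?S" by (simp add: inert_def)
    have fX: "form n \<beta> (bas x) (app (tau a b) (bas y)) = J n (\<lambda>w. Dl n \<beta> w * X w)"
      using form_bas_left_J[OF \<beta> n keys_tau[of a b q c'], of p] True by (simp add: x y X_def)
    have fY: "form n \<beta> (app (tau a b) (bas x)) (bas y) = J n (\<lambda>w. Dl n \<beta> w * Y w)"
      and apY: "appr n (\<lambda>w. Dl n \<beta> w * Y w)"
      using form_bas_right_J[OF \<beta> n keys_tau[of a b p c], of q] True by (simp_all add: x y Y_def)
    have apX: "appr n (\<lambda>w. Dl n \<beta> w * X w)"
    proof -
      obtain H where "lau0 n (ev n ?S (app (tau a b) (bas y))) H" using ev_lau by blast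
      from lau0_times[OF lau0_mon[of n "\<lambda>i. - p i"] this] obtain t H' where "lau n X H' t"
        unfolding lau0_def X_def[abs_def] by blast
      then show ?thesis using appr_mult_lau[OF weight_identity(2)[OF \<beta> n]] by blast
    qed
    define Z where "Z w = Dl n \<beta> w * X w + -1 * (Dl n \<beta> w * Y w)" for w
    have apZ: "appr n Z" and JZ: "J n Z = J n (\<lambda>w. Dl n \<beta> w * X w) - J n (\<lambda>w. Dl n \<beta> w * Y w)"
      using J_add[OF apX J_cmult(1)[OF apY, of "-1"]] J_cmult(2)[OF apY, of "-1"] by (simp_all add: Z_def[abs_def])
    note sw = J_swap[OF apZ ab(1,2)]
    have key: "Z w + Z (w \<circ> tsp a b) = -1 * (Dl n \<beta> w * Wf n b a v w)" if w: "w \<in> Tor n" for w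
    proof (cases "w a = w b")
      case eq: True
      have "(a, b) \<in> Pairs n" using ab by (simp add: Pairs_def)
      then have "Dl n \<beta> w = 0"
        unfolding Dl_def by (rule prod_zero[OF finite_Pairs bexI[rotated]]) (simp add: sqd_def eq)
      then show ?thesis by (simp add: Z_def Dl_swap[OF ab(1,2)])
    next
      case ne: False
      let ?w = "w \<circ> tsp a b"
      have w': "?w \<in> Tor n" by (rule Tor_swap[OF ab(1,2) w])
      have nz: "w a \<noteq> 0" "w b \<noteq> 0" using Tor_nonzero[OF w] ab by auto
      have ww: "?w \<circ> tsp a b = w" by (simp add: comp_assoc)
      have wab: "?w a = w b" "?w b = w a" by simp_all
      define P P' Q Q' where "P = mon n (\<lambda>i. - p i) w" and "P' = mon n (\<lambda>i. - p i) ?w"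
        and "Q = mon n q w" and "Q' = mon n q ?w"
      \<comment> \<open>On the unit circle conjugation inverts the coordinates, which exchanges the
        two coefficients.\<close>
      have cw: "cnj (w a / (w a - w b)) = w b / (w b - w a)"
      proof -
        have "cnj (w a / (w a - w b)) = inverse (w a) / (inverse (w a) - inverse (w b))"
          using inverse_Tor[OF w ab(1)] inverse_Tor[OF w ab(2)] by simp
        then show ?thesis using nz ne by (simp add: divide_simps)
      qed
      have cw': "cnj (w b / (w b - w a)) = w a / (w a - w b)"
        using cw by (metis complex_cnj_cnj)
      have et: "ev n ?S (app (tau a b) F) w = w a / (w a - w b) * (ev n ?S F ?w - ev n ?S F w)" for F
        by (rule ev_tau[OF S ab nz ne])
      have et': "ev n ?S (app (tau a b) F) ?w = w b / (w b - w a) * (ev n ?S F w - ev n ?S F ?w)" for F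
        using ev_tau[OF S ab, of ?w F, unfolded wab ww, OF nz(2,1) ne[symmetric]] .
      have evy: "ev n ?S (app (tau a b) (bas y)) w = w a / (w a - w b) * (Q' - Q)"
        unfolding et by (simp add: ev_bas y Q_def Q'_def)
      have evy': "ev n ?S (app (tau a b) (bas y)) ?w = w b / (w b - w a) * (Q - Q')"
        unfolding et' by (simp add: ev_bas y Q_def Q'_def)
      have bx: "ev n ?S (bas x) u = mon n p u" for u by (simp add: ev_bas x)
      have evx: "cnj (ev n ?S (app (tau a b) (bas x)) w) = w b / (w b - w a) * (P' - P)"
        unfolding et bx complex_cnj_mult complex_cnj_diff cw cnj_mon[OF w] cnj_mon[OF w'] P_def P'_def ..
      have evx': "cnj (ev n ?S (app (tau a b) (bas x)) ?w) = w a / (w a - w b) * (P - P')"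
        unfolding et' bx complex_cnj_mult complex_cnj_diff cw' cnj_mon[OF w] cnj_mon[OF w'] P_def P'_def ..
      have PQ: "P * Q = mon n v w" "P' * Q' = mon n v ?w"
        using mon_add[OF w, of "\<lambda>i. - p i" q] mon_add[OF w', of "\<lambda>i. - p i" q]
        by (simp_all add: P_def Q_def P'_def Q'_def v_def algebra_simps)
      have "Z w + Z ?w = Dl n \<beta> w * (X w - Y w + (X ?w - Y ?w))"
        unfolding Z_def Dl_swap[OF ab(1,2)] by (simp add: algebra_simps)
      also have "X w - Y w + (X ?w - Y ?w) = - ((w a + w b) / (w a - w b) * (P * Q - P' * Q'))"
        unfolding X_def Y_def evy evy' evx evx' P_def[symmetric] P'_def[symmetric] Q_def[symmetric] Q'_def[symmetric]
        by (rule ratio_identity[OF ne])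
      also have "\<dots> = - Wf n b a v w"
        unfolding PQ Wf_def mon_swap[OF ab(1,2)] by (simp add: transpose_commute[of b a])
      finally show ?thesis by (simp only: mult_minus_left mult_minus_right mult_1_left)
    qed
    have "2 * J n Z = J n (\<lambda>w. Z w + Z (w \<circ> tsp a b))"
      using J_add(2)[OF apZ sw(1)] sw(2) by simp
    also have "\<dots> = J n (\<lambda>w. -1 * (Dl n \<beta> w * Wf n b a v w))"
      by (rule conjunct1[OF J_cong[OF J_add(1)[OF apZ sw(1)]]]) (rule key)
    also have "\<dots> = - J n (\<lambda>w. Dl n \<beta> w * Wf n b a v w)"
      using J_cmult(2)[OF weight_identity(3)[OF \<beta> ab(2), of a], of "-1" v] ab by simp
    finally have "2 * J n Z = - J n (\<lambda>w. Dl n \<beta> w * Wf n b a v w)" .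
    then have "J n Z = - (1 / 2) * J n (\<lambda>w. Dl n \<beta> w * Wf n b a v w)" by (simp add: field_simps)
    then show ?thesis using True JZ unfolding fX fY by (simp add: x y v_def)
  qed
qed

lemma Wf_antisym: "Wf n j i v w = - Wf n i j v w"
proof -
  have "u / (w i - w j) = - (u / (w j - w i))" for u by (metis minus_diff_eq minus_divide_right)
  then show ?thesis unfolding Wf_def by (simp add: transpose_commute[of j i] add.commute)
qed

text \<open>The defect of the derivative term is \<open>1 / \<beta>\<close> times what
  \<open>weight_identity\<close> yields, that is half the sum of the \<open>H j\<close>. The terms
  with \<open>j > i\<close> and those with \<open>j < i\<close> each subtract half of their
  \<open>H j\<close>: their opposite signs in \<open>dx\<close> are compensated by the antisymmetry
  of \<open>Wf\<close>.\<close>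

theorem adj_dx:
  assumes \<beta>: "\<beta> > 0"
  shows "adj n \<beta> (dx n \<beta> i) (dx n \<beta> i)"
proof (cases "i < n")
  case False
  then show ?thesis by (simp add: dx_def adj_zero)
next
  case i: True
  show ?thesis
  proof (rule adj_basis)
    fix x y :: pidx
    obtain p c where x: "x = (p, c)" by force
    obtain q c' where y: "y = (q, c')" by force
    define v where "v = (\<lambda>i. q i - p i)"
    define col where "col = (if c = c' then 1 else 0 :: complex)"
    define H where "H j = J n (\<lambda>w. Dl n \<beta> w * Wf n i j v w)" for j
    have t1: "form n \<beta> (bas x) (app (tau j i) (bas y)) - form n \<beta> (app (tau j i) (bas x)) (bas y) = col * (- (1 / 2) * H j)"
      if "j \<in> {i+1..<n}" for j
      using tau_defect[OF \<beta>, of j n i x y] that i by (simp add: x y col_def H_def v_def)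
    have t2: "form n \<beta> (bas x) (app (tau i j) (bas y)) - form n \<beta> (app (tau i j) (bas x)) (bas y) = col * (1 / 2 * H j)"
      if "j \<in> {0..<i}" for j
    proof -
      have "j \<in> {..<n} - {i}" using that i by auto
      from J_cmult(2)[OF weight_identity(3)[OF \<beta> i this, of v], of "-1"]
      have "J n (\<lambda>w. Dl n \<beta> w * Wf n j i v w) = - H j"
        by (simp add: H_def Wf_antisym[of n j i])
      then show ?thesis
        using tau_defect[OF \<beta>, of i n j x y] that i by (simp add: x y col_def v_def)
    qed
    have D: "form n \<beta> (bas x) (app (sc (of_real (1 / \<beta>)) * Dx i) (bas y)) - form n \<beta> (app (sc (of_real (1 / \<beta>)) * Dx i) (bas x)) (bas y)
        = col * (1 / 2 * (\<Sum>j\<in>{..<n} - {i}. H j))"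
    proof -
      have "form n \<beta> (bas x) (app (sc (of_real (1 / \<beta>)) * Dx i) (bas y)) - form n \<beta> (app (sc (of_real (1 / \<beta>)) * Dx i) (bas x)) (bas y)
        = of_real (1 / \<beta>) * (of_int (q i) - of_int (p i)) * gm n \<beta> x y"
        by (simp add: x y Dx_def form_smul_left form_smul_right form_bas algebra_simps)
      also have "gm n \<beta> x y = col * J n (\<lambda>w. Dl n \<beta> w * mon n v w)"
        by (simp add: gm_def x y col_def v_def)
      also have "of_real (1 / \<beta>) * (of_int (q i) - of_int (p i)) * (col * J n (\<lambda>w. Dl n \<beta> w * mon n v w))
        = col * (of_real (1 / \<beta>) * (of_int (v i) * J n (\<lambda>w. Dl n \<beta> w * mon n v w)))"
        by (simp add: v_def)
      also have "of_int (v i) * J n (\<lambda>w. Dl n \<beta> w * mon n v w) = of_real (\<beta> / 2) * (\<Sum>j\<in>{..<n} - {i}. H j)"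
        unfolding H_def by (rule weight_identity(1)[OF \<beta> i])
      finally show ?thesis using \<beta> by simp
    qed
    have N: "form n \<beta> (bas x) (app (of_nat k) (bas y)) = form n \<beta> (app (of_nat k) (bas x)) (bas y)" for k
      by (simp add: form_smul_left form_smul_right)
    have "{..<n} - {i} = {i+1..<n} \<union> {0..<i}" using i by auto
    then have split: "(\<Sum>j\<in>{..<n} - {i}. H j) = (\<Sum>j\<in>{i+1..<n}. H j) + (\<Sum>j\<in>{0..<i}. H j)"
      by (simp add: sum.union_disjoint)
    have "form n \<beta> (bas x) (app (dx n \<beta> i) (bas y)) - form n \<beta> (app (dx n \<beta> i) (bas x)) (bas y)
      = (form n \<beta> (bas x) (app (sc (of_real (1 / \<beta>)) * Dx i) (bas y)) - form n \<beta> (app (sc (of_real (1 / \<beta>)) * Dx i) (bas x)) (bas y))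
      + (\<Sum>j\<in>{i+1..<n}. form n \<beta> (bas x) (app (tau j i) (bas y)) - form n \<beta> (app (tau j i) (bas x)) (bas y))
      - (\<Sum>j\<in>{0..<i}. form n \<beta> (bas x) (app (tau i j) (bas y)) - form n \<beta> (app (tau i j) (bas x)) (bas y))"
      unfolding dx_eq[OF i] app_ring(3,4) form_add_left form_add_right form_minus_left form_minus_right
        app_sum_left form_sum_left form_sum_right sum_subtractf N
      by simp
    also have "\<dots> = col * (1 / 2 * (\<Sum>j\<in>{..<n} - {i}. H j)) + (\<Sum>j\<in>{i+1..<n}. col * (- (1 / 2) * H j)) - (\<Sum>j\<in>{0..<i}. col * (1 / 2 * H j))"
      unfolding D using t1 t2 by (intro arg_cong2[of _ _ _ _ "(+)"] arg_cong2[of _ _ _ _ "(-)"] sum.cong refl) auto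
    also have "\<dots> = 0"
    proof -
      have "(\<Sum>j\<in>A. col * (- (1 / 2) * H j)) = - (1 / 2) * (col * sum H A)" "(\<Sum>j\<in>A. col * (1 / 2 * H j)) = 1 / 2 * (col * sum H A)" for A
        by (simp_all add: sum_distrib_left sum_negf)
      then show ?thesis unfolding split by (simp add: algebra_simps)
    qed
    finally show "form n \<beta> (app (dx n \<beta> i) (bas x)) (bas y) = form n \<beta> (bas x) (app (dx n \<beta> i) (bas y))" by simp
  qed
qed

lemma adj_Kx:
  assumes \<beta>: "\<beta> > 0" and ab: "a < n" "b < n"
  shows "adj n \<beta> (Kx a b) (Kx a b)"
proof (rule adj_basis)
  fix x y :: pidx
  obtain p c where x: "x = (p, c)" by force
  obtain q c' where y: "y = (q, c')" by force
  have n: "0 < n" using ab by simp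
  have "mon n (\<lambda>i. q i - p (tsp a b i)) (w \<circ> tsp a b) = mon n (\<lambda>i. q (tsp a b i) - p i) w" for w
    unfolding mon_swap[OF ab] by (simp add: comp_def)
  then have "J n (\<lambda>w. Dl n \<beta> w * mon n (\<lambda>i. q (tsp a b i) - p i) w) = J n (\<lambda>w. Dl n \<beta> w * mon n (\<lambda>i. q i - p (tsp a b i)) w)"
    using J_swap(2)[OF Dl_mon_appr[OF \<beta> n, of "\<lambda>i. q i - p (tsp a b i)"] ab] by (simp only: Dl_swap[OF ab])
  then show "form n \<beta> (app (Kx a b) (bas x)) (bas y) = form n \<beta> (bas x) (app (Kx a b) (bas y))"
    by (simp add: x y Kx_def form_bas gm_def)
qed

section \<open>Translation from functions on index lists\<close>

text \<open>The expansion of \<open>Y(u - r)\<close> in powers of \<open>1/u\<close>.\<close>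
definition shf :: "nat \<Rightarrow> 'r::ring_1 fps \<Rightarrow> 'r fps" where
  "shf r Y = Abs_fps (\<lambda>s. if s = 0 then Y $ 0 else
     \<Sum>t\<in>{1..s}. of_nat (((s - 1) choose (s - t)) * r ^ (s - t)) * Y $ t)"

lemma shf_nth_0 [simp]: "shf r Y $ 0 = Y $ 0"
  by (simp add: shf_def)

lemma shf_nth_Suc: "shf r Y $ Suc s = (\<Sum>t\<le>s. of_nat ((s choose t) * r ^ (s - t)) * Y $ Suc t)"
proof -
  have "shf r Y $ Suc s = (\<Sum>t\<in>{1..Suc s}. of_nat ((s choose (Suc s - t)) * r ^ (Suc s - t)) * Y $ t)"
    by (simp add: shf_def)
  also have "\<dots> = (\<Sum>t\<le>s. of_nat ((s choose (s - t)) * r ^ (s - t)) * Y $ Suc t)"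
    by (rule sum.reindex_bij_witness[of _ Suc "\<lambda>t. t - 1"]) auto
  also have "\<dots> = (\<Sum>t\<le>s. of_nat ((s choose t) * r ^ (s - t)) * Y $ Suc t)"
    by (intro sum.cong refl) (simp add: binomial_symmetric[symmetric])
  finally show ?thesis .
qed

lemma shf_add: "shf r (Y + Z) = shf r Y + shf r Z"
  by (rule fps_ext) (simp add: shf_def distrib_left sum.distrib)

lemma shf_zero [simp]: "shf r 0 = 0"
  by (rule fps_ext) (simp add: shf_def)

lemma shf_sum: "shf r (\<Sum>x\<in>X. f x) = (\<Sum>x\<in>X. shf r (f x))"
  by (induction X rule: infinite_finite_induct) (auto simp: shf_add)

lemma shf_one [simp]: "shf r 1 = 1"
  by (rule fps_ext) (auto simp: shf_def intro!: sum.neutral)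

lemma shf_const_mult: "shf r (fps_const c * Y) = fps_const c * shf r Y"
proof (rule fps_ext)
  fix s
  have "of_nat k * (c * y) = c * (of_nat k * y)" for k y
    by (metis mult.assoc mult_of_nat_commute)
  then show "shf r (fps_const c * Y) $ s = (fps_const c * shf r Y) $ s"
    by (simp add: shf_def sum_distrib_left del: of_nat_mult)
qed

text \<open>The coefficient form of \<open>u * z(u - r) = r * z(u - r) + (u z)(u - r)\<close>;
  Pascal's rule for the binomials in the expansion.\<close>

lemma shf_pascal:
  assumes "z $ 0 = 0"
  shows "shf r z $ Suc s = of_nat r * shf r z $ s + shf r (Abs_fps (\<lambda>t. z $ Suc t)) $ s"
proof (cases s)
  case 0
  then show ?thesis using assms by (simp add: shf_nth_Suc)
next
  case (Suc q)
  have "shf r z $ Suc (Suc q) = (\<Sum>t\<le>Suc q. of_nat ((Suc q choose t) * r ^ (Suc q - t)) * z $ Suc t)"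
    by (rule shf_nth_Suc)
  also have "\<dots> = of_nat (r ^ Suc q) * z $ 1 + (\<Sum>t\<le>q. of_nat ((Suc q choose Suc t) * r ^ (q - t)) * z $ Suc (Suc t))"
    by (subst sum.atMost_Suc_shift) simp
  also have "(\<Sum>t\<le>q. of_nat ((Suc q choose Suc t) * r ^ (q - t)) * z $ Suc (Suc t))
     = (\<Sum>t\<le>q. of_nat ((q choose Suc t) * r ^ (q - t)) * z $ Suc (Suc t))
     + (\<Sum>t\<le>q. of_nat ((q choose t) * r ^ (q - t)) * z $ Suc (Suc t))"
    unfolding sum.distrib[symmetric]
    by (intro sum.cong refl) (simp add: distrib_right add_mult_distrib)
  also have "(\<Sum>t\<le>q. of_nat ((q choose t) * r ^ (q - t)) * z $ Suc (Suc t)) = shf r (Abs_fps (\<lambda>t. z $ Suc t)) $ Suc q"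
    by (simp add: shf_nth_Suc)
  also have "of_nat (r ^ Suc q) * z $ 1 + ((\<Sum>t\<le>q. of_nat ((q choose Suc t) * r ^ (q - t)) * z $ Suc (Suc t)) + shf r (Abs_fps (\<lambda>t. z $ Suc t)) $ Suc q)
     = of_nat r * shf r z $ Suc q + shf r (Abs_fps (\<lambda>t. z $ Suc t)) $ Suc q"
  proof -
    have "of_nat r * shf r z $ Suc q = (\<Sum>t\<le>q. of_nat ((q choose t) * r ^ (Suc q - t)) * z $ Suc t)"
      unfolding shf_nth_Suc sum_distrib_left
    proof (intro sum.cong refl)
      fix t assume "t \<in> {..q}"
      then have "(q choose t) * r ^ (Suc q - t) = r * ((q choose t) * r ^ (q - t))"
        by (simp add: Suc_diff_le)
      then show "of_nat r * (of_nat ((q choose t) * r ^ (q - t)) * z $ Suc t) = of_nat ((q choose t) * r ^ (Suc q - t)) * z $ Suc t"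
        by (simp only: of_nat_mult[of r] mult.assoc)
    qed
    also have "\<dots> = (\<Sum>t\<le>Suc q. of_nat ((q choose t) * r ^ (Suc q - t)) * z $ Suc t)"
      by (simp add: binomial_eq_0)
    also have "\<dots> = of_nat (r ^ Suc q) * z $ 1 + (\<Sum>t\<le>q. of_nat ((q choose Suc t) * r ^ (q - t)) * z $ Suc (Suc t))"
      by (subst sum.atMost_Suc_shift) simp
    finally show ?thesis by simp
  qed
  finally show ?thesis by (simp add: Suc)
qed

context dunkl
begin

text \<open>Multiplicativity of the shift in the one case needed. The series
  \<open>z = R i 0 * Y\<close> is characterised by a first-order recurrence, and by
  \<open>shf_pascal\<close> its shift satisfies the same recurrence with \<open>d i\<close> replaced
  by \<open>d i - r\<close>.\<close>

lemma shf_R: "shf r (R i 0 * Y) = R i r * shf r Y"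
proof -
  define z where "z = R i 0 * Y"
  have AR: "A i r * R i r = fps_X" for r
    unfolding R_def fps_X_central[of "g i r"] by (simp add: mult.assoc[symmetric] A_g)
  have Az: "A i 0 * z = fps_X * Y"
    by (simp add: z_def mult.assoc[symmetric] AR)
  have z0: "z $ 0 = 0"
    by (simp add: z_def R_def mult.assoc)
  have nth: "(A i r * W) $ Suc s = W $ Suc s + (d i - of_nat r) * W $ s" for r W s
  proof -
    have "A i r * W = W + fps_const (d i - of_nat r) * (fps_X * W)"
      by (simp add: A_def distrib_right mult.assoc)
    then show ?thesis by (simp)
  qed
  \<comment> \<open>The equation \<open>(u + d i) * z = Y\<close>, coefficient by
    coefficient.\<close>
  have rec: "z $ Suc s + d i * z $ s = Y $ s" for s
    using arg_cong[OF Az, of "\<lambda>f. f $ Suc s"] by (simp add: nth)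
  have Y: "Y = Abs_fps (\<lambda>t. z $ Suc t) + fps_const (d i) * z"
    by (rule fps_ext) (simp add: rec)
  have "A i r * shf r z = fps_X * shf r Y"
  proof (rule fps_ext)
    fix s
    show "(A i r * shf r z) $ s = (fps_X * shf r Y) $ s"
    proof (cases s)
      case 0
      then show ?thesis by (simp add: A_def distrib_right mult.assoc z0)
    next
      case (Suc q)
      have "(fps_X * shf r Y) $ s = shf r Y $ q"
        by (simp add: Suc)
      also have "\<dots> = shf r (Abs_fps (\<lambda>t. z $ Suc t)) $ q + d i * shf r z $ q"
        by (subst Y) (simp add: shf_add shf_const_mult)
      finally show ?thesis
        unfolding Suc nth shf_pascal[OF z0, of r q] by (simp add: left_diff_distrib)
    qed
  qed
  then have "g i r * (A i r * shf r z) = g i r * (fps_X * shf r Y)" by simp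
  then show ?thesis
    unfolding z_def R_def fps_X_central[of "g i r"] by (simp add: mult.assoc[symmetric] g_A)
qed

text \<open>Reconciles two ways to evaluate at \<open>u - r\<close>: the shift of the finished
  series in the concrete \<open>Aop\<close>, and the shift inside each resolvent in the abstract
  chain.\<close>

lemma shf_T: "shf r (T 0 is a b) = T r is a b"
proof (induction "is" arbitrary: a)
  case Nil
  then show ?case by (simp add: of_bool_def)
next
  case (Cons i js)
  have "shf r (L i 0 a c * T 0 js c b) = L i r a c * T r js c b" for c
  proof -
    have "shf r (L i 0 a c * T 0 js c b) = shf r (of_bool (a = c) * T 0 js c b) + shf r (R i 0 * (Es i c a * T 0 js c b))"
      by (simp add: L_def distrib_right shf_add mult.assoc)
    also have "shf r (of_bool (a = c) * T 0 js c b) = of_bool (a = c) * T r js c b"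
      by (cases "a = c") (simp_all add: Cons.IH)
    also have "shf r (R i 0 * (Es i c a * T 0 js c b)) = R i r * (Es i c a * T r js c b)"
      unfolding shf_R unfolding Es_def shf_const_mult Cons.IH ..
    finally show ?thesis by (simp add: L_def distrib_right mult.assoc)
  qed
  then show ?case by (simp add: shf_sum)
qed

end

section \<open>Comparison with list-indexed operators\<close>

definition fe :: "nat \<Rightarrow> int list \<Rightarrow> nat \<Rightarrow> int" where "fe n e = (\<lambda>i. if i < n then e ! i else 0)"
definition fc :: "nat \<Rightarrow> nat list \<Rightarrow> nat \<Rightarrow> nat" where "fc n c = (\<lambda>i. if i < n then c ! i else 0)"

text \<open>The bridge to list-indexed states. Every concrete operator is matched by a rule moving
  it through \<open>drp n\<close>, so all identities can be proved in the ring \<open>endo\<close>.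
  Lists are padded by zero; components of \<open>F\<close> with other entries beyond
  \<open>n\<close> are forgotten.\<close>

definition drp :: "nat \<Rightarrow> pst \<Rightarrow> st" where
  "drp n F = (\<lambda>(e, c). if length e = n \<and> length c = n then lk F (fe n e, fc n c) else 0)"

lemma drp_add: "drp n (F + G) = (\<lambda>p. drp n F p + drp n G p)"
  by (auto simp: drp_def fun_eq_iff lookup_add)

lemma drp_minus: "drp n (F - G) = (\<lambda>p. drp n F p - drp n G p)"
  by (auto simp: drp_def fun_eq_iff lookup_minus)

lemma drp_smul: "drp n (smul c F) = (\<lambda>p. c * drp n F p)"
  by (auto simp: drp_def fun_eq_iff)

lemma drp_zero: "drp n 0 = (\<lambda>p. 0)"
  by (auto simp: drp_def fun_eq_iff)

lemma drp_sum: "drp n (\<Sum>x\<in>X. f x) = (\<lambda>p. \<Sum>x\<in>X. drp n (f x) p)"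
  by (induction X rule: infinite_finite_induct) (auto simp: drp_zero drp_add)

lemma fe_upd: "length e = n \<Longrightarrow> i < n \<Longrightarrow> fe n (e[i := x]) = (fe n e)(i := x)"
  by (auto simp: fe_def fun_eq_iff nth_list_update)

lemma fc_upd: "length e = n \<Longrightarrow> i < n \<Longrightarrow> fc n (e[i := x]) = (fc n e)(i := x)"
  by (auto simp: fc_def fun_eq_iff nth_list_update)

lemma swap_list_length [simp]: "length (swap_list i j xs) = length xs"
  by (simp add: swap_list_def)

lemma fe_swap: "length e = n \<Longrightarrow> i < n \<Longrightarrow> j < n \<Longrightarrow> fe n (swap_list i j e) = fe n e \<circ> tr i j"
  by (auto simp: fe_def fun_eq_iff swap_list_def nth_list_update Transposition.transpose_def)

lemma fc_swap: "length e = n \<Longrightarrow> i < n \<Longrightarrow> j < n \<Longrightarrow> fc n (swap_list i j e) = fc n e \<circ> tr i j"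
  by (auto simp: fc_def fun_eq_iff swap_list_def nth_list_update Transposition.transpose_def)

lemma comp_tr_eq: "f \<circ> tr i j = g \<longleftrightarrow> f = g \<circ> tr i j"
  by (metis comp_assoc comp_id transpose_comp_involutory)

lemma lookup_Kx: "lk (app (Kx i j) F) (e, c) = lk F (e \<circ> tr i j, c)"
  unfolding Kx_def
  by (subst lookup_app_mk_single[where z = "(e \<circ> tr i j, c)" and c = 1]) (auto simp: lookup_bas comp_tr_eq split: prod.split)

lemma lookup_Px: "lk (app (Px i j) F) (e, c) = lk F (e, c \<circ> tr i j)"
  unfolding Px_def
  by (subst lookup_app_mk_single[where z = "(e, c \<circ> tr i j)" and c = 1]) (auto simp: lookup_bas comp_tr_eq split: prod.split)

lemma lookup_Dx: "lk (app (Dx i) F) (e, c) = of_int (e i) * lk F (e, c)"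
  unfolding Dx_def
  by (subst lookup_app_mk_single[where z = "(e, c)" and c = "of_int (e i)"]) (auto simp: lookup_bas split: prod.split)

lemma lookup_Em: "lk (app (Em i x y) F) (e, c) = (if c i = x then lk F (e, c(i := y)) else 0)"
proof -
  have "lk (app (Em i x y) F) (e, c) = (if c i = x then 1 else 0) * lk F (e, c(i := y))"
    unfolding Em_def
  proof (rule lookup_app_mk_single)
    fix p :: pidx
    obtain e' c' where p: "p = (e', c')" by force
    have "c' i = y \<and> c'(i := x) = c \<longleftrightarrow> c i = x \<and> c' = c(i := y)"
      by auto
    then show "lk (case p of (e, c) \<Rightarrow> if c i = y then bas (e, c(i := x)) else 0) (e, c)
        = (if p = (e, c(i := y)) then if c i = x then 1 else 0 else 0)"
      by (auto simp: p lookup_bas)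
  qed
  then show ?thesis by simp
qed

lemma lookup_Bx: "lk (app (Bx a) F) (e, c) = (if c = (\<lambda>_. 0) then lk F (e, a) else 0)"
proof -
  have "lk (app (Bx a) F) (e, c) = (if c = (\<lambda>_. 0) then 1 else 0) * lk F (e, a)"
    unfolding Bx_def
    by (rule lookup_app_mk_single) (auto simp: lookup_bas split: prod.split)
  then show ?thesis by simp
qed

lemma lookup_Prx: "lk (app (Prx n N) F) (e, c) = (if \<forall>i<n. c i \<in> {1..N} then lk F (e, c) else 0)"
proof -
  have "lk (app (Prx n N) F) (e, c) = (if \<forall>i<n. c i \<in> {1..N} then 1 else 0) * lk F (e, c)"
    unfolding Prx_def
    by (rule lookup_app_mk_single) (auto simp: lookup_bas split: prod.split)
  then show ?thesis by (auto split: if_splits)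
qed

lemma Kop_drp: "i < n \<Longrightarrow> j < n \<Longrightarrow> Kop i j (drp n F) = drp n (app (Kx i j) F)"
  by (auto simp: Kop_def drp_def fun_eq_iff lookup_Kx fe_swap)

lemma Pop_drp: "i < n \<Longrightarrow> j < n \<Longrightarrow> Pop i j (drp n F) = drp n (app (Px i j) F)"
  by (auto simp: Pop_def drp_def fun_eq_iff lookup_Px fc_swap)

lemma Dop_drp: "i < n \<Longrightarrow> Dop i (drp n F) = drp n (app (Dx i) F)"
  by (auto simp: Dop_def drp_def fun_eq_iff lookup_Dx fe_def)

lemma Eop_drp: "i < n \<Longrightarrow> Eop i x y (drp n F) = drp n (app (Em i x y) F)"
  by (auto simp: Eop_def drp_def fun_eq_iff lookup_Em fc_upd) (auto simp: fc_def)

lemma mulz_drp: "i < n \<Longrightarrow> length (fst p) = n \<Longrightarrow> mulz i (drp n F) p = drp n (app (Zx i) F) p"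
  by (cases p) (auto simp: mulz_def drp_def lookup_Zx fe_upd, simp add: fe_def)

lemma finite_supp_drp: "finite (supp (drp n F))"
proof -
  have "supp (drp n F) \<subseteq> (\<lambda>(e, c). (map e [0..<n], map c [0..<n])) ` ks F"
  proof
    fix p assume "p \<in> supp (drp n F)"
    then obtain e c where p: "p = (e, c)" "length e = n" "length c = n" "lk F (fe n e, fc n c) \<noteq> 0"
      by (cases p) (auto simp: supp_def drp_def split: if_splits)
    then have "map (fe n e) [0..<n] = e" "map (fc n c) [0..<n] = c"
      by (auto simp: fe_def fc_def intro!: nth_equalityI)
    then have "p = (\<lambda>(e, c). (map e [0..<n], map c [0..<n])) (fe n e, fc n c)" using p by simp
    then show "p \<in> (\<lambda>(e, c). (map e [0..<n], map c [0..<n])) ` ks F"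
      using p(4) by (auto simp: in_keys_iff)
  qed
  then show ?thesis by (rule finite_subset) simp
qed

lemma Zx_tau:
  assumes "a < n" "b < n" "a \<noteq> b"
  shows "(Zx a - Zx b) * tau a b = Zx a * (Kx a b - 1)"
proof (rule endo_eq_by_ev[of n])
  fix F w l assume w: "w \<in> Dst n"
  have S: "inert n (\<lambda>x. lab n x = l)" by (rule inert_lab)
  have nz: "w a \<noteq> 0" "w b \<noteq> 0" "w a \<noteq> w b" and wT: "w \<in> Tor n"
    using w assms Tor_nonzero[of w n] by (auto simp: Dst_def)
  have K: "ev n (\<lambda>x. lab n x = l) (app (Kx a b) F) w = ev n (\<lambda>x. lab n x = l) F (w \<circ> tr a b)"
  proof -
    have "ev n (\<lambda>x. lab n x = l) (app (Kx a b) (bas x)) w = ev n (\<lambda>x. lab n x = l) (bas x) (w \<circ> tr a b)" for x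
    proof -
      obtain e c where x: "x = (e, c)" by force
      have "lab n (e \<circ> tr a b, c) = lab n (e, c)"
        using assms by (auto simp: lab_pair fun_eq_iff Transposition.transpose_def)
      then show ?thesis using assms by (simp add: x Kx_def ev_bas mon_swap)
    qed
    then show ?thesis unfolding ev_app[of n _ "Kx a b" F] ev_expand[of n _ F "w \<circ> tr a b"] by simp
  qed
  show "ev n (\<lambda>x. lab n x = l) (app ((Zx a - Zx b) * tau a b) F) w = ev n (\<lambda>x. lab n x = l) (app (Zx a * (Kx a b - 1)) F) w"
    using nz assms
    by (simp add: ev_minus ev_Zx[OF S] ev_tau[OF S] K) (simp add: diff_divide_distrib[symmetric] left_diff_distrib[symmetric])
qed

text \<open>Uniqueness for the definite description in \<open>ddop\<close>: equal products along a
  line of exponents would force infinite support, as in \<open>Zx_diff_inj\<close>.\<close>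

lemma mulz_diff_unique:
  assumes ab: "a < n" "b < n" "a \<noteq> b"
    and fin: "finite (supp h)" and eq: "\<And>p. length (fst p) = n \<Longrightarrow> mulz a h p = mulz b h p"
    and len: "length (fst p) = n"
  shows "h p = 0"
proof (rule ccontr)
  assume nz: "h p \<noteq> 0"
  obtain e c where p: "p = (e, c)" by force
  have n: "length e = n" using len p by simp
  define es where "es k = e[a := e ! a + int k, b := e ! b - int k]" for k
  have "h (es k, c) = h (e, c)" for k
  proof (induction k)
    case 0
    then show ?case using ab n by (simp add: es_def)
  next
    case (Suc k)
    define e1 where "e1 = e[a := e ! a + int (Suc k), b := e ! b - int k]"
    have "mulz a h (e1, c) = mulz b h (e1, c)" using n by (intro eq) (simp add: e1_def)
    moreover have "e1[a := e1 ! a - 1] = es k" "e1[b := e1 ! b - 1] = es (Suc k)"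
      using ab n by (auto simp: e1_def es_def list_eq_iff_nth_eq nth_list_update)
    ultimately show ?case using Suc by (simp add: mulz_def)
  qed
  then have "range (\<lambda>k. (es k, c)) \<subseteq> supp h"
    using nz p by (auto simp: supp_def)
  moreover have "inj (\<lambda>k. (es k, c))"
  proof (rule injI)
    fix k l assume "(es k, c) = (es l, c)"
    then have "es k ! b = es l ! b" by simp
    then show "k = l" using ab n by (simp add: es_def)
  qed
  ultimately show False using fin finite_subset range_inj_infinite by blast
qed

lemma ddop_drp:
  assumes ab: "a < n" "b < n" "a \<noteq> b"
  shows "ddop n a b (drp n F) = drp n (app (tau a b) F)"
  unfolding ddop_def
proof (rule the_equality)
  let ?g = "drp n (app (tau a b) F)"
  have main: "mulz a ?g p - mulz b ?g p = mulz a (\<lambda>q. Kop a b (drp n F) q - drp n F q) p" if "length (fst p) = n" for p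
  proof -
    have "(\<lambda>q. Kop a b (drp n F) q - drp n F q) = drp n (app (Kx a b - 1) F)"
      using ab by (simp add: Kop_drp drp_minus)
    moreover have "app (Zx a) (app (tau a b) F) - app (Zx b) (app (tau a b) F) = app (Zx a) (app (Kx a b - 1) F)"
      using arg_cong[OF Zx_tau[OF ab], of "\<lambda>A. app A F"] by (simp only: app_ring)
    ultimately show ?thesis
      using that ab by (simp add: mulz_drp fun_cong[OF drp_minus, symmetric] del: app_ring)
  qed
  then show ok: "finite (supp ?g) \<and> (\<forall>p. length (fst p) \<noteq> n \<longrightarrow> ?g p = 0) \<and>
      (\<forall>p. length (fst p) = n \<longrightarrow> mulz a ?g p - mulz b ?g p = mulz a (\<lambda>q. Kop a b (drp n F) q - drp n F q) p)"
    using finite_supp_drp by (auto simp: drp_def)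
  fix g assume g: "finite (supp g) \<and> (\<forall>p. length (fst p) \<noteq> n \<longrightarrow> g p = 0) \<and>
      (\<forall>p. length (fst p) = n \<longrightarrow> mulz a g p - mulz b g p = mulz a (\<lambda>q. Kop a b (drp n F) q - drp n F q) p)"
  define h where "h p = g p - ?g p" for p
  have "supp h \<subseteq> supp g \<union> supp ?g" by (auto simp: supp_def h_def)
  then have "finite (supp h)" using g finite_supp_drp finite_subset by blast
  moreover have "mulz a h p = mulz b h p" if "length (fst p) = n" for p
  proof -
    have "mulz a g p - mulz b g p = mulz a ?g p - mulz b ?g p" using g main[OF that] that by metis
    then show ?thesis by (cases p) (simp add: mulz_def h_def algebra_simps)
  qed
  ultimately have "h p = 0" if "length (fst p) = n" for p
    using mulz_diff_unique[OF ab] that by blast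
  moreover have "h p = 0" if "length (fst p) \<noteq> n" for p
    using g that by (auto simp: h_def drp_def split: prod.split)
  ultimately have "h p = 0" for p by blast
  then show "g = ?g" by (auto simp: h_def fun_eq_iff)
qed

lemma dop_drp:
  assumes i: "i < n"
  shows "dop n \<beta> i (drp n F) = drp n (app (dx n \<beta> i) F)"
proof -
  have c: "of_nat n - of_nat (i + 1) = (of_nat (n - Suc i) :: complex)"
    using i by (simp add: of_nat_diff)
  have s1: "(\<Sum>j\<in>{i+1..<n}. ddop n j i (drp n F) p) = drp n (app (\<Sum>j\<in>{i+1..<n}. tau j i) F) p" for p
    unfolding app_sum_left drp_sum using i by (intro sum.cong refl) (auto simp: ddop_drp)
  have s2: "(\<Sum>j\<in>{0..<i}. ddop n i j (drp n F) p) = drp n (app (\<Sum>j\<in>{0..<i}. tau i j) F) p" for p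
    unfolding app_sum_left drp_sum using i by (intro sum.cong refl) (auto simp: ddop_drp)
  show ?thesis
    unfolding dop_def c s1 s2 Dop_drp[OF i] dx_eq[OF i] app_ring app_sc app_of_nat drp_add drp_minus drp_smul ..
qed

locale cs = fixes n N :: nat and \<beta> :: real
begin
sublocale dunkl "dx n \<beta>" Em "\<lambda>i. Kx i (Suc i)" "\<lambda>i. Px i (Suc i)" Bx "Prx n N" n N
  by (rule dunkl_dx)

text \<open>Agreement is required only on functions of the form \<open>drp n F\<close>, which
  suffices because these are mapped among themselves.\<close>

definition reps :: "opser \<Rightarrow> endo fps \<Rightarrow> bool" where
  "reps Q Y \<longleftrightarrow> (\<forall>s F. Q s (drp n F) = drp n (app (Y $ s) F))"

lemma reps_mult: "reps Q Y \<Longrightarrow> reps Q' Z \<Longrightarrow> reps (ser_mult Q Q') (Y * Z)"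
  by (auto simp: reps_def ser_mult_def fps_mult_nth app_sum_left drp_sum atLeast0AtMost)

lemma reps_one: "reps ser_one 1"
  by (auto simp: reps_def ser_one_def ser_zero_op_def drp_zero)

lemma dop_power_drp: "i < n \<Longrightarrow> (dop n \<beta> i ^^ k) (drp n F) = drp n (app (dx n \<beta> i ^ k) F)"
  by (induction k) (auto simp: dop_drp)

lemma minus_power: "(- y) ^ k = of_int ((- 1) ^ k) * (y :: endo) ^ k"
proof -
  have "(- y) ^ k = (- 1) ^ k * y ^ k" by (rule power_minus)
  then show ?thesis by (metis of_int_1 of_int_minus of_int_power)
qed

lemma reps_Lser: "i < n \<Longrightarrow> reps (Lser n \<beta> i a b) (L i 0 a b)"
  unfolding reps_def
proof (intro allI)
  fix s F assume i: "i < n"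
  have R: "(R i 0 * Es i b a) $ s = (if s = 0 then 0 else (- dx n \<beta> i) ^ (s - 1) * Em i b a)"
    by (simp add: R_def g_def Es_def mult.assoc)
  show "Lser n \<beta> i a b s (drp n F) = drp n (app (L i 0 a b $ s) F)"
  proof (cases "s = 0")
    case True
    then show ?thesis using R by (simp add: Lser_def L_def ser_zero_op_def drp_zero of_bool_def)
  next
    case False
    then have "L i 0 a b $ s = of_int ((- 1) ^ (s - 1)) * dx n \<beta> i ^ (s - 1) * Em i b a"
      using R by (simp add: L_def of_bool_def minus_power[symmetric] del: of_int_power of_int_minus)
    then have "app (L i 0 a b $ s) F = smul (of_int ((- 1) ^ (s - 1))) (app (dx n \<beta> i ^ (s - 1)) (app (Em i b a) F))"
      by (simp add: mult.assoc app_of_int del: of_int_power of_int_minus)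
    then show ?thesis
      using False i by (simp add: Lser_def Eop_drp dop_power_drp drp_smul)
  qed
qed

lemma reps_Tpart: "set is \<subseteq> {..<n} \<Longrightarrow> reps (Tpart n N \<beta> is a b) (T 0 is a b)"
proof (induction "is" arbitrary: a)
  case Nil
  then show ?case by (auto simp: reps_def ser_zero_op_def drp_zero of_bool_def)
next
  case (Cons i js)
  then have "reps (ser_mult (Lser n \<beta> i a c) (Tpart n N \<beta> js c b)) (L i 0 a c * T 0 js c b)" for c
    by (intro reps_mult reps_Lser) auto
  then show ?case by (simp add: reps_def fps_sum_nth app_sum_left drp_sum)
qed

lemma reps_shift: "reps Q Y \<Longrightarrow> reps (ser_shift (of_nat r) Q) (shf r Y)"
  unfolding reps_def ser_shift_def
proof (intro allI)
  fix s F assume Q: "\<forall>s F. Q s (drp n F) = drp n (app (Y $ s) F)"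
  show "(if s = 0 then Q 0 (drp n F) else (\<lambda>p. \<Sum>t\<in>{1..s}. of_nat ((s - 1) choose (s - t)) * of_nat r ^ (s - t) * Q t (drp n F) p))
     = drp n (app (shf r Y $ s) F)"
    by (auto simp: Q shf_def app_sum_left drp_sum drp_smul simp del: of_nat_mult) simp
qed

lemma reps_rows:
  "reps (foldr ser_mult (map (\<lambda>r. ser_shift (of_nat (r - 1)) (Tser n N \<beta> r (w r))) [Suc k..<Suc m]) ser_one)
     (rows [0..<n] k [Suc k..<Suc m] w)"
proof (induction "m - k" arbitrary: k)
  case 0
  then show ?case by (auto simp: reps_one)
next
  case (Suc q)
  then have k: "[Suc k..<Suc m] = Suc k # [Suc (Suc k)..<Suc m]" by (simp add: upt_conv_Cons del: upt_Suc)
  have "reps (ser_shift (of_nat k) (Tser n N \<beta> (Suc k) (w (Suc k)))) (T k [0..<n] (Suc k) (w (Suc k)))"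
    unfolding Tser_def shf_T[of k, symmetric] by (rule reps_shift, rule reps_Tpart) auto
  moreover have "q = m - Suc k" using Suc.hyps(2) by simp
  ultimately show ?case
    unfolding k using Suc.hyps(1)[of "Suc k"] by (auto intro!: reps_mult simp del: upt_Suc)
qed

theorem Aop_drp: "Aop n N \<beta> m s (drp n F) = drp n (app (qdet m [0..<n] $ s) F)"
proof -
  have "reps (ser_listprod (map (\<lambda>r. ser_shift (of_nat (r - 1)) (Tser n N \<beta> r (w r))) [1..<m+1])) (rows [0..<n] 0 [1..<m+1] w)" for w
    using reps_rows[of w 0 m] by (simp add: ser_listprod_def)
  then have r: "ser_listprod (map (\<lambda>r. ser_shift (of_nat (r - 1)) (Tser n N \<beta> r (w r))) [1..<m+1]) s (drp n F)
      = drp n (app (rows [0..<n] 0 [1..<m+1] w $ s) F)" for w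
    unfolding reps_def by blast
  have of_int_nth: "((of_int z :: endo fps) * Y) $ s = of_int z * Y $ s" for z Y
    by (metis fps_mult_left_const_nth fps_of_int)
  show ?thesis
    unfolding Aop_def r qdet_def Gsum_def
    by (simp add: fps_sum_nth app_sum_left drp_sum of_int_nth drp_smul del: upt_Suc)
qed

end

section \<open>Triangularity of the Dunkl operators\<close>

text \<open>A transposition of distant positions is a shorter one conjugated by an adjacent one;
  three sign changes leave one.\<close>

lemma transposition_antisymmetry:
  fixes h :: "(nat \<Rightarrow> 'a) \<Rightarrow> (nat \<Rightarrow> 'b) \<Rightarrow> complex"
  assumes adj: "\<And>i e c. Suc i < n \<Longrightarrow> h (e \<circ> tr i (Suc i)) (c \<circ> tr i (Suc i)) = - h e c"
  shows "a < b \<Longrightarrow> b < n \<Longrightarrow> h (e \<circ> tr a b) (c \<circ> tr a b) = - h e c"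
proof (induction b arbitrary: e c)
  case (Suc b)
  show ?case
  proof (cases "a = b")
    case True
    have "h (e \<circ> tr b (Suc b)) (c \<circ> tr b (Suc b)) = - h e c" by (rule adj) (use Suc.prems in simp)
    then show ?thesis by (simp only: True)
  next
    case False
    then have ab: "a < b" "b < n" using Suc.prems by auto
    have t: "tr a (Suc b) = tr b (Suc b) \<circ> tr a b \<circ> tr b (Suc b)"
      using ab by (auto simp: fun_eq_iff Transposition.transpose_def)
    have "h (e \<circ> tr a (Suc b)) (c \<circ> tr a (Suc b))
        = h (((e \<circ> tr b (Suc b)) \<circ> tr a b) \<circ> tr b (Suc b)) (((c \<circ> tr b (Suc b)) \<circ> tr a b) \<circ> tr b (Suc b))"
      by (simp only: t comp_assoc)
    also have "\<dots> = - h ((e \<circ> tr b (Suc b)) \<circ> tr a b) ((c \<circ> tr b (Suc b)) \<circ> tr a b)"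
      by (rule adj) (use Suc.prems in simp)
    also have "\<dots> = h (e \<circ> tr b (Suc b)) (c \<circ> tr b (Suc b))"
      by (subst Suc.IH[OF ab]) simp
    also have "\<dots> = - h e c"
      by (rule adj) (use Suc.prems in simp)
    finally show ?thesis .
  qed
qed simp

lemma permutation_antisymmetry:
  fixes h :: "(nat \<Rightarrow> 'a) \<Rightarrow> (nat \<Rightarrow> 'b) \<Rightarrow> complex"
  assumes adj: "\<And>i e c. Suc i < n \<Longrightarrow> h (e \<circ> tr i (Suc i)) (c \<circ> tr i (Suc i)) = - h e c"
    and w: "w permutes {..<n}"
  shows "h (e \<circ> w) (c \<circ> w) = of_int (sign w) * h e c"
proof -
  have "\<forall>e c. h (e \<circ> w) (c \<circ> w) = of_int (sign w) * h e c"
    using w finite_lessThan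
  proof (rule permutes_induct)
    fix a b p assume ab: "a \<in> {..<n}" "b \<in> {..<n}" "a \<noteq> b" and p: "p permutes {..<n}"
      and IH: "\<forall>e c. h (e \<circ> p) (c \<circ> p) = of_int (sign p) * h e c"
    have t: "h (e \<circ> tr a b) (c \<circ> tr a b) = - h e c" for e c
      using ab transposition_antisymmetry[of n h, OF adj, of a b] transposition_antisymmetry[of n h, OF adj, of b a]
      by (cases "a < b") (auto simp: transpose_commute)
    have s: "sign (tr a b \<circ> p) = - sign p"
      using ab p by (subst sign_compose) (auto simp: sign_swap_id permutation_swap_id intro: permutation_permutes[THEN iffD2])
    show "\<forall>e c. h (e \<circ> (tr a b \<circ> p)) (c \<circ> (tr a b \<circ> p)) = of_int (sign (tr a b \<circ> p)) * h e c"
      unfolding s comp_assoc[symmetric] by (simp add: IH t)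
  qed auto
  then show ?thesis by blast
qed

lemma sorting_permutation:
  fixes f :: "nat \<Rightarrow> int"
  shows "\<exists>w. w permutes {..<n} \<and> (\<forall>i j. i < j \<longrightarrow> j < n \<longrightarrow> f (w i) \<le> f (w j))"
proof -
  let ?xs = "map f [0..<n]"
  obtain p where p: "p permutes {..<length ?xs}" "permute_list p ?xs = sort ?xs"
    using mset_eq_permutation[of "sort ?xs" ?xs] by auto
  have nth: "sort ?xs ! i = f (p i)" if "i < n" for i
    using p that permutes_in_image[OF p(1), of i] by (simp add: p(2)[symmetric] permute_list_def)
  have "f (p i) \<le> f (p j)" if "i < j" "j < n" for i j
    using that nth[of i] nth[of j] sorted_nth_mono[of "sort ?xs" i j] by simp
  then show ?thesis using p(1) by (intro exI[of _ p]) auto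
qed

lemma standard_arrangement:
  fixes \<kappa> :: "nat \<Rightarrow> int" and a :: "nat \<Rightarrow> nat"
  assumes "inj_on \<kappa> {..<n}"
  shows "\<exists>w. w permutes {..<n} \<and> (\<forall>i j. i < j \<longrightarrow> j < n \<longrightarrow>
    a (w i) < a (w j) \<or> a (w i) = a (w j) \<and> \<kappa> (w i) < \<kappa> (w j))"
proof -
  \<comment> \<open>\<open>M\<close> exceeds every difference of two values of \<kappa>, so the
    lexicographic comparison becomes the comparison of the single integers
    \<open>a i * M + \<kappa> i\<close>.\<close>
  define M where "M = 2 * (\<Sum>i<n. \<bar>\<kappa> i\<bar>) + 1"
  have M: "\<kappa> j - \<kappa> i < M" "M > 0" if "i < n" "j < n" for i j
    using that member_le_sum[of i "{..<n}" "\<lambda>i. \<bar>\<kappa> i\<bar>"] member_le_sum[of j "{..<n}" "\<lambda>i. \<bar>\<kappa> i\<bar>"]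
    by (auto simp: M_def)
  obtain w where w: "w permutes {..<n}"
    and s: "\<And>i j. i < j \<Longrightarrow> j < n \<Longrightarrow> int (a (w i)) * M + \<kappa> (w i) \<le> int (a (w j)) * M + \<kappa> (w j)"
    using sorting_permutation[of n "\<lambda>i. int (a i) * M + \<kappa> i"] by blast
  have "a (w i) < a (w j) \<or> a (w i) = a (w j) \<and> \<kappa> (w i) < \<kappa> (w j)" if ij: "i < j" "j < n" for i j
  proof -
    have n: "w i < n" "w j < n" "w i \<noteq> w j"
      using ij permutes_in_image[OF w, of i] permutes_in_image[OF w, of j] permutes_inj[OF w]
      by (auto dest: injD)
    then have ne: "\<kappa> (w i) \<noteq> \<kappa> (w j)" using assms by (auto dest: inj_onD)
    have "\<not> a (w j) < a (w i)"
    proof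
      assume "a (w j) < a (w i)"
      then have "(int (a (w j)) + 1) * M \<le> int (a (w i)) * M"
        using M[OF n(1,2)] by (intro mult_right_mono) auto
      then show False using s[OF ij] M[OF n(1,2)] by (simp add: distrib_right)
    qed
    then show ?thesis using s[OF ij] ne by (cases "a (w i) = a (w j)") auto
  qed
  then show ?thesis using w by blast
qed

text \<open>Dominance of decreasing rearrangements, in a form that does not mention the rearrangement: the partial
  sums of the sorted sequence are recovered from the hinge sums by taking \<open>t\<close> to be an entry.\<close>
definition hinge :: "nat \<Rightarrow> (nat \<Rightarrow> int) \<Rightarrow> int \<Rightarrow> int" where
  "hinge n \<kappa> t = (\<Sum>i<n. max (\<kappa> i - t) 0)"

definition hle :: "nat \<Rightarrow> (nat \<Rightarrow> int) \<Rightarrow> (nat \<Rightarrow> int) \<Rightarrow> bool" where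
  "hle n \<kappa> \<kappa>' \<longleftrightarrow> (\<Sum>i<n. \<kappa> i) = (\<Sum>i<n. \<kappa>' i) \<and> (\<forall>t. hinge n \<kappa> t \<le> hinge n \<kappa>' t)"

lemma hle_cong:
  assumes "\<And>i. i < n \<Longrightarrow> \<kappa> i = \<kappa>' i"
  shows "hle n \<kappa> \<mu> \<longleftrightarrow> hle n \<kappa>' \<mu>" "hle n \<mu> \<kappa> \<longleftrightarrow> hle n \<mu> \<kappa>'"
  using assms by (auto simp: hle_def hinge_def)

lemma hle_permute:
  assumes w: "w permutes {..<n}"
  shows "hle n (\<lambda>i. \<kappa> (w i)) \<mu> \<longleftrightarrow> hle n \<kappa> \<mu>" "hle n \<mu> (\<lambda>i. \<kappa> (w i)) \<longleftrightarrow> hle n \<mu> \<kappa>"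
  unfolding hle_def hinge_def
  using sum.permute[OF w, of \<kappa>] sum.permute[OF w, of "\<lambda>i. max (\<kappa> i - t) 0" for t] by (simp_all add: comp_def)

lemma sum_two:
  fixes f :: "nat \<Rightarrow> int"
  assumes "p < n" "q < n" "p \<noteq> q"
  shows "(\<Sum>i<n. f i) = f p + f q + (\<Sum>i\<in>{..<n} - {p, q}. f i)"
proof -
  have "{..<n} = insert p (insert q ({..<n} - {p, q}))" using assms by auto
  then show ?thesis using assms
    by (metis (no_types, lifting) DiffD2 add.assoc finite_Diff finite_insert finite_lessThan insertI1 insert_commute insert_iff sum.insert)
qed

text \<open>Two entries are replaced by a pair with the same sum lying strictly below the larger
  one, so by convexity no hinge sum increases. One of them strictly decreases, which excludes that
  the result agrees with the bound \<mu>.\<close>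

lemma squeeze:
  assumes pq: "p < n" "q < n" "p \<noteq> q" and s: "\<kappa>' p + \<kappa>' q = \<kappa> p + \<kappa> q"
    and o: "\<And>i. i \<noteq> p \<Longrightarrow> i \<noteq> q \<Longrightarrow> i < n \<Longrightarrow> \<kappa>' i = \<kappa> i"
    and b: "\<kappa>' p < max (\<kappa> p) (\<kappa> q)" "\<kappa>' q < max (\<kappa> p) (\<kappa> q)"
    and h: "hle n \<kappa> \<mu>"
  shows "hle n \<kappa>' \<mu>" and "\<exists>i<n. \<kappa>' i \<noteq> \<mu> i"
proof -
  have r: "(\<Sum>i\<in>{..<n} - {p, q}. F (\<kappa>' i)) = (\<Sum>i\<in>{..<n} - {p, q}. F (\<kappa> i) :: int)" for F
    using o by (intro sum.cong refl) auto
  have le: "hinge n \<kappa>' t \<le> hinge n \<kappa> t" for t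
    unfolding hinge_def sum_two[OF pq] using s b r[of "\<lambda>x. max (x - t) 0"] by (auto simp: max_def split: if_splits)
  have eq: "(\<Sum>i<n. \<kappa>' i) = (\<Sum>i<n. \<kappa> i)"
    unfolding sum_two[OF pq] using s r[of "\<lambda>x. x"] by simp
  show "hle n \<kappa>' \<mu>" using h le eq order_trans unfolding hle_def by metis
  \<comment> \<open>At a threshold one below the larger entry, the new pair contributes nothing and
    the old pair at least one.\<close>
  have lt: "hinge n \<kappa>' (max (\<kappa> p) (\<kappa> q) - 1) < hinge n \<kappa> (max (\<kappa> p) (\<kappa> q) - 1)"
    unfolding hinge_def sum_two[OF pq] using s b r[of "\<lambda>x. max (x - (max (\<kappa> p) (\<kappa> q) - 1)) 0"]
    by (auto simp: max_def split: if_splits)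
  show "\<exists>i<n. \<kappa>' i \<noteq> \<mu> i"
  proof (rule ccontr)
    assume "\<not> (\<exists>i<n. \<kappa>' i \<noteq> \<mu> i)"
    then have "hinge n \<kappa>' t = hinge n \<mu> t" for t by (auto simp: hinge_def)
    then show False using h lt by (metis hle_def linorder_not_le)
  qed
qed

lemma hle_partial_sums:
  assumes h: "hle n \<kappa> \<mu>" and dec: "\<And>i j. i < j \<Longrightarrow> j < n \<Longrightarrow> \<mu> i > \<mu> j" and i: "i \<le> n"
  shows "(\<Sum>j<i. \<kappa> j) \<le> (\<Sum>j<i. \<mu> j)"
proof (cases "i = n")
  case True
  then show ?thesis using h by (simp add: hle_def)
next
  case False
  then have i: "i < n" using i by simp
  let ?t = "\<mu> i"
  have "hinge n \<mu> ?t = (\<Sum>j<n. if j < i then \<mu> j - ?t else 0)"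
    unfolding hinge_def
  proof (intro sum.cong refl)
    fix j assume "j \<in> {..<n}"
    then show "max (\<mu> j - ?t) 0 = (if j < i then \<mu> j - ?t else 0)"
      using dec[of j i] dec[of i j] i by (cases j i rule: linorder_cases) auto
  qed
  also have "\<dots> = (\<Sum>j<i. \<mu> j - ?t)"
    using i by (intro sum.mono_neutral_cong_right) auto
  finally have 1: "hinge n \<mu> ?t = (\<Sum>j<i. \<mu> j - ?t)" .
  have "(\<Sum>j<i. \<kappa> j - ?t) \<le> (\<Sum>j<i. max (\<kappa> j - ?t) 0)" by (intro sum_mono) simp
  also have "\<dots> \<le> hinge n \<kappa> ?t"
    unfolding hinge_def using i by (intro sum_mono2) auto
  also have "\<dots> \<le> hinge n \<mu> ?t" using h by (simp add: hle_def)
  finally show ?thesis by (simp add: 1 sum_subtractf)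
qed

section \<open>Triangular operators on exponents\<close>

text \<open>Vectors as left behind by a bra, with all colours zero. Real coefficients are required,
  since reality of the expansion coefficients is part of the claim.\<close>

definition spn :: "(nat \<Rightarrow> int) set \<Rightarrow> pst set" where
  "spn V = {F. \<forall>x. lk F x \<in> \<real> \<and> (lk F x \<noteq> 0 \<longrightarrow> fst x \<in> V \<and> snd x = (\<lambda>_. 0))}"

abbreviation bs :: "(nat \<Rightarrow> int) \<Rightarrow> pst" where "bs e \<equiv> bas (e, \<lambda>_. 0)"

lemma spn_zero [simp]: "0 \<in> spn V"
  by (simp add: spn_def)

lemma spn_add: "F \<in> spn V \<Longrightarrow> G \<in> spn V \<Longrightarrow> F + G \<in> spn V"
  by (auto simp: spn_def lookup_add) (metis add_0 add_0_right)+

lemma spn_smul: "c \<in> \<real> \<Longrightarrow> F \<in> spn V \<Longrightarrow> smul c F \<in> spn V"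
  by (auto simp: spn_def)

lemma spn_uminus: "F \<in> spn V \<Longrightarrow> - F \<in> spn V"
  by (auto simp: spn_def)

lemma spn_sum: "(\<And>x. x \<in> X \<Longrightarrow> f x \<in> spn V) \<Longrightarrow> (\<Sum>x\<in>X. f x) \<in> spn V"
  by (induction X rule: infinite_finite_induct) (auto intro: spn_add)

lemma spn_bs: "e \<in> V \<Longrightarrow> bs e \<in> spn V"
  by (simp add: spn_def lookup_bas)

lemma spn_mono: "F \<in> spn V \<Longrightarrow> V \<subseteq> W \<Longrightarrow> F \<in> spn W"
  by (auto simp: spn_def)

lemma spn_app:
  assumes "\<And>e. e \<in> V \<Longrightarrow> app M (bs e) \<in> spn W" "F \<in> spn V"
  shows "app M F \<in> spn W"
proof -
  have "app M F = (\<Sum>x\<in>ks F. smul (lk F x) (app M (bas x)))"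
    by (subst pst_expand[of F]) (simp add: app_sum app_smul)
  moreover have "smul (lk F x) (app M (bas x)) \<in> spn W" if "x \<in> ks F" for x
  proof (rule spn_smul)
    show "lk F x \<in> \<real>" using assms(2) unfolding spn_def by blast
    obtain e c where x: "x = (e, c)" by force
    have "lk F (e, c) \<noteq> 0" using that by (simp add: x in_keys_iff)
    then have "e \<in> V \<and> c = (\<lambda>_. 0)" using assms(2) unfolding spn_def by fastforce
    then show "app M (bas x) \<in> spn W" using assms(1) by (simp add: x)
  qed
  ultimately show ?thesis by (simp add: spn_sum)
qed

definition apx :: "endo \<Rightarrow> complex \<Rightarrow> (nat \<Rightarrow> int) \<Rightarrow> (nat \<Rightarrow> int) set \<Rightarrow> bool" where
  "apx M c e U \<longleftrightarrow> c \<in> \<real> \<and> app M (bs e) - smul c (bs e) \<in> spn U"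

lemma apx_zero: "apx 0 0 e U"
  by (simp add: apx_def)

lemma apx_scalar: "c \<in> \<real> \<Longrightarrow> app M (bs e) = smul c (bs e) \<Longrightarrow> apx M c e U"
  by (simp add: apx_def)

lemma apx_add:
  assumes "apx M c e U" "apx M' c' e U"
  shows "apx (M + M') (c + c') e U"
proof -
  have "app (M + M') (bs e) - smul (c + c') (bs e)
      = (app M (bs e) - smul c (bs e)) + (app M' (bs e) - smul c' (bs e))"
    by (simp add: smul_left_add)
  then show ?thesis using assms spn_add unfolding apx_def by (metis Reals_add)
qed

lemma apx_uminus: 
  assumes "apx M c e U"
  shows "apx (- M) (- c) e U"
proof -
  have "app (- M) (bs e) - smul (- c) (bs e) = - (app M (bs e) - smul c (bs e))"
    by (rule poly_mapping_eqI) (simp add: lookup_minus)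
  then show ?thesis using assms spn_uminus unfolding apx_def by (metis Reals_minus_iff)
qed

lemma apx_diff: "apx M c e U \<Longrightarrow> apx M' c' e U \<Longrightarrow> apx (M - M') (c - c') e U"
  using apx_add[of M c e U "- M'" "- c'"] apx_uminus by simp

lemma apx_sum: "(\<And>x. x \<in> X \<Longrightarrow> apx (M x) (c x) e U) \<Longrightarrow> apx (\<Sum>x\<in>X. M x) (\<Sum>x\<in>X. c x) e U"
  by (induction X rule: infinite_finite_induct) (auto simp: apx_zero apx_add)

lemma apx_mono: "apx M c e U \<Longrightarrow> U \<subseteq> W \<Longrightarrow> apx M c e W"
  using spn_mono by (auto simp: apx_def)

text \<open>\<open>c\<close> is a diagonal entry of \<open>M\<close> at \<open>e\<close> modulo
  \<open>U\<close>. Invariance of \<open>U\<close> is what makes such statements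
  multiplicative.\<close>

definition dg :: "endo \<Rightarrow> complex \<Rightarrow> (nat \<Rightarrow> int) \<Rightarrow> (nat \<Rightarrow> int) set \<Rightarrow> bool" where
  "dg M c e U \<longleftrightarrow> apx M c e U \<and> (\<forall>F\<in>spn U. app M F \<in> spn U)"

lemma dgI:
  assumes "apx M c e U" "\<And>e. e \<in> U \<Longrightarrow> apx M (c' e) e U"
  shows "dg M c e U"
proof -
  have "app M (bs e) \<in> spn U" if "e \<in> U" for e
  proof -
    have "(app M (bs e) - smul (c' e) (bs e)) + smul (c' e) (bs e) \<in> spn U"
      using assms(2)[OF that] that by (intro spn_add spn_smul spn_bs) (auto simp: apx_def)
    then show ?thesis by simp
  qed
  then show ?thesis using assms(1) spn_app unfolding dg_def by blast
qed

lemma dg_zero: "dg 0 0 e U"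
  by (simp add: dg_def apx_zero)

lemma dg_one: "dg 1 1 e U"
  by (simp add: dg_def apx_def)

lemma dg_add: "dg M c e U \<Longrightarrow> dg M' c' e U \<Longrightarrow> dg (M + M') (c + c') e U"
  by (simp add: dg_def apx_add spn_add)

lemma dg_uminus: "dg M c e U \<Longrightarrow> dg (- M) (- c) e U"
  by (simp add: dg_def apx_uminus spn_uminus)

lemma dg_sum: "(\<And>x. x \<in> X \<Longrightarrow> dg (M x) (c x) e U) \<Longrightarrow> dg (\<Sum>x\<in>X. M x) (\<Sum>x\<in>X. c x) e U"
  by (induction X rule: infinite_finite_induct) (auto simp: dg_zero dg_add)

lemma dg_mult:
  assumes "dg M c e U" "dg M' c' e U"
  shows "dg (M * M') (c * c') e U"
proof -
  have "app (M * M') (bs e) - smul (c * c') (bs e)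
      = app M (app M' (bs e) - smul c' (bs e)) + smul c' (app M (bs e) - smul c (bs e))"
    by (simp add: app_minus app_smul smul_minus mult.commute)
  moreover have "\<dots> \<in> spn U"
    using assms by (intro spn_add spn_smul) (auto simp: dg_def apx_def)
  ultimately show ?thesis using assms by (auto simp: dg_def apx_def)
qed

lemma dg_power: "dg M c e U \<Longrightarrow> dg (M ^ k) (c ^ k) e U"
  by (induction k) (auto simp: dg_one dg_mult)

definition dgs :: "endo fps \<Rightarrow> complex fps \<Rightarrow> (nat \<Rightarrow> int) \<Rightarrow> (nat \<Rightarrow> int) set \<Rightarrow> bool" where
  "dgs Y y e U \<longleftrightarrow> (\<forall>s. dg (Y $ s) (y $ s) e U)"

lemma dgs_one: "dgs 1 1 e U"
  by (simp add: dgs_def dg_one dg_zero)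

lemma dgs_mult: "dgs Y y e U \<Longrightarrow> dgs Z z e U \<Longrightarrow> dgs (Y * Z) (y * z) e U"
  by (auto simp: dgs_def fps_mult_nth intro!: dg_sum dg_mult)

lemma dgs_prod_list:
  "(\<And>i. i \<in> set is \<Longrightarrow> dgs (Y i) (y i) e U) \<Longrightarrow> dgs (prod_list (map Y is)) (prod_list (map y is)) e U"
  by (induction "is") (auto simp: dgs_one dgs_mult)

text \<open>The off-diagonal terms of the divided differences: two exponents are moved towards each other, or
  exchanged when the left one is larger.\<close>
definition move :: "nat \<Rightarrow> (nat \<Rightarrow> int) \<Rightarrow> (nat \<Rightarrow> int) \<Rightarrow> bool" where
  "move n e e' \<longleftrightarrow> (\<exists>p q x. p < q \<and> q < n \<and> e' = e(q := x, p := e q + e p - x) \<and>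
     (e q < x \<and> x \<le> e p \<or> e p < x \<and> x < e q))"

lemma moveI:
  "p < q \<Longrightarrow> q < n \<Longrightarrow> e q < x \<and> x \<le> e p \<or> e p < x \<and> x < e q \<Longrightarrow> move n e (e(q := x, p := e q + e p - x))"
  unfolding move_def by blast

text \<open>If \<open>e p < e q\<close>, the endpoint of the geometric sum reproduces
  \<open>e\<close> itself with coefficient -1. If \<open>e q < e p\<close>, the sum contains the
  exchanged exponents but not \<open>e\<close>, so there is no diagonal term.\<close>

lemma apx_tau:
  assumes "p < q" "q < n"
  shows "apx (tau q p) (- of_bool (e p < e q)) e {e'. move n e e'}"
proof (cases "e q < e p")
  case True
  have "(\<Sum>x\<in>{e q<..e p}. bs (e(q := x, p := e q + e p - x))) \<in> spn {e'. move n e e'}"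
    using assms by (intro spn_sum spn_bs CollectI moveI) auto
  then show ?thesis using True by (auto simp: apx_def tau_def)
next
  case False
  show ?thesis
  proof (cases "e p = e q")
    case True
    then show ?thesis by (simp add: apx_def tau_def)
  next
    case False
    then have pq: "e p < e q" using \<open>\<not> e q < e p\<close> by simp
    then have i: "{e p<..e q} = insert (e q) {e p<..<e q}" by auto
    have m: "(\<Sum>x\<in>{e p<..<e q}. bs (e(q := x, p := e q + e p - x))) \<in> spn {e'. move n e e'}"
      using assms by (intro spn_sum spn_bs CollectI moveI) auto
    have "app (tau q p) (bs e) = - (bs e + (\<Sum>x\<in>{e p<..<e q}. bs (e(q := x, p := e q + e p - x))))"
      using pq assms by (simp add: tau_def i)
    then have "app (tau q p) (bs e) - smul (- 1) (bs e) = - (\<Sum>x\<in>{e p<..<e q}. bs (e(q := x, p := e q + e p - x)))"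
      by (simp add: poly_mapping_eq_iff fun_eq_iff lookup_minus lookup_add)
    then show ?thesis using m pq by (simp add: apx_def spn_uminus)
  qed
qed

text \<open>The Dunkl eigenvalue before simplification: the sums count pairs of positions according
  to the order of their exponents. \<open>dval_standard\<close> evaluates the count.\<close>

definition dval :: "nat \<Rightarrow> real \<Rightarrow> (nat \<Rightarrow> int) \<Rightarrow> nat \<Rightarrow> complex" where
  "dval n \<beta> e i = of_real (1 / \<beta> * of_int (e i)) + of_nat (n - Suc i)
     + (\<Sum>j\<in>{i+1..<n}. - of_bool (e i < e j)) - (\<Sum>j\<in>{0..<i}. - of_bool (e j < e i))"

lemma apx_dx:
  assumes "i < n"
  shows "apx (dx n \<beta> i) (dval n \<beta> e i) e {e'. move n e e'}"
  unfolding dx_eq[OF assms] dval_def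
proof (intro apx_add apx_diff apx_sum)
  show "apx (sc (of_real (1 / \<beta>)) * Dx i) (of_real (1 / \<beta> * of_int (e i))) e {e'. move n e e'}"
    by (rule apx_scalar) (auto simp: Dx_def)
  show "apx (of_nat (n - Suc i)) (of_nat (n - Suc i)) e {e'. move n e e'}"
    by (rule apx_scalar) auto
  show "apx (tau j i) (- of_bool (e i < e j)) e {e'. move n e e'}" if "j \<in> {i+1..<n}" for j
    by (rule apx_tau) (use that in auto)
  show "apx (tau i j) (- of_bool (e j < e i)) e {e'. move n e e'}" if "j \<in> {0..<i}" for j
    by (rule apx_tau) (use that assms in auto)
qed

lemma dg_dx:
  assumes "i < n" "\<And>e'. move n e e' \<Longrightarrow> e' \<in> U" "\<And>e' e''. e' \<in> U \<Longrightarrow> move n e' e'' \<Longrightarrow> e'' \<in> U"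
  shows "dg (dx n \<beta> i) (dval n \<beta> e i) e U"
proof (rule dgI)
  show "apx (dx n \<beta> i) (dval n \<beta> e i) e U"
    by (rule apx_mono[OF apx_dx]) (use assms in auto)
  show "apx (dx n \<beta> i) (dval n \<beta> e' i) e' U" if "e' \<in> U" for e'
    by (rule apx_mono[OF apx_dx]) (use assms that in auto)
qed

section \<open>Integer sequences and dominance\<close>

lemma under_bounds: "N \<ge> 1 \<Longrightarrow> 1 \<le> under N k \<and> under N k \<le> int N"
  unfolding under_def by (smt (verit) of_nat_1 of_nat_mono pos_mod_bound pos_mod_sign)

lemma under_over: "under N k - int N * over N k = k"
proof -
  have "under N k - k = int N * (- ((k - 1) div int N))"
    unfolding under_def using minus_mult_div_eq_mod[of "k - 1" "int N"] by (simp add: algebra_simps)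
  then have "int N dvd under N k - k" by simp
  then show ?thesis by (simp add: over_def)
qed

lemma under_over_unique:
  assumes "a \<in> {1..N}"
  shows "under N (int a - int N * e) = int a" "over N (int a - int N * e) = e"
proof -
  have "(int a - int N * e - 1) mod int N = (int a - 1 + (- e) * int N) mod int N" by (simp add: algebra_simps)
  also have "\<dots> = (int a - 1) mod int N" by (rule mod_mult_self1)
  also have "\<dots> = int a - 1" using assms by (intro mod_pos_pos_trivial) auto
  finally show u: "under N (int a - int N * e) = int a" by (simp add: under_def)
  show "over N (int a - int N * e) = e" using assms unfolding over_def u by simp
qed

lemma filter_append_filter_not:
  "sorted_wrt (\<lambda>x y. P y \<longrightarrow> P x) xs \<Longrightarrow> filter P xs @ filter (\<lambda>x. \<not> P x) xs = xs"
proof (induction xs)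
  case (Cons x xs)
  then show ?case by (cases "P x") (auto simp: filter_empty_conv filter_id_conv)
qed simp

definition kap :: "nat \<Rightarrow> (nat \<Rightarrow> nat) \<Rightarrow> (nat \<Rightarrow> int) \<Rightarrow> nat \<Rightarrow> int" where
  "kap N a e i = int (a i) - int N * e i"

definition colsorted :: "nat \<Rightarrow> nat \<Rightarrow> (nat \<Rightarrow> nat) \<Rightarrow> bool" where
  "colsorted n N a \<longleftrightarrow> (\<forall>i j. i < j \<longrightarrow> j < n \<longrightarrow> a i \<le> a j) \<and> (\<forall>i<n. a i \<in> {1..N})"

text \<open>Ascending colours differ by less than \<open>N\<close> between two sites, so the order
  of exponents decides the order of the integers up to ties. Every move then pulls the two integers
  strictly below the larger one, except the exchange of two sites of equal colour.\<close>

lemma move_hle: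
  assumes a: "colsorted n N a" and m: "move n e e'" and h: "hle n (kap N a e) \<mu>"
  shows "hle n (kap N a e') \<mu> \<and> ((\<exists>i<n. kap N a e' i \<noteq> \<mu> i) \<or>
    (\<exists>p q. p < q \<and> q < n \<and> a p = a q \<and> kap N a e' p > kap N a e' q))"
proof -
  obtain p q x where pq: "p < q" "q < n" and e': "e' = e(q := x, p := e q + e p - x)"
    and x: "e q < x \<and> x \<le> e p \<or> e p < x \<and> x < e q"
    using m unfolding move_def by blast
  have n: "p < n" "q < n" "p \<noteq> q" using pq by auto
  have ap: "int (a p) \<le> int (a q)" "int (a q) < int (a p) + int N" "int N > 0"
    using a n pq unfolding colsorted_def by (force, smt (verit) atLeastAtMost_iff of_nat_1 of_nat_le_iff, force)
  have k': "kap N a e' q = int (a q) - int N * x" "kap N a e' p = int (a p) - int N * (e q + e p - x)"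
    and o: "\<And>i. i \<noteq> p \<Longrightarrow> i \<noteq> q \<Longrightarrow> kap N a e' i = kap N a e i"
    using n by (auto simp: kap_def e')
  have s: "kap N a e' p + kap N a e' q = kap N a e p + kap N a e q"
    unfolding k' by (simp add: kap_def algebra_simps)
  have mono: "int N * y + int N \<le> int N * z" if "y < z" for y z
  proof -
    have "int N * (y + 1) \<le> int N * z" using that by (intro mult_left_mono) auto
    then show ?thesis by (simp add: algebra_simps)
  qed
  show ?thesis
  \<comment> \<open>The exceptional exchange keeps the multiset of integers and leaves the larger
    one on the left; the second alternative of the conclusion records this.\<close>
  proof (cases "a p = a q \<and> x = e p \<and> e q < e p")
    case True
    then have sw: "kap N a e' p = kap N a e q" "kap N a e' q = kap N a e p"
      unfolding k' by (simp_all add: kap_def)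
    have "(\<Sum>i<n. F (kap N a e' i)) = (\<Sum>i<n. F (kap N a e i) :: int)" for F
    proof -
      have "(\<Sum>i\<in>{..<n} - {p, q}. F (kap N a e' i)) = (\<Sum>i\<in>{..<n} - {p, q}. F (kap N a e i))"
        using o by (intro sum.cong refl) auto
      then show ?thesis unfolding sum_two[OF n] sw by simp
    qed
    from this[of "\<lambda>y. y"] this[of "\<lambda>y. max (y - t) 0" for t]
    have "hle n (kap N a e') \<mu>" using h by (simp add: hle_def hinge_def)
    moreover have "kap N a e' q < kap N a e' p"
      unfolding sw using True mono[of "e q" "e p"] ap by (simp add: kap_def)
    ultimately show ?thesis using True pq by blast
  next
    case False
    have "kap N a e' p < max (kap N a e p) (kap N a e q) \<and> kap N a e' q < max (kap N a e p) (kap N a e q)"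
    proof (cases "e q < x \<and> x \<le> e p")
      case True
      have "kap N a e' q < kap N a e q"
        unfolding k' using mono[of "e q" x] True ap by (simp add: kap_def)
      moreover have "kap N a e' p < kap N a e q"
      proof (cases "x = e p")
        case xe: True
        then show ?thesis unfolding k' using False True ap by (simp add: kap_def)
      next
        case xe: False
        then show ?thesis unfolding k' using mono[of "e q" "e q + e p - x"] True ap by (simp add: kap_def)
      qed
      ultimately show ?thesis by linarith
    next
      case False
      then have c: "e p < x" "x < e q" using x by auto
      have "kap N a e' q < kap N a e p"
        unfolding k' using mono[of "e p" x] c ap by (simp add: kap_def)
      moreover have "kap N a e' p < kap N a e p"
        unfolding k' using mono[of "e p" "e q + e p - x"] c ap by (simp add: kap_def)
      ultimately show ?thesis by linarith
    qed
    then show ?thesis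
      using squeeze[OF n s o _ _ h] by blast
  qed
qed

lemma sum_list_take: "i \<le> length l \<Longrightarrow> sum_list (take i l) = (\<Sum>j<i. l ! j)" for l :: "int list"
  by (simp add: sum_list_sum_nth min_def atLeast0LessThan)

lemma Lset_less:
  assumes "k \<in> Lset n" "i < j" "j < n"
  shows "k ! j < k ! i"
  using assms(2,3)
proof (induction j)
  case (Suc j)
  have "k ! Suc j < k ! j" using assms(1) Suc.prems by (simp add: Lset_def)
  then show ?case using Suc by (cases "i = j") auto
qed simp

lemma Lset_length: "k \<in> Lset n \<Longrightarrow> length k = n"
  by (simp add: Lset_def)

lemma Lset_inj: "k \<in> Lset n \<Longrightarrow> i < n \<Longrightarrow> j < n \<Longrightarrow> k ! i = k ! j \<longleftrightarrow> i = j"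
  using Lset_less[of k n i j] Lset_less[of k n j i] by (cases i j rule: linorder_cases) auto

lemma Lset_eqI:
  assumes "k \<in> Lset n" "l \<in> Lset n" "set k = set l"
  shows "k = l"
proof -
  have "sorted_wrt (\<lambda>x y. y < x) k \<and> sorted_wrt (\<lambda>x y. y < x) l"
    using assms(1,2) Lset_less Lset_length unfolding sorted_wrt_iff_nth_less by metis
  then have "sorted_wrt (<) (rev k) \<and> sorted_wrt (<) (rev l)" by (simp add: sorted_wrt_rev)
  then have "rev k = rev l"
    using assms(3) by (intro strict_sorted_equal) auto
  then show ?thesis by simp
qed

lemma hle_dom_less:
  assumes k: "k \<in> Lset n" and l: "l \<in> Lset n" and h: "hle n ((!) l) ((!) k)"
  shows "l = k \<or> dom_less l k"
proof -
  have s: "(\<Sum>j<i. l ! j) \<le> (\<Sum>j<i. k ! j)" if "i \<le> n" for i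
    using hle_partial_sums[OF h _ that] Lset_less[OF k] by blast
  have "sum_list l = sum_list k"
    using h Lset_length[OF k] Lset_length[OF l] by (simp add: sum_list_sum_nth atLeast0LessThan hle_def)
  then show ?thesis
    using s Lset_length[OF k] Lset_length[OF l] by (auto simp: dom_less_def sum_list_take)
qed

text \<open>Partial sums bound the first entry from above and, with equality of the total sums, the
  last entry from below; a decreasing sequence lies between them.\<close>

lemma finite_dom_less: "finite {l \<in> Lset n. dom_less l k}"
proof (cases "length k = n \<and> n > 0")
  case False
  then have "{l \<in> Lset n. dom_less l k} \<subseteq> {[]}" by (auto simp: dom_less_def Lset_def)
  then show ?thesis using finite_subset by blast
next
  case True
  then obtain n' where n': "n = Suc n'" by (cases n) auto
  have "set l \<subseteq> {k ! n'..k ! 0}" if l: "l \<in> Lset n" and d: "dom_less l k" for l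
  proof -
    have sums: "(\<Sum>j<i. l ! j) \<le> (\<Sum>j<i. k ! j)" if "i \<le> n" for i
      using d that True Lset_length[OF l] by (auto simp: dom_less_def sum_list_take)
    have "(\<Sum>j<n. l ! j) = (\<Sum>j<n. k ! j)"
      using d True Lset_length[OF l] by (auto simp: dom_less_def sum_list_sum_nth atLeast0LessThan)
    then have b: "l ! 0 \<le> k ! 0" "l ! n' \<ge> k ! n'"
      using sums[of 1] sums[of n'] n' by simp_all
    have "l ! i \<le> l ! 0" "l ! n' \<le> l ! i" if "i < n" for i
      using that Lset_less[OF l, of 0 i] Lset_less[OF l, of i n'] n' by (cases "i = 0"; cases "i = n'"; force)+
    then show ?thesis using b Lset_length[OF l] by (force simp: in_set_conv_nth)
  qed
  then have "{l \<in> Lset n. dom_less l k} \<subseteq> {l. set l \<subseteq> {k ! n'..k ! 0} \<and> length l = n}"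
    using Lset_length by blast
  then show ?thesis using finite_lists_length_eq[of "{k ! n'..k ! 0}" n] finite_subset by blast
qed

lemma dom_less_trans: "dom_less a b \<Longrightarrow> dom_less b c \<Longrightarrow> a \<noteq> c \<Longrightarrow> dom_less a c"
  unfolding dom_less_def by (auto intro: order_trans)

lemma dom_less_asym:
  assumes "dom_less a b" "dom_less b a"
  shows False
proof -
  have len: "length a = length b" using assms by (simp add: dom_less_def)
  have eq: "sum_list (take i a) = sum_list (take i b)" if "i \<le> length a" for i
    using assms that unfolding dom_less_def by (simp add: order_antisym)
  have "a ! i = b ! i" if "i < length a" for i
    using eq[of i] eq[of "Suc i"] that len by (simp add: take_Suc_conv_app_nth)
  then have "a = b" using len by (simp add: list_eq_iff_nth_eq)
  then show False using assms by (simp add: dom_less_def)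
qed

lemma dom_less_trans': "dom_less a b \<Longrightarrow> dom_less b c \<Longrightarrow> dom_less a c"
  using dom_less_trans dom_less_asym by blast

section \<open>The antisymmetric subspace\<close>

lemma commute_mult: "a * z = z * a \<Longrightarrow> b * z = z * b \<Longrightarrow> (a * b) * z = z * (a * b)" for a :: "'a::semigroup_mult"
  by (metis mult.assoc)

lemma comp_perm_eq:
  assumes "w permutes A"
  shows "f \<circ> w = g \<circ> w \<longleftrightarrow> f = g"
  using permutes_surj[OF assms] by (metis fun.map_comp surj_fun_eq comp_id surj_iff comp_assoc)

lemma sign_of_int_square: "of_int (sign w) * (of_int (sign w) * x) = (x::complex)"
  by (simp add: sign_def)

lemma perm_lt: "w permutes {..<n} \<Longrightarrow> w i < n \<longleftrightarrow> i < n"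
  using permutes_in_image[of w "{..<n}" i] by simp

context cs
begin

text \<open>Configurations \<open>(e, c)\<close> correspond to integer sequences through \<open>k\<^sub>i = c\<^sub>i - N e\<^sub>i\<close>.\<close>
definition pe :: "int list \<Rightarrow> nat \<Rightarrow> int" where
  "pe k = (\<lambda>i. if i < n then over N (k ! i) else 0)"

definition pc :: "int list \<Rightarrow> nat \<Rightarrow> nat" where
  "pc k = (\<lambda>i. if i < n then nat (under N (k ! i)) else 0)"

definition okx :: "(nat \<Rightarrow> int) \<Rightarrow> (nat \<Rightarrow> nat) \<Rightarrow> bool" where
  "okx e c \<longleftrightarrow> (\<forall>i<n. c i \<in> {1..N}) \<and> (\<forall>i\<ge>n. e i = 0 \<and> c i = 0)"

definition Fv :: "pst set" where
  "Fv = {F. (\<forall>e c. lk F (e, c) \<noteq> 0 \<longrightarrow> okx e c) \<and>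
     (\<forall>w e c. w permutes {..<n} \<longrightarrow> lk F (e \<circ> w, c \<circ> w) = of_int (sign w) * lk F (e, c))}"

definition uh :: "int list \<Rightarrow> pst" where
  "uh k = (\<Sum>w | w permutes {..<n}. smul (of_int (sign w)) (bas (pe k \<circ> w, pc k \<circ> w)))"

lemma Fv_perm: "F \<in> Fv \<Longrightarrow> w permutes {..<n} \<Longrightarrow> lk F (e \<circ> w, c \<circ> w) = of_int (sign w) * lk F (e, c)"
  by (simp add: Fv_def)

lemma Fv_zero: "0 \<in> Fv"
  by (simp add: Fv_def)

lemma Fv_okx: "F \<in> Fv \<Longrightarrow> lk F (e, c) \<noteq> 0 \<Longrightarrow> okx e c"
  by (simp add: Fv_def)

lemma FvI:
  "(\<And>e c. lk F (e, c) \<noteq> 0 \<Longrightarrow> okx e c) \<Longrightarrow>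
   (\<And>w e c. w permutes {..<n} \<Longrightarrow> lk F (e \<circ> w, c \<circ> w) = of_int (sign w) * lk F (e, c)) \<Longrightarrow> F \<in> Fv"
  by (simp add: Fv_def)

lemma Fv_add:
  assumes "F \<in> Fv" "G \<in> Fv"
  shows "F + G \<in> Fv"
proof (rule FvI)
  fix e c assume "lk (F + G) (e, c) \<noteq> 0"
  then have "lk F (e, c) \<noteq> 0 \<or> lk G (e, c) \<noteq> 0" by (auto simp: lookup_add)
  then show "okx e c" using assms Fv_okx by blast
qed (simp add: lookup_add distrib_left Fv_perm assms)

lemma Fv_smul: "F \<in> Fv \<Longrightarrow> smul z F \<in> Fv"
  by (rule FvI) (auto simp: Fv_perm Fv_okx)

lemma Fv_uminus: "F \<in> Fv \<Longrightarrow> - F \<in> Fv"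
  by (simp add: Fv_def)

lemma Fv_minus: "F \<in> Fv \<Longrightarrow> G \<in> Fv \<Longrightarrow> F - G \<in> Fv"
  using Fv_add[of F "- G"] Fv_uminus by simp

lemma Fv_sum: "(\<And>x. x \<in> X \<Longrightarrow> f x \<in> Fv) \<Longrightarrow> (\<Sum>x\<in>X. f x) \<in> Fv"
  by (induction X rule: infinite_finite_induct) (auto intro: Fv_zero Fv_add)

lemma lk_uh: "lk (uh k) (e, c) = (\<Sum>w | w permutes {..<n}. of_int (sign w) * of_bool (pe k \<circ> w = e \<and> pc k \<circ> w = c))"
  unfolding uh_def lookup_sum' by (intro sum.cong refl) (auto simp: lookup_bas)

lemma uh_nonzero: "lk (uh k) (e, c) \<noteq> 0 \<Longrightarrow> \<exists>w. w permutes {..<n} \<and> e = pe k \<circ> w \<and> c = pc k \<circ> w"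
  unfolding lk_uh by (smt (verit, ccfv_threshold) mem_Collect_eq mult_zero_right of_bool_eq(1) sum.neutral)

lemma pc_range: "N \<ge> 1 \<Longrightarrow> i < n \<Longrightarrow> pc k i \<in> {1..N}"
  using under_bounds[of N "k ! i"] by (auto simp: pc_def nat_le_iff)

lemma kap_pt: "N \<ge> 1 \<Longrightarrow> i < n \<Longrightarrow> int (pc k i) - int N * pe k i = k ! i"
  using under_bounds[of N "k ! i"] under_over[of N "k ! i"] by (simp add: pc_def pe_def)

lemma kap_pt_perm: "N \<ge> 1 \<Longrightarrow> w permutes {..<n} \<Longrightarrow> i < n \<Longrightarrow> kap N (pc k \<circ> w) (pe k \<circ> w) i = k ! w i"
  using kap_pt[of "w i"] perm_lt[of w n i] by (simp add: kap_def)

lemma uh_Fv: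
  assumes "N \<ge> 1"
  shows "uh k \<in> Fv"
proof (rule FvI)
  fix e c assume "lk (uh k) (e, c) \<noteq> 0"
  then obtain w where w: "w permutes {..<n}" "e = pe k \<circ> w" "c = pc k \<circ> w" using uh_nonzero by blast
  have "c i \<in> {1..N}" if "i < n" for i
    using w that perm_lt[OF w(1), of i] pc_range[OF assms, of "w i" k] by simp
  moreover have "e i = 0 \<and> c i = 0" if "i \<ge> n" for i
    using w that perm_lt[OF w(1), of i] by (simp add: pe_def pc_def)
  ultimately show "okx e c" by (simp add: okx_def)
next
  fix v :: "nat \<Rightarrow> nat" and e c assume v: "v permutes {..<n}"
  have "lk (uh k) (e \<circ> v, c \<circ> v)
      = (\<Sum>w | w permutes {..<n}. of_int (sign (w \<circ> v)) * of_bool (pe k \<circ> (w \<circ> v) = e \<circ> v \<and> pc k \<circ> (w \<circ> v) = c \<circ> v))"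
    unfolding lk_uh by (rule sum_permutations_compose_right[OF v])
  also have "\<dots> = (\<Sum>w | w permutes {..<n}. of_int (sign v) * (of_int (sign w) * of_bool (pe k \<circ> w = e \<and> pc k \<circ> w = c)))"
  proof (intro sum.cong refl)
    fix w assume "w \<in> {w. w permutes {..<n}}"
    then have "sign (w \<circ> v) = sign w * sign v"
      using v by (intro sign_compose) (auto intro: permutation_permutes[THEN iffD2])
    then show "of_int (sign (w \<circ> v)) * of_bool (pe k \<circ> (w \<circ> v) = e \<circ> v \<and> pc k \<circ> (w \<circ> v) = c \<circ> v)
       = of_int (sign v) * (of_int (sign w) * (of_bool (pe k \<circ> w = e \<and> pc k \<circ> w = c) :: complex))"
      unfolding comp_assoc[symmetric] comp_perm_eq[OF v] by simp
  qed
  finally show "lk (uh k) (e \<circ> v, c \<circ> v) = of_int (sign v) * lk (uh k) (e, c)"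
    by (simp add: lk_uh sum_distrib_left)
qed

text \<open>Two equal integers would mean equal exponents and equal colours at two sites, where
  antisymmetry forces a zero coefficient. The distinct integers can then be sorted.\<close>

lemma Fv_decreasing:
  assumes F: "F \<in> Fv" and nz: "lk F (e, c) \<noteq> 0"
  shows "\<exists>k\<in>Lset n. \<exists>w. w permutes {..<n} \<and> pe k = e \<circ> w \<and> pc k = c \<circ> w"
proof -
  define \<kappa> where "\<kappa> i = int (c i) - int N * e i" for i
  have c: "\<And>i. i < n \<Longrightarrow> c i \<in> {1..N}" and z: "\<And>i. i \<ge> n \<Longrightarrow> e i = 0 \<and> c i = 0"
    using Fv_okx[OF F nz] unfolding okx_def by blast+
  have u: "under N (\<kappa> i) = int (c i)" "over N (\<kappa> i) = e i" if "i < n" for i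
    using under_over_unique[OF c[OF that], of "e i"] by (simp_all add: \<kappa>_def)
  have inj: "i = j" if ij: "i < n" "j < n" "\<kappa> i = \<kappa> j" for i j
  proof (rule ccontr)
    assume "i \<noteq> j"
    have eq: "c i = c j" "e i = e j" using u[OF ij(1)] u[OF ij(2)] ij(3) by auto
    then have "e \<circ> tr i j = e" "c \<circ> tr i j = c" by (auto simp: fun_eq_iff Transposition.transpose_def)
    moreover have "lk F (e \<circ> tr i j, c \<circ> tr i j) = of_int (sign (tr i j)) * lk F (e, c)"
      using ij by (intro Fv_perm[OF F] permutes_swap_id) auto
    ultimately show False using nz \<open>i \<noteq> j\<close> by (simp add: sign_swap_id)
  qed
  obtain w where w: "w permutes {..<n}" and s: "\<And>i j. i < j \<Longrightarrow> j < n \<Longrightarrow> - \<kappa> (w i) \<le> - \<kappa> (w j)"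
    using sorting_permutation[of n "\<lambda>i. - \<kappa> i"] by blast
  let ?k = "map (\<lambda>i. \<kappa> (w i)) [0..<n]"
  have "\<kappa> (w j) < \<kappa> (w i)" if "i < j" "j < n" for i j
    using s[OF that] inj[of "w i" "w j"] perm_lt[OF w, of i] perm_lt[OF w, of j] that permutes_inj[OF w]
    by (cases "\<kappa> (w i) = \<kappa> (w j)") (auto dest: injD)
  then have "?k \<in> Lset n" by (simp add: Lset_def)
  moreover have "pe ?k = e \<circ> w" "pc ?k = c \<circ> w"
    using u z perm_lt[OF w] by (auto simp: pe_def pc_def fun_eq_iff) (meson not_less)+
  ultimately show ?thesis using w by blast
qed

lemma Fv_eqI:
  assumes F: "F \<in> Fv" "G \<in> Fv" and eq: "\<And>k. k \<in> Lset n \<Longrightarrow> lk F (pe k, pc k) = lk G (pe k, pc k)"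
  shows "F = G"
proof -
  have D: "F - G \<in> Fv" using F Fv_minus by blast
  have "lk (F - G) (e, c) = 0" for e c
  proof (rule ccontr)
    assume nz: "lk (F - G) (e, c) \<noteq> 0"
    obtain k w where k: "k \<in> Lset n" "w permutes {..<n}" "pe k = e \<circ> w" "pc k = c \<circ> w"
      using Fv_decreasing[OF D nz] by blast
    have "lk (F - G) (pe k, pc k) = of_int (sign w) * lk (F - G) (e, c)"
      using Fv_perm[OF D k(2)] k by simp
    then show False using nz eq[OF k(1)] by (simp add: lookup_minus sign_def split: if_splits)
  qed
  then have "F - G = 0" by (intro poly_mapping_eqI) auto
  then show ?thesis by simp
qed

lemma uh_inj:
  assumes N: "N \<ge> 1" and k: "k \<in> Lset n" "l \<in> Lset n" and w: "w permutes {..<n}"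
    and eq: "pe k \<circ> w = pe l" "pc k \<circ> w = pc l"
  shows "k = l" "w = id"
proof -
  have kl: "k ! w i = l ! i" if "i < n" for i
    using kap_pt_perm[OF N w that, of k] kap_pt[OF N that, of l] by (simp add: eq kap_def)
  have "set l = (\<lambda>i. l ! i) ` {..<n}" "set k = (\<lambda>i. k ! i) ` {..<n}"
    using k by (auto simp: Lset_def in_set_conv_nth)
  moreover have "(\<lambda>i. l ! i) ` {..<n} = (\<lambda>i. k ! i) ` (w ` {..<n})"
    unfolding image_image using kl by (intro image_cong) auto
  ultimately have "set k = set l" by (simp add: permutes_image[OF w])
  then show "k = l" using k Lset_eqI by blast
  then have "w i = i" if "i < n" for i
    using kl[OF that] Lset_inj[OF k(1), of "w i" i] that perm_lt[OF w, of i] by simp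
  then show "w = id" using w by (auto simp: fun_eq_iff permutes_def)
qed

lemma lk_uh_pt:
  assumes N: "N \<ge> 1" and k: "k \<in> Lset n" "l \<in> Lset n"
  shows "lk (uh k) (pe l, pc l) = (if k = l then 1 else 0)"
proof -
  have "lk (uh k) (pe l, pc l) = (\<Sum>w | w permutes {..<n}. if w = id then if k = l then 1 else 0 else 0)"
    unfolding lk_uh
  proof (intro sum.cong refl)
    fix w assume "w \<in> {w. w permutes {..<n}}"
    then show "of_int (sign w) * of_bool (pe k \<circ> w = pe l \<and> pc k \<circ> w = pc l) = (if w = id then if k = l then 1 else (0::complex) else 0)"
      using uh_inj[OF N k, of w] uh_inj(1)[OF N k permutes_id] by (auto simp: sign_id)
  qed
  also have "\<dots> = (if k = l then 1 else 0)"
    by (subst sum.delta) (auto simp: finite_permutations permutes_id)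
  finally show ?thesis .
qed

text \<open>The coefficients at the sorted configurations \<open>(pe k, pc k)\<close> are dual to
  the \<open>uh k\<close> by \<open>lk_uh_pt\<close>, and they determine an antisymmetric
  vector.\<close>

lemma Fv_expand:
  assumes N: "N \<ge> 1" and F: "F \<in> Fv"
  defines "Ks \<equiv> {k \<in> Lset n. lk F (pe k, pc k) \<noteq> 0}"
  shows "finite Ks" and "F = (\<Sum>k\<in>Ks. smul (lk F (pe k, pc k)) (uh k))"
proof -
  have "inj_on (\<lambda>k. (pe k, pc k)) Ks"
  proof (rule inj_onI)
    fix k l assume "k \<in> Ks" "l \<in> Ks" "(pe k, pc k) = (pe l, pc l)"
    then show "k = l" using uh_inj(1)[OF N, of k l id] by (simp add: Ks_def permutes_id)
  qed
  moreover have "(\<lambda>k. (pe k, pc k)) ` Ks \<subseteq> ks F" by (auto simp: Ks_def in_keys_iff)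
  ultimately show fin: "finite Ks" using finite_keys finite_subset finite_imageD by metis
  show "F = (\<Sum>k\<in>Ks. smul (lk F (pe k, pc k)) (uh k))"
  proof (rule Fv_eqI[OF F])
    show "(\<Sum>k\<in>Ks. smul (lk F (pe k, pc k)) (uh k)) \<in> Fv"
      by (intro Fv_sum Fv_smul uh_Fv N)
    fix l assume l: "l \<in> Lset n"
    have "lk (\<Sum>k\<in>Ks. smul (lk F (pe k, pc k)) (uh k)) (pe l, pc l)
        = (\<Sum>k\<in>Ks. if k = l then lk F (pe l, pc l) else 0)"
      unfolding lookup_sum' using l by (intro sum.cong refl) (auto simp: Ks_def lk_uh_pt[OF N])
    also have "\<dots> = lk F (pe l, pc l)" using l fin by (auto simp: Ks_def)
    finally show "lk F (pe l, pc l) = lk (\<Sum>k\<in>Ks. smul (lk F (pe k, pc k)) (uh k)) (pe l, pc l)" by simp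
  qed
qed

section \<open>Matrix elements of the quantum determinants\<close>

definition V :: "(nat \<Rightarrow> nat) \<Rightarrow> (nat \<Rightarrow> int) \<Rightarrow> (nat \<Rightarrow> int) set" where
  "V a \<mu> = {e. (\<forall>i\<ge>n. e i = 0 \<and> a i = 0) \<and> hle n (kap N a e) \<mu>}"

lemma V_move: "colsorted n N a \<Longrightarrow> e \<in> V a \<mu> \<Longrightarrow> move n e e' \<Longrightarrow> e' \<in> V a \<mu>"
  using move_hle[of n N a e e' \<mu>] by (auto simp: V_def move_def)

definition fac :: "complex \<Rightarrow> complex fps" where
  "fac c = Abs_fps (sc_factor c)"

lemma R_nth: "(1 + R i 0) $ s = (if s = 0 then 1 else (- dx n \<beta> i) ^ (s - 1))"
  by (simp add: R_def g_def)

definition Mf :: "nat \<Rightarrow> (nat \<Rightarrow> nat) \<Rightarrow> endo fps" where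
  "Mf m a = prod_list (map (\<lambda>i. 1 + R i 0) (filter (\<lambda>i. a i \<le> m) [0..<n]))"

abbreviation Y :: "nat \<Rightarrow> nat \<Rightarrow> endo" where
  "Y m s \<equiv> qdet m [0..<n] $ s"

text \<open>Ascending colours put the sites with colour at most \<open>m\<close> in front, which is
  the shape required by \<open>B_qdet\<close>.\<close>

lemma Bx_Y:
  assumes a: "colsorted n N a" and m: "m \<le> N"
  shows "app (Bx a) (app (Y m s) F) = app (Mf m a $ s) (app (Bx a) F)"
proof -
  have "filter (\<lambda>i. a i \<le> m) [0..<n] @ filter (\<lambda>i. \<not> a i \<le> m) [0..<n] = [0..<n]"
    by (rule filter_append_filter_not) (use a in \<open>force simp: colsorted_def sorted_wrt_iff_nth_less\<close>)
  moreover have "Bs a * qdet m (filter (\<lambda>i. a i \<le> m) [0..<n] @ filter (\<lambda>i. \<not> a i \<le> m) [0..<n]) = Mf m a * Bs a"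
    unfolding Mf_def by (rule B_qdet) (use a m in \<open>auto simp: colsorted_def\<close>)
  ultimately have "(Bs a * qdet m [0..<n]) $ s = (Mf m a * Bs a) $ s" by simp
  then have "Bx a * Y m s = Mf m a $ s * Bx a"
    by (simp add: Bs_def)
  then have "app (Bx a * Y m s) F = app (Mf m a $ s * Bx a) F" by simp
  then show ?thesis by simp
qed

lemma dgs_Mf:
  assumes "\<And>e'. move n e e' \<Longrightarrow> e' \<in> U" "\<And>e' e''. e' \<in> U \<Longrightarrow> move n e' e'' \<Longrightarrow> e'' \<in> U"
  shows "dgs (Mf m a) (prod_list (map (\<lambda>i. fac (dval n \<beta> e i)) (filter (\<lambda>i. a i \<le> m) [0..<n]))) e U"
  unfolding Mf_def
proof (rule dgs_prod_list)
  fix i assume "i \<in> set (filter (\<lambda>i. a i \<le> m) [0..<n])"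
  then have "dg (dx n \<beta> i) (dval n \<beta> e i) e U" using assms by (intro dg_dx) auto
  then have "dg ((- dx n \<beta> i) ^ s) ((- dval n \<beta> e i) ^ s) e U" for s by (intro dg_power dg_uminus)
  then show "dgs (1 + R i 0) (fac (dval n \<beta> e i)) e U"
    unfolding dgs_def R_nth by (simp add: fac_def sc_factor_def dg_one)
qed

lemma Bx_uh: "app (Bx a) (uh k) = (\<Sum>w | w permutes {..<n}. smul (of_int (sign w)) (if pc k \<circ> w = a then bs (pe k \<circ> w) else 0))"
  unfolding uh_def app_sum app_smul by (simp add: Bx_def)

lemma uh_V:
  assumes N: "N \<ge> 1" and w: "w permutes {..<n}"
  shows "pe k \<circ> w \<in> V (pc k \<circ> w) ((!) k)"
proof -
  have "hle n (\<lambda>i. k ! w i) ((!) k)"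
    unfolding hle_permute[OF w] by (simp add: hle_def)
  then have "hle n (kap N (pc k \<circ> w) (pe k \<circ> w)) ((!) k)"
    using hle_cong(1)[of n "kap N (pc k \<circ> w) (pe k \<circ> w)" "\<lambda>i. k ! w i"] kap_pt_perm[OF N w] by blast
  then show ?thesis using perm_lt[OF w] by (auto simp: V_def pe_def pc_def not_less)
qed

lemma Bx_Y_uh:
  assumes N: "N \<ge> 1" and a: "colsorted n N a" and m: "m \<le> N"
  shows "app (Bx a) (app (Y m s) (uh k)) \<in> spn (V a ((!) k))"
proof -
  have B: "app (Bx a) (uh k) \<in> spn (V a ((!) k))"
    unfolding Bx_uh using uh_V[OF N, of _ k] by (intro spn_sum spn_smul) (auto intro!: spn_bs)
  \<comment> \<open>\<open>dgs\<close> refers to a base point \<open>e\<close>; if there is none,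
    the bra of \<open>uh k\<close> is already zero.\<close>
  show ?thesis
  proof (cases "V a ((!) k) = {}")
    case True
    then have "app (Bx a) (uh k) = 0" using B by (intro poly_mapping_eqI) (auto simp: spn_def)
    then show ?thesis by (simp add: Bx_Y[OF a m])
  next
    case False
    then obtain e where e: "e \<in> V a ((!) k)" by blast
    have "dgs (Mf m a) (prod_list (map (\<lambda>i. fac (dval n \<beta> e i)) (filter (\<lambda>i. a i \<le> m) [0..<n]))) e (V a ((!) k))"
      by (rule dgs_Mf) (use V_move[OF a] e in blast)+
    then show ?thesis unfolding Bx_Y[OF a m] using B by (auto simp: dgs_def dg_def)
  qed
qed

lemma Prs_T:
  assumes "b \<in> {1..N}"
  shows "a \<in> {1..N} \<Longrightarrow> T r is a b * Prs = Prs * T r is a b"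
proof (induction "is" arbitrary: a)
  case Nil
  then show ?case by (simp add: of_bool_def)
next
  case (Cons i js)
  have "L i r a c * T r js c b * Prs = Prs * (L i r a c * T r js c b)" if "c \<in> {1..N}" for c
    by (rule commute_mult[OF Prs_L[OF Cons.prems that] Cons.IH[OF that]])
  then show ?case by (auto simp: sum_distrib_left sum_distrib_right intro!: sum.cong)
qed

lemma Prs_rows:
  "set ys \<subseteq> {1..N} \<Longrightarrow> (\<And>j. k < j \<Longrightarrow> j \<le> k + length ys \<Longrightarrow> w j \<in> {1..N}) \<Longrightarrow>
    rows is k ys w * Prs = Prs * rows is k ys w"
proof (induction ys arbitrary: k)
  case (Cons b ys)
  have 1: "T k is b (w (Suc k)) * Prs = Prs * T k is b (w (Suc k))"
    by (rule Prs_T) (use Cons.prems in auto)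
  have 2: "rows is (Suc k) ys w * Prs = Prs * rows is (Suc k) ys w"
    by (rule Cons.IH) (use Cons.prems in auto)
  show ?case unfolding rows.simps by (rule commute_mult[OF 1 2])
qed simp

lemma Prs_qdet:
  assumes m: "m \<le> N"
  shows "qdet m is * Prs = Prs * qdet m is"
proof -
  have "of_int (sign w) * (1 * rows is 0 [1..<m+1] w * 1) * Prs = Prs * (of_int (sign w) * (1 * rows is 0 [1..<m+1] w * 1))"
    if w: "w permutes {1..m}" for w
  proof -
    have r: "rows is 0 [1..<m+1] w * Prs = Prs * rows is 0 [1..<m+1] w"
    proof (rule Prs_rows)
      fix j assume "0 < j" "j \<le> 0 + length [1..<m+1]"
      then have "j \<in> {1..m}" by (simp del: upt_Suc)
      then have "w j \<in> {1..m}" using w by (simp only: permutes_in_image)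
      then show "w j \<in> {1..N}" using m by auto
    qed (use m in auto)
    show ?thesis using commute_mult[OF mult_of_int_commute r, of "sign w"] by simp
  qed
  then show ?thesis
    unfolding qdet_def Gsum_def sum_distrib_left sum_distrib_right by (intro sum.cong) auto
qed

text \<open>\<open>Pres_qdet\<close> makes \<open>S i + 1\<close> annihilate the image of an
  antisymmetric vector; adjacent exchanges generate all permutations. The colour range follows from
  commutation with the projector.\<close>

lemma Y_antisym:
  assumes F: "F \<in> Fv" and m: "m \<le> N"
  shows "w permutes {..<n} \<Longrightarrow> lk (app (Y m s) F) (e \<circ> w, c \<circ> w) = of_int (sign w) * lk (app (Y m s) F) (e, c)"
    and "lk (app (Y m s) F) (e, c) \<noteq> 0 \<Longrightarrow> i < n \<Longrightarrow> c i \<in> {1..N}"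
proof -
  have Pr: "app (Prx n N) F = F"
  proof (rule poly_mapping_eqI)
    fix x show "lk (app (Prx n N) F) x = lk F x"
      using Fv_okx[OF F] by (cases x) (auto simp: lookup_Prx okx_def)
  qed
  have S1: "S i + 1 = fps_const (Kx i (Suc i) * Px i (Suc i) + 1)" for i
    by (simp flip: fps_const_1_eq_1)
  have "app (Kx i (Suc i) * Px i (Suc i)) (app (Y m s) F) = - app (Y m s) F" if i: "Suc i < n" for i
  proof -
    obtain Y' where Y': "(S i + 1) * qdet m [0..<n] * Prs = Y' * ((S i + 1) * Prs)"
      using Pres_qdet[OF i m] unfolding Pres_def by blast
    have "((S i + 1) * qdet m [0..<n] * Prs) $ s = (Y' * ((S i + 1) * Prs)) $ s"
      using Y' by simp
    then have eq: "(Kx i (Suc i) * Px i (Suc i) + 1) * Y m s * Prx n N = Y' $ s * ((Kx i (Suc i) * Px i (Suc i) + 1) * Prx n N)"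
      unfolding S1 by (simp add: fps_const_mult[symmetric] del: fps_const_mult fps_const_add) (simp add: fps_mult_right_const_nth mult.assoc[symmetric])
    have "lk F (e \<circ> tr i (Suc i), c \<circ> tr i (Suc i)) = - lk F (e, c)" for e c
      using Fv_perm[OF F, of "tr i (Suc i)"] i by (simp add: sign_swap_id permutes_swap_id)
    then have "app (Kx i (Suc i) * Px i (Suc i) + 1) F = 0"
      by (intro poly_mapping_eqI, case_tac k) (simp add: lookup_add lookup_Kx lookup_Px)
    then have "app (Kx i (Suc i) * Px i (Suc i) + 1) (app (Y m s) F) = 0"
      using arg_cong[OF eq, of "\<lambda>A. app A F"] Pr by (simp del: app_ring(3))
    then show ?thesis by (simp add: add_eq_0_iff2)
  qed
  then have adj0: "lk (app (Kx i (Suc i) * Px i (Suc i)) (app (Y m s) F)) x = - lk (app (Y m s) F) x" if "Suc i < n" for i x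
    using that by simp
  then have adj: "lk (app (Y m s) F) (e \<circ> tr i (Suc i), c \<circ> tr i (Suc i)) = - lk (app (Y m s) F) (e, c)" if "Suc i < n" for i e c
    using adj0[OF that, of "(e, c)"] by (simp add: lookup_Kx lookup_Px)
  show "w permutes {..<n} \<Longrightarrow> lk (app (Y m s) F) (e \<circ> w, c \<circ> w) = of_int (sign w) * lk (app (Y m s) F) (e, c)"
    using permutation_antisymmetry[of n "\<lambda>e c. lk (app (Y m s) F) (e, c)", OF adj] by blast
  assume nz: "lk (app (Y m s) F) (e, c) \<noteq> 0" and i: "i < n"
  have "(qdet m [0..<n] * Prs) $ s = (Prs * qdet m [0..<n]) $ s" by (simp add: Prs_qdet[OF m])
  then have eq: "Prx n N * Y m s = Y m s * Prx n N" by simp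
  have "app (Prx n N) (app (Y m s) F) = app (Y m s) F"
    using arg_cong[OF eq, of "\<lambda>A. app A F"] Pr by simp
  then have "lk (app (Prx n N) (app (Y m s) F)) (e, c) \<noteq> 0" using nz by simp
  then show "c i \<in> {1..N}" using i by (simp add: lookup_Prx split: if_splits)
qed

end

lemma sc_mult_nth: "sc_mult ((fps_nth) f) ((fps_nth) g) = fps_nth (f * g)"
  by (rule ext) (simp add: sc_mult_def fps_mult_nth atLeast0AtMost)

lemma sc_one_nth: "sc_one = fps_nth 1"
  by (rule ext) (simp add: sc_one_def)

lemma foldr_sc_mult: "foldr sc_mult (map (\<lambda>i. fps_nth (f i)) xs) sc_one = fps_nth (prod_list (map f xs))"
  by (induction xs) (simp_all add: sc_one_nth sc_mult_nth)

context cs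
begin

section \<open>Diagonal entries\<close>

definition cval :: "int list \<Rightarrow> nat \<Rightarrow> real" where
  "cval k i = 1 / \<beta> * of_int (over N (k ! i)) + of_nat i"

definition colset :: "nat \<Rightarrow> int list \<Rightarrow> nat set" where
  "colset m k = {i. i < n \<and> under N (k ! i) \<le> int m}"

lemma Asc_fps: "Asc n N \<beta> m k = fps_nth (\<Prod>i\<in>colset m k. fac (of_real (cval k i)))"
proof -
  have "map (\<lambda>i. if under N (k ! i) \<le> int m then sc_factor (of_real (1 / \<beta> * of_int (over N (k ! i)) + of_nat i)) else sc_one) [0..<n]
      = map (\<lambda>i. fps_nth (if under N (k ! i) \<le> int m then fac (of_real (cval k i)) else 1)) [0..<n]"
    by (intro map_cong refl) (simp add: fac_def cval_def sc_one_nth fps_nth_Abs_fps fun_eq_iff)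
  then have "Asc n N \<beta> m k = fps_nth (prod_list (map (\<lambda>i. if under N (k ! i) \<le> int m then fac (of_real (cval k i)) else 1) [0..<n]))"
    unfolding Asc_def by (simp only: foldr_sc_mult)
  also have "prod_list (map (\<lambda>i. if under N (k ! i) \<le> int m then fac (of_real (cval k i)) else 1) [0..<n])
     = (\<Prod>i\<in>{..<n}. if under N (k ! i) \<le> int m then fac (of_real (cval k i)) else 1)"
    by (subst prod.distinct_set_conv_list[symmetric]) (auto simp: atLeast0LessThan)
  also have "\<dots> = (\<Prod>i\<in>colset m k. fac (of_real (cval k i)))"
    by (intro prod.mono_neutral_cong_right) (auto simp: colset_def)
  finally show ?thesis .
qed

lemma pt_standard:
  assumes N: "N \<ge> 1" and k: "k \<in> Lset n"
  obtains w where "w permutes {..<n}" "colsorted n N (pc k \<circ> w)"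
    "\<And>i j. i < j \<Longrightarrow> j < n \<Longrightarrow> pc k (w i) < pc k (w j) \<or> pc k (w i) = pc k (w j) \<and> k ! w i < k ! w j"
proof -
  have "inj_on ((!) k) {..<n}" using Lset_inj[OF k] by (auto simp: inj_on_def)
  from standard_arrangement[OF this, of "pc k"] obtain w where w: "w permutes {..<n}"
    and s: "\<And>i j. i < j \<Longrightarrow> j < n \<Longrightarrow> pc k (w i) < pc k (w j) \<or> pc k (w i) = pc k (w j) \<and> k ! w i < k ! w j"
    by blast
  have "colsorted n N (pc k \<circ> w)"
    unfolding colsorted_def
  proof (intro conjI allI impI)
    show "(pc k \<circ> w) i \<le> (pc k \<circ> w) j" if "i < j" "j < n" for i j
      using s[OF that] by auto
    show "(pc k \<circ> w) i \<in> {1..N}" if "i < n" for i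
      using pc_range[OF N, of "w i" k] perm_lt[OF w, of i] that by simp
  qed
  then show ?thesis using that w s by blast
qed

lemma colsort:
  assumes c: "\<forall>i<n. c i \<in> {1..N}"
  obtains w where "w permutes {..<n}" "colsorted n N (c \<circ> w)"
proof -
  obtain w where w: "w permutes {..<n}" and s: "\<And>i j. i < j \<Longrightarrow> j < n \<Longrightarrow> int (c (w i)) \<le> int (c (w j))"
    using sorting_permutation[of n "\<lambda>i. int (c i)"] by blast
  have "colsorted n N (c \<circ> w)" using s c perm_lt[OF w] by (auto simp: colsorted_def)
  then show ?thesis using that w by blast
qed

text \<open>Antisymmetry says nothing about the entries beyond \<open>n\<close>. Their vanishing is
  read from the bra with sorted colours, whose support lies in \<open>V\<close>.\<close>

lemma Y_uh_Fv:
  assumes N: "N \<ge> 1" and m: "m \<le> N"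
  shows "app (Y m s) (uh k) \<in> Fv"
proof (rule FvI)
  let ?F = "app (Y m s) (uh k)"
  note U = uh_Fv[OF N, of k]
  show perm: "lk ?F (e \<circ> w, c \<circ> w) = of_int (sign w) * lk ?F (e, c)" if "w permutes {..<n}" for w e c
    by (rule Y_antisym(1)[OF U m that])
  fix e c assume nz: "lk ?F (e, c) \<noteq> 0"
  have c: "\<forall>i<n. c i \<in> {1..N}" using Y_antisym(2)[OF U m nz] by blast
  obtain w where w: "w permutes {..<n}" "colsorted n N (c \<circ> w)" using colsort[OF c] by blast
  have "lk (app (Bx (c \<circ> w)) ?F) (e \<circ> w, \<lambda>_. 0) \<noteq> 0"
    using nz perm[OF w(1), of e c] by (simp add: lookup_Bx sign_def)
  then have "e \<circ> w \<in> V (c \<circ> w) ((!) k)"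
    using Bx_Y_uh[OF N w(2) m, of s k] by (force simp: spn_def)
  then have z: "(e \<circ> w) i = 0 \<and> (c \<circ> w) i = 0" if "i \<ge> n" for i using that by (simp add: V_def)
  have "e i = 0 \<and> c i = 0" if "i \<ge> n" for i
    using z[OF that] that w(1) by (simp add: permutes_def)
  then show "okx e c" using c by (simp add: okx_def)
qed

lemma Y_Fv:
  assumes N: "N \<ge> 1" and m: "m \<le> N" and F: "F \<in> Fv"
  shows "app (Y m s) F \<in> Fv"
  by (subst Fv_expand(2)[OF N F]) (auto simp: app_sum app_smul intro!: Fv_sum Fv_smul Y_uh_Fv N m)

lemma Y_uh_lower:
  assumes N: "N \<ge> 1" and m: "m \<le> N" and k: "k \<in> Lset n" and l: "l \<in> Lset n"
  shows "lk (app (Y m s) (uh k)) (pe l, pc l) \<in> \<real>"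
    and "lk (app (Y m s) (uh k)) (pe l, pc l) \<noteq> 0 \<Longrightarrow> l = k \<or> dom_less l k"
proof -
  let ?F = "app (Y m s) (uh k)"
  obtain w where w: "w permutes {..<n}" "colsorted n N (pc l \<circ> w)"
    using pt_standard[OF N l] by blast
  have "lk ?F (pe l \<circ> w, pc l \<circ> w) = of_int (sign w) * lk ?F (pe l, pc l)"
    by (rule Fv_perm[OF Y_uh_Fv[OF N m] w(1)])
  then have eq: "lk ?F (pe l, pc l) = of_int (sign w) * lk (app (Bx (pc l \<circ> w)) ?F) (pe l \<circ> w, \<lambda>_. 0)"
    by (simp add: lookup_Bx sign_of_int_square)
  have B: "app (Bx (pc l \<circ> w)) ?F \<in> spn (V (pc l \<circ> w) ((!) k))" by (rule Bx_Y_uh[OF N w(2) m])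
  show "lk ?F (pe l, pc l) \<in> \<real>" unfolding eq using B by (intro Reals_mult) (auto simp: spn_def)
  assume "lk ?F (pe l, pc l) \<noteq> 0"
  then have "lk (app (Bx (pc l \<circ> w)) ?F) (pe l \<circ> w, \<lambda>_. 0) \<noteq> 0" unfolding eq by auto
  then have "pe l \<circ> w \<in> V (pc l \<circ> w) ((!) k)" using B by (force simp: spn_def)
  then have "hle n (kap N (pc l \<circ> w) (pe l \<circ> w)) ((!) k)" by (simp add: V_def)
  then have "hle n (\<lambda>i. l ! w i) ((!) k)"
    using hle_cong(1)[of n "kap N (pc l \<circ> w) (pe l \<circ> w)" "\<lambda>i. l ! w i"] kap_pt_perm[OF N w(1)] by blast
  then have "hle n ((!) l) ((!) k)" by (simp only: hle_permute[OF w(1)])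
  then show "l = k \<or> dom_less l k" by (rule hle_dom_less[OF k l])
qed

text \<open>In this arrangement larger exponents belong to later positions of the decreasing
  sequence \<open>k\<close>. The two counts in \<open>dval\<close>, with the constant
  \<open>n - Suc i\<close>, therefore add up to the number of \<open>j\<close> with
  \<open>w j < w i\<close>, which is \<open>w i\<close>.\<close>

lemma dval_standard:
  assumes N: "N \<ge> 1" and k: "k \<in> Lset n" and w: "w permutes {..<n}" "colsorted n N (pc k \<circ> w)"
    and s: "\<And>i j. i < j \<Longrightarrow> j < n \<Longrightarrow> pc k (w i) < pc k (w j) \<or> pc k (w i) = pc k (w j) \<and> k ! w i < k ! w j"
    and i: "i < n"
  shows "dval n \<beta> (pe k \<circ> w) i = of_real (cval k (w i))"
proof -
  have lt: "pe k (w p) < pe k (w q) \<longleftrightarrow> w p < w q" if pq: "p < q" "q < n" for p q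
  proof -
    have n: "w p < n" "w q < n" "w p \<noteq> w q"
      using pq perm_lt[OF w(1)] permutes_inj[OF w(1)] by (auto dest: injD)
    have K: "int (pc k (w p)) - int N * pe k (w p) = k ! w p" "int (pc k (w q)) - int N * pe k (w q) = k ! w q"
      using kap_pt[OF N] n by auto
    have c: "pc k (w p) \<le> pc k (w q)" "int (pc k (w q)) < int (pc k (w p)) + int N"
      using s[OF pq] pc_range[OF N n(1), of k] pc_range[OF N n(2), of k] by auto
    have mono: "int N * y + int N \<le> int N * z" if "y < z" for y z
    proof -
      have "int N * (y + 1) \<le> int N * z" using that by (intro mult_left_mono) auto
      then show ?thesis by (simp add: algebra_simps)
    qed
    have "pe k (w p) < pe k (w q) \<longleftrightarrow> k ! w q < k ! w p"
    proof (cases "pe k (w p)" "pe k (w q)" rule: linorder_cases)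
      case less
      then show ?thesis using mono[OF less] K c by linarith
    next
      case equal
      then show ?thesis using K c by simp
    next
      case greater
      then show ?thesis using mono[OF greater] K c by linarith
    qed
    also have "\<dots> \<longleftrightarrow> w p < w q"
      using Lset_less[OF k, of "w p" "w q"] Lset_less[OF k, of "w q" "w p"] n by (cases "w p" "w q" rule: linorder_cases) auto
    finally show ?thesis .
  qed
  have wne: "w i \<noteq> w j" if "i \<noteq> j" for i j using that permutes_inj[OF w(1)] by (auto dest: injD)
  have "(\<Sum>j<n. of_bool (w j < w i) :: complex) = (\<Sum>j<n. of_bool (j < w i))"
    using sum.permute[OF w(1), of "\<lambda>j. of_bool (j < w i) :: complex"] by (simp add: comp_def)
  also have "\<dots> = (\<Sum>j<w i. 1)"
    using perm_lt[OF w(1), of i] i by (intro sum.mono_neutral_cong_right) auto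
  finally have tot: "(\<Sum>j<n. of_bool (w j < w i) :: complex) = of_nat (w i)" by simp
  have n: "{..<n} = {0..<i} \<union> insert i {i+1..<n}" using i by auto
  have "(\<Sum>j<n. f j) = (\<Sum>j\<in>{0..<i}. f j) + (f i + (\<Sum>j\<in>{i+1..<n}. f j))" for f :: "nat \<Rightarrow> complex"
    unfolding n by (subst sum.union_disjoint) auto
  from this[of "\<lambda>j. of_bool (w j < w i)"]
  have split: "(\<Sum>j<n. of_bool (w j < w i) :: complex)
      = (\<Sum>j\<in>{0..<i}. of_bool (w j < w i)) + (\<Sum>j\<in>{i+1..<n}. of_bool (w j < w i))"
    by (simp del: sum_of_bool_eq)
  have lo: "(\<Sum>j\<in>{0..<i}. - of_bool (pe k (w j) < pe k (w i)) :: complex) = - (\<Sum>j\<in>{0..<i}. of_bool (w j < w i))"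
    unfolding sum_negf using lt i by (intro arg_cong[of _ _ uminus] sum.cong refl) auto
  have "(\<Sum>j\<in>{i+1..<n}. - of_bool (pe k (w i) < pe k (w j)) :: complex) = (\<Sum>j\<in>{i+1..<n}. of_bool (w j < w i) - 1)"
  proof (intro sum.cong refl)
    fix j assume "j \<in> {i+1..<n}"
    then show "(- of_bool (pe k (w i) < pe k (w j)) :: complex) = of_bool (w j < w i) - 1"
      using lt[of i j] wne[of i j] by auto
  qed
  also have "\<dots> = (\<Sum>j\<in>{i+1..<n}. of_bool (w j < w i)) - of_nat (n - Suc i)"
    by (simp add: sum_subtractf)
  finally have hi: "(\<Sum>j\<in>{i+1..<n}. - of_bool (pe k (w i) < pe k (w j)) :: complex)
     = (\<Sum>j\<in>{i+1..<n}. of_bool (w j < w i)) - of_nat (n - Suc i)" .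
  have "pe k (w i) = over N (k ! w i)" using perm_lt[OF w(1), of i] i by (simp add: pe_def)
  then show ?thesis
    unfolding dval_def comp_apply lo hi using tot split by (simp add: cval_def add.commute)
qed

text \<open>The diagonal coefficient is taken at the arrangement with ascending colours and, inside
  a colour, ascending integers. There the Dunkl operators are triangular even against exchanges of
  equal colours.\<close>

lemma Y_uh_diag:
  assumes N: "N \<ge> 1" and m: "m \<le> N" and k: "k \<in> Lset n"
  shows "lk (app (Y m s) (uh k)) (pe k, pc k) = Asc n N \<beta> m k s" and "Asc n N \<beta> m k s \<in> \<real>"
proof -
  let ?F = "app (Y m s) (uh k)"
  obtain w where w: "w permutes {..<n}" and a: "colsorted n N (pc k \<circ> w)"
    and st: "\<And>i j. i < j \<Longrightarrow> j < n \<Longrightarrow> pc k (w i) < pc k (w j) \<or> pc k (w i) = pc k (w j) \<and> k ! w i < k ! w j"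
    using pt_standard[OF N k] by metis
  define c where "c = pc k \<circ> w"
  define e where "e = pe k \<circ> w"
  \<comment> \<open>All configurations below \<open>k\<close>, its other arrangements included,
    except the chosen one.\<close>
  define U where "U = {e' \<in> V c ((!) k). \<exists>i<n. kap N c e' i \<noteq> k ! w i}"
  have ac: "colsorted n N c" using a by (simp add: c_def)
  have mv: "e'' \<in> U" if h: "hle n (kap N c e') (\<lambda>i. k ! w i)" "e' \<in> V c ((!) k)" and m': "move n e' e''" for e' e''
  proof -
    have "(\<exists>i<n. kap N c e'' i \<noteq> k ! w i) \<or> (\<exists>p q. p < q \<and> q < n \<and> c p = c q \<and> kap N c e'' p > kap N c e'' q)"
      using move_hle[OF ac m' h(1)] by blast
    \<comment> \<open>An exchange puts a larger integer before a smaller one of the same colour,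
      which the chosen arrangement never has.\<close>
    moreover have "\<exists>i<n. kap N c e'' i \<noteq> k ! w i"
      if "p < q" "q < n" "c p = c q" "kap N c e'' p > kap N c e'' q" for p q
    proof (rule ccontr)
      assume "\<not> (\<exists>i<n. kap N c e'' i \<noteq> k ! w i)"
      then have "kap N c e'' p = k ! w p" "kap N c e'' q = k ! w q" using that by auto
      moreover have "k ! w p < k ! w q" using st[OF that(1,2)] that(3) by (simp add: c_def)
      ultimately show False using that(4) by simp
    qed
    ultimately show ?thesis using V_move[OF ac h(2) m'] by (auto simp: U_def)
  qed
  have hp: "hle n f (\<lambda>i. k ! w i) \<longleftrightarrow> hle n f ((!) k)" for f by (rule hle_permute(2)[OF w])
  have eV: "e \<in> V c ((!) k)" unfolding e_def c_def by (rule uh_V[OF N w])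
  have dm: "dgs (Mf m c) (prod_list (map (\<lambda>i. fac (dval n \<beta> e i)) (filter (\<lambda>i. c i \<le> m) [0..<n]))) e U"
    by (rule dgs_Mf; rule mv) (use eV in \<open>auto simp: hp U_def V_def\<close>)
  have "prod_list (map (\<lambda>i. fac (dval n \<beta> e i)) (filter (\<lambda>i. c i \<le> m) [0..<n]))
      = (\<Prod>i\<in>{i. i < n \<and> c i \<le> m}. fac (dval n \<beta> e i))"
    by (subst prod.distinct_set_conv_list[symmetric]) (auto intro!: prod.cong)
  also have "\<dots> = (\<Prod>i\<in>{i. i < n \<and> c i \<le> m}. fac (of_real (cval k (w i))))"
    using dval_standard[OF N k w a st] by (intro prod.cong refl) (simp add: e_def)
  also have "\<dots> = (\<Prod>i\<in>colset m k. fac (of_real (cval k i)))"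
  proof (rule prod.reindex_bij_betw)
    have mem: "i < n \<and> c i \<le> m \<longleftrightarrow> w i \<in> colset m k" for i
      using perm_lt[OF w, of i] by (simp add: c_def pc_def colset_def nat_le_iff)
    have "w ` {i. i < n \<and> c i \<le> m} = colset m k"
    proof (intro equalityI subsetI)
      fix j assume j: "j \<in> colset m k"
      have "w (inv w j) = j" by (rule permutes_inverses(1)[OF w])
      then show "j \<in> w ` {i. i < n \<and> c i \<le> m}" using j mem[of "inv w j"] by (intro image_eqI[of _ _ "inv w j"]) simp_all
    qed (use mem in blast)
    then show "bij_betw w {i. i < n \<and> c i \<le> m} (colset m k)"
      using permutes_inj[OF w] by (auto simp: bij_betw_def intro: inj_on_subset)
  qed
  finally have val: "fps_nth (prod_list (map (\<lambda>i. fac (dval n \<beta> e i)) (filter (\<lambda>i. c i \<le> m) [0..<n]))) = Asc n N \<beta> m k"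
    by (simp add: Asc_fps)
  have dgA: "dg (Mf m c $ s) (Asc n N \<beta> m k s) e U" using dm by (simp add: dgs_def val)
  then show "Asc n N \<beta> m k s \<in> \<real>" by (simp add: dg_def apx_def)
  have "app (Bx c) (uh k) - smul (of_int (sign w)) (bs e)
      = (\<Sum>v\<in>{v. v permutes {..<n}} - {w}. smul (of_int (sign v)) (if pc k \<circ> v = c then bs (pe k \<circ> v) else 0))"
    unfolding Bx_uh using w by (subst sum.remove[of _ w]) (auto simp: finite_permutations c_def e_def)
  also have "\<dots> \<in> spn U"
  proof (intro spn_sum spn_smul)
    fix v assume v: "v \<in> {v. v permutes {..<n}} - {w}"
    show "(if pc k \<circ> v = c then bs (pe k \<circ> v) else 0) \<in> spn U"
    proof (cases "pc k \<circ> v = c")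
      case True
      have vp: "v permutes {..<n}" "v \<noteq> w" using v by auto
      obtain i where i: "v i \<noteq> w i" using vp(2) by blast
      then have "i < n" using vp(1) w by (metis lessThan_iff permutes_not_in)
      then have "kap N c (pe k \<circ> v) i \<noteq> k ! w i"
        using kap_pt_perm[OF N vp(1), of i k] Lset_inj[OF k, of "v i" "w i"] i perm_lt[OF vp(1), of i] perm_lt[OF w, of i]
        by (simp add: True)
      then have "pe k \<circ> v \<in> U" using uh_V[OF N vp(1), of k] \<open>i < n\<close> by (auto simp: U_def True)
      then show ?thesis by (simp add: True spn_bs)
    qed simp
  qed auto
  finally have B: "app (Bx c) (uh k) - smul (of_int (sign w)) (bs e) \<in> spn U" .
  have eU: "lk G (e, \<lambda>_. 0) = 0" if "G \<in> spn U" for G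
  proof -
    have "e \<notin> U" using kap_pt_perm[OF N w, of _ k] by (auto simp: U_def c_def e_def)
    then show ?thesis using that by (force simp: spn_def)
  qed
  have "app (Mf m c $ s) (app (Bx c) (uh k) - smul (of_int (sign w)) (bs e)) \<in> spn U"
    "app (Mf m c $ s) (bs e) - smul (Asc n N \<beta> m k s) (bs e) \<in> spn U"
    using dgA B by (auto simp: dg_def apx_def)
  from this[THEN eU] have "lk (app (Mf m c $ s) (app (Bx c) (uh k))) (e, \<lambda>_. 0) = of_int (sign w) * Asc n N \<beta> m k s"
    by (simp add: app_minus app_smul lookup_minus lookup_bas)
  then have "lk (app (Bx c) ?F) (e, \<lambda>_. 0) = of_int (sign w) * Asc n N \<beta> m k s"
    by (simp add: Bx_Y[OF ac m])
  moreover have "lk ?F (pe k \<circ> w, pc k \<circ> w) = of_int (sign w) * lk ?F (pe k, pc k)"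
    by (rule Fv_perm[OF Y_uh_Fv[OF N m] w])
  ultimately have "of_int (sign w) * (of_int (sign w) * lk ?F (pe k, pc k)) = of_int (sign w) * (of_int (sign w) * Asc n N \<beta> m k s)"
    by (simp add: lookup_Bx c_def e_def)
  then show "lk ?F (pe k, pc k) = Asc n N \<beta> m k s"
    by (simp only: sign_of_int_square)
qed

definition D :: "int list \<Rightarrow> int list set" where
  "D k = {l \<in> Lset n. dom_less l k}"

theorem Y_uh:
  assumes N: "N \<ge> 1" and m: "m \<le> N" and k: "k \<in> Lset n"
  shows "\<exists>r :: int list \<Rightarrow> real. app (Y m s) (uh k) = smul (Asc n N \<beta> m k s) (uh k) + (\<Sum>l\<in>D k. smul (of_real (r l)) (uh l))"
proof
  let ?F = "app (Y m s) (uh k)"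
  let ?c = "\<lambda>l. lk ?F (pe l, pc l)"
  have fin: "finite (D k)" unfolding D_def by (rule finite_dom_less)
  have nk: "k \<notin> D k" by (simp add: D_def dom_less_def)
  have "?F = (\<Sum>l\<in>{l \<in> Lset n. ?c l \<noteq> 0}. smul (?c l) (uh l))"
    by (rule Fv_expand(2)[OF N Y_uh_Fv[OF N m]])
  also have "\<dots> = (\<Sum>l\<in>insert k (D k). smul (?c l) (uh l))"
    using fin k Y_uh_lower(2)[OF N m k] by (intro sum.mono_neutral_left) (auto simp: D_def)
  also have "\<dots> = smul (?c k) (uh k) + (\<Sum>l\<in>D k. smul (?c l) (uh l))"
    using fin nk by simp
  finally have F: "?F = smul (?c k) (uh k) + (\<Sum>l\<in>D k. smul (?c l) (uh l))" .
  have S: "(\<Sum>l\<in>D k. smul (?c l) (uh l)) = (\<Sum>l\<in>D k. smul (of_real (Re (?c l))) (uh l))"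
    using Y_uh_lower(1)[OF N m k] by (intro sum.cong refl) (auto simp: D_def of_real_Re)
  show "?F = smul (Asc n N \<beta> m k s) (uh k) + (\<Sum>l\<in>D k. smul (of_real (Re (?c l))) (uh l))"
    by (rule trans[OF F]) (simp only: S Y_uh_diag(1)[OF N m k, of s])
qed

subsection \<open>Separation of eigenvalues and eigenvectors\<close>

lemma fac_mult: "fac c * fps_of_poly [:1, c:] = fps_of_poly [:1, c + 1:]"
proof (rule fps_ext)
  fix s
  have "fac c * fps_of_poly [:1, c:] = fac c + fps_const c * (fac c * fps_X)"
    by (simp add: fps_of_poly_pCons algebra_simps)
  then have "(fac c * fps_of_poly [:1, c:]) $ s = fac c $ s + c * (if s = 0 then 0 else fac c $ (s - 1))"
    by simp
  also have "\<dots> = fps_of_poly [:1, c + 1:] $ s"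
    by (cases s; cases "s - 1") (auto simp: fac_def sc_factor_def coeff_pCons split: nat.splits)
  finally show "(fac c * fps_of_poly [:1, c:]) $ s = fps_of_poly [:1, c + 1:] $ s" .
qed

lemma fac_prod_identity:
  assumes eq: "(\<Prod>c\<in>C. fac (of_real c)) = (\<Prod>d\<in>D'. fac (of_real d))"
  shows "(\<Prod>c\<in>C. [:1, complex_of_real c + 1:]) * (\<Prod>d\<in>D'. [:1, complex_of_real d:])
       = (\<Prod>d\<in>D'. [:1, complex_of_real d + 1:]) * (\<Prod>c\<in>C. [:1, complex_of_real c:])"
proof -
  have 1: "fps_of_poly (\<Prod>c\<in>X. [:1, complex_of_real c + 1:])
      = (\<Prod>c\<in>X. fac (of_real c)) * fps_of_poly (\<Prod>c\<in>X. [:1, complex_of_real c:])" for X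
    unfolding fps_of_poly_prod prod.distrib[symmetric] fac_mult ..
  have "fps_of_poly ((\<Prod>c\<in>C. [:1, complex_of_real c + 1:]) * (\<Prod>d\<in>D'. [:1, complex_of_real d:]))
       = fps_of_poly ((\<Prod>d\<in>D'. [:1, complex_of_real d + 1:]) * (\<Prod>c\<in>C. [:1, complex_of_real c:]))"
    unfolding fps_of_poly_mult 1 eq by (simp add: ac_simps)
  then show ?thesis by (simp only: fps_of_poly_eq_iff)
qed

text \<open>The pole of the factor of \<open>c\<close> could be cancelled only by a zero coming from
  \<open>c - 1\<close>, which the gap condition excludes, so it is a pole of the other product. In
  the variable \<open>1 / u\<close> the pole of \<open>c = 0\<close> lies at infinity and is
  invisible to this argument.\<close>

lemma fac_prod_subset:
  assumes fin: "finite C" "finite D'" and gap: "\<And>c. c \<in> C \<Longrightarrow> c + 1 \<notin> C"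
    and eq: "(\<Prod>c\<in>C. fac (of_real c)) = (\<Prod>d\<in>D'. fac (of_real d))"
    and c: "c \<in> C" "c \<noteq> 0"
  shows "c \<in> D'"
proof -
  let ?x = "- 1 / complex_of_real c"
  have "(\<Prod>c\<in>C. poly [:1, complex_of_real c:] ?x) = 0"
    using fin c by (intro prod_zero) auto
  then have "(\<Prod>c\<in>C. poly [:1, complex_of_real c + 1:] ?x) * (\<Prod>d\<in>D'. poly [:1, complex_of_real d:] ?x) = 0"
    using arg_cong[OF fac_prod_identity[OF eq], of "\<lambda>p. poly p ?x"] by (simp only: poly_mult poly_prod mult_zero_right)
  then consider b where "b \<in> C" "poly [:1, complex_of_real b + 1:] ?x = 0" | d where "d \<in> D'" "poly [:1, complex_of_real d:] ?x = 0"
    using fin by (auto simp only: mult_eq_0_iff prod_zero_iff)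
  then show ?thesis
  proof cases
    case 1
    then have "complex_of_real b + 1 = complex_of_real c" using c(2) by (simp add: field_simps)
    then have "b + 1 = c" by (metis of_real_1 of_real_add of_real_eq_iff)
    then show ?thesis using gap[OF 1(1)] c by simp
  next
    case 2
    then have "complex_of_real d = complex_of_real c" using c(2) by (simp add: field_simps)
    then show ?thesis using 2 by simp
  qed
qed

lemma fac_prod_nth: "finite C \<Longrightarrow> (\<Prod>c\<in>C. fac (f c)) $ 0 = 1 \<and> (\<Prod>c\<in>C. fac (f c)) $ Suc 0 = of_nat (card C)"
  by (induction C rule: finite_induct) (auto simp: fps_mult_nth_1' fac_def sc_factor_def fps_mult_nth)

text \<open>The nonzero elements are the poles. The coefficient of the first power counts the
  factors and so decides whether 0 belongs to the set.\<close>

lemma fac_prod_inj: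
  assumes fin: "finite C" "finite D'" and gap: "\<And>c. c \<in> C \<Longrightarrow> c + 1 \<notin> C" "\<And>c. c \<in> D' \<Longrightarrow> c + 1 \<notin> D'"
    and eq: "(\<Prod>c\<in>C. fac (of_real c)) = (\<Prod>d\<in>D'. fac (of_real d))"
  shows "C = D'"
proof -
  have nz: "C - {0} = D' - {0}"
    using fac_prod_subset[OF fin gap(1) eq] fac_prod_subset[OF fin(2,1) gap(2) eq[symmetric]] by blast
  have "(of_nat (card C) :: complex) = of_nat (card D')"
    using fac_prod_nth[OF fin(1)] fac_prod_nth[OF fin(2)] eq by metis
  then have "card C = card D'" by simp
  then show ?thesis using nz fin by (metis card_Diff_singleton_if insert_Diff insert_Diff_single card_insert_if Diff_insert_absorb card.insert finite_Diff insert_absorb n_not_Suc_n)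
qed

definition lev :: "nat \<Rightarrow> int list \<Rightarrow> nat set" where
  "lev m k = {i. i < n \<and> under N (k ! i) = int m}"

lemma over_mono:
  assumes N: "N \<ge> 1" and k: "k \<in> Lset n" and ij: "i < j" "j < n"
  shows "over N (k ! i) \<le> over N (k ! j)"
    and "under N (k ! i) = under N (k ! j) \<Longrightarrow> over N (k ! i) < over N (k ! j)"
proof -
  have lt: "k ! j < k ! i" by (rule Lset_less[OF k ij])
  have u: "under N (k ! i) - int N * over N (k ! i) = k ! i" "under N (k ! j) - int N * over N (k ! j) = k ! j"
    by (rule under_over)+
  show "over N (k ! i) \<le> over N (k ! j)"
  proof (rule ccontr)
    assume "\<not> over N (k ! i) \<le> over N (k ! j)"
    then have "int N * (over N (k ! j) + 1) \<le> int N * over N (k ! i)" by (intro mult_left_mono) auto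
    then show False using u lt under_bounds[OF N, of "k ! i"] under_bounds[OF N, of "k ! j"] by (simp add: algebra_simps)
  qed
  assume "under N (k ! i) = under N (k ! j)"
  then have "int N * over N (k ! i) < int N * over N (k ! j)" using u lt by linarith
  then show "over N (k ! i) < over N (k ! j)" using N by simp
qed

text \<open>Sites of equal colour have distinct exponents, so the positive
  \<open>1 / \<beta>\<close> widens the distance beyond one; this supplies the gap for
  \<open>fac_prod_inj\<close>.\<close>

lemma cval_less:
  assumes N: "N \<ge> 1" and \<beta>: "\<beta> > 0" and k: "k \<in> Lset n" and ij: "i < j" "j < n"
  shows "cval k i < cval k j" and "under N (k ! i) = under N (k ! j) \<Longrightarrow> cval k i + 1 < cval k j"
proof -
  have "1 / \<beta> * of_int (over N (k ! i)) \<le> 1 / \<beta> * of_int (over N (k ! j))"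
    using over_mono(1)[OF N k ij] \<beta> by (intro mult_left_mono) auto
  moreover have ij': "real i + 1 \<le> real j" using ij by simp
  ultimately show "cval k i < cval k j" unfolding cval_def by linarith
  assume "under N (k ! i) = under N (k ! j)"
  then have "1 / \<beta> * of_int (over N (k ! i)) < 1 / \<beta> * of_int (over N (k ! j))"
    using over_mono(2)[OF N k ij] \<beta> by (intro mult_strict_left_mono) auto
  then show "cval k i + 1 < cval k j" unfolding cval_def using ij' by linarith
qed

lemma cval_inj: "N \<ge> 1 \<Longrightarrow> \<beta> > 0 \<Longrightarrow> k \<in> Lset n \<Longrightarrow> i < n \<Longrightarrow> j < n \<Longrightarrow> cval k i = cval k j \<longleftrightarrow> i = j"
  using cval_less(1)[of k i j] cval_less(1)[of k j i] by (cases i j rule: linorder_cases) auto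

text \<open>The quotient of consecutive eigenvalues, for \<open>m\<close> and \<open>m - 1\<close>,
  involves only the sites of colour \<open>m\<close>.\<close>

lemma lev_determined:
  assumes N: "N \<ge> 1" and \<beta>: "\<beta> > 0" and k: "k \<in> Lset n" "l \<in> Lset n"
    and eq: "\<And>m. m \<in> {1..N} \<Longrightarrow> Asc n N \<beta> m k = Asc n N \<beta> m l" and m: "m \<in> {1..N}"
  shows "cval k ` lev m k = cval l ` lev m l"
proof -
  define P where "P m k = (\<Prod>i\<in>colset m k. fac (of_real (cval k i)))" for m k
  have P: "P m k = P m l" if "m \<le> N" for m
  proof (cases "m = 0")
    case True
    have "\<not> under N x \<le> 0" for x using under_bounds[OF N, of x] by simp
    then have "colset 0 k = {}" for k by (simp add: colset_def)
    then show ?thesis using True by (simp add: P_def)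
  next
    case False
    then have "fps_nth (P m k) = fps_nth (P m l)" using eq[of m] that by (simp add: Asc_fps P_def)
    then show ?thesis by (simp add: fps_nth_inject)
  qed
  have fin: "finite (colset m k)" "finite (lev m k)" for m k by (simp_all add: colset_def lev_def)
  have Q: "P m k = P (m - 1) k * (\<Prod>c\<in>cval k ` lev m k. fac (of_real c))" if "k \<in> Lset n" for k
  proof -
    have "colset m k = colset (m - 1) k \<union> lev m k" "colset (m - 1) k \<inter> lev m k = {}"
      using m by (auto simp: colset_def lev_def)
    then have "P m k = P (m - 1) k * (\<Prod>i\<in>lev m k. fac (of_real (cval k i)))"
      using fin by (simp add: P_def prod.union_disjoint)
    moreover have "inj_on (cval k) (lev m k)" using cval_inj[OF N \<beta> that] by (auto simp: inj_on_def lev_def)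
    ultimately show ?thesis by (simp add: prod.reindex)
  qed
  have nz: "P (m - 1) k \<noteq> 0" using fac_prod_nth[OF fin(1)[of "m - 1" k], of "\<lambda>i. of_real (cval k i)"] by (auto simp: P_def)
  have gap: "c + 1 \<notin> cval k ` lev m k" if k: "k \<in> Lset n" and c: "c \<in> cval k ` lev m k" for k c
  proof
    assume "c + 1 \<in> cval k ` lev m k"
    then obtain i j where i: "i \<in> lev m k" "c = cval k i" and j: "j \<in> lev m k" "c + 1 = cval k j" using c by blast
    then show False using cval_less[OF N \<beta> k, of i j] cval_less[OF N \<beta> k, of j i]
      by (cases i j rule: linorder_cases) (auto simp: lev_def)
  qed
  have e1: "P m k = P m l" and e2: "P (m - 1) k = P (m - 1) l" using m by (auto intro!: P)
  have "P (m - 1) k * (\<Prod>c\<in>cval k ` lev m k. fac (of_real c)) = P (m - 1) k * (\<Prod>c\<in>cval l ` lev m l. fac (of_real c))"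
    using Q[OF k(1)] Q[OF k(2)] e1 e2 by metis
  then have "(\<Prod>c\<in>cval k ` lev m k. fac (of_real c)) = (\<Prod>c\<in>cval l ` lev m l. fac (of_real c))"
    using nz by simp
  then show ?thesis using fin gap k by (intro fac_prod_inj) auto
qed

text \<open>The values of all colours together, sorted, give \<open>cval\<close> at each position.
  Injectivity of \<open>cval\<close> then locates the colour of each position, and colour and value
  give back the integer.\<close>

theorem separation:
  assumes N: "N \<ge> 1" and \<beta>: "\<beta> > 0" and k: "k \<in> Lset n" "l \<in> Lset n"
    and eq: "\<And>m. m \<in> {1..N} \<Longrightarrow> Asc n N \<beta> m k = Asc n N \<beta> m l"
  shows "k = l"
proof -
  have lv: "cval k ` lev m k = cval l ` lev m l" if "m \<in> {1..N}" for m
    by (rule lev_determined[OF N \<beta> k _ that]) (rule eq)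
  have un: "cval k ` {..<n} = (\<Union>m\<in>{1..N}. cval k ` lev m k)" for k
  proof -
    have "\<exists>m\<in>{1..N}. i \<in> lev m k" if "i < n" for i
      using under_bounds[OF N, of "k ! i"] that by (intro bexI[of _ "nat (under N (k ! i))"]) (auto simp: lev_def nat_le_iff)
    then show ?thesis by (auto simp: lev_def) blast
  qed
  have "(\<Union>m\<in>{1..N}. cval k ` lev m k) = (\<Union>m\<in>{1..N}. cval l ` lev m l)"
    using lv by (intro SUP_cong refl) auto
  then have "set (map (cval k) [0..<n]) = set (map (cval l) [0..<n])"
    using un[of k] un[of l] by (simp add: atLeast0LessThan)
  then have "map (cval k) [0..<n] = map (cval l) [0..<n]"
    using cval_less(1)[OF N \<beta> k(1)] cval_less(1)[OF N \<beta> k(2)]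
    by (intro strict_sorted_equal) (auto simp: sorted_wrt_iff_nth_less)
  then have c: "cval k i = cval l i" if "i < n" for i using that by (simp add: list_eq_iff_nth_eq)
  have "k ! i = l ! i" if i: "i < n" for i
  proof -
    define m where "m = nat (under N (k ! i))"
    have m: "m \<in> {1..N}" "i \<in> lev m k" using under_bounds[OF N, of "k ! i"] i by (auto simp: m_def lev_def nat_le_iff)
    then obtain j where j: "j \<in> lev m l" "cval k i = cval l j" using lv[OF m(1)] by blast
    then have "j = i" using c[OF i] cval_inj[OF N \<beta> k(2), of i j] i by (auto simp: lev_def)
    then have u: "under N (l ! i) = under N (k ! i)" using j m by (simp add: lev_def)
    have "over N (l ! i) = over N (k ! i)" using c[OF i] \<beta> by (simp add: cval_def)
    then show ?thesis using u under_over[of N "k ! i"] under_over[of N "l ! i"] by simp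
  qed
  then show ?thesis using Lset_length k by (auto intro: nth_equalityI)
qed

lemma Mf_commute_const:
  assumes "\<And>i. y * dx n \<beta> i = dx n \<beta> i * y"
  shows "y * Mf m a $ s = Mf m a $ s * y"
proof -
  have "(1 + R i 0) * fps_const y = fps_const y * (1 + R i 0)" for i
  proof (rule fps_ext)
    fix t
    have "(- dx n \<beta> i) ^ k * y = y * (- dx n \<beta> i) ^ k" for k
      by (rule power_commuting_commutes) (simp add: assms)
    then show "((1 + R i 0) * fps_const y) $ t = (fps_const y * (1 + R i 0)) $ t"
      unfolding fps_mult_left_const_nth fps_mult_right_const_nth R_nth by simp
  qed
  then have "prod_list (map (\<lambda>i. 1 + R i 0) xs) * fps_const y = fps_const y * prod_list (map (\<lambda>i. 1 + R i 0) xs)" for xs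
    by (induction xs) (auto intro: commute_mult)
  then have "(Mf m a * fps_const y) $ s = (fps_const y * Mf m a) $ s" by (simp add: Mf_def)
  then show ?thesis by (simp add: fps_mult_right_const_nth)
qed

lemma Mf_commute: "Mf m a $ s * Mf m' a $ s' = Mf m' a $ s' * Mf m a $ s"
  by (intro Mf_commute_const Mf_commute_const[symmetric] dx_commute)

lemma Fv_eqI_sorted:
  assumes N: "N \<ge> 1" and F: "F \<in> Fv" "G \<in> Fv" and eq: "\<And>a. colsorted n N a \<Longrightarrow> app (Bx a) F = app (Bx a) G"
  shows "F = G"
proof (rule Fv_eqI[OF F])
  fix k assume "k \<in> Lset n"
  then obtain w where w: "w permutes {..<n}" "colsorted n N (pc k \<circ> w)" using pt_standard[OF N] by blast
  have "lk H (pe k, pc k) = of_int (sign w) * lk (app (Bx (pc k \<circ> w)) H) (pe k \<circ> w, \<lambda>_. 0)" if "H \<in> Fv" for H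
    using Fv_perm[OF that w(1), of "pe k" "pc k"] by (simp add: lookup_Bx sign_of_int_square)
  then show "lk F (pe k, pc k) = lk G (pe k, pc k)" using F eq[OF w(2)] by simp
qed

text \<open>Antisymmetric vectors are determined by their sorted bras, on which both operators act
  by functions of the commuting \<open>dx\<close>.\<close>

lemma Y_commute:
  assumes N: "N \<ge> 1" and m: "m \<le> N" "m' \<le> N" and F: "F \<in> Fv"
  shows "app (Y m s) (app (Y m' s') F) = app (Y m' s') (app (Y m s) F)"
proof (rule Fv_eqI_sorted[OF N])
  fix a assume a: "colsorted n N a"
  have "app (Mf m a $ s * Mf m' a $ s') (app (Bx a) F) = app (Mf m' a $ s' * Mf m a $ s) (app (Bx a) F)"
    by (simp only: Mf_commute)
  then show "app (Bx a) (app (Y m s) (app (Y m' s') F)) = app (Bx a) (app (Y m' s') (app (Y m s) F))"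
    by (simp add: Bx_Y[OF a] m)
qed (intro Y_Fv N m F)+

section \<open>Common eigenvectors by spectral projection\<close>

definition W :: "int list set \<Rightarrow> pst set" where
  "W T' = {F. \<exists>r :: int list \<Rightarrow> real. F = (\<Sum>l\<in>T'. smul (of_real (r l)) (uh l))}"

lemma W_zero: "0 \<in> W T'"
  unfolding W_def by (rule CollectI, rule exI[of _ "\<lambda>_. 0"]) simp

lemma W_add:
  assumes "F \<in> W T'" "G \<in> W T'"
  shows "F + G \<in> W T'"
proof -
  obtain r r' :: "int list \<Rightarrow> real" where "F = (\<Sum>l\<in>T'. smul (of_real (r l)) (uh l))" "G = (\<Sum>l\<in>T'. smul (of_real (r' l)) (uh l))"
    using assms by (auto simp: W_def)
  then have "F + G = (\<Sum>l\<in>T'. smul (of_real (r l + r' l)) (uh l))"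
    by (simp add: smul_left_add sum.distrib)
  then show ?thesis unfolding W_def by (intro CollectI exI)
qed

lemma W_smul:
  assumes "F \<in> W T'" "c \<in> \<real>"
  shows "smul c F \<in> W T'"
proof -
  obtain r :: "int list \<Rightarrow> real" and c' where "F = (\<Sum>l\<in>T'. smul (of_real (r l)) (uh l))" "c = of_real c'"
    using assms by (auto simp: W_def elim: Reals_cases)
  then have "smul c F = (\<Sum>l\<in>T'. smul (of_real (c' * r l)) (uh l))"
    by (simp add: smul_sum)
  then show ?thesis unfolding W_def by (intro CollectI exI)
qed

lemma W_sum: "(\<And>x. x \<in> X \<Longrightarrow> f x \<in> W T') \<Longrightarrow> (\<Sum>x\<in>X. f x) \<in> W T'"
  by (induction X rule: infinite_finite_induct) (auto intro: W_add W_zero)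

lemma W_uh:
  assumes "finite T'" "l \<in> T'"
  shows "uh l \<in> W T'"
proof -
  have "(\<Sum>j\<in>T'. smul (of_real (if j = l then 1 else 0)) (uh j)) = (\<Sum>j\<in>T'. if j = l then uh l else 0)"
    by (intro sum.cong) auto
  then have "uh l = (\<Sum>j\<in>T'. smul (of_real (if j = l then 1 else 0)) (uh j))" using assms by simp
  then show ?thesis unfolding W_def by (intro CollectI exI)
qed

lemma W_app:
  assumes "\<And>l. l \<in> T' \<Longrightarrow> app M (uh l) \<in> W T''" "F \<in> W T'"
  shows "app M F \<in> W T''"
proof -
  obtain r :: "int list \<Rightarrow> real" where "F = (\<Sum>l\<in>T'. smul (of_real (r l)) (uh l))"
    using assms by (auto simp: W_def)
  then have "app M F = (\<Sum>l\<in>T'. smul (of_real (r l)) (app M (uh l)))" by (simp add: app_sum app_smul)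
  then show ?thesis using assms(1) by (simp add: W_sum W_smul)
qed

lemma W_mono: "finite T'' \<Longrightarrow> T' \<subseteq> T'' \<Longrightarrow> F \<in> W T' \<Longrightarrow> F \<in> W T''"
  using W_app[of T' 1 T'' F] by (auto intro: W_uh)

lemma W_kill:
  assumes "\<And>l. l \<in> T' \<Longrightarrow> app M (uh l) = 0" "F \<in> W T'"
  shows "app M F = 0"
proof -
  obtain r :: "int list \<Rightarrow> real" where "F = (\<Sum>l\<in>T'. smul (of_real (r l)) (uh l))"
    using assms by (auto simp: W_def)
  then show ?thesis using assms(1) by (simp add: app_sum app_smul)
qed

lemma finite_D: "finite (D k)"
  unfolding D_def by (rule finite_dom_less)

lemma D_trans: "l \<in> D k \<Longrightarrow> D l \<subseteq> D k"
  using dom_less_trans' by (auto simp: D_def)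

lemma D_irrefl: "k \<notin> D k"
  by (simp add: D_def dom_less_def)

lemma Y_uh_W:
  assumes N: "N \<ge> 1" and m: "m \<le> N" and k: "k \<in> Lset n"
  shows "app (Y m s) (uh k) - smul (Asc n N \<beta> m k s) (uh k) \<in> W (D k)"
proof -
  obtain r :: "int list \<Rightarrow> real" where "app (Y m s) (uh k) = smul (Asc n N \<beta> m k s) (uh k) + (\<Sum>l\<in>D k. smul (of_real (r l)) (uh l))"
    using Y_uh[OF N m k] by blast
  then have "app (Y m s) (uh k) - smul (Asc n N \<beta> m k s) (uh k) = (\<Sum>l\<in>D k. smul (of_real (r l)) (uh l))" by simp
  then show ?thesis unfolding W_def by (intro CollectI exI)
qed

definition symm :: "endo \<Rightarrow> bool" where
  "symm Z \<longleftrightarrow> (\<forall>F\<in>Fv. app Z F \<in> Fv \<and> (\<forall>m\<le>N. \<forall>s. app (Y m s) (app Z F) = app Z (app (Y m s) F)))"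

text \<open>The product of the normalised factors \<open>(A - a\<^sub>l) / (a\<^sub>k - a\<^sub>l)\<close> over a down-closed set of indices
  \<open>l < k\<close>, with \<open>A\<close> a coefficient separating \<open>k\<close> from \<open>l\<close>, annihilates the span of those \<open>u\<^sub>l\<close>.\<close>
lemma projector:
  assumes N: "N \<ge> 1" and \<beta>: "\<beta> > 0" and k: "k \<in> Lset n"
  shows "finite Q \<Longrightarrow> Q \<subseteq> D k \<Longrightarrow> (\<And>l. l \<in> Q \<Longrightarrow> D l \<subseteq> Q) \<Longrightarrow>
    \<exists>Z. symm Z \<and> (\<forall>l\<in>Q. app Z (uh l) = 0) \<and> app Z (uh k) - uh k \<in> W (D k) \<and> (\<forall>F\<in>W (D k). app Z F \<in> W (D k))"
proof (induction Q rule: finite_psubset_induct)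
  case (psubset Q)
  show ?case
  proof (cases "Q = {}")
    case True
    then show ?thesis by (intro exI[of _ 1]) (simp add: symm_def W_zero)
  next
    case False
    \<comment> \<open>A maximal element is removed, so that the rest of \<open>Q\<close> is still
      closed downwards.\<close>
    have "\<exists>l\<in>Q. \<forall>x\<in>Q. x \<noteq> l \<longrightarrow> \<not> dom_less l x"
      using False psubset.hyps(1) dom_less_asym dom_less_trans'
      by (intro Finite_Set.bex_max_element) (auto simp: asymp_on_def transp_on_def)
    then obtain l where l: "l \<in> Q" and mx: "\<And>x. x \<in> Q \<Longrightarrow> x \<noteq> l \<Longrightarrow> \<not> dom_less l x" by blast
    have lk: "l \<in> Lset n" "l \<in> D k" "l \<noteq> k" using l psubset.prems D_irrefl by (auto simp: D_def)
    let ?Q = "Q - {l}"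
    have down: "D l' \<subseteq> ?Q" if "l' \<in> Q" for l'
      using psubset.prems(2)[OF that] that mx D_irrefl by (auto simp: D_def)
    obtain Z where Z: "symm Z" "\<forall>l\<in>?Q. app Z (uh l) = 0" "app Z (uh k) - uh k \<in> W (D k)" "\<forall>F\<in>W (D k). app Z F \<in> W (D k)"
      using psubset.IH[of ?Q] l psubset.prems(1) down by auto
    obtain m s where m: "m \<in> {1..N}" and ne: "Asc n N \<beta> m k s \<noteq> Asc n N \<beta> m l s"
      using separation[OF N \<beta> k lk(1)] lk(3) by blast
    then have mN: "m \<le> N" by simp
    define \<alpha> where "\<alpha> = Asc n N \<beta> m k s"
    define \<gamma> where "\<gamma> = Asc n N \<beta> m l s"
    have re: "\<alpha> \<in> \<real>" "\<gamma> \<in> \<real>" and nz: "\<alpha> - \<gamma> \<noteq> 0"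
      using Y_uh_diag(2)[OF N mN] k lk ne by (auto simp: \<alpha>_def \<gamma>_def)
    define H where "H = sc (1 / (\<alpha> - \<gamma>)) * (Y m s - sc \<gamma>)"
    have H: "app H F = smul (1 / (\<alpha> - \<gamma>)) (app (Y m s) F - smul \<gamma> F)" for F
      by (simp add: H_def)
    have rec: "1 / (\<alpha> - \<gamma>) \<in> \<real>" using re by auto
    \<comment> \<open>For \<open>l' = l\<close> the diagonal coefficient cancels, so
      \<open>H\<close> maps \<open>uh l\<close> into the span of what lies strictly below
      it.\<close>
    have Hu: "app H (uh l') \<in> W T'" if "l' \<in> Lset n" "finite T'" "D l' \<subseteq> T'" "l' \<in> T' \<or> l' = l" for l' T'
    proof -
      have 1: "app (Y m s) (uh l') - smul (Asc n N \<beta> m l' s) (uh l') \<in> W T'"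
        using Y_uh_W[OF N mN that(1)] that W_mono by blast
      have 2: "smul (Asc n N \<beta> m l' s - \<gamma>) (uh l') \<in> W T'"
      proof (cases "l' = l")
        case False
        then show ?thesis using that Y_uh_diag(2)[OF N mN that(1)] re by (intro W_smul W_uh) auto
      qed (simp add: \<gamma>_def W_zero)
      have "app (Y m s) (uh l') - smul \<gamma> (uh l')
          = (app (Y m s) (uh l') - smul (Asc n N \<beta> m l' s) (uh l')) + smul (Asc n N \<beta> m l' s - \<gamma>) (uh l')"
        by (rule poly_mapping_eqI) (simp add: lookup_minus lookup_add algebra_simps)
      then show ?thesis unfolding H by (simp only: W_smul[OF W_add[OF 1 2] rec])
    qed
    have HW: "app H F \<in> W (D k)" if "F \<in> W (D k)" for F
      by (rule W_app[OF _ that], rule Hu) (use D_trans finite_D in \<open>auto simp: D_def\<close>)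
    show ?thesis
    proof (intro exI[of _ "Z * H"] conjI ballI)
      show "symm (Z * H)"
        unfolding symm_def
      proof (intro ballI conjI allI impI)
        fix F assume F: "F \<in> Fv"
        have HF: "app H F \<in> Fv" unfolding H by (intro Fv_smul Fv_minus Y_Fv N mN F)
        then show "app (Z * H) F \<in> Fv" using Z(1) by (simp add: symm_def)
        fix m' s' assume m': "m' \<le> N"
        have "app (Y m' s') (app H F) = app H (app (Y m' s') F)"
          unfolding H by (simp add: app_smul app_minus Y_commute[OF N m' mN F])
        then show "app (Y m' s') (app (Z * H) F) = app (Z * H) (app (Y m' s') F)"
          using Z(1) HF m' by (simp add: symm_def)
      qed
      fix l' assume l': "l' \<in> Q"
      then have "app H (uh l') \<in> W ?Q"
        using psubset.hyps(1) psubset.prems(1) down by (intro Hu) (auto simp: D_def)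
      then show "app (Z * H) (uh l') = 0" using W_kill[of ?Q Z] Z(2) by simp
    next
      have 1: "app (Y m s) (uh k) - smul \<alpha> (uh k) \<in> W (D k)" unfolding \<alpha>_def by (rule Y_uh_W[OF N mN k])
      define w where "w = smul (1 / (\<alpha> - \<gamma>)) (app (Y m s) (uh k) - smul \<alpha> (uh k))"
      have w: "w \<in> W (D k)" unfolding w_def by (rule W_smul[OF 1 rec])
      have "app H (uh k) = uh k + w"
        unfolding H w_def using nz by (intro poly_mapping_eqI) (simp add: lookup_minus lookup_add field_simps)
      then have eq: "app (Z * H) (uh k) - uh k = (app Z (uh k) - uh k) + app Z w" by (simp add: app_add)
      show "app (Z * H) (uh k) - uh k \<in> W (D k)" unfolding eq using Z(3,4) w by (intro W_add) auto
    next
      fix F assume "F \<in> W (D k)"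
      then show "app (Z * H) F \<in> W (D k)" using HW Z(4) by simp
    qed
  qed
qed

text \<open>The projector \<open>Z\<close> commutes with the operators on antisymmetric vectors and
  kills everything below \<open>k\<close>, in particular the error \<open>Y - a_k\<close> makes on
  \<open>uh k\<close>. Hence \<open>Z\<close> applied to \<open>uh k\<close> is an eigenvector, with
  leading coefficient one.\<close>

theorem eigenvector:
  assumes N: "N \<ge> 1" and \<beta>: "\<beta> > 0" and k: "k \<in> Lset n"
  shows "\<exists>r :: int list \<Rightarrow> real. \<forall>m\<le>N. \<forall>s.
    app (Y m s) (uh k + (\<Sum>l\<in>D k. smul (of_real (r l)) (uh l)))
      = smul (Asc n N \<beta> m k s) (uh k + (\<Sum>l\<in>D k. smul (of_real (r l)) (uh l)))"
proof -
  obtain Z where Z: "symm Z" "\<forall>l\<in>D k. app Z (uh l) = 0" "app Z (uh k) - uh k \<in> W (D k)"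
    using projector[OF N \<beta> k finite_D[of k] order_refl] D_trans by blast
  obtain r :: "int list \<Rightarrow> real" where "app Z (uh k) - uh k = (\<Sum>l\<in>D k. smul (of_real (r l)) (uh l))"
    using Z(3) by (auto simp: W_def)
  then have r: "app Z (uh k) = uh k + (\<Sum>l\<in>D k. smul (of_real (r l)) (uh l))" by (simp add: algebra_simps)
  have "app (Y m s) (app Z (uh k)) = smul (Asc n N \<beta> m k s) (app Z (uh k))" if m: "m \<le> N" for m s
  proof -
    have "app Z (app (Y m s) (uh k) - smul (Asc n N \<beta> m k s) (uh k)) = 0"
      using W_kill[of "D k" Z] Z(2) Y_uh_W[OF N m k] by blast
    then show ?thesis using Z(1) uh_Fv[OF N, of k] m by (simp add: symm_def app_minus app_smul)
  qed
  then show ?thesis unfolding r by blast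
qed

end

section \<open>Orthogonality\<close>

definition adjs :: "nat \<Rightarrow> real \<Rightarrow> endo fps \<Rightarrow> endo fps \<Rightarrow> bool" where
  "adjs n \<beta> Q Q' \<longleftrightarrow> (\<forall>s. adj n \<beta> (Q $ s) (Q' $ s))"

lemma adjs_mult:
  assumes "adjs n \<beta> Q Q'" "adjs n \<beta> P P'"
  shows "adjs n \<beta> (Q * P) (P' * Q')"
  unfolding adjs_def
proof
  fix s
  have "(P' * Q') $ s = (\<Sum>t=0..s. P' $ (s - t) * Q' $ t)"
    unfolding fps_mult_nth by (subst sum.atLeastAtMost_rev) (auto intro!: sum.cong)
  moreover have "adj n \<beta> (\<Sum>t=0..s. Q $ t * P $ (s - t)) (\<Sum>t=0..s. P' $ (s - t) * Q' $ t)"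
    using assms by (intro adj_sum adj_mult) (auto simp: adjs_def)
  ultimately show "adj n \<beta> ((Q * P) $ s) ((P' * Q') $ s)" by (simp add: fps_mult_nth)
qed

lemma gm_tr:
  assumes \<beta>: "\<beta> > 0" and ab: "a < n" "b < n"
  shows "gm n \<beta> (e \<circ> tr a b, c) (e' \<circ> tr a b, c') = gm n \<beta> (e, c) (e', c')"
proof -
  have "form n \<beta> (app (Kx a b) (bas (e, c))) (app (Kx a b) (bas (e', c')))
      = form n \<beta> (bas (e, c)) (app (Kx a b * Kx a b) (bas (e', c')))"
    using adj_Kx[OF \<beta> ab] unfolding adj_def app_ring by blast
  then show ?thesis unfolding Kx_Kx by (simp add: Kx_def form_bas)
qed

lemma gm_permute:
  assumes \<beta>: "\<beta> > 0" and w: "w permutes {..<n}"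
  shows "gm n \<beta> (e \<circ> w, c \<circ> w) (e' \<circ> w, c' \<circ> w) = gm n \<beta> (e, c) (e', c')"
proof -
  have "\<forall>e e'. gm n \<beta> (e \<circ> w, c) (e' \<circ> w, c') = gm n \<beta> (e, c) (e', c')"
    using w finite_lessThan
  proof (rule permutes_induct)
    fix a b p assume "a \<in> {..<n}" "b \<in> {..<n}"
      and IH: "\<forall>e e'. gm n \<beta> (e \<circ> p, c) (e' \<circ> p, c') = gm n \<beta> (e, c) (e', c')"
    then show "\<forall>e e'. gm n \<beta> (e \<circ> (tr a b \<circ> p), c) (e' \<circ> (tr a b \<circ> p), c') = gm n \<beta> (e, c) (e', c')"
      unfolding comp_assoc[symmetric] using gm_tr[OF \<beta>, of a n b] by simp
  qed simp
  then have "gm n \<beta> (e \<circ> w, c) (e' \<circ> w, c') = gm n \<beta> (e, c) (e', c')" by blast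
  then show ?thesis by (cases "c = c'") (auto simp: gm_def comp_perm_eq[OF w])
qed

text \<open>The part of the form with colours \<open>c\<close>, equal by \<open>form_Bx\<close> to
  the form of two bras. Self-adjointness can be used only here, since the operators are known
  through bras with sorted colours.\<close>

definition cform :: "nat \<Rightarrow> real \<Rightarrow> (nat \<Rightarrow> nat) \<Rightarrow> pst \<Rightarrow> pst \<Rightarrow> complex" where
  "cform n \<beta> c F G = (\<Sum>x | x \<in> ks F \<and> snd x = c. \<Sum>y | y \<in> ks G \<and> snd y = c. cnj (lk F x) * lk G y * gm n \<beta> x y)"

lemma form_cform: "form n \<beta> F G = (\<Sum>c\<in>snd ` ks F. cform n \<beta> c F G)"
proof -
  have "form n \<beta> F G = (\<Sum>c\<in>snd ` ks F. \<Sum>x | x \<in> ks F \<and> snd x = c. \<Sum>y\<in>ks G. cnj (lk F x) * lk G y * gm n \<beta> x y)"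
    unfolding form_def by (rule sum.image_gen) simp
  also have "\<dots> = (\<Sum>c\<in>snd ` ks F. cform n \<beta> c F G)"
    unfolding cform_def by (intro sum.cong refl sum.mono_neutral_right) (auto simp: gm_def)
  finally show ?thesis .
qed

lemma app_Bx: "app (Bx a) F = (\<Sum>x | x \<in> ks F \<and> snd x = a. smul (lk F x) (bs (fst x)))"
proof -
  have "app (Bx a) F = (\<Sum>x\<in>ks F. smul (lk F x) (app (Bx a) (bas x)))"
    by (subst pst_expand[of F]) (simp add: app_sum app_smul)
  also have "\<dots> = (\<Sum>x | x \<in> ks F \<and> snd x = a. smul (lk F x) (bs (fst x)))"
    by (intro sum.mono_neutral_cong_right) (auto simp: Bx_def split: prod.splits)
  finally show ?thesis .
qed

lemma form_Bx: "form n \<beta> (app (Bx a) F) (app (Bx a) G) = cform n \<beta> a F G"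
  unfolding app_Bx form_sum_left unfolding form_sum_right cform_def
  by (intro sum.cong refl) (auto simp: form_smul_left form_smul_right form_bas gm_def)

context cs
begin

text \<open>The two signs of the antisymmetric vectors cancel and the Gram coefficients are
  invariant, so parts with rearranged colours agree and the sorted ones suffice.\<close>

lemma cform_permute:
  assumes \<beta>: "\<beta> > 0" and F: "F \<in> Fv" "G \<in> Fv" and w: "w permutes {..<n}"
  shows "cform n \<beta> c F G = cform n \<beta> (c \<circ> w) F G"
proof -
  let ?i = "\<lambda>x :: pidx. (fst x \<circ> inv w, snd x \<circ> inv w)"
  let ?j = "\<lambda>x :: pidx. (fst x \<circ> w, snd x \<circ> w)"
  have inv: "?i (?j x) = x" "?j (?i x) = x" for x
    using permutes_inv_o[OF w] by (auto simp: comp_assoc)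
  have lkj: "lk H (?j x) = of_int (sign w) * lk H x" if "H \<in> Fv" for H x
    using Fv_perm[OF that w, of "fst x" "snd x"] by simp
  have keyj: "?j x \<in> ks H \<longleftrightarrow> x \<in> ks H" if "H \<in> Fv" for H x
    using lkj[OF that, of x] by (simp add: in_keys_iff sign_def)
  have keyi: "?i x \<in> ks H \<longleftrightarrow> x \<in> ks H" if "H \<in> Fv" for H x
    using keyj[OF that, of "?i x"] by (simp only: inv)
  have ci: "(c \<circ> w) \<circ> inv w = c" using permutes_inv_o(1)[OF w] by (simp add: comp_assoc)
  have sq: "(of_int (sign w) :: complex) * of_int (sign w) = 1" by (simp add: sign_def)
  have trm: "cnj (lk F (?j x)) * lk G (?j y) * gm n \<beta> (?j x) (?j y) = cnj (lk F x) * lk G y * gm n \<beta> x y" for x y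
  proof -
    have "cnj (lk F (?j x)) * lk G (?j y) = (of_int (sign w) * of_int (sign w)) * (cnj (lk F x) * lk G y)"
      unfolding lkj[OF F(1)] lkj[OF F(2)] by simp
    moreover have "gm n \<beta> (?j x) (?j y) = gm n \<beta> x y"
      using gm_permute[OF \<beta> w, of "fst x" "snd x" "fst y" "snd y"] by simp
    ultimately show ?thesis by (simp only: sq mult_1)
  qed
  show ?thesis
    unfolding cform_def
  proof (rule sum.reindex_bij_witness[where i = ?i and j = ?j])
    fix x assume x: "x \<in> {x. x \<in> ks F \<and> snd x = c}"
    show "?i (?j x) = x" by (rule inv)
    show "?j x \<in> {x. x \<in> ks F \<and> snd x = c \<circ> w}" using x keyj[OF F(1), of x] by simp
    show "(\<Sum>y | y \<in> ks G \<and> snd y = c \<circ> w. cnj (lk F (?j x)) * lk G y * gm n \<beta> (?j x) y)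
        = (\<Sum>y | y \<in> ks G \<and> snd y = c. cnj (lk F x) * lk G y * gm n \<beta> x y)"
    proof (rule sum.reindex_bij_witness[where i = ?j and j = ?i])
      fix y assume y: "y \<in> {y. y \<in> ks G \<and> snd y = c \<circ> w}"
      show "?j (?i y) = y" by (rule inv)
      show "?i y \<in> {y. y \<in> ks G \<and> snd y = c}" using y keyi[OF F(2), of y] ci by simp
      show "cnj (lk F x) * lk G (?i y) * gm n \<beta> x (?i y) = cnj (lk F (?j x)) * lk G y * gm n \<beta> (?j x) y"
        using trm[of x "?i y"] by (simp only: inv)
    next
      fix y assume y: "y \<in> {y. y \<in> ks G \<and> snd y = c}"
      show "?i (?j y) = y" by (rule inv)
      show "?j y \<in> {y. y \<in> ks G \<and> snd y = c \<circ> w}" using y keyj[OF F(2), of y] by simp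
    qed
  next
    fix x assume x: "x \<in> {x. x \<in> ks F \<and> snd x = c \<circ> w}"
    show "?j (?i x) = x" by (rule inv)
    show "?i x \<in> {x. x \<in> ks F \<and> snd x = c}" using x keyi[OF F(1), of x] ci by simp
  qed
qed

text \<open>Adjoints reverse products; the factors are functions of commuting self-adjoint
  operators, so the reversed product is the same.\<close>

lemma adj_Mf:
  assumes \<beta>: "\<beta> > 0"
  shows "adj n \<beta> (Mf m a $ s) (Mf m a $ s)"
proof -
  have c: "(1 + R i 0) * prod_list (map (\<lambda>j. 1 + R j 0) xs) = prod_list (map (\<lambda>j. 1 + R j 0) xs) * (1 + R i 0)" for i xs
  proof -
    have "(1 + R j 0) * (1 + R i 0) = (1 + R i 0) * (1 + R j 0)" for j
      using RR[of j 0 i 0] by (simp add: distrib_left distrib_right)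
    then have "prod_list (map (\<lambda>j. 1 + R j 0) xs) * (1 + R i 0) = (1 + R i 0) * prod_list (map (\<lambda>j. 1 + R j 0) xs)"
      by (induction xs) (auto intro: commute_mult)
    then show ?thesis by simp
  qed
  have r: "adjs n \<beta> (1 + R i 0) (1 + R i 0)" for i
    unfolding adjs_def R_nth using \<beta> by (auto intro!: adj_one adj_power adj_uminus adj_dx)
  have "adjs n \<beta> (prod_list (map (\<lambda>j. 1 + R j 0) xs)) (prod_list (map (\<lambda>j. 1 + R j 0) xs))" for xs
  proof (induction xs)
    case Nil
    then show ?case by (auto simp: adjs_def adj_one adj_zero)
  next
    case (Cons i xs)
    show ?case using adjs_mult[OF r Cons.IH, of i] by (simp add: c)
  qed
  then show ?thesis by (simp add: adjs_def Mf_def)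
qed

text \<open>The usual argument for distinct eigenvalues, with one of them real, carried out for each
  sorted colour sequence separately.\<close>

theorem orthogonal:
  assumes N: "N \<ge> 1" and \<beta>: "\<beta> > 0" and m: "m \<le> N" and F: "F \<in> Fv" "G \<in> Fv"
    and ev: "app (Y m s) F = smul a F" "app (Y m s) G = smul b G" and ab: "a \<in> \<real>" "a \<noteq> b"
  shows "form n \<beta> F G = 0"
proof -
  have sorted: "cform n \<beta> c F G = 0" if c: "colsorted n N c" for c
  proof -
    have E: "app (Mf m c $ s) (app (Bx c) F) = smul a (app (Bx c) F)" "app (Mf m c $ s) (app (Bx c) G) = smul b (app (Bx c) G)"
      unfolding Bx_Y[OF c m, symmetric] ev app_smul by (rule refl)+
    have "form n \<beta> (app (Mf m c $ s) (app (Bx c) F)) (app (Bx c) G) = form n \<beta> (app (Bx c) F) (app (Mf m c $ s) (app (Bx c) G))"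
      using adj_Mf[OF \<beta>] unfolding adj_def by blast
    then have "cnj a * cform n \<beta> c F G = b * cform n \<beta> c F G"
      unfolding E form_smul_left form_smul_right form_Bx .
    moreover have "cnj a = a" using ab(1) by (rule Reals_cnj_iff[THEN iffD1])
    ultimately show ?thesis using ab(2) by simp
  qed
  have "cform n \<beta> c F G = 0" if "c \<in> snd ` ks F" for c
  proof -
    obtain e where "lk F (e, c) \<noteq> 0" using \<open>c \<in> snd ` ks F\<close> by (auto simp: in_keys_iff)
    then have "\<forall>i<n. c i \<in> {1..N}" using Fv_okx[OF F(1)] by (simp add: okx_def)
    then obtain w where w: "w permutes {..<n}" "colsorted n N (c \<circ> w)" by (rule colsort)
    then show ?thesis using cform_permute[OF \<beta> F w(1), of c] sorted by simp
  qed
  then show ?thesis by (simp add: form_cform)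
qed

section \<open>Transfer to list-indexed states\<close>

definition lst :: "pidx \<Rightarrow> idx" where
  "lst x = (map (fst x) [0..<n], map (snd x) [0..<n])"

definition fn :: "idx \<Rightarrow> pidx" where
  "fn p = (fe n (fst p), fc n (snd p))"

lemma fn_lst: "okx (fst x) (snd x) \<Longrightarrow> fn (lst x) = x"
  by (cases x) (auto simp: fn_def lst_def fe_def fc_def okx_def fun_eq_iff)

lemma lst_fn: "length (fst p) = n \<Longrightarrow> length (snd p) = n \<Longrightarrow> lst (fn p) = p"
  by (cases p) (auto simp: fn_def lst_def fe_def fc_def intro!: nth_equalityI)

lemma drp_lst: "okx (fst x) (snd x) \<Longrightarrow> drp n F (lst x) = lk F x"
  using fn_lst[of x] by (simp add: drp_def lst_def fn_def)

lemma drp_fn: "drp n F p = (if length (fst p) = n \<and> length (snd p) = n then lk F (fn p) else 0)"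
  by (cases p) (simp add: drp_def fn_def)

lemma sp_basic_gm:
  assumes \<beta>: "\<beta> > 0" and len: "length (fst p) = n" "length (snd p) = n" "length (fst q) = n" "length (snd q) = n"
  shows "sp_basic n \<beta> p q = 1 / of_nat (fact n) * gm n \<beta> (fn p) (fn q)"
proof -
  have col: "fc n (snd p) = fc n (snd q) \<longleftrightarrow> snd p = snd q"
    using lst_fn[OF len(1,2)] lst_fn[OF len(3,4)] by (metis fn_def lst_def snd_conv)
  have "torus_int n (\<lambda>w. Delta n \<beta> w * Defs.monom n (fst p) (map inverse w) * Defs.monom n (fst q) w)
      = torus_int n (\<lambda>w. Dl n \<beta> (nth w) * mon n (\<lambda>i. fe n (fst q) i - fe n (fst p) i) (nth w))"
  proof (rule torus_int_cong)
    fix ws :: "complex list" assume ws: "length ws = n" "\<forall>i<n. cmod (ws ! i) = 1"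
    have nz: "ws ! i \<noteq> 0" if "i < n" for i using ws(2) that by force
    have "Defs.monom n (fst p) (map inverse ws) * Defs.monom n (fst q) ws
        = mon n (\<lambda>i. fe n (fst q) i - fe n (fst p) i) (nth ws)"
      unfolding Defs.monom_def mon_def prod.distrib[symmetric]
    proof (intro prod.cong refl)
      fix i assume "i \<in> {..<n}"
      then have i: "i < n" by simp
      have "inverse (ws ! i) powi (fst p ! i) = ws ! i powi (- (fst p ! i))"
        by (simp add: power_int_inverse power_int_minus)
      then show "map inverse ws ! i powi (fst p ! i) * ws ! i powi (fst q ! i) = ws ! i powi (fe n (fst q) i - fe n (fst p) i)"
        using i ws(1) power_int_add[of "ws ! i" "- (fst p ! i)" "fst q ! i"] nz[OF i] by (simp add: fe_def)
    qed
    then show "Delta n \<beta> ws * Defs.monom n (fst p) (map inverse ws) * Defs.monom n (fst q) ws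
       = Dl n \<beta> (nth ws) * mon n (\<lambda>i. fe n (fst q) i - fe n (fst p) i) (nth ws)"
      using Delta_eq_Dl[OF \<beta> ws(2)] by (simp add: mult.assoc)
  qed
  then show ?thesis by (simp add: sp_basic_def gm_def J_def fn_def col)
qed

lemma supp_drp:
  assumes "F \<in> Fv"
  shows "supp (drp n F) = lst ` ks F"
proof (intro equalityI subsetI)
  fix p assume "p \<in> supp (drp n F)"
  then have "length (fst p) = n" "length (snd p) = n" "lk F (fn p) \<noteq> 0"
    by (auto simp: supp_def drp_fn split: if_splits)
  then show "p \<in> lst ` ks F" using lst_fn[of p] by (metis image_eqI in_keys_iff)
next
  fix p assume "p \<in> lst ` ks F"
  then obtain x where x: "x \<in> ks F" "p = lst x" by blast
  then have "okx (fst x) (snd x)" using Fv_okx[OF assms, of "fst x" "snd x"] by (simp add: in_keys_iff)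
  then show "p \<in> supp (drp n F)" using x by (simp add: supp_def drp_lst in_keys_iff)
qed

lemma sp_drp:
  assumes \<beta>: "\<beta> > 0" and F: "F \<in> Fv" "G \<in> Fv"
  shows "sp n \<beta> (drp n F) (drp n G) = 1 / of_nat (fact n) * form n \<beta> F G"
proof -
  have ok: "okx (fst x) (snd x)" if "H \<in> Fv" "x \<in> ks H" for H x
    using Fv_okx[OF that(1), of "fst x" "snd x"] that(2) by (simp add: in_keys_iff)
  have inj: "inj_on lst (ks H)" if "H \<in> Fv" for H
    by (rule inj_on_inverseI[of _ fn]) (rule fn_lst[OF ok[OF that]])
  have "sp n \<beta> (drp n F) (drp n G) = (\<Sum>x\<in>ks F. \<Sum>y\<in>ks G. cnj (drp n F (lst x)) * drp n G (lst y) * sp_basic n \<beta> (lst x) (lst y))"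
    unfolding sp_def supp_drp[OF F(1)] supp_drp[OF F(2)] sum.reindex[OF inj[OF F(1)]] sum.reindex[OF inj[OF F(2)]] comp_def ..
  also have "\<dots> = (\<Sum>x\<in>ks F. \<Sum>y\<in>ks G. 1 / of_nat (fact n) * (cnj (lk F x) * lk G y * gm n \<beta> x y))"
  proof (intro sum.cong refl)
    fix x y assume x: "x \<in> ks F" and y: "y \<in> ks G"
    have "sp_basic n \<beta> (lst x) (lst y) = 1 / of_nat (fact n) * gm n \<beta> x y"
      using sp_basic_gm[OF \<beta>, of "lst x" "lst y"] fn_lst[OF ok[OF F(1) x]] fn_lst[OF ok[OF F(2) y]] by (simp add: lst_def)
    then show "cnj (drp n F (lst x)) * drp n G (lst y) * sp_basic n \<beta> (lst x) (lst y)
        = 1 / of_nat (fact n) * (cnj (lk F x) * lk G y * gm n \<beta> x y)"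
      by (simp add: drp_lst[OF ok[OF F(1) x]] drp_lst[OF ok[OF F(2) y]])
  qed
  also have "\<dots> = 1 / of_nat (fact n) * form n \<beta> F G"
    by (simp only: form_def sum_distrib_left)
  finally show ?thesis .
qed

lemma drp_uh:
  assumes "N \<ge> 1"
  shows "drp n (uh k) = uhat n N k"
proof
  fix p :: idx
  have *: "pe k \<circ> w = fst (fn p) \<and> pc k \<circ> w = snd (fn p) \<longleftrightarrow>
      p = (map (\<lambda>i. over N (k ! w i)) [0..<n], map (\<lambda>i. nat (under N (k ! w i))) [0..<n])"
    if w: "w permutes {..<n}" and len: "length (fst p) = n" "length (snd p) = n" for w
  proof -
    have l: "lst (pe k \<circ> w, pc k \<circ> w) = (map (\<lambda>i. over N (k ! w i)) [0..<n], map (\<lambda>i. nat (under N (k ! w i))) [0..<n])"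
      using perm_lt[OF w] by (auto simp: lst_def pe_def pc_def)
    have "okx (pe k \<circ> w) (pc k \<circ> w)"
      using pc_range[OF assms] perm_lt[OF w] by (auto simp: okx_def pe_def pc_def)
    then have f: "fn (lst (pe k \<circ> w, pc k \<circ> w)) = (pe k \<circ> w, pc k \<circ> w)" by (intro fn_lst) simp
    have "fn p = (pe k \<circ> w, pc k \<circ> w) \<longleftrightarrow> p = lst (pe k \<circ> w, pc k \<circ> w)"
      using f lst_fn[OF len] by metis
    then show ?thesis unfolding l by (auto simp: prod_eq_iff)
  qed
  show "drp n (uh k) p = uhat n N k p"
  proof (cases "length (fst p) = n \<and> length (snd p) = n")
    case True
    then have "drp n (uh k) p = (\<Sum>w | w permutes {..<n}. of_int (sign w) * of_bool (pe k \<circ> w = fst (fn p) \<and> pc k \<circ> w = snd (fn p)))"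
      using lk_uh[of k "fst (fn p)" "snd (fn p)"] by (simp add: drp_fn)
    also have "\<dots> = uhat n N k p"
      unfolding uhat_def atLeast0LessThan using * True by (intro sum.cong refl) auto
    finally show ?thesis .
  next
    case False
    then have "drp n (uh k) p = 0" by (auto simp: drp_fn)
    moreover have "uhat n N k p = 0" unfolding uhat_def using False by (intro sum.neutral) auto
    ultimately show ?thesis by simp
  qed
qed

lemma drp_Fspace:
  assumes F: "F \<in> Fv"
  shows "drp n F \<in> Fspace n N"
proof -
  have "drp n F p = 0" if "\<not> valid_idx n N p" for p
  proof (rule ccontr)
    assume "drp n F p \<noteq> 0"
    then have len: "length (fst p) = n" "length (snd p) = n" and nz: "lk F (fn p) \<noteq> 0"
      by (auto simp: drp_fn split: if_splits)
    have "okx (fst (fn p)) (snd (fn p))" using Fv_okx[OF F, of "fst (fn p)" "snd (fn p)"] nz by simp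
    then show False using that len by (auto simp: valid_idx_def okx_def fn_def fc_def in_set_conv_nth subset_iff)
  qed
  then have st: "is_state n N (drp n F)" by (simp add: is_state_def finite_supp_drp)
  have "Kop i j (drp n F) = (\<lambda>p. - Pop i j (drp n F) p)" if ij: "i < n" "j < n" "i \<noteq> j" for i j
  proof -
    have key: "lk (app (Kx i j) F) x = - lk (app (Px i j) F) x" for x
    proof (cases x)
      case (Pair e c)
      have "lk F (e \<circ> tr i j, (c \<circ> tr i j) \<circ> tr i j) = of_int (sign (tr i j)) * lk F (e, c \<circ> tr i j)"
        using ij by (intro Fv_perm[OF F] permutes_swap_id) auto
      then show ?thesis using ij by (simp add: Pair lookup_Kx lookup_Px comp_assoc sign_swap_id)
    qed
    show ?thesis unfolding Kop_drp[OF ij(1,2)] Pop_drp[OF ij(1,2)] by (rule ext) (simp add: drp_fn key)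
  qed
  then show ?thesis using st by (simp add: Fspace_def)
qed

lemma map_comp_transpose: "Suc i < k \<Longrightarrow> map (h \<circ> tr i (Suc i)) [0..<k] = swap_list i (Suc i) (map h [0..<k])"
  by (auto simp: swap_list_def list_eq_iff_nth_eq nth_list_update Transposition.transpose_def)

text \<open>The preimage pads every index by zeros. The relation between the two exchanges becomes a
  sign under their joint action, extended from adjacent exchanges to all permutations.\<close>

lemma Fspace_drp:
  assumes f: "f \<in> Fspace n N"
  shows "\<exists>F\<in>Fv. f = drp n F"
proof -
  define F where "F = (\<Sum>p\<in>supp f. smul (f p) (bas (fn p)))"
  define z where "z e c \<longleftrightarrow> (\<forall>i\<ge>n. e i = (0::int) \<and> c i = (0::nat))" for e c
  have fin: "finite (supp f)" and val: "\<And>p. \<not> valid_idx n N p \<Longrightarrow> f p = 0"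
    and anti: "\<And>i j. i < n \<Longrightarrow> j < n \<Longrightarrow> i \<noteq> j \<Longrightarrow> Kop i j f = (\<lambda>p. - Pop i j f p)"
    using f by (auto simp: Fspace_def is_state_def)
  have fl: "fn (lst (e, c)) = (e, c)" if "z e c" for e c
    using that by (auto simp: z_def fn_def lst_def fe_def fc_def fun_eq_iff)
  have zf: "z (fst (fn p)) (snd (fn p))" for p by (simp add: z_def fn_def fe_def fc_def)
  have lkF: "lk F (e, c) = (if z e c then f (lst (e, c)) else 0)" for e c
  proof -
    have "lk F (e, c) = (\<Sum>p\<in>supp f. if p = lst (e, c) then if z e c then f (lst (e, c)) else 0 else 0)"
      unfolding F_def lookup_sum'
    proof (intro sum.cong refl)
      fix p assume "p \<in> supp f"
      then have v: "valid_idx n N p" using val[of p] by (auto simp: supp_def)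
      then have "lst (fn p) = p" by (intro lst_fn) (auto simp: valid_idx_def)
      then have "fn p = (e, c) \<longleftrightarrow> p = lst (e, c) \<and> z e c"
        using fl[of e c] zf[of p] by (metis fst_conv snd_conv)
      then show "lk (smul (f p) (bas (fn p))) (e, c) = (if p = lst (e, c) then if z e c then f (lst (e, c)) else 0 else 0)"
        by (auto simp: lookup_bas)
    qed
    also have "\<dots> = (if z e c then f (lst (e, c)) else 0)"
      using fin by (auto simp: supp_def)
    finally show ?thesis .
  qed
  have "F \<in> Fv"
  proof (rule FvI)
    fix e c assume "lk F (e, c) \<noteq> 0"
    then have "z e c" "valid_idx n N (lst (e, c))" using val[of "lst (e, c)"] by (auto simp: lkF split: if_splits)
    then show "okx e c" by (auto simp: okx_def z_def valid_idx_def lst_def image_subset_iff)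
  next
    fix w :: "nat \<Rightarrow> nat" and e c assume w: "w permutes {..<n}"
    have "lk F (e \<circ> tr i (Suc i), c \<circ> tr i (Suc i)) = - lk F (e, c)" if i: "Suc i < n" for i e c
    proof -
      have zz: "z (e \<circ> tr i (Suc i)) (c \<circ> tr i (Suc i)) \<longleftrightarrow> z e c"
        using i by (auto simp: z_def Transposition.transpose_def)
      have se: "map (e \<circ> tr i (Suc i)) [0..<n] = swap_list i (Suc i) (map e [0..<n])"
        and sw: "map (c \<circ> tr i (Suc i)) [0..<n] = swap_list i (Suc i) (map c [0..<n])"
        by (rule map_comp_transpose[OF i])+
      have "swap_list i (Suc i) (swap_list i (Suc i) (map c [0..<n])) = map c [0..<n]"
        using i by (auto simp: swap_list_def list_eq_iff_nth_eq nth_list_update)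
      then show "lk F (e \<circ> tr i (Suc i), c \<circ> tr i (Suc i)) = - lk F (e, c)"
        unfolding lkF zz lst_def fst_conv snd_conv se sw
        using fun_cong[OF anti[of i "Suc i"], of "(map e [0..<n], swap_list i (Suc i) (map c [0..<n]))"] i
        by (simp add: Kop_def Pop_def)
    qed
    then show "lk F (e \<circ> w, c \<circ> w) = of_int (sign w) * lk F (e, c)"
      using permutation_antisymmetry[of n "\<lambda>e c. lk F (e, c)", OF _ w] by blast
  qed
  moreover have "f = drp n F"
  proof
    fix p show "f p = drp n F p"
    proof (cases "length (fst p) = n \<and> length (snd p) = n")
      case True
      then show ?thesis using lkF[of "fst (fn p)" "snd (fn p)"] zf[of p] lst_fn[of p] by (simp add: drp_fn)
    next
      case False
      then show ?thesis using val[of p] by (auto simp: drp_fn valid_idx_def)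
    qed
  qed
  ultimately show ?thesis by blast
qed

section \<open>The basis property\<close>

definition spanned :: "(int list \<Rightarrow> pst) \<Rightarrow> pst set" where
  "spanned X = {F. \<exists>Q c. finite Q \<and> Q \<subseteq> Lset n \<and> F = (\<Sum>k\<in>Q. smul (c k) (X k))}"

lemma spanned_zero: "0 \<in> spanned X"
  unfolding spanned_def by (rule CollectI, rule exI[of _ "{}"]) simp

lemma spanned_base: "k \<in> Lset n \<Longrightarrow> X k \<in> spanned X"
  unfolding spanned_def by (rule CollectI, intro exI[of _ "{k}"] exI[of _ "\<lambda>_. 1"]) simp

lemma spanned_smul:
  assumes "F \<in> spanned X"
  shows "smul z F \<in> spanned X"
proof -
  obtain Q c where "finite Q" "Q \<subseteq> Lset n" "F = (\<Sum>k\<in>Q. smul (c k) (X k))" using assms unfolding spanned_def by blast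
  then have "finite Q \<and> Q \<subseteq> Lset n \<and> smul z F = (\<Sum>k\<in>Q. smul (z * c k) (X k))" by (simp add: smul_sum)
  then show ?thesis unfolding spanned_def by (intro CollectI exI)
qed

lemma spanned_add:
  assumes "F \<in> spanned X" "G \<in> spanned X"
  shows "F + G \<in> spanned X"
proof -
  obtain Q c where Q: "finite Q" "Q \<subseteq> Lset n" "F = (\<Sum>k\<in>Q. smul (c k) (X k))" using assms(1) unfolding spanned_def by blast
  obtain Q' c' where Q': "finite Q'" "Q' \<subseteq> Lset n" "G = (\<Sum>k\<in>Q'. smul (c' k) (X k))" using assms(2) unfolding spanned_def by blast
  have "F = (\<Sum>k\<in>Q \<union> Q'. smul (if k \<in> Q then c k else 0) (X k))"
    unfolding Q(3) using Q Q' by (intro sum.mono_neutral_cong_left) auto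
  moreover have "G = (\<Sum>k\<in>Q \<union> Q'. smul (if k \<in> Q' then c' k else 0) (X k))"
    unfolding Q'(3) using Q Q' by (intro sum.mono_neutral_cong_left) auto
  ultimately have "F + G = (\<Sum>k\<in>Q \<union> Q'. smul ((if k \<in> Q then c k else 0) + (if k \<in> Q' then c' k else 0)) (X k))"
    by (simp only: smul_left_add sum.distrib)
  then have "finite (Q \<union> Q') \<and> Q \<union> Q' \<subseteq> Lset n \<and>
      F + G = (\<Sum>k\<in>Q \<union> Q'. smul ((if k \<in> Q then c k else 0) + (if k \<in> Q' then c' k else 0)) (X k))"
    using Q(1,2) Q'(1,2) by blast
  then show ?thesis unfolding spanned_def by (intro CollectI exI)
qed

lemma spanned_sum: "(\<And>x. x \<in> I \<Longrightarrow> f x \<in> spanned X) \<Longrightarrow> (\<Sum>x\<in>I. f x) \<in> spanned X"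
  by (induction I rule: infinite_finite_induct) (auto intro: spanned_zero spanned_add)

lemma drp_zero_imp:
  assumes "F \<in> Fv" "\<And>p. drp n F p = 0"
  shows "F = 0"
proof -
  have "lk F x = 0" for x
  proof (rule ccontr)
    assume nz: "lk F x \<noteq> 0"
    then have "okx (fst x) (snd x)" using Fv_okx[OF assms(1), of "fst x" "snd x"] by simp
    then show False using drp_lst[of x F] assms(2) nz by simp
  qed
  then show ?thesis by (intro poly_mapping_eqI) simp
qed

context
  fixes X :: "int list \<Rightarrow> pst" and r :: "int list \<Rightarrow> int list \<Rightarrow> real"
  assumes N: "N \<ge> 1"
    and X: "\<And>k. k \<in> Lset n \<Longrightarrow> X k = uh k + (\<Sum>l\<in>D k. smul (of_real (r k l)) (uh l))"
begin

lemma X_Fv: "k \<in> Lset n \<Longrightarrow> X k \<in> Fv"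
  unfolding X by (intro Fv_add Fv_sum Fv_smul uh_Fv N)

text \<open>Inversion of a unitriangular matrix, by induction on the finite number of elements below
  \<open>k\<close>.\<close>

lemma uh_spanned: "k \<in> Lset n \<Longrightarrow> uh k \<in> spanned X"
proof (induction "card (D k)" arbitrary: k rule: less_induct)
  case less
  have "uh l \<in> spanned X" if l: "l \<in> D k" for l
  proof -
    have "D l \<subset> D k" using D_trans[OF l] l D_irrefl by blast
    then have "card (D l) < card (D k)" by (intro psubset_card_mono finite_D)
    then show ?thesis using less.hyps l by (simp add: D_def)
  qed
  then have "X k + smul (- 1) (\<Sum>l\<in>D k. smul (of_real (r k l)) (uh l)) \<in> spanned X"
    using less.prems by (intro spanned_add spanned_smul spanned_sum spanned_base)
  moreover have "X k + smul (- 1) (\<Sum>l\<in>D k. smul (of_real (r k l)) (uh l)) = uh k"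
    unfolding X[OF less.prems] by (intro poly_mapping_eqI) (simp add: lookup_add)
  ultimately show ?case by simp
qed

lemma lk_X:
  assumes k: "k \<in> Lset n" and l: "l \<in> Lset n"
  shows "lk (X k) (pe l, pc l) = (if l = k then 1 else if l \<in> D k then of_real (r k l) else 0)"
proof -
  have "lk (\<Sum>j\<in>D k. smul (of_real (r k j)) (uh j)) (pe l, pc l) = (\<Sum>j\<in>D k. if j = l then of_real (r k l) else 0)"
    unfolding lookup_sum' using l by (intro sum.cong refl) (auto simp: D_def lk_uh_pt[OF N])
  also have "\<dots> = (if l \<in> D k then of_real (r k l) else 0)" using finite_D by simp
  finally show ?thesis using D_irrefl by (auto simp: X[OF k] lookup_add lk_uh_pt[OF N k l])
qed

text \<open>At a dominance-maximal \<open>k\<close> with nonzero coefficient, no other vector of the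
  combination has a component at \<open>(pe k, pc k)\<close>.\<close>

lemma X_independent:
  assumes Q: "finite Q" "Q \<subseteq> Lset n" and z: "(\<Sum>k\<in>Q. smul (c k) (X k)) = 0"
  shows "\<forall>k\<in>Q. c k = 0"
proof (rule ccontr)
  assume "\<not> (\<forall>k\<in>Q. c k = 0)"
  then have ne: "{k \<in> Q. c k \<noteq> 0} \<noteq> {}" by blast
  have "\<exists>k\<in>{k \<in> Q. c k \<noteq> 0}. \<forall>l\<in>{k \<in> Q. c k \<noteq> 0}. l \<noteq> k \<longrightarrow> \<not> dom_less k l"
    using ne Q(1) dom_less_asym dom_less_trans'
    by (intro Finite_Set.bex_max_element) (auto simp: asymp_on_def transp_on_def)
  then obtain k where k: "k \<in> Q" "c k \<noteq> 0" and mx: "\<And>l. l \<in> Q \<Longrightarrow> c l \<noteq> 0 \<Longrightarrow> l \<noteq> k \<Longrightarrow> \<not> dom_less k l"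
    by blast
  have "(\<Sum>l\<in>Q. c l * lk (X l) (pe k, pc k)) = (\<Sum>l\<in>Q. if l = k then c k else 0)"
  proof (intro sum.cong refl)
    fix l assume l: "l \<in> Q"
    then have "l \<in> Lset n" "k \<in> Lset n" using Q(2) k by auto
    then show "c l * lk (X l) (pe k, pc k) = (if l = k then c k else 0)"
      using lk_X[of l k] mx[OF l] by (cases "c l = 0") (auto simp: D_def)
  qed
  also have "\<dots> = c k" using k Q(1) by simp
  finally have "lk (\<Sum>l\<in>Q. smul (c l) (X l)) (pe k, pc k) = c k" by (simp add: lookup_sum')
  then show False using k z by simp
qed

lemma X_basis: "is_basis n N (Lset n) (\<lambda>k. drp n (X k))"
  unfolding is_basis_def
proof (intro conjI allI impI ballI)
  have ind: "\<forall>k\<in>Q. c k = 0" if Q: "finite Q" "Q \<subseteq> Lset n" and z: "\<forall>p. (\<Sum>k\<in>Q. c k * drp n (X k) p) = 0" for Q c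
  proof (rule X_independent[OF Q])
    have "drp n (\<Sum>k\<in>Q. smul (c k) (X k)) p = 0" for p
      using spec[OF z, of p] by (simp add: drp_sum drp_smul)
    moreover have "(\<Sum>k\<in>Q. smul (c k) (X k)) \<in> Fv" using Q by (intro Fv_sum Fv_smul X_Fv) auto
    ultimately show "(\<Sum>k\<in>Q. smul (c k) (X k)) = 0" by (intro drp_zero_imp)
  qed
  show "inj_on (\<lambda>k. drp n (X k)) (Lset n)"
  proof (rule inj_onI, rule ccontr)
    fix k l assume kl: "k \<in> Lset n" "l \<in> Lset n" "drp n (X k) = drp n (X l)" "k \<noteq> l"
    then have "\<forall>j\<in>{k, l}. (if j = k then 1 else - 1 :: complex) = 0" by (intro ind) auto
    then show False by simp
  qed
  show "(\<lambda>k. drp n (X k)) ` Lset n \<subseteq> Fspace n N" using X_Fv drp_Fspace by auto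
  show "\<exists>Q c. finite Q \<and> Q \<subseteq> Lset n \<and> f = (\<lambda>p. \<Sum>k\<in>Q. c k * drp n (X k) p)" if "f \<in> Fspace n N" for f
  proof -
    obtain F where F: "F \<in> Fv" "f = drp n F" using Fspace_drp \<open>f \<in> Fspace n N\<close> by blast
    have "(\<Sum>k | k \<in> Lset n \<and> lk F (pe k, pc k) \<noteq> 0. smul (lk F (pe k, pc k)) (uh k)) \<in> spanned X"
      by (intro spanned_sum spanned_smul uh_spanned) auto
    then have "F \<in> spanned X" using Fv_expand(2)[OF N F(1)] by simp
    then obtain Q c where "finite Q" "Q \<subseteq> Lset n" "F = (\<Sum>k\<in>Q. smul (c k) (X k))" unfolding spanned_def by blast
    then have "finite Q \<and> Q \<subseteq> Lset n \<and> f = (\<lambda>p. \<Sum>k\<in>Q. c k * drp n (X k) p)"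
      by (simp add: F(2) drp_sum drp_smul)
    then show ?thesis by blast
  qed
  fix Q c k assume "finite Q \<and> Q \<subseteq> Lset n \<and> (\<forall>p. (\<Sum>k\<in>Q. c k * drp n (X k) p) = 0)" "k \<in> Q"
  then show "c k = 0" using ind by blast
qed

end

lemma spectral_basis:
  assumes N: "N \<ge> 1" and \<beta>: "\<beta> > 0"
  shows "\<exists>(X :: int list \<Rightarrow> st) (x :: int list \<Rightarrow> int list \<Rightarrow> real).
     is_basis n N (Lset n) X \<and>
     (\<forall>k\<in>Lset n. X k = (\<lambda>p. uhat n N k p +
         (\<Sum>l\<in>{l\<in>Lset n. dom_less l k}. of_real (x k l) * uhat n N l p))) \<and>
     (\<forall>m\<in>{1..N}. \<forall>k\<in>Lset n. \<forall>s.
         Aop n N \<beta> m s (X k) = (\<lambda>p. Asc n N \<beta> m k s * X k p)) \<and>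
     (\<forall>k\<in>Lset n. \<forall>l\<in>Lset n. k \<noteq> l \<longrightarrow> (\<exists>m\<in>{1..N}. Asc n N \<beta> m k \<noteq> Asc n N \<beta> m l)) \<and>
     (\<forall>k\<in>Lset n. \<forall>l\<in>Lset n. k \<noteq> l \<longrightarrow> sp n \<beta> (X k) (X l) = 0)"
proof -
  have "\<forall>k\<in>Lset n. \<exists>r :: int list \<Rightarrow> real. \<forall>m\<le>N. \<forall>s.
      app (Y m s) (uh k + (\<Sum>l\<in>D k. smul (of_real (r l)) (uh l)))
        = smul (Asc n N \<beta> m k s) (uh k + (\<Sum>l\<in>D k. smul (of_real (r l)) (uh l)))"
    using eigenvector[OF N \<beta>] by (rule ballI)
  from bchoice[OF this] obtain r :: "int list \<Rightarrow> int list \<Rightarrow> real" where r: "\<forall>k\<in>Lset n. \<forall>m\<le>N. \<forall>s.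
      app (Y m s) (uh k + (\<Sum>l\<in>D k. smul (of_real (r k l)) (uh l)))
        = smul (Asc n N \<beta> m k s) (uh k + (\<Sum>l\<in>D k. smul (of_real (r k l)) (uh l)))" ..
  define X where "X k = uh k + (\<Sum>l\<in>D k. smul (of_real (r k l)) (uh l))" for k
  have ev: "app (Y m s) (X k) = smul (Asc n N \<beta> m k s) (X k)" if "k \<in> Lset n" "m \<le> N" for k m s
    unfolding X_def using bspec[OF r that(1)] that(2) by blast
  have XF: "X k \<in> Fv" if "k \<in> Lset n" for k
    by (rule X_Fv[OF N _ that]) (rule X_def)
  have sep: "\<exists>m\<in>{1..N}. Asc n N \<beta> m k \<noteq> Asc n N \<beta> m l" if "k \<in> Lset n" "l \<in> Lset n" "k \<noteq> l" for k l
    using separation[OF N \<beta> that(1,2)] that(3) by blast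
  have orth: "sp n \<beta> (drp n (X k)) (drp n (X l)) = 0" if kl: "k \<in> Lset n" "l \<in> Lset n" "k \<noteq> l" for k l
  proof -
    obtain m s where m: "m \<in> {1..N}" "Asc n N \<beta> m k s \<noteq> Asc n N \<beta> m l s" using sep[OF kl] by blast
    then have mN: "m \<le> N" by simp
    have "form n \<beta> (X k) (X l) = 0"
      by (rule orthogonal[OF N \<beta> mN XF[OF kl(1)] XF[OF kl(2)] ev[OF kl(1) mN] ev[OF kl(2) mN] Y_uh_diag(2)[OF N mN kl(1)] m(2)])
    then show ?thesis by (simp only: sp_drp[OF \<beta> XF[OF kl(1)] XF[OF kl(2)]] mult_zero_right)
  qed
  show ?thesis
  proof (intro exI conjI ballI allI impI)
    show "is_basis n N (Lset n) (\<lambda>k. drp n (X k))"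
      by (rule X_basis[OF N]) (rule X_def)
    show "drp n (X k) = (\<lambda>p. uhat n N k p + (\<Sum>l\<in>{l\<in>Lset n. dom_less l k}. of_real (r k l) * uhat n N l p))" for k
      by (simp only: X_def drp_add drp_sum drp_smul drp_uh[OF N] D_def)
    show "Aop n N \<beta> m s (drp n (X k)) = (\<lambda>p. Asc n N \<beta> m k s * drp n (X k) p)"
      if "m \<in> {1..N}" "k \<in> Lset n" for m k s
      using that by (simp only: Aop_drp ev atLeastAtMost_iff drp_smul)
  qed (use sep orth in blast)+
qed

end

theorem theorem5:
  fixes N n :: nat and \<beta> :: real
  assumes "N \<ge> 1" and "n \<ge> 1" and "\<beta> > 0"
  shows "\<exists>(X :: int list \<Rightarrow> st) (x :: int list \<Rightarrow> int list \<Rightarrow> real).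
     is_basis n N (Lset n) X \<and>
     (\<forall>k\<in>Lset n. X k = (\<lambda>p. uhat n N k p +
         (\<Sum>l\<in>{l\<in>Lset n. dom_less l k}. of_real (x k l) * uhat n N l p))) \<and>
     (\<forall>m\<in>{1..N}. \<forall>k\<in>Lset n. \<forall>s.
         Aop n N \<beta> m s (X k) = (\<lambda>p. Asc n N \<beta> m k s * X k p)) \<and>
     (\<forall>k\<in>Lset n. \<forall>l\<in>Lset n. k \<noteq> l \<longrightarrow> (\<exists>m\<in>{1..N}. Asc n N \<beta> m k \<noteq> Asc n N \<beta> m l)) \<and>
     (\<forall>k\<in>Lset n. \<forall>l\<in>Lset n. k \<noteq> l \<longrightarrow> sp n \<beta> (X k) (X l) = 0)"
  using cs.spectral_basis[of N \<beta> n] assms by (simp only:)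

end
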